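(* Let $n\ge 2$ and $k\ge 0$ be integers, and let $g_{n,k}:=|\{\beta\in B_n:\|\beta\|_d=2k+n-1\}|$. Then $$g_{n,k}\le 2^n\left(\frac{k+n-1}{n-1}\right)^{n-2}\binom{k+n-2}{n-2}.$$
   Context: Let $D^2\subseteq\mathbb{C}$ be the closed unit disk, let $p_1<\dots<p_n$ be points of $(-1,1)$ (the punctures), and let $P_n=\{p_1,\dots,p_n\}$. Let $H_n$ be the group of orientation-preserving homeomorphisms $h:\mathbb{C}\to\mathbb{C}$ such that $h(P_n)=P_n$, $h(\partial D^2)=\partial D^2$, $h(1)=1$ and $h(-1)=-1$. The braid group $B_n$ is the quotient of $H_n$ by the isotopy relation (isotopy through elements of $H_n$). The trivial lamination $\mathbf{L}$ is the union of the vertical lines $\frac12(p_j+p_{j+1})+i\mathbb{R}$, $1\le j\le n-1$. The diagrammatic norm of $\beta\in B_n$ is $\|\beta\|_d:=\min\{|h([-1,1])\cap\mathbf{L}| : h\in H_n \text{ represents }\beta\}$. *)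

theory Defs
  imports "HOL-Complex_Analysis.Complex_Analysis" "HOL-Library.Extended_Nat"
begin

text \<open>The punctures are \<open>p 1 < \<dots> < p n\<close>; values of \<open>p\<close> outside \<open>{1..n}\<close> are irrelevant.\<close>

definition valid_punctures :: "nat \<Rightarrow> (nat \<Rightarrow> real) \<Rightarrow> bool" where
  "valid_punctures n p \<longleftrightarrow> strict_mono_on {1..n} p \<and> p ` {1..n} \<subseteq> {-1<..<1}"

definition punctures :: "nat \<Rightarrow> (nat \<Rightarrow> real) \<Rightarrow> complex set" where
  "punctures n p = (\<lambda>j. complex_of_real (p j)) ` {1..n}"

text \<open>For a homeomorphism of the plane, preserving orientation means having local degree \<open>1\<close>
  at every point: the image of a small positively oriented circle around \<open>z\<close> winds once,
  positively, around \<open>h z\<close>. By injectivity of \<open>h\<close> the winding number does not depend on the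
  radius of the circle, so all radii are allowed.\<close>

definition orientation_preserving :: "(complex \<Rightarrow> complex) \<Rightarrow> bool" where
  "orientation_preserving h \<longleftrightarrow> (\<forall>z. \<forall>r>0. winding_number (h \<circ> circlepath z r) (h z) = 1)"

definition braid_homeos :: "nat \<Rightarrow> (nat \<Rightarrow> real) \<Rightarrow> (complex \<Rightarrow> complex) set" where
  "braid_homeos n p =
     {h. (\<exists>g. homeomorphism UNIV UNIV h g) \<and> orientation_preserving h \<and>
         h ` punctures n p = punctures n p \<and>
         h ` sphere 0 1 = sphere 0 1 \<and> h 1 = 1 \<and> h (-1) = -1}"

definition braid_isotopy ::
    "nat \<Rightarrow> (nat \<Rightarrow> real) \<Rightarrow> ((complex \<Rightarrow> complex) \<times> (complex \<Rightarrow> complex)) set" where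
  "braid_isotopy n p =
     {(h, h'). homotopic_with_canon (\<lambda>f. f \<in> braid_homeos n p) UNIV UNIV h h'}"

lemma equiv_braid_isotopy: "equiv (braid_homeos n p) (braid_isotopy n p)"
proof (rule equivI)
  show "braid_isotopy n p \<subseteq> braid_homeos n p \<times> braid_homeos n p"
  proof (rule subrelI)
    fix f g assume "(f, g) \<in> braid_isotopy n p"
    then have "homotopic_with_canon (\<lambda>h. h \<in> braid_homeos n p) UNIV UNIV f g"
      unfolding braid_isotopy_def by simp
    from homotopic_with_imp_property[OF this]
    show "(f, g) \<in> braid_homeos n p \<times> braid_homeos n p" by simp
  qed
  have "continuous_on UNIV h" if "h \<in> braid_homeos n p" for h
    using that unfolding braid_homeos_def homeomorphism_def by blast
  then show "refl_on (braid_homeos n p) (braid_isotopy n p)"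
    unfolding refl_on_def braid_isotopy_def by simp
  show "sym (braid_isotopy n p)"
    unfolding sym_def braid_isotopy_def by (simp add: homotopic_with_sym)
  show "trans (braid_isotopy n p)"
  proof (rule transI)
    fix f g h assume "(f, g) \<in> braid_isotopy n p" "(g, h) \<in> braid_isotopy n p"
    then have fg: "homotopic_with_canon (\<lambda>h. h \<in> braid_homeos n p) UNIV UNIV f g"
      and gh: "homotopic_with_canon (\<lambda>h. h \<in> braid_homeos n p) UNIV UNIV g h"
      unfolding braid_isotopy_def by simp_all
    from homotopic_with_trans[OF fg gh] show "(f, h) \<in> braid_isotopy n p"
      unfolding braid_isotopy_def by simp
  qed
qed

definition braid_group :: "nat \<Rightarrow> (nat \<Rightarrow> real) \<Rightarrow> (complex \<Rightarrow> complex) set set" where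
  "braid_group n p = braid_homeos n p // braid_isotopy n p"

definition trivial_lamination :: "nat \<Rightarrow> (nat \<Rightarrow> real) \<Rightarrow> complex set" where
  "trivial_lamination n p = (\<Union>j\<in>{1..n-1}. {z. Re z = (p j + p (j + 1)) / 2})"

definition ecard :: "'a set \<Rightarrow> enat" where
  "ecard A = (if finite A then enat (card A) else \<infinity>)"

text \<open>Some representatives of a braid meet the lamination in infinitely many points; counting in
  \<^typ>\<open>enat\<close> keeps them from contributing the junk value \<open>card A = 0\<close>. The infimum of a nonempty
  set of extended naturals is attained, so it is the minimum.\<close>

definition diagrammatic_norm ::
    "nat \<Rightarrow> (nat \<Rightarrow> real) \<Rightarrow> (complex \<Rightarrow> complex) set \<Rightarrow> enat" where
  "diagrammatic_norm n p \<beta> =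
     (INF h\<in>\<beta>. ecard (h ` closed_segment (-1) 1 \<inter> trivial_lamination n p))"

end

theory Submission
  imports Defs
begin

text \<open>
 A representative of minimal intersection number with \<open>L\<close> has no bigon and no touching point with
 \<open>L\<close>. Cut the curve \<open>h([-1,1])\<close> along the lines of \<open>L\<close>: in each strip between
 two consecutive lines its pieces form a noncrossing perfect matching of the intersection points, and the absence of
 bigons forces every innermost arc to have its ends on different lines or to go around the puncture of the strip.
 Hence the matching is determined by the numbers \<open>2i + 1\<close>, \<open>2j + 1\<close> of points on the two
 lines together with one index that takes at most \<open>2 (min i j + 1)\<close> values. If two such curves have the
 same data, a homeomorphism of the disc carries one to the other and preserves all lines; it is built by
 Caratheodory's theorem from its values on the boundaries of the pieces of the strips, and Alexander's trick in each
 piece makes it isotopic to the identity. So a braid is determined by a composition and one index per strip. In the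
 product of the numbers of indices the largest factor can be dropped, the AM-GM inequality bounds the rest by the
 power in the statement, and the binomial coefficient counts the compositions.
\<close>

text \<open>The homeomorphisms are merely continuous, so curves and lines cannot be made transverse
  by smoothness: each isotopy is written down explicitly. Close to the curve it is a vertical shear
  of the source, where the curve is the straight segment \<open>[-1,1]\<close>. Globally one cuts
  into Jordan domains, over which boundary homeomorphisms extend and isotopies are coned. The
  cutting is done in the source: there the preimages of the lines are chords of the two half-discs,
  pairwise disjoint within a half-disc because a shared end would be a touching point. The
  comparison of \<open>h\<close> and \<open>h'\<close> uses one map seen from two sides. In the
  source, \<open>Psi\<close> preserves the diameter and fixes the punctures, so \<open>h'\<close> is
  isotopic to \<open>h' o Psi\<close>. In the target, \<open>phi = h' o Psi o h^-1\<close> preserves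
  the lines and fixes the punctures, so \<open>h\<close> is isotopic to \<open>phi o h\<close>. The
  two end results agree on the disc. The numbers of points on the lines are odd because the strips
  are perfectly matched and the ends \<open>-1\<close> and \<open>1\<close> count as single points
  on two extra lines.\<close>

abbreviation joint_cont :: "'a::topological_space set => (real => 'a => 'b::topological_space) => bool"
 where "joint_cont D k == continuous_on ({0..1} \<times> D) (\<lambda>x. k (fst x) (snd x))"

section \<open>Caratheodory's theorem\<close>

definition Jordan :: "complex set => bool" where
 "Jordan J \<longleftrightarrow> (\<exists>g. simple_path g & pathfinish g = pathstart g & path_image g = J)"

lemma Jordan_facts:
 assumes "Jordan J"
 shows "compact J" "J ~= {}" "open (inside J)" "connected (inside J)" "bounded (inside J)" "inside J ~= {}"
  "frontier (inside J) = J" "closure (inside J) = J Un inside J" "compact (J Un inside J)"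
  "J \<inter> inside J = {}" "simply_connected (inside J)" "frontier (outside J) = J" "open (outside J)"
  "connected (outside J)" "outside J ~= {}" "inside J \<inter> outside J = {}" "inside J Un outside J = - J"
proof -
 obtain g where g: "simple_path g" "pathfinish g = pathstart g" and J: "path_image g = J"
  using assms by (auto simp: Jordan_def)
 note * = Jordan_inside_outside[OF g, unfolded J]
 show "compact J" "J ~= {}" using g(1) J compact_simple_path_image by auto
 show "simply_connected (inside J)" using simply_connected_inside_simple_path[OF g(1)] J by simp
 show cl: "closure (inside J) = J Un inside J" using * by (metis closure_Un_frontier sup_commute)
 show "compact (J Un inside J)" using * by (simp flip: cl)
 show "J \<inter> inside J = {}" using inside_no_overlap[of J] by blast
 show "open (inside J)" "connected (inside J)" "bounded (inside J)" "inside J ~= {}"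
  "frontier (inside J) = J" "frontier (outside J) = J" "open (outside J)"
  "connected (outside J)" "outside J ~= {}" "inside J \<inter> outside J = {}" "inside J Un outside J = - J"
  using * by simp_all
qed

text \<open>Let \<open>K\<close> be the Jordan curve without a short open arc about
  \<open>w\<close>. The curve and \<open>sphere w e Un K\<close> meet exactly in \<open>K\<close>,
  which is connected, and neither of them separates \<open>u\<close> from \<open>v\<close> when
  these are closer to \<open>w\<close> than \<open>K\<close> is. By Janiszewski's theorem their
  union does not separate \<open>u\<close> from \<open>v\<close> either, which gives a path that
  stays inside the curve and inside the ball.\<close>

lemma Jordan_inside_locally_connected:
 fixes g :: "real => complex"
 assumes "simple_path g" "pathfinish g = pathstart g" "w \<in> path_image g" "e > 0"
 obtains d where "d > 0"
  "\<And>u v. u \<in> inside (path_image g) \<inter> ball w d ==> v \<in> inside (path_image g) \<inter> ball w d ==>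
   \<exists>q. path q & path_image q <= inside (path_image g) \<inter> ball w e & pathstart q = u & pathfinish q = v"
proof -
 define J where "J = path_image g"
 obtain a where a: "a \<in> {0..1}" "g a = w"
  using assms(3) by (auto simp: path_image_def)
 define q where "q = shiftpath a g"
 have q: "simple_path q" "pathfinish q = pathstart q" "path_image q = J" "pathstart q = w"
  using assms a by (auto simp: q_def J_def simple_path_shiftpath path_image_shiftpath
    closed_shiftpath pathstart_shiftpath)
 have cq: "continuous_on {0..1} q" using q(1) by (simp add: simple_path_def path_def)
 have q01: "q 0 = w" "q 1 = w" using q by (auto simp: pathstart_def pathfinish_def)
 obtain et0 where et0: "et0 > 0" "\<And>t. t \<in> {0..1} ==> dist t 0 < et0 ==> dist (q t) (q 0) < e"
  using cq \<open>e > 0\<close> unfolding continuous_on_iff by (meson atLeastAtMost_iff order_refl zero_le_one)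
 obtain et1 where et1: "et1 > 0" "\<And>t. t \<in> {0..1} ==> dist t 1 < et1 ==> dist (q t) (q 1) < e"
  using cq \<open>e > 0\<close> unfolding continuous_on_iff by (meson atLeastAtMost_iff order_refl zero_le_one)
 define et where "et = min (1/3) (min (et0/2) (et1/2))"
 have et: "0 < et" "et <= 1/3" "et < et0" "et < et1" using et0 et1 by (auto simp: et_def)
 define K where "K = q ` {et..1-et}"
 have K: "compact K" "connected K" "K ~= {}"
  using cq et unfolding K_def
  by (auto intro!: compact_continuous_image connected_continuous_image elim: continuous_on_subset)
 have KJ: "K <= J" using et q(3) by (auto simp: K_def path_image_def)
 have wK: "w \<notin> K"
 proof
  assume "w \<in> K"
  then obtain t where "t \<in> {et..1-et}" "q t = q 0" by (auto simp: K_def q01)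
  with q(1) et show False unfolding simple_path_def loop_free_def by fastforce
 qed
 have JK: "z \<in> K" if zJ: "z \<in> J" "dist w z \<ge> e" for z
 proof -
  obtain t where t: "t \<in> {0..1}" "q t = z"
   using zJ(1) unfolding q(3)[symmetric] path_image_def by auto
  have "\<not> t < et" using et0(2)[of t] t that et by (auto simp: q01 dist_real_def dist_commute)
  moreover have "\<not> t > 1 - et" using et1(2)[of t] t that et by (auto simp: q01 dist_real_def dist_commute)
  ultimately show ?thesis using t by (auto simp: K_def)
 qed
 define d where "d = min e (infdist w K)"
 have "infdist w K > 0" using K wK
  by (metis compact_imp_closed infdist_nonneg in_closed_iff_infdist_zero less_eq_real_def)
 hence d: "d > 0" "d <= e" using \<open>e > 0\<close> by (auto simp: d_def)
 have dK: "z \<notin> K" if "dist w z < d" for z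
  using that infdist_le[of z K w] by (auto simp: d_def)
 have cJ: "compact J" using assms(1) by (simp add: J_def compact_simple_path_image)
 have JJ: "open (inside J)" "connected (inside J)" "J \<inter> inside J = {}"
  using Jordan_inside_outside[OF assms(1,2)] inside_no_overlap[of J] by (simp_all add: J_def Int_commute)
 show thesis
 proof
  fix u v assume u: "u \<in> inside (path_image g) \<inter> ball w d" and v: "v \<in> inside (path_image g) \<inter> ball w d"
  have "connected_component (- (J Un (sphere w e Un K))) u v"
  proof (rule Janiszewski[OF cJ])
   show "closed (sphere w e Un K)" using K by (intro closed_Un) (auto simp: compact_imp_closed)
   have "J \<inter> (sphere w e Un K) = K" using KJ JK by auto
   thus "connected (J \<inter> (sphere w e Un K))" using K by simp
   show "connected_component (- J) u v" unfolding connected_component_def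
    using u v JJ by (intro exI[of _ "inside J"]) (auto simp: J_def)
   show "connected_component (- (sphere w e Un K)) u v" unfolding connected_component_def
    using u v d dK by (intro exI[of _ "ball w d"]) auto
  qed
  hence "connected_component (- (J Un sphere w e)) u v"
   by (rule connected_component_of_subset) auto
  moreover have "open (- (J Un sphere w e))"
   using cJ by (intro open_Compl closed_Un) (auto simp: compact_imp_closed)
  ultimately have "path_component (- (J Un sphere w e)) u v"
   by (simp add: open_path_connected_component)
  then obtain q where q: "path q" "path_image q <= - (J Un sphere w e)" "pathstart q = u" "pathfinish q = v"
   by (auto simp: path_component_def)
  have con: "connected (path_image q)" using q by (simp add: connected_path_image)
  have uq: "u \<in> path_image q" using q by auto
  have "path_image q <= ball w e"
  proof (rule ccontr)
   assume "\<not> ?thesis"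
   hence "path_image q - ball w e ~= {}" by auto
   moreover have "path_image q \<inter> ball w e ~= {}" using uq u d by auto
   ultimately have "path_image q \<inter> frontier (ball w e) ~= {}"
    using connected_Int_frontier[OF con] by blast
   thus False using q \<open>e > 0\<close> by auto
  qed
  moreover have "path_image q <= inside J"
  proof (rule ccontr)
   assume "\<not> ?thesis"
   hence "path_image q - inside J ~= {}" by auto
   moreover have "path_image q \<inter> inside J ~= {}" using uq u by (auto simp: J_def)
   ultimately have "path_image q \<inter> frontier (inside J) ~= {}"
    using connected_Int_frontier[OF con] by blast
   thus False using q Jordan_inside_outside[OF assms(1,2)] by (auto simp: J_def)
  qed
  ultimately show "\<exists>q. path q & path_image q <= inside (path_image g) \<inter> ball w e & pathstart q = u & pathfinish q = v"
   using q by (auto simp: J_def)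
 qed (rule d)
qed

lemma fashoda_complex:
 fixes f g :: "real => complex"
 assumes "path f" "path g" "path_image f <= cbox a b" "path_image g <= cbox a b"
  "Re (pathstart f) = Re a" "Re (pathfinish f) = Re b"
  "Im (pathstart g) = Im a" "Im (pathfinish g) = Im b"
 obtains z where "z \<in> path_image f" "z \<in> path_image g"
proof -
 define v :: "complex => real^2" where "v = (\<lambda>z. \<chi> i. if i = 1 then Re z else Im z)"
 have v12: "v z $ 1 = Re z" "v z $ 2 = Im z" for z by (simp_all add: v_def)
 have cv: "continuous_on S v" for S
  unfolding v_def
 proof (rule continuous_on_vec_lambda)
  show "continuous_on S (\<lambda>z. if i = 1 then Re z else Im z)" for i :: 2
   by (cases "i = 1") (auto intro!: continuous_intros)
 qed
 have vbox: "v z \<in> cbox (v a) (v b)" if "z \<in> cbox a b" for z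
  using that by (simp add: mem_box_cart forall_2 v12 in_cbox_complex_iff)
 obtain z where "z \<in> path_image (v \<circ> f)" "z \<in> path_image (v \<circ> g)"
 proof (rule fashoda[of "v \<circ> f" "v \<circ> g" "v a" "v b"])
  show "path (v \<circ> f)" "path (v \<circ> g)" using assms cv by (auto intro: path_continuous_image)
 qed (use assms vbox in \<open>auto simp: path_image_compose pathstart_compose pathfinish_compose v12\<close>)
 then obtain x y where "x \<in> path_image f" "y \<in> path_image g" "v x = v y"
  by (auto simp: path_image_compose)
 moreover from this have "x = y" by (metis complex_eqI v12)
 ultimately show thesis using that by blast
qed

text \<open>A two-constants estimate in logarithmic coordinates; what matters is that
  \<open>e\<close> depends on \<open>d\<close>, \<open>et\<close> and \<open>M\<close> only. The
  function \<open>ph (exp s)\<close> is multiplied by \<open>exp (La (q s - c))\<close>, where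
  \<open>q\<close> is an exponential whose argument turns by \<open>2 pi\<close> over the height
  \<open>d\<close>. So \<open>Re q <= 0\<close> on the horizontal sides of a rectangle of height
  \<open>d\<close>, \<open>q\<close> is tiny on its far left side, and \<open>q = 2 c\<close> at the
  middle point \<open>s1\<close> with real part \<open>- ln 2\<close>. The factor is thus at least 1
  at \<open>s1\<close> and very small on the three sides, while on the path the smallness of
  \<open>ph\<close> compensates for it. The maximum principle gives the bound at
  \<open>s1\<close>.\<close>

lemma small_on_crossing_path:
 fixes d et M :: real
 assumes "d > 0" "et > 0" "M > 0"
 obtains e where "e > 0"
  "\<And>ph ga. ph holomorphic_on ball 0 1 ==> (\<And>z. z \<in> ball 0 1 ==> norm (ph z) <= M) ==> path ga ==>
   (\<And>s. s \<in> path_image ga ==> - ln 2 < Re s & Re s < 0 & norm (ph (exp s)) <= e) ==>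
   Im (pathfinish ga) \<ge> Im (pathstart ga) + d ==> \<exists>z. norm z = 1/2 & norm (ph z) <= et"
proof -
 define ka where "ka = 2 * pi / d"
 have ka: "ka > 0" "ka * d = 2 * pi" using assms by (auto simp: ka_def)
 define c where "c = exp (- ka * ln 2) / 2"
 have c: "c > 0" by (simp add: c_def)
 define K where "K = ln 2 + \<bar>ln (c / 2)\<bar> / ka + 1"
 have K: "K > ln 2" 
 proof -
  have "\<bar>ln (c / 2)\<bar> / ka \<ge> 0" using ka(1) by (intro divide_nonneg_pos) auto
  thus ?thesis by (simp add: K_def)
 qed
 have Kc: "exp (- ka * K) <= c / 2"
 proof -
  have "ka * K \<ge> ka * (\<bar>ln (c / 2)\<bar> / ka)" using ka by (intro mult_left_mono) (auto simp: K_def)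
  hence "- ka * K <= ln (c / 2)" using ka by simp
  hence "exp (- ka * K) <= exp (ln (c / 2))" by simp
  thus ?thesis using c by simp
 qed
 \<comment> \<open>Chosen such that \<open>M exp (- La c / 2) <= et\<close>: this handles the three
   sides, where only the bound \<open>M\<close> is known for \<open>ph\<close>.\<close>
 define La where "La = 2 * \<bar>ln (et / M)\<bar> / c"
 have La: "La \<ge> 0" using c by (simp add: La_def)
 have MLa: "M * exp (- La * c / 2) <= et"
 proof -
  have "- La * c / 2 <= ln (et / M)" using c by (simp add: La_def)
  hence "exp (- La * c / 2) <= exp (ln (et / M))" by (simp only: exp_le_cancel_iff)
  hence "exp (- La * c / 2) <= et / M" using assms by (simp only: exp_ln divide_pos_pos)
  thus ?thesis using assms by (simp add: field_simps)
 qed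
 \<comment> \<open>On the path the factor is at most \<open>exp La\<close>, so this \<open>e\<close>
   makes the product at most \<open>et\<close> there.\<close>
 define e where "e = et * exp (- La)"
 show thesis
 proof
  show "e > 0" using assms by (simp add: e_def)
  fix ph :: "complex => complex" and ga
  assume hol: "ph holomorphic_on ball 0 1" and bd: "\<And>z. z \<in> ball 0 1 ==> norm (ph z) <= M"
   and p: "path ga"
   and ga: "\<And>s. s \<in> path_image ga ==> - ln 2 < Re s & Re s < 0 & norm (ph (exp s)) <= e"
   and Im: "Im (pathfinish ga) \<ge> Im (pathstart ga) + d"
  define \<alpha> where "\<alpha> = Im (pathstart ga)"
  define bet where "bet = \<alpha> + d"
  define mid where "mid = \<alpha> + d / 2"
  define R where "R = box (Complex (-K) \<alpha>) (Complex 0 bet)"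
  have Rmem: "z \<in> R \<longleftrightarrow> - K < Re z & Re z < 0 & \<alpha> < Im z & Im z < bet" for z
   by (auto simp: R_def in_box_complex_iff)
  define s1 where "s1 = Complex (- ln 2) mid"
  define q where "q = (\<lambda>s. exp (ka *\<^sub>R (s - Complex 0 mid)))"
  have Req: "Re (q s) = exp (ka * Re s) * cos (ka * (Im s - mid))" for s
   by (simp add: q_def Re_exp)
  have nq: "norm (q s) = exp (ka * Re s)" for s by (simp add: q_def)
  define W where "W = (\<lambda>s. ph (exp s) * exp (La *\<^sub>R (q s - of_real c)))"
  have nW: "norm (W s) = norm (ph (exp s)) * exp (La * (Re (q s) - c))" for s
   by (simp add: W_def norm_mult)
  have expb: "exp s \<in> ball 0 1" if "Re s < 0" for s :: complex using that by simp
  have holW: "W holomorphic_on {s. Re s < 0}"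
   unfolding W_def q_def scaleR_conv_of_real
   by (intro holomorphic_intros holomorphic_on_compose_gen[OF _ hol, unfolded o_def]) auto
  define P where "P = path_image ga"
  have cP: "compact P" "P ~= {}" unfolding P_def by (rule compact_path_image[OF p], rule path_image_nonempty)
  obtain sm where sm: "sm \<in> P" "\<And>s. s \<in> P ==> Re s <= Re sm"
   using continuous_attains_sup[OF cP continuous_on_Re[OF continuous_on_id]] by blast
  define ro where "ro = Re sm"
  have ro: "ro < 0" "- ln 2 < ro" using sm ga by (auto simp: ro_def P_def)
  define U where "U = connected_component_set (R - P) s1"
  have oRP: "open (R - P)" using cP by (auto simp: R_def compact_imp_closed open_Diff)
  have s1: "s1 \<in> R - P" using K assms ga[of s1] by (auto simp: s1_def Rmem P_def mid_def bet_def ln_gt_zero)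
  have oU: "open U" "U <= R - P" "s1 \<in> U"
   using oRP s1 by (auto simp: U_def open_connected_component connected_component_subset)
  \<comment> \<open>A path in \<open>R - P\<close> from \<open>s1\<close> to a point to the right of
    all of \<open>ga\<close>, prolonged horizontally to both vertical sides, would have to cross
    \<open>ga\<close>. Hence \<open>closure U\<close> stays in \<open>Re s <= ro < 0\<close>, where
    \<open>W\<close> is continuous.\<close>
  have Ule: "Re s2 <= ro" if s2: "s2 \<in> U" for s2
  proof (rule ccontr)
   assume gt: "\<not> ?thesis"
   have "path_component (R - P) s1 s2"
    using s2 oRP by (simp add: U_def open_path_connected_component)
   then obtain de where de: "path de" "path_image de <= R - P" "pathstart de = s1" "pathfinish de = s2"
    by (auto simp: path_component_def)
   have s2R: "s2 \<in> R - P" using s2 oU by auto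
   define x1 x2 where "x1 = Complex (-K) mid" and "x2 = Complex 0 (Im s2)"
   define F where "F = linepath x1 s1 +++ de +++ linepath s2 x2"
   have segL: "Re z <= - ln 2 & -K <= Re z & Im z = mid" if "z \<in> closed_segment x1 s1" for z
    using that K by (auto simp: x1_def s1_def closed_segment_same_Im closed_segment_eq_real_ivl)
   have segR: "Re z > ro & Re z <= 0 & Im z = Im s2" if "z \<in> closed_segment s2 x2" for z
    using that gt s2R by (auto simp: x2_def Rmem closed_segment_same_Im closed_segment_eq_real_ivl split: if_splits)
   have Fim: "path_image F = closed_segment x1 s1 Un path_image de Un closed_segment s2 x2"
    using de by (auto simp: F_def path_image_join)
   have F1: "-K <= Re z & Re z <= 0 & \<alpha> < Im z & Im z < bet & z \<notin> P" if "z \<in> path_image F" for z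
    using that unfolding Fim
   proof (elim UnE)
    assume "z \<in> closed_segment x1 s1"
    from segL[OF this] show ?thesis using assms ga[of z] order_trans[of "Re z" "- ln 2" 0]
     by (auto simp: mid_def bet_def P_def)
   next
    assume "z \<in> path_image de" thus ?thesis using de Rmem[of z] by auto
   next
    assume "z \<in> closed_segment s2 x2"
    from segR[OF this] have *: "Re z > ro" "Re z <= 0" "Im z = Im s2" by auto
    have "z \<notin> P" using sm(2)[of z] *(1) by (auto simp: ro_def)
    moreover have "-K <= Re z" using *(1) ro(2) K by linarith
    ultimately show ?thesis using * s2R Rmem[of s2] by auto
   qed
   \<comment> \<open>Clamping the heights of \<open>ga\<close> to the rectangle allows the crossing
     theorem to be applied; a crossing at a height strictly between the two bounds is a point of
     \<open>ga\<close> itself.\<close>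
   define cl where "cl = (\<lambda>z. Complex (Re z) (max \<alpha> (min bet (Im z))))"
   have ccl: "continuous_on S cl" for S
    unfolding cl_def by (intro continuous_on_Complex continuous_intros)
   obtain z where z: "z \<in> path_image F" "z \<in> path_image (cl \<circ> ga)"
   proof (rule fashoda_complex[of F "cl \<circ> ga" "Complex (-K) \<alpha>" "Complex 0 bet"])
    show "path F" using de by (auto simp: F_def)
    show "path (cl \<circ> ga)" using p ccl by (auto intro: path_continuous_image)
    show "path_image F <= cbox (Complex (- K) \<alpha>) (Complex 0 bet)"
    proof
     fix z assume "z \<in> path_image F"
     from F1[OF this] show "z \<in> cbox (Complex (- K) \<alpha>) (Complex 0 bet)" by (simp add: in_cbox_complex_iff)
    qed
    show "path_image (cl \<circ> ga) <= cbox (Complex (- K) \<alpha>) (Complex 0 bet)"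
    proof -
     have "cl s \<in> cbox (Complex (- K) \<alpha>) (Complex 0 bet)" if "s \<in> path_image ga" for s
      using ga[OF that] K assms(1) by (simp add: in_cbox_complex_iff cl_def bet_def)
     thus ?thesis unfolding path_image_compose by blast
    qed
    show "Re (pathstart F) = Re (Complex (- K) \<alpha>)" "Re (pathfinish F) = Re (Complex 0 bet)"
     by (auto simp: F_def x1_def x2_def)
    show "Im (pathstart (cl \<circ> ga)) = Im (Complex (- K) \<alpha>)" "Im (pathfinish (cl \<circ> ga)) = Im (Complex 0 bet)"
     using Im assms(1) by (auto simp: pathstart_compose pathfinish_compose cl_def \<alpha>_def bet_def)
   qed
   from z(2) obtain s where s: "s \<in> P" "z = cl s" by (auto simp: path_image_compose P_def)
   have "\<alpha> < Im z" "Im z < bet" using F1[OF z(1)] by auto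
   hence "Im z = Im s" by (auto simp: s cl_def max_def min_def split: if_splits)
   hence "z = s" using s by (auto simp: complex_eq_iff cl_def)
   thus False using F1[OF z(1)] s by auto
  qed
  have clU: "closure U <= {s. Re s <= ro}"
   by (rule closure_minimal) (use Ule in \<open>auto simp: closed_halfspace_Re_le\<close>)
  have "norm (W s1) <= et"
  proof (rule maximum_modulus_frontier[of W U])
   show "W holomorphic_on interior U"
    using holW by (rule holomorphic_on_subset) (use interior_subset oU Rmem in auto)
   show "continuous_on (closure U) W"
    using holW[THEN holomorphic_on_imp_continuous_on] by (rule continuous_on_subset) (use clU ro in auto)
   show "bounded U" using oU bounded_subset[of R U] by (auto simp: R_def)
   show "s1 \<in> U" by (rule oU)
   fix z assume z: "z \<in> frontier U"
   hence zc: "z \<in> closure U" "z \<notin> U" using oU by (auto simp: frontier_def interior_open)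
   have Rez: "Re z < 0" using zc clU ro by auto
   have zR: "z \<in> closure R" using zc closure_mono[of U R] oU by auto
   have zcb: "- K <= Re z & \<alpha> <= Im z & Im z <= bet"
   proof -
    have "closure R <= cbox (Complex (-K) \<alpha>) (Complex 0 bet)" unfolding R_def
     by (rule closure_minimal) (auto simp: box_subset_cbox)
    with zR show ?thesis by (auto simp: in_cbox_complex_iff)
   qed
   have nin: "z \<notin> R - P"
   proof
    assume "z \<in> R - P"
    hence "z \<in> connected_component_set (R - P) z" "open (connected_component_set (R - P) z)"
     using oRP by (auto simp: open_connected_component)
    hence "connected_component_set (R - P) z \<inter> U ~= {}"
     using zc(1) open_Int_closure_eq_empty[of "connected_component_set (R - P) z" U] by blast
    hence "connected_component_set (R - P) z = U"
     unfolding U_def using connected_component_nonoverlap[of "R - P" z s1] by blast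
    thus False using zc \<open>z \<in> connected_component_set (R - P) z\<close> by auto
   qed
   have M0: "norm (ph (exp z)) <= M" using bd expb Rez by auto
   show "norm (W z) <= et"
   proof (cases "z \<in> P")
    case True
    have "Re (q z) - c <= 1"
    proof -
     have "norm (q z) <= 1" using nq[of z] mult_pos_neg[OF ka(1) Rez] by simp
     thus ?thesis using complex_Re_le_cmod[of "q z"] c by linarith
    qed
    hence "La * (Re (q z) - c) <= La" using mult_left_mono[OF _ La, of "Re (q z) - c" 1] by simp
    hence "norm (W z) <= e * exp La" unfolding nW
     using ga[of z] True assms(2) by (intro mult_mono) (auto simp: P_def e_def)
    thus ?thesis by (simp add: e_def mult.assoc flip: exp_add)
   next
    case False
    hence "z \<notin> R" using nin by auto
    then consider "Re z = -K" | "Im z = \<alpha>" | "Im z = bet" using zcb Rez unfolding Rmem by force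
    hence "Re (q z) - c <= - c / 2"
    proof cases
     case 1
     hence "norm (q z) <= c / 2" using Kc nq[of z] by simp
     thus ?thesis using abs_Re_le_cmod[of "q z"] by linarith
    next
     case 2
     hence "ka * (Im z - mid) = - pi" using ka by (auto simp: mid_def algebra_simps)
     hence "Re (q z) <= 0" using Req[of z] by simp
     thus ?thesis using c by simp
    next
     case 3
     hence "ka * (Im z - mid) = pi" using ka by (auto simp: mid_def bet_def algebra_simps)
     hence "Re (q z) <= 0" using Req[of z] by simp
     thus ?thesis using c by simp
    qed
    hence "La * (Re (q z) - c) <= La * (- c / 2)" using La by (rule mult_left_mono)
    hence "norm (W z) <= M * exp (- La * c / 2)" unfolding nW
     using M0 assms by (intro mult_mono) auto
    thus ?thesis using MLa by linarith
   qed
  qed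
  moreover have "norm (ph (exp s1)) <= norm (W s1)"
  proof -
   have "Re (q s1) = 2 * c" using Req[of s1] by (simp add: s1_def c_def)
   hence "La * (Re (q s1) - c) \<ge> 0" using La c by simp
   hence "exp (La * (Re (q s1) - c)) \<ge> 1" by simp
   thus ?thesis using nW[of s1] mult_left_mono[of 1 "exp (La * (Re (q s1) - c))" "norm (ph (exp s1))"] by simp
  qed
  moreover have "norm (exp s1) = 1/2" by (simp add: s1_def exp_minus)
  ultimately show "\<exists>z. norm z = 1/2 & norm (ph z) <= et" by (intro exI[of _ "exp s1"]) auto
 qed
qed


text \<open>If \<open>g\<close> oscillated near \<open>w\<close>, the image of a short path in \<open>Om\<close> near \<open>w\<close> would be a long path close to
 the unit circle on which \<open>f - w\<close> is small, contradicting the previous lemma.\<close>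

lemma biholomorphism_oscillation:
 fixes c :: "real => complex" and f g :: "complex => complex"
 defines "Om \<equiv> inside (path_image c)"
 assumes c: "simple_path c" "pathfinish c = pathstart c"
  and f: "f holomorphic_on ball 0 1" "f ` ball 0 1 <= Om"
  and g: "g holomorphic_on Om" "g ` Om <= ball 0 1" "\<And>z. z \<in> Om ==> f (g z) = z"
  and w: "w \<in> path_image c" and "e > 0"
 obtains d where "d > 0" "\<And>u v. u \<in> Om \<inter> ball w d ==> v \<in> Om \<inter> ball w d ==> norm (g u - g v) < e"
proof -
 have J: "Jordan (path_image c)" using c by (auto simp: Jordan_def)
 have bO: "bounded Om" "open Om" and wOm: "w \<notin> Om"
  using Jordan_facts(3,5,10)[OF J] w by (auto simp: Om_def)
 have "bounded ((\<lambda>z. z - w) ` Om)"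
  using bO by (simp add: bounded_translation_minus)
 then obtain M where M: "M > 0" "\<And>z. z \<in> Om ==> norm (z - w) <= M"
  by (auto simp: bounded_pos)
 define ph where "ph = (\<lambda>z. f z - w)"
 have hol: "ph holomorphic_on ball 0 1" unfolding ph_def using f by (intro holomorphic_intros)
 have bd: "norm (ph z) <= M" if "z \<in> ball 0 1" for z using M(2) f(2) that by (auto simp: ph_def image_subset_iff)
 have nz: "ph z ~= 0" if "z \<in> ball 0 1" for z using wOm f(2) that by (auto simp: ph_def image_subset_iff)
 \<comment> \<open>The bound \<open>exp (- e / 4)\<close> leaves less than \<open>e / 2\<close> for
   the oscillation of the logarithm of the modulus; the bound \<open>1/2\<close> places the circle
   of the previous lemma in the disc where \<open>ph\<close> exceeds \<open>et\<close>.\<close>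
 define r where "r = max (1/2) (exp (- e / 4))"
 have r: "1/2 <= r" "r < 1" "- e / 4 <= ln r" using \<open>e > 0\<close>
  by (auto simp: r_def ln_ge_iff)
 have "compact (cball (0::complex) r)" "cball (0::complex) r ~= {}" using r by auto
 moreover have "continuous_on (cball 0 r) (\<lambda>z. norm (ph z))"
  using r hol by (intro continuous_intros continuous_on_subset[OF holomorphic_on_imp_continuous_on[OF hol]]) auto
 ultimately obtain z0 where z0: "z0 \<in> cball 0 r" "\<And>z. z \<in> cball 0 r ==> norm (ph z0) <= norm (ph z)"
  using continuous_attains_inf[of "cball 0 r" "\<lambda>z. norm (ph z)"] by blast
 define et where "et = norm (ph z0) / 2"
 have et: "et > 0" "\<And>z. z \<in> cball 0 r ==> et < norm (ph z)"

 proof -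
  have "norm (ph z0) > 0" using nz[of z0] z0 r by auto
  thus "et > 0" "\<And>z. z \<in> cball 0 r ==> et < norm (ph z)" using z0(2) unfolding et_def by (smt (verit) field_sum_of_halves)+
 qed
 obtain eps where eps: "eps > 0"
  "\<And>ph ga. ph holomorphic_on ball 0 1 ==> (\<And>z. z \<in> ball 0 1 ==> norm (ph z) <= M) ==> path ga ==>
   (\<And>s. s \<in> path_image ga ==> - ln 2 < Re s & Re s < 0 & norm (ph (exp s)) <= eps) ==>
   Im (pathfinish ga) \<ge> Im (pathstart ga) + e / 2 ==> \<exists>z. norm z = 1/2 & norm (ph z) <= et"
  by (rule small_on_crossing_path[of "e / 2" et M]) (use \<open>e > 0\<close> et(1) M(1) in auto)
 obtain d where d: "d > 0"
  "\<And>u v. u \<in> Om \<inter> ball w d ==> v \<in> Om \<inter> ball w d ==>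
   \<exists>q. path q & path_image q <= Om \<inter> ball w (min eps et) & pathstart q = u & pathfinish q = v"
  unfolding Om_def by (rule Jordan_inside_locally_connected[OF c w, of "min eps et"]) (use eps(1) et(1) in auto)
 show thesis
 proof
  fix u v assume uv: "u \<in> Om \<inter> ball w d" "v \<in> Om \<inter> ball w d"
  then obtain q where q: "path q" "path_image q <= Om \<inter> ball w (min eps et)" "pathstart q = u" "pathfinish q = v"
   using d by blast
  have gq: "path (g \<circ> q)"
   using q g(1) by (intro path_continuous_image) (auto intro: continuous_on_subset holomorphic_on_imp_continuous_on)
  have gim: "norm z < 1 & r < norm z & norm (ph z) < eps" if zim: "z \<in> path_image (g \<circ> q)" for z
  proof -
   obtain y where y: "y \<in> Om" "dist w y < min eps et" "z = g y"
    using zim q(2) unfolding path_image_compose by fastforce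
   hence lt: "norm (ph z) < eps" "norm (ph z) < et" using g(3)[of y] by (simp_all add: ph_def dist_norm norm_minus_commute)
   have "norm z < 1" using y g(2) by (simp add: image_subset_iff)
   moreover have "z \<notin> cball 0 r" using et(2)[of z] lt by linarith
   ultimately show ?thesis using lt by simp
  qed
  have nz0: "0 \<notin> path_image (g \<circ> q)" using gim r by force
  have gq1: "continuous_on {0..1} (g \<circ> q)" using gq by (simp add: path_def)
  have gq2: "contractible {0..1::real}" by (simp add: convex_imp_contractible)
  have gq3: "(g \<circ> q) t ~= 0" if "t \<in> {0..1}" for t
   using nz0 imageI[OF that, of "g \<circ> q"] by (auto simp: path_image_def)
  \<comment> \<open>Along a logarithm of the path the angular extent becomes a difference of
    heights. It is less than \<open>e / 2\<close> by the previous lemma, applied to \<open>l\<close>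
    and to its reverse.\<close>
  obtain l where l: "continuous_on {0..1} l" "\<And>t. t \<in> {0..1} ==> (g \<circ> q) t = exp (l t)"
   using continuous_logarithm_on_contractible[OF gq1 gq2 gq3] by blast
  have lp: "path l" using l by (simp add: path_def)
  have lim: "ln r < Re s & Re s < 0 & norm (ph (exp s)) < eps" if "s \<in> path_image l" for s
  proof -
   obtain t where t: "t \<in> {0..1}" "s = l t" using \<open>s \<in> path_image l\<close> by (auto simp: path_image_def)
   hence *: "exp s \<in> path_image (g \<circ> q)" using l(2)[of t] imageI[OF t(1), of "g \<circ> q"] by (simp add: path_image_def)
   have "exp (Re s) < 1" "r < exp (Re s)" using gim[OF *] by auto
   hence "Re s < 0" "ln r < ln (exp (Re s))" using r by (auto simp del: ln_exp)
   thus ?thesis using gim[OF *] by auto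
  qed
  have lim2: "- ln 2 < Re s & Re s < 0 & norm (ph (exp s)) <= eps" if "s \<in> path_image l" for s
  proof -
   have "ln (1/2) <= ln r" using r by (subst ln_le_cancel_iff) auto
   thus ?thesis using lim[OF that] by (auto simp: ln_div)
  qed
  have no: "\<not> (\<exists>z. norm z = 1/2 & norm (ph z) <= et)"
  proof clarify
   fix z :: complex assume "norm z = 1/2" "norm (ph z) <= et"
   thus False using et(2)[of z] r(1) by simp
  qed
  have notfar: "\<not> Im (pathfinish l') \<ge> Im (pathstart l') + e / 2"
   if l': "path l'" "path_image l' = path_image l" for l'
  proof
   assume far: "Im (pathfinish l') \<ge> Im (pathstart l') + e / 2"
   have "\<exists>z. norm z = 1/2 & norm (ph z) <= et"
   proof (rule eps(2)[of ph l'])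
    show "- ln 2 < Re s & Re s < 0 & norm (ph (exp s)) <= eps" if "s \<in> path_image l'" for s
     by (rule lim2) (use that l' in simp)
   qed (fact hol, fact bd, fact l'(1), fact far)
   with no show False by (rule notE)
  qed
  have "\<not> Im (l 1) \<ge> Im (l 0) + e / 2"
   using notfar[OF lp refl] by (simp only: pathstart_def pathfinish_def simp_thms)
  moreover have "\<not> Im (l 0) \<ge> Im (l 1) + e / 2"
   using notfar[of "reversepath l", unfolded path_reversepath path_image_reversepath, OF lp refl]
   by (simp only: pathstart_reversepath pathfinish_reversepath) (simp only: pathstart_def pathfinish_def simp_thms)
  moreover have l01: "l 0 \<in> path_image l" "l 1 \<in> path_image l"
   using pathstart_in_path_image[of l] pathfinish_in_path_image[of l]
   by (simp_all only: pathstart_def pathfinish_def)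
  moreover have "\<bar>Re (l 1) - Re (l 0)\<bar> < e / 2"  "Re (l 0) <= 0" "Re (l 1) <= 0"
   using lim[OF l01(1)] lim[OF l01(2)] r(3) \<open>e > 0\<close> by linarith+
  ultimately have ll: "norm (l 1 - l 0) < e" "Re (l 0) <= 0" "Re (l 1) <= 0"
   using cmod_le[of "l 1 - l 0"] by (simp_all add: abs_if split: if_splits)
  have "norm (exp (l 1) - exp (l 0)) <= 1 * norm (l 1 - l 0)"
  proof (rule field_differentiable_bound[where S = "{s. Re s <= 0}" and f = exp and f' = exp])
   show "convex {s. Re s <= 0}" by (simp add: convex_halfspace_Re_le)
   show "(exp has_field_derivative exp z) (at z within {s. Re s <= 0})" for z :: complex
    by (rule has_field_derivative_at_within[OF DERIV_exp])
   show "norm (exp z) <= 1" if "z \<in> {s. Re s <= 0}" for z using that by simp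
   show "l 1 \<in> {s. Re s <= 0}" "l 0 \<in> {s. Re s <= 0}" using ll by auto
  qed
  moreover have "g u = exp (l 0)" "g v = exp (l 1)"
   using l(2)[of 0] l(2)[of 1] unfolding q(3,4)[symmetric] pathstart_def pathfinish_def by simp_all
  ultimately show "norm (g u - g v) < e" using ll by (simp add: norm_minus_commute)
 qed (rule d)
qed


text \<open>If \<open>F\<close> missed a point \<open>q t1\<close> of one arc and a point
  \<open>q t2\<close> of the other, these two points would cut the loop into two closed arcs that
  cover \<open>F\<close>, both meet it, and have no common point in it.\<close>

lemma connected_loop_contains_arc:
 fixes q :: "real => complex"
 assumes q: "simple_path q" "pathfinish q = pathstart q"
  and F: "closed F" "connected F" "F <= path_image q" and s: "0 < s" "s < 1"
  and "q 0 \<in> F" "q s \<in> F"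
 shows "q ` {0..s} <= F \<or> q ` {s..1} <= F"
proof (rule ccontr)
 assume "\<not> ?thesis"
 then obtain t1 t2 where t: "t1 \<in> {0..s}" "t2 \<in> {s..1}" "q t1 \<notin> F" "q t2 \<notin> F" by blast
 have cq: "continuous_on {0..1} q" using q by (simp add: simple_path_def path_def)
 define A where "A = q ` {t1..t2}"
 define B where "B = q ` ({0..t1} Un {t2..1})"
 have t12: "{t1..t2} <= {0..1}" "{0..t1} Un {t2..1} <= {0..1}" using t s by auto
 have "closed A" "closed B"
  unfolding A_def B_def
  by (intro compact_imp_closed compact_continuous_image continuous_on_subset[OF cq] t12; simp add: compact_Un)+
 moreover have "F <= A Un B"
 proof -
  have "path_image q = q ` ({t1..t2} Un ({0..t1} Un {t2..1}))"
  proof -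
   have "{0..1} = {t1..t2} Un ({0..t1} Un {t2..1})" using t(1,2) s by auto
   thus ?thesis unfolding path_image_def by (rule arg_cong)
  qed
  thus ?thesis using F by (auto simp: A_def B_def)
 qed
 moreover have "A \<inter> B \<inter> F = {}"
 proof (rule ccontr)
  assume "A \<inter> B \<inter> F ~= {}"
  then obtain z where z: "z \<in> A" "z \<in> B" "z \<in> F" by blast
  obtain x where x: "x \<in> {t1..t2}" "z = q x" using z(1) unfolding A_def by (rule imageE)
  obtain y where y: "y \<in> {0..t1} Un {t2..1}" "z = q y" using z(2) unfolding B_def by (rule imageE)
  have xy: "x \<in> {t1..t2}" "y \<in> {0..t1} Un {t2..1}" "q x = q y" "q x \<in> F" using x y z(3) by simp_all
  hence "x = y \<or> x = 0 & y = 1 \<or> x = 1 & y = 0"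
  proof -
   have lf: "\<And>x y. x \<in> {0..1} ==> y \<in> {0..1} ==> q x = q y ==> x = y \<or> x = 0 & y = 1 \<or> x = 1 & y = 0"
    using q(1) unfolding simple_path_def loop_free_def by metis
   show ?thesis by (rule lf[OF subsetD[OF t12(1) xy(1)] subsetD[OF t12(2) xy(2)] xy(3)])
  qed
  moreover have "x ~= t1" "x ~= t2" using xy(4) t(3,4) by blast+
  moreover have q0: "q 1 \<in> F" using q(2) assms(8) by (simp add: pathstart_def pathfinish_def)
  have "t1 ~= 0" "t2 ~= 1" using q0 assms(8) t(3,4) by metis+
  hence "0 < t1" "t2 < 1" using t by auto
  ultimately show False using xy by auto
 qed
 moreover have "q s \<in> A" "q 0 \<in> B" using t s by (auto simp: A_def B_def)
 ultimately show False using F(2) assms(8,9) using connected_closedD[OF F(2), of A B] by blast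
qed

text \<open>The rotations of a point by the multiples of \<open>2 pi / m\<close> leave gaps of arc
  length \<open>2 pi R / m\<close>, which is below \<open>ka\<close> for large
  \<open>m\<close>.\<close>

lemma rotation_exists:
 fixes z :: complex and ka R :: real
 assumes "ka > 0" "R > 0"
 obtains m where "m > 0" "\<And>z y. norm z = R ==> norm y = R ==> \<exists>k<m. norm (cis (2 * pi * real k / real m) * z - y) < ka"
proof -
 obtain m :: nat where m: "2 * pi * R / ka < real m" using reals_Archimedean2 by blast
 have "2 * pi * R / ka > 0" using assms by simp
 hence m0: "m > 0" using m by (metis of_nat_0_less_iff less_trans)
 have mk: "2 * pi * R / real m < ka" using m m0 assms by (simp add: field_simps)
 show thesis
 proof
  fix z y :: complex assume zy: "norm z = R" "norm y = R"
  define t where "t = Arg2pi (y / z)"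
  have z0: "z ~= 0" "y ~= 0" using zy assms by auto
  have t: "0 <= t" "t < 2 * pi" "y = cis t * z"
  proof -
   show "0 <= t" "t < 2 * pi" unfolding t_def by (rule Arg2pi_ge_0, rule Arg2pi_lt_2pi)
   have "y / z = of_real (norm (y / z)) * exp (\<i> * of_real (Arg2pi (y / z)))" by (rule Arg2pi_eq)
   hence "y / z = exp (\<i> * of_real t)" using zy assms by (simp add: norm_divide t_def)
   hence "y / z = cis t" by (simp add: cis_conv_exp)
   thus "y = cis t * z" using z0 by (simp add: field_simps)
  qed
  define k where "k = nat \<lfloor>t * real m / (2 * pi)\<rfloor>"
  have nn: "0 <= t * real m / (2 * pi)" using t by simp
  have k1: "real k <= t * real m / (2 * pi)" "t * real m / (2 * pi) < real k + 1"
   using nn by (auto simp: k_def)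
  have "t * real m / (2 * pi) < real m" using t m0 by (simp add: field_simps)
  hence km: "k < m" using k1 by linarith
  have k2: "\<bar>2 * pi * real k / real m - t\<bar> <= 2 * pi / real m"
  proof -
   have "2 * pi * real k / real m <= t" using k1(1) m0 by (simp add: field_simps)
   moreover have "t <= 2 * pi * (real k + 1) / real m" using k1(2) m0 by (simp add: field_simps)
   moreover have "2 * pi * (real k + 1) / real m = 2 * pi * real k / real m + 2 * pi / real m"
    by (simp add: distrib_left add_divide_distrib)
   ultimately show ?thesis by linarith
  qed
  have "norm (cis a - cis b) <= \<bar>a - b\<bar>" for a b
  proof -
   have "cis a - cis b = cis b * (exp (\<i> * of_real (a - b)) - 1)"
    by (simp add: cis_conv_exp algebra_simps flip: exp_add)
   hence "norm (cis a - cis b) = 2 * \<bar>sin ((a - b) / 2)\<bar>"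
    by (simp only: norm_mult norm_cis dist_exp_i_1 mult_1)
   thus ?thesis using abs_sin_x_le_abs_x[of "(a - b) / 2"] by simp
  qed
  from this[of "2 * pi * real k / real m" t]
  have "norm (cis (2 * pi * real k / real m) - cis t) <= 2 * pi / real m" using k2 by linarith
  moreover have "cis (2 * pi * real k / real m) * z - y = (cis (2 * pi * real k / real m) - cis t) * z"
   using t by (simp add: algebra_simps)
  ultimately have "norm (cis (2 * pi * real k / real m) * z - y) <= 2 * pi / real m * R"
   using zy(1) assms(2) by (simp add: norm_mult mult_right_mono del: times_divide_eq_left)
  thus "\<exists>k<m. norm (cis (2 * pi * real k / real m) * z - y) < ka" using km mk by auto
 qed (rule m0)
qed

text \<open>Multiply \<open>G - ze\<close> with its rotations about a point of \<open>Om\<close> close to the boundary arc: as the rotations of a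
 small disc outside \<open>Om\<close> cover a circle, the product vanishes on the whole frontier of its domain.\<close>

lemma boundary_constant_on_open_arc:
 fixes G :: "complex => complex"
 assumes J: "Jordan J" and contG: "continuous_on (J Un inside J) G" and holG: "G holomorphic_on inside J"
  and p: "p \<in> J" and "ro > 0" and const: "\<And>z. z \<in> J ==> dist p z < ro ==> G z = ze"
 shows "\<exists>w\<in>inside J. G w = ze"
proof -
 note JF = Jordan_facts[OF J]
 define Om where "Om = inside J"
 have "p \<in> closure Om" using p JF by (simp add: Om_def)
 then obtain w1 where w1: "w1 \<in> Om" "dist w1 p < ro / 8"
  using \<open>ro > 0\<close> by (meson closure_approachable divide_pos_pos zero_less_numeral)
 have "p \<in> closure (outside J)" using p JF(12) by (auto simp: frontier_def)
 then obtain o1 where o1: "o1 \<in> outside J" "dist o1 p < ro / 8"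
  using \<open>ro > 0\<close> by (meson closure_approachable divide_pos_pos zero_less_numeral)
 obtain ka where ka: "ka > 0" "ball o1 ka <= outside J"
  using JF(13) o1(1) by (meson open_contains_ball)
 define R where "R = dist w1 o1"
 have "w1 ~= o1" using w1(1) o1(1) JF(16) unfolding Om_def by blast
 hence R: "R > 0" by (simp add: R_def)
 have R2: "R < ro / 2" using dist_triangle2[of w1 o1 p] w1(2) o1(2) \<open>ro > 0\<close> by (simp add: R_def)
 obtain m where m: "m > 0"
  "\<And>z y. norm z = R ==> norm y = R ==> \<exists>k<m. norm (cis (2 * pi * real k / real m) * z - y) < ka"
  using rotation_exists[OF ka(1) R] by blast
 define rot where "rot = (\<lambda>k z. w1 + cis (2 * pi * real k / real m) * (z - w1))"
 have drot: "dist w1 (rot k z) = dist w1 z" for k z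
  by (simp add: rot_def dist_norm norm_mult norm_minus_commute)
 have crot: "continuous_on S (rot k)" "isCont (rot k) z" for S k z unfolding rot_def by (intro continuous_intros)+
 define V where "V = ball w1 R \<inter> (\<Inter>k<m. rot k -` Om)"
 have oV: "open V" unfolding V_def
  using JF(3) by (intro open_Int open_ball open_INT ballI continuous_open_vimage crot) (auto simp: Om_def)
 have w1V: "w1 \<in> V" using R w1 by (auto simp: V_def rot_def)
 have clV: "closure V <= cball w1 R \<inter> (\<Inter>k<m. rot k -` (J Un Om))"
 proof (rule closure_minimal)
  show "V <= cball w1 R \<inter> (\<Inter>k<m. rot k -` (J Un Om))" by (auto simp: V_def)
  show "closed (cball w1 R \<inter> (\<Inter>k<m. rot k -` (J Un Om)))"
   using JF(9) by (intro closed_Int closed_cball closed_INT ballI continuous_closed_vimage crot)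
    (auto simp: Om_def compact_imp_closed)
 qed
 define F where "F = (\<lambda>z. \<Prod>k<m. G (rot k z) - ze)"
 have "norm (F w1) <= 0"
 proof (rule maximum_modulus_frontier[of F V])
  have "(\<lambda>z. G (rot k z)) holomorphic_on interior V" if "k < m" for k
  proof -
   have "rot k holomorphic_on interior V" unfolding rot_def by (intro holomorphic_intros)
   moreover have "rot k ` interior V <= inside J"
    using interior_subset[of V] \<open>k < m\<close> by (auto simp: V_def Om_def)
   ultimately show ?thesis using holomorphic_on_compose_gen[OF _ holG] by (simp add: o_def)
  qed
  thus "F holomorphic_on interior V" unfolding F_def by (intro holomorphic_intros) auto
  show "continuous_on (closure V) F" unfolding F_def
  proof (intro continuous_on_prod continuous_on_diff continuous_on_const)
   fix k assume "k \<in> {..<m}"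
   hence "rot k ` closure V <= J Un inside J" using clV by (auto simp: Om_def)
   thus "continuous_on (closure V) (\<lambda>z. G (rot k z))"
    using continuous_on_compose2[OF contG crot(1)] by blast
  qed
  show "bounded V" by (rule bounded_subset[of "ball w1 R"]) (auto simp: V_def)
  show "w1 \<in> V" by (rule w1V)
  fix z assume "z \<in> frontier V"
  hence z: "z \<in> closure V" "z \<notin> V" using oV by (auto simp: frontier_def interior_open)
  have zR: "dist w1 z <= R" using subsetD[OF clV z(1)] by simp
  \<comment> \<open>On the circle of radius \<open>R\<close> some rotation takes \<open>z\<close>
    into the ball about \<open>o1\<close> outside the curve, but every rotation keeps
    \<open>closure V\<close> in \<open>J Un Om\<close>. So a frontier point fails to lie in
    \<open>V\<close> only because some rotation moves it onto \<open>J\<close>, and there the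
    corresponding factor is 0.\<close>
  have "dist w1 z ~= R"
  proof
   assume "dist w1 z = R"
   hence "norm (z - w1) = R" "norm (o1 - w1) = R" unfolding R_def dist_norm by (simp_all only: norm_minus_commute)
   from m(2)[OF this] obtain k where k: "k < m" "norm (cis (2 * pi * real k / real m) * (z - w1) - (o1 - w1)) < ka"
    by blast
   moreover have "rot k z - o1 = cis (2 * pi * real k / real m) * (z - w1) - (o1 - w1)"
    by (simp add: rot_def)
   ultimately have "norm (rot k z - o1) < ka" by metis
   hence "rot k z \<in> ball o1 ka" by (simp add: dist_norm norm_minus_commute)
   hence "rot k z \<in> outside J" using ka(2) by blast
   moreover have "rot k z \<in> J Un inside J"
    using subsetD[OF clV z(1)] k(1) unfolding Om_def by blast
   ultimately show False using JF(16,17) by blast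
  qed
  hence "z \<in> ball w1 R" using zR by auto
  then obtain k where k: "k < m" "rot k z \<notin> Om" using z by (auto simp: V_def)
  hence "rot k z \<in> J" using subsetD[OF clV z(1)] by blast
  moreover have "dist p (rot k z) < ro"
  proof -
   have "dist p (rot k z) <= dist p w1 + dist w1 (rot k z)" by (rule dist_triangle)
   thus ?thesis using drot[of k z] zR R2 w1(2) \<open>ro > 0\<close> by (simp add: dist_commute)
  qed
  ultimately have "G (rot k z) = ze" by (rule const)
  hence "F z = 0" using k by (auto simp: F_def intro!: prod_zero)
  thus "norm (F z) <= 0" by simp
 qed
 hence "F w1 = 0" by simp
 hence "G w1 = ze" by (auto simp: F_def rot_def)
 thus ?thesis using w1 by (auto simp: Om_def)
qed


text \<open>Caratheodory's theorem. The extended Riemann map is injective on \<open>J\<close> because its fibres over the unit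
 circle are connected, so that a fibre with two points would contain an arc of \<open>J\<close>.\<close>

lemma Jordan_disc_coordinates:
 assumes J: "Jordan J" and o: "o1 \<in> inside J"
 obtains G :: "complex => complex" where "continuous_on (J Un inside J) G" "inj_on G (J Un inside J)"
  "G ` (J Un inside J) = cball 0 1" "G ` J = sphere 0 1" "G o1 = 0"
proof -
 note JF = Jordan_facts[OF J]
 obtain c where c: "simple_path c" "pathfinish c = pathstart c" "path_image c = J"
  using J by (auto simp: Jordan_def)
 define Om where "Om = inside J"
 have "Om ~= UNIV" using JF(5) not_bounded_UNIV by (auto simp: Om_def)
 then obtain h k where hk: "h holomorphic_on Om" "k holomorphic_on ball 0 1"
   "\<And>z. z \<in> Om ==> h z \<in> ball 0 1 & k (h z) = z" "\<And>z. z \<in> ball 0 1 ==> k z \<in> Om & h (k z) = z"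
  using Riemann_mapping_theorem[of Om] JF(3,6,11) unfolding Om_def by blast
 have "h o1 \<in> ball 0 1" using hk(3) o by (simp add: Om_def)
 then obtain m m' where m: "m (h o1) = 0" "m holomorphic_on ball 0 1" "m ` ball 0 1 <= ball 0 1"
   "m' holomorphic_on ball 0 1" "m' ` ball 0 1 <= ball 0 1"
   "\<And>z. z \<in> ball 0 1 ==> m (m' z) = z" "\<And>z. z \<in> ball 0 1 ==> m' (m z) = z"
  by (rule ball_biholomorphism_exists) blast
 define g where "g = m \<circ> h"
 define f where "f = k \<circ> m'"
 have f: "f holomorphic_on ball 0 1" "f ` ball 0 1 <= Om"
  using hk m unfolding f_def by (auto intro: holomorphic_on_compose_gen)
 have g: "g holomorphic_on Om" "g ` Om <= ball 0 1" "g o1 = 0"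
  using hk m unfolding g_def by (auto intro: holomorphic_on_compose_gen simp: image_subset_iff)
 have fg: "f (g z) = z" if "z \<in> Om" for z
  using hk(3)[OF that] m(7)[of "h z"] by (simp add: f_def g_def)
 have gf: "g (f z) = z" if "z \<in> ball 0 1" for z
  using hk(4)[of "m' z"] m(5,6) that by (simp add: f_def g_def image_subset_iff)
 have contg: "continuous_on Om g" using g by (simp add: holomorphic_on_imp_continuous_on)
 have contf: "continuous_on (ball 0 1) f" using f by (simp add: holomorphic_on_imp_continuous_on)
 have osc: "\<exists>d>0. \<forall>u\<in>Om \<inter> ball w d. \<forall>v\<in>Om \<inter> ball w d. norm (g u - g v) < e"
  if "w \<in> J Un Om" "e > 0" for w e
 proof (cases "w \<in> J")
  case True
  hence w: "w \<in> path_image c" using c by simp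
  obtain d where "d > 0" "\<And>u v. u \<in> inside (path_image c) \<inter> ball w d ==> v \<in> inside (path_image c) \<inter> ball w d ==> norm (g u - g v) < e"
   by (rule biholomorphism_oscillation[OF c(1,2) f(1) _ _ _ _ w \<open>e > 0\<close>, of g])
    (use f g fg in \<open>auto simp: Om_def c(3)\<close>)
  thus ?thesis unfolding c(3) Om_def by blast
 next
  case False
  hence "w \<in> Om" using that by auto
  then obtain d where d: "d > 0" "\<And>u. u \<in> Om ==> dist u w < d ==> dist (g u) (g w) < e / 2"
   using contg \<open>e > 0\<close> unfolding continuous_on_iff by (metis half_gt_zero)
  have "norm (g u - g v) < e" if "u \<in> Om \<inter> ball w d" "v \<in> Om \<inter> ball w d" for u v
   using d(2)[of u] d(2)[of v] that dist_triangle_half_l[of "g u" "g w" e "g v"]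
   by (simp add: dist_commute dist_norm[of "g u" "g v", symmetric])
  thus ?thesis using d by blast
 qed
 \<comment> \<open>A Lebesgue number of the covering of the compact set \<open>J Un Om\<close> by
   the balls from \<open>osc\<close> turns small oscillation at each point into uniform continuity,
   hence into an extension to the closure.\<close>
 have unif: "uniformly_continuous_on Om g"
  unfolding uniformly_continuous_on_def
 proof (intro allI impI)
  fix e :: real assume "e > 0"
  then obtain D where D: "\<And>w. w \<in> J Un Om ==> D w > 0"
   "\<And>w u v. w \<in> J Un Om ==> u \<in> Om \<inter> ball w (D w) ==> v \<in> Om \<inter> ball w (D w) ==> norm (g u - g v) < e"
  proof -
   have "\<forall>w\<in>J Un Om. \<exists>d>0. \<forall>u\<in>Om \<inter> ball w d. \<forall>v\<in>Om \<inter> ball w d. norm (g u - g v) < e"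
    using osc \<open>e > 0\<close> by blast
   from bchoice[OF this] show thesis using that by blast
  qed
  have cpt: "compact (J Un Om)" using JF(9) by (simp add: Om_def)
  obtain de where de: "de > 0" "\<And>x. x \<in> J Un Om ==> \<exists>B\<in>(\<lambda>w. ball w (D w)) ` (J Un Om). ball x de <= B"
   by (rule Heine_Borel_lemma[OF cpt, of "(\<lambda>w. ball w (D w)) ` (J Un Om)"]) (use D(1) in auto)
  show "\<exists>d>0. \<forall>x\<in>Om. \<forall>x'\<in>Om. dist x' x < d \<longrightarrow> dist (g x') (g x) < e"
  proof (intro exI[of _ de] conjI ballI impI de(1))
   fix x x' assume x: "x \<in> Om" "x' \<in> Om" "dist x' x < de"
   obtain w where w: "w \<in> J Un Om" "ball x de <= ball w (D w)" using de(2)[of x] x by blast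
   have "x \<in> ball x de" "x' \<in> ball x de" using x de(1) by (auto simp: dist_commute)
   hence "norm (g x' - g x) < e" by (intro D(2)[OF w(1)]) (use subsetD[OF w(2)] x in auto)
   thus "dist (g x') (g x) < e" by (simp add: dist_norm)
  qed
 qed
 have cl: "closure Om = J Un Om" using JF(8) by (simp add: Om_def)
 obtain G where G: "uniformly_continuous_on (closure Om) G" "\<And>x. x \<in> Om ==> g x = G x"
  by (rule uniformly_continuous_on_extension_on_closure[OF unif]) blast
 have contG: "continuous_on (J Un Om) G"
  using G(1) cl by (simp add: uniformly_continuous_imp_continuous)
 have GO: "G ` Om = ball 0 1"
 proof
  show "G ` Om <= ball 0 1" using g(2) G(2) by (simp add: image_subset_iff)
  show "ball 0 1 <= G ` Om"
  proof
   fix z :: complex assume "z \<in> ball 0 1"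
   hence "f z \<in> Om" "G (f z) = z" using f(2) gf G(2)[of "f z"] by (auto simp: image_subset_iff)
   thus "z \<in> G ` Om" by force
  qed
 qed
 have im: "G ` (J Un Om) = cball 0 1"
 proof
  have "G ` closure Om <= closure (G ` Om)"
   using contG cl by (intro image_closure_subset) (auto intro: subsetD[OF closure_subset])
  thus "G ` (J Un Om) <= cball 0 1" by (simp add: GO cl)
  have "compact (G ` (J Un Om))" using contG JF(9) by (simp add: compact_continuous_image Om_def)
  moreover have "ball 0 1 <= G ` (J Un Om)" unfolding GO[symmetric] by blast
  ultimately have "closure (ball 0 1) <= G ` (J Un Om)" by (intro closure_minimal compact_imp_closed)
  thus "cball 0 1 <= G ` (J Un Om)" by simp
 qed
 have GJ: "norm (G w) = 1" if w: "w \<in> J" for w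
 proof (rule ccontr)
  assume "norm (G w) ~= 1"
  moreover have "G w \<in> cball 0 1" unfolding im[symmetric] using w by blast
  ultimately have lt: "G w \<in> ball 0 1" by simp
  have "w \<in> closure Om" using w cl by simp
  then obtain x where x: "\<And>n. x n \<in> Om" "x \<longlonglongrightarrow> w" by (auto simp: closure_sequential)
  have "(\<lambda>n. G (x n)) \<longlonglongrightarrow> G w"
   using contG x w unfolding continuous_on_sequentially by (auto simp: o_def)
  hence "(\<lambda>n. f (G (x n))) \<longlonglongrightarrow> f (G w)"
  proof -
   have "G (x n) \<in> ball 0 1" for n using GO x(1) by blast
   thus ?thesis
    using continuous_on_tendsto_compose[OF contf \<open>(\<lambda>n. G (x n)) \<longlonglongrightarrow> G w\<close> lt] by simp
  qed
  moreover have "f (G (x n)) = x n" for n using fg[OF x(1)] G(2)[OF x(1)] by simp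
  ultimately have "f (G w) = w" using x(2) LIMSEQ_unique by auto
  moreover have "f (G w) \<in> Om" using f(2) lt by blast
  ultimately show False using w JF(10) by (auto simp: Om_def)
 qed
 have fibre: "connected {w \<in> J Un Om. G w = ze}" if ze: "norm ze = 1" for ze
 proof -
  \<comment> \<open>The fibre is a decreasing intersection of compact connected sets: the closures
    of the images under \<open>f\<close> of the convex caps of the disc at
    \<open>ze\<close>.\<close>
  define N where "N = (\<lambda>n::nat. closure (f ` (ball 0 1 \<inter> ball ze (1 / Suc n))))"
  have mem: "w \<in> N n \<longleftrightarrow> (\<exists>x. (\<forall>i. x i \<in> Om & dist ze (G (x i)) < 1 / Suc n) & x \<longlonglongrightarrow> w)" for w n
  proof -
   have eq: "f ` (ball 0 1 \<inter> ball ze (1 / Suc n)) = {x \<in> Om. dist ze (G x) < 1 / Suc n}"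
   proof
    show "f ` (ball 0 1 \<inter> ball ze (1 / Suc n)) <= {x \<in> Om. dist ze (G x) < 1 / Suc n}"
    proof clarify
     fix z :: complex assume z: "z \<in> ball 0 1" "z \<in> ball ze (1 / Suc n)"
     hence "f z \<in> Om" "G (f z) = z" using f(2) gf[of z] G(2)[of "f z"] by (auto simp: image_subset_iff)
     thus "f z \<in> Om & dist ze (G (f z)) < 1 / Suc n" using z(2) by simp
    qed
    show "{x \<in> Om. dist ze (G x) < 1 / Suc n} <= f ` (ball 0 1 \<inter> ball ze (1 / Suc n))"
    proof clarify
     fix x assume x: "x \<in> Om" "dist ze (G x) < 1 / Suc n"
     hence "g x \<in> ball 0 1 \<inter> ball ze (1 / Suc n)" using g(2) G(2) by (simp add: image_subset_iff)
     thus "x \<in> f ` (ball 0 1 \<inter> ball ze (1 / Suc n))" using fg[OF x(1)] by (metis imageI)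
    qed
   qed
   show ?thesis unfolding N_def eq closure_sequential by auto
  qed
  have eq: "{w \<in> J Un Om. G w = ze} = \<Inter> (range N)"
  proof (intro equalityI subsetI)
   fix w assume w: "w \<in> {w \<in> J Un Om. G w = ze}"
   hence "w \<in> closure Om" using cl by simp
   then obtain x where x: "\<And>n. x n \<in> Om" "x \<longlonglongrightarrow> w" by (auto simp: closure_sequential)
   have lim: "(\<lambda>n. G (x n)) \<longlonglongrightarrow> ze"
    using contG x w unfolding continuous_on_sequentially by (auto simp: o_def)
   show "w \<in> \<Inter> (range N)"
   proof clarify
    fix n
    obtain k where k: "\<And>i. i \<ge> k ==> dist (G (x i)) ze < 1 / Suc n"
     using lim unfolding lim_sequentially by (meson divide_pos_pos of_nat_0_less_iff zero_less_Suc zero_less_one)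
    show "w \<in> N n" unfolding mem
     using k x by (intro exI[of _ "\<lambda>i. x (i + k)"]) (auto simp: dist_commute LIMSEQ_ignore_initial_segment)
   qed
  next
   fix w assume w: "w \<in> \<Inter> (range N)"
   hence "w \<in> N 0" by blast
   then obtain x where "\<And>n. x n \<in> Om" "x \<longlonglongrightarrow> w" unfolding mem by blast
   hence wcl: "w \<in> J Un Om" unfolding cl[symmetric] closure_sequential by blast
   have "dist ze (G w) <= 1 / Suc n" for n
   proof -
    have "w \<in> N n" using w by blast
    then obtain x where x: "\<And>i. x i \<in> Om" "\<And>i. dist ze (G (x i)) < 1 / Suc n" "x \<longlonglongrightarrow> w" unfolding mem by blast
    have "(\<lambda>n. G (x n)) \<longlonglongrightarrow> G w"
     using contG x wcl unfolding continuous_on_sequentially by (auto simp: o_def)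
    hence "(\<lambda>n. dist ze (G (x n))) \<longlonglongrightarrow> dist ze (G w)" by (intro tendsto_intros)
    thus ?thesis by (rule LIMSEQ_le_const2) (use x(2) less_imp_le in blast)
   qed
   hence "dist ze (G w) <= 0"
    by (metis LIMSEQ_inverse_real_of_nat LIMSEQ_le_const inverse_eq_divide)
   thus "w \<in> {w \<in> J Un Om. G w = ze}" using wcl by simp
  qed
  have con: "connected (N n)" for n
   unfolding N_def
   by (intro connected_imp_connected_closure connected_continuous_image continuous_on_subset[OF contf] convex_connected convex_Int convex_ball) auto
  have sub: "N n <= closure Om" for n unfolding N_def by (intro closure_mono) (use f(2) in auto)
  have cpt: "compact (N n)" for n
   using compact_closure[of Om] JF(5) sub[of n] closed_closure
   by (metis (no_types, lifting) N_def Om_def closed_Int_compact inf.absorb1)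
  have mono: "N n <= N k" if "k <= n" for n k
   unfolding N_def using that by (intro closure_mono image_mono Int_mono subset_refl subset_ball) (simp add: frac_le)
  show ?thesis unfolding eq by (intro connected_nest con cpt mono)
 qed
 have inj: "inj_on G (J Un Om)"
 proof (rule inj_onI)
  fix a b assume ab: "a \<in> J Un Om" "b \<in> J Un Om" "G a = G b"
  show "a = b"
  proof (cases "a \<in> Om \<or> b \<in> Om")
   case True
   have "norm (G x) < 1" if "x \<in> Om" for x using GO imageI[OF that, of G] by simp
   hence "a \<in> Om" "b \<in> Om" using ab True GJ by force+
   thus ?thesis using fg G(2) ab(3) by metis
  next
   case False
   hence abJ: "a \<in> J" "b \<in> J" using ab by auto
   show ?thesis
   proof (rule ccontr)
    assume "a ~= b"
    obtain t0 where t0: "t0 \<in> {0..1}" "c t0 = a" using abJ(1) c(3) by (auto simp: path_image_def)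
    define q where "q = shiftpath t0 c"
    have q: "simple_path q" "pathfinish q = pathstart q" "path_image q = J" "pathstart q = a"
     using c t0 by (auto simp: q_def simple_path_shiftpath path_image_shiftpath
       closed_shiftpath pathstart_shiftpath)
    have q01: "q 0 = a" "q 1 = a" using q by (auto simp: pathstart_def pathfinish_def)
    obtain s where s: "s \<in> {0..1}" "q s = b" using abJ(2) unfolding q(3)[symmetric] path_image_def by blast
    hence s01: "0 < s" "s < 1" using \<open>a ~= b\<close> q01 by (auto simp: less_eq_real_def)
    define F where "F = {w \<in> J Un Om. G w = G a}"
    have FJ: "F <= J" using GJ[OF abJ(1)] GO by (force simp: F_def)
    have "closed F"
    proof -
     have "closed {w \<in> J Un Om. G w \<in> {G a}}"
      using continuous_closed_preimage[OF contG, of "{G a}"] compact_imp_closed[OF JF(9)]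
      by (simp add: vimage_def Int_def Om_def)
     thus ?thesis by (simp add: F_def)
    qed
    hence arc: "q ` {0..s} <= F \<or> q ` {s..1} <= F"
     by (intro connected_loop_contains_arc q(1,2) s01)
      (use fibre[OF GJ[OF abJ(1)]] FJ q(3) q01 s ab in \<open>auto simp: F_def\<close>)
    have cq: "continuous_on {0..1} q" using q(1) by (simp add: simple_path_def path_def)
    have lf: "\<And>x y. x \<in> {0..1} ==> y \<in> {0..1} ==> q x = q y ==> x = y \<or> x = 0 & y = 1 \<or> x = 1 & y = 0"
     using q(1) unfolding simple_path_def loop_free_def by metis
    obtain t A where t: "0 < t" "t < 1" "A <= {0..1}" "compact A" "t \<notin> A"
      "\<And>x. x \<in> {0..1} - A ==> q x \<in> F"
    proof (cases "q ` {0..s} <= F")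
     case True
     show thesis by (rule that[of "s / 2" "{s..1}"]) (use s01 True in auto)
    next
     case False
     hence "q ` {s..1} <= F" using arc by blast
     thus thesis by (intro that[of "(s + 1) / 2" "{0..s}"]) (use s01 in auto)
    qed
    have qt: "q t \<notin> q ` A"
    proof
     assume "q t \<in> q ` A"
     then obtain y where y: "y \<in> A" "q t = q y" by blast
     have "t = y \<or> t = 0 & y = 1 \<or> t = 1 & y = 0"
      by (rule lf) (use t y in auto)
     thus False using t y by auto
    qed
    have "closed (q ` A)" by (intro compact_imp_closed compact_continuous_image continuous_on_subset[OF cq] t)
    then obtain ro where ro: "ro > 0" "ball (q t) ro <= - q ` A"
     using qt open_contains_ball[of "- q ` A"] by (metis ComplI open_Compl)
    have "\<exists>w\<in>inside J. G w = G a"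
    proof (rule boundary_constant_on_open_arc[OF J _ _ _ ro(1)])
     show "continuous_on (J Un inside J) G" using contG by (simp add: Om_def)
     show "G holomorphic_on inside J"
      using holomorphic_transform[OF g(1), of G] G(2) by (simp add: Om_def)
     show "q t \<in> J" unfolding q(3)[symmetric] path_image_def using t by auto
     fix z assume z: "z \<in> J" "dist (q t) z < ro"
     then obtain x where x: "x \<in> {0..1}" "z = q x" unfolding q(3)[symmetric] path_image_def by blast
     have "x \<notin> A" using z(2) ro(2) x(2) by (auto simp: subset_iff)
     hence "z \<in> F" using t(6) x by auto
     thus "G z = G a" by (simp add: F_def)
    qed
    then obtain w where w: "w \<in> Om" "G w = G a" by (auto simp: Om_def)
    hence "norm (G a) < 1" using GO by (metis imageI mem_ball_0)
    thus False using GJ[OF abJ(1)] by simp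
   qed
  qed
 qed
 show thesis
 proof
  show "continuous_on (J Un inside J) G" "inj_on G (J Un inside J)" "G ` (J Un inside J) = cball 0 1"
   using contG inj im by (simp_all add: Om_def)
  show "G o1 = 0" using G(2)[of o1] g(3) o by (simp add: Om_def)
  show "G ` J = sphere 0 1"
  proof (intro equalityI subsetI)
   fix z assume "z \<in> G ` J" thus "z \<in> sphere 0 1" using GJ by auto
  next
   fix z :: complex assume z: "z \<in> sphere 0 1"
   hence "z \<in> G ` (J Un Om)" unfolding im by simp
   moreover have "z \<notin> G ` Om" unfolding GO using z by simp
   ultimately show "z \<in> G ` J" by blast
  qed
 qed
qed

section \<open>Arcs and chords in Jordan domains\<close>

definition is_arc :: "complex set => complex => complex => bool" where
 "is_arc A a b \<longleftrightarrow> (\<exists>g. arc g & path_image g = A & pathstart g = a & pathfinish g = b)"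

lemma is_arc_sym: "is_arc A a b ==> is_arc A b a"
 unfolding is_arc_def by (metis arc_reversepath path_image_reversepath pathfinish_reversepath pathstart_reversepath)

lemma arc_facts:
 assumes "is_arc A a b"
 shows "compact A" "connected A" "a \<in> A" "b \<in> A" "a ~= b" "connected (A - {a, b})" "A - {a, b} ~= {}"
  "A <= closure (A - {a, b})"
proof -
 obtain g where g: "arc g" "path_image g = A" "pathstart g = a" "pathfinish g = b"
  using assms by (auto simp: is_arc_def)
 show A: "compact A" "connected A" "a \<in> A" "b \<in> A" "a ~= b"
  using g compact_arc_image[of g] connected_arc_image[of g] arc_distinct_ends[of g] by auto
 show "connected (A - {a, b})"  "A - {a, b} ~= {}"
  using connected_simple_path_endless[OF arc_imp_simple_path[OF g(1)]]
   nonempty_simple_path_endless[OF arc_imp_simple_path[OF g(1)]] g by auto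
 show "A <= closure (A - {a, b})"
 proof
  fix x assume "x \<in> A"
  hence "x islimpt A" using A by (intro connected_imp_perfect) auto
  moreover have "A <= {a, b} Un (A - {a, b})" by auto
  ultimately have "x islimpt ({a, b} Un (A - {a, b}))" by (rule islimpt_subset)
  hence "x islimpt (A - {a, b})" by (subst (asm) islimpt_Un_finite) auto
  thus "x \<in> closure (A - {a, b})" by (simp add: closure_def)
 qed
qed

lemma is_arc_image:
 assumes "is_arc A a b" "continuous_on A f" "inj_on f A"
 shows "is_arc (f ` A) (f a) (f b)"
proof -
 obtain g where g: "arc g" "path_image g = A" "pathstart g = a" "pathfinish g = b"
  using assms by (auto simp: is_arc_def)
 hence "simple_path (f \<circ> g)" using assms by (intro simple_path_continuous_image) (auto simp: arc_imp_simple_path)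
 moreover have "f a ~= f b" using assms(3) arc_facts(3-5)[OF assms(1)] by (auto dest: inj_onD)
 ultimately have "arc (f \<circ> g)" using g by (auto simp: arc_simple_path pathstart_compose pathfinish_compose)
 thus ?thesis unfolding is_arc_def
  using g by (intro exI[of _ "f \<circ> g"]) (auto simp: path_image_compose pathstart_compose pathfinish_compose)
qed

lemma is_arc_segment: "a ~= b ==> is_arc (closed_segment a b) a b"
 unfolding is_arc_def by (intro exI[of _ "linepath a b"]) (auto simp: arc_linepath)

lemma Jordan_join:
 assumes "is_arc A a b" "is_arc B a b" "A \<inter> B = {a, b}"
 shows "Jordan (A Un B)"
proof -
 obtain g where g: "arc g" "path_image g = A" "pathstart g = a" "pathfinish g = b"
  using assms by (auto simp: is_arc_def)
 obtain h where h: "arc h" "path_image h = B" "pathstart h = b" "pathfinish h = a"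
  using is_arc_sym[OF assms(2)] by (auto simp: is_arc_def)
 have "simple_path (g +++ h)" using g h assms by (intro simple_path_join_loop) auto
 thus ?thesis unfolding Jordan_def using g h by (intro exI[of _ "g +++ h"]) (auto simp: path_image_join)
qed

lemma Jordan_split:
 assumes "Jordan J" "a \<in> J" "b \<in> J" "a ~= b"
 obtains A B where "is_arc A a b" "is_arc B a b" "A \<inter> B = {a, b}" "A Un B = J"
proof -
 obtain g where g: "simple_path g" "pathfinish g = pathstart g" "path_image g = J"
  using assms by (auto simp: Jordan_def)
 obtain u d where ud: "arc u" "arc d" "pathstart u = a" "pathfinish u = b" "pathstart d = b" "pathfinish d = a"
  "(path_image u) \<inter> (path_image d) = {a,b}" "(path_image u) Un (path_image d) = path_image g"
  using exists_double_arc[OF g(1,2), of a b] assms g(3) by auto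
 have "is_arc (path_image u) a b" "is_arc (path_image d) b a" using ud by (auto simp: is_arc_def)
 thus thesis using that[of "path_image u" "path_image d"] ud(7,8) g(3) is_arc_sym by auto
qed

lemma Jordan_image:
 assumes "Jordan J" "continuous_on J f" "inj_on f J"
 shows "Jordan (f ` J)"
proof -
 obtain g where g: "simple_path g" "pathfinish g = pathstart g" "path_image g = J"
  using assms by (auto simp: Jordan_def)
 hence "simple_path (f \<circ> g)" using assms by (intro simple_path_continuous_image) auto
 thus ?thesis unfolding Jordan_def
  using g by (intro exI[of _ "f \<circ> g"]) (auto simp: path_image_compose pathstart_compose pathfinish_compose)
qed

lemma theta_split:
 assumes A: "is_arc A a b" and B: "is_arc B a b" and c: "is_arc c a b"
  and AB: "A \<inter> B = {a, b}" "c \<inter> (A Un B) = {a, b}" and ins: "c - (A Un B) <= inside (A Un B)"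
 shows "Jordan (A Un c)" "Jordan (B Un c)" "inside (A Un c) \<inter> inside (B Un c) = {}"
  "inside (A Un c) Un inside (B Un c) Un (c - {a, b}) = inside (A Un B)"
proof -
 have ends: "a \<in> A" "b \<in> A" "a \<in> B" "b \<in> B" "a \<in> c" "b \<in> c" using arc_facts A B c by blast+
 have Ac: "A \<inter> c = {a, b}" and Bc: "B \<inter> c = {a, b}" using AB ends by blast+
 show "Jordan (A Un c)" "Jordan (B Un c)" using Jordan_join A B c Ac Bc by blast+
 obtain f where f: "arc f" "path_image f = A" "pathstart f = a" "pathfinish f = b" using A by (auto simp: is_arc_def)
 obtain g where g: "arc g" "path_image g = B" "pathstart g = a" "pathfinish g = b" using B by (auto simp: is_arc_def)
 obtain h where h: "arc h" "path_image h = c" "pathstart h = a" "pathfinish h = b" using c by (auto simp: is_arc_def)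
 have ne: "c \<inter> inside (A Un B) ~= {}" using ins arc_facts(7)[OF c] AB by blast
 have "inside (A Un c) \<inter> inside (B Un c) = {} &
  inside (A Un c) Un inside (B Un c) Un (c - {a, b}) = inside (A Un B)"
  by (rule split_inside_simple_closed_curve[of f a b g h])
   (use f g h AB Ac Bc ne arc_facts(5)[OF c] in \<open>auto simp: arc_imp_simple_path\<close>)
 thus "inside (A Un c) \<inter> inside (B Un c) = {}"
  "inside (A Un c) Un inside (B Un c) Un (c - {a, b}) = inside (A Un B)" by auto
qed

lemma theta_cells:
 assumes A: "is_arc A a b" and B: "is_arc B a b" and c: "is_arc c a b"
  and AB: "A \<inter> B = {a, b}" "c \<inter> (A Un B) = {a, b}" and ins: "c - (A Un B) <= inside (A Un B)"
 shows "((A Un c) Un inside (A Un c)) Un ((B Un c) Un inside (B Un c)) = (A Un B) Un inside (A Un B)"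
  "((A Un c) Un inside (A Un c)) \<inter> ((B Un c) Un inside (B Un c)) = c"
proof -
 note th = theta_split[OF assms]
 define I1 I2 I where "I1 = inside (A Un c)" and "I2 = inside (B Un c)" and "I = inside (A Un B)"
 have 1: "I1 \<inter> I2 = {}" "I1 Un I2 Un (c - {a, b}) = I" using th by (simp_all only: I1_def I2_def I_def)
 have 2: "I1 \<inter> c = {}" "I2 \<inter> c = {}" "I \<inter> (A Un B) = {}"
  using Jordan_facts(10)[OF th(1)] Jordan_facts(10)[OF th(2)] Jordan_facts(10)[OF Jordan_join[OF A B AB(1)]]
  unfolding I1_def I2_def I_def by blast+
 have 3: "a \<in> A" "b \<in> A" "a \<in> c" "b \<in> c" using arc_facts(3,4) A c by blast+
 have "x \<in> A Un c Un I1 \<or> x \<in> B Un c Un I2 \<longleftrightarrow> x \<in> (A Un B) Un I" for x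
  using 1(2)[symmetric] AB(2) 3 by auto
 thus "((A Un c) Un inside (A Un c)) Un ((B Un c) Un inside (B Un c)) = (A Un B) Un inside (A Un B)"
  unfolding I1_def I2_def I_def by blast
 have "I1 \<inter> (A Un B) = {}" "I2 \<inter> (A Un B) = {}" using 2(3) 1(2) by auto
 hence "x \<in> c" if "x \<in> A Un c Un I1" "x \<in> B Un c Un I2" for x
  using that 1(1) AB(1) 3 by auto
 thus "((A Un c) Un inside (A Un c)) \<inter> ((B Un c) Un inside (B Un c)) = c"
  unfolding I1_def I2_def by blast
qed

text \<open>At the zeros of \<open>r\<close> nothing is known about \<open>g\<close> but its
  boundedness, and that suffices. This is the situation at the apex of a cone.\<close>

lemma cont_scaleR_bdd:
 fixes r :: "'a::metric_space => real" and g :: "'a => complex"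
 assumes r: "continuous_on S r" and g: "continuous_on {x \<in> S. r x ~= 0} g"
  and bd: "\<And>x. x \<in> S ==> r x ~= 0 ==> norm (g x) <= 1"
 shows "continuous_on S (\<lambda>x. r x *\<^sub>R g x)"
 unfolding continuous_on_eq_continuous_within
proof
 fix x assume x: "x \<in> S"
 have rx: "(r \<longlongrightarrow> r x) (at x within S)" using r x by (simp add: continuous_on_def)
 show "continuous (at x within S) (\<lambda>x. r x *\<^sub>R g x)"
 proof (cases "r x = 0")
  case True
  have "((\<lambda>y. r y *\<^sub>R g y) \<longlongrightarrow> 0) (at x within S)"
  proof (rule Lim_null_comparison)
   have "norm (r y *\<^sub>R g y) <= \<bar>r y\<bar>" if "y \<in> S" for y
    using bd[OF that] by (cases "r y = 0") (auto simp: mult_left_le)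
   thus "\<forall>\<^sub>F y in at x within S. norm (r y *\<^sub>R g y) <= \<bar>r y\<bar>"
    unfolding eventually_at_filter by (auto intro: always_eventually)
   have "((\<lambda>y. \<bar>r y\<bar>) \<longlongrightarrow> \<bar>r x\<bar>) (at x within S)" by (intro tendsto_intros rx)
   thus "((\<lambda>y. \<bar>r y\<bar>) \<longlongrightarrow> 0) (at x within S)" using True by simp
  qed
  thus ?thesis using True by (simp add: continuous_within)
 next
  case False
  have "openin (top_of_set S) (S \<inter> r -` (- {0}))"
   by (rule continuous_openin_preimage_gen[OF r]) auto
  then obtain T where T: "open T" "S \<inter> r -` (- {0}) = S \<inter> T" by (auto simp: openin_open)
  have "at x within S = at x within {x \<in> S. r x ~= 0}"
   by (rule at_within_nhd[of _ T]) (use T x False in auto)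
  moreover have "continuous_on {x \<in> S. r x ~= 0} (\<lambda>x. r x *\<^sub>R g x)"
   by (intro continuous_intros g continuous_on_subset[OF r]) auto
  ultimately show ?thesis using x False by (simp add: continuous_on_eq_continuous_within)
 qed
qed

lemma cone_continuous:
 fixes b :: "real => complex => complex"
 assumes cont: "continuous_on (T \<times> sphere 0 1) (\<lambda>x. b (fst x) (snd x))"
  and nb: "\<And>t z. t \<in> T ==> norm z = 1 ==> norm (b t z) = 1"
 shows "continuous_on (T \<times> UNIV) (\<lambda>x. norm (snd x) *\<^sub>R b (fst x) (sgn (snd x)))"
proof (rule cont_scaleR_bdd)
 show "continuous_on (T \<times> UNIV) (\<lambda>x. norm (snd x :: complex))" by (intro continuous_intros)
 have "continuous_on {x \<in> T \<times> UNIV. norm (snd x) ~= 0} (\<lambda>x. (fst x, sgn (snd x :: complex)))"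
  unfolding sgn_div_norm by (intro continuous_intros) auto
 moreover have "(\<lambda>x. (fst x, sgn (snd x))) ` {x \<in> T \<times> UNIV. norm (snd x :: complex) ~= 0} <= T \<times> sphere 0 1"
  by (auto simp: norm_sgn)
 ultimately show "continuous_on {x \<in> T \<times> UNIV. norm (snd x) ~= 0} (\<lambda>x. b (fst x) (sgn (snd x)))"
  using continuous_on_compose2[OF cont] by fastforce
qed (auto simp: nb norm_sgn)

lemma cone_bij:
 assumes b: "inj_on b (sphere 0 1)" "b ` sphere 0 1 = sphere (0::complex) 1"
 shows "norm (norm z *\<^sub>R b (sgn z)) = norm z" "inj (\<lambda>z. norm z *\<^sub>R b (sgn z))"
  "norm w = 1 ==> norm w *\<^sub>R b (sgn w) = b w" "surj (\<lambda>z. norm z *\<^sub>R b (sgn z))"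
proof -
 have nb: "norm (b z) = 1" if "norm z = 1" for z using b(2) that by (metis imageI mem_sphere_0)
 have n: "norm (norm z *\<^sub>R b (sgn z)) = norm z" for z using nb[of "sgn z"] by (cases "z = 0") (auto simp: norm_sgn)
 thus "norm (norm z *\<^sub>R b (sgn z)) = norm z" .
 show "inj (\<lambda>z. norm z *\<^sub>R b (sgn z))"
 proof (rule injI)
  fix x y assume eq: "norm x *\<^sub>R b (sgn x) = norm y *\<^sub>R b (sgn y)"
  hence nxy: "norm x = norm y" using n by metis
  show "x = y"
  proof (cases "x = 0")
   case False
   hence y0: "y ~= 0" and "b (sgn x) = b (sgn y)" using eq nxy by auto
   hence "sgn x = sgn y" using inj_onD[OF b(1), of "sgn x" "sgn y"] False by (simp add: norm_sgn)
   moreover have "x = norm x *\<^sub>R sgn x" "y = norm y *\<^sub>R sgn y" using False y0 by (simp_all add: sgn_div_norm)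
   ultimately show ?thesis using nxy by metis
  qed (use nxy in auto)
 qed
 show "norm w = 1 ==> norm w *\<^sub>R b (sgn w) = b w" by (simp add: sgn_div_norm)
 show "surj (\<lambda>z. norm z *\<^sub>R b (sgn z))"
 proof -
  have "w \<in> range (\<lambda>z. norm z *\<^sub>R b (sgn z))" for w
  proof (cases "w = 0")
   case True thus ?thesis by (intro image_eqI[of _ _ 0]) auto
  next
   case False
   hence "sgn w \<in> sphere 0 1" by (simp add: norm_sgn)
   then obtain v where v: "norm v = 1" "b v = sgn w" using b(2) by (metis imageE mem_sphere_0)
   have "sgn (norm w *\<^sub>R v) = v" using v False by (simp add: sgn_div_norm)
   hence "w = norm (norm w *\<^sub>R v) *\<^sub>R b (sgn (norm w *\<^sub>R v))"
    using v False by (simp add: sgn_div_norm)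
   thus ?thesis by blast
  qed
  thus ?thesis by auto
 qed
qed


text \<open>In disc coordinates of both domains the boundary map becomes a homeomorphism of the unit
  circle, which extends to the disc as a cone from the origin.\<close>

lemma Jordan_extension:
 fixes ga :: "complex => complex"
 assumes J: "Jordan J" and ga: "continuous_on J ga" "inj_on ga J"
 obtains Ps where "continuous_on (J Un inside J) Ps" "inj_on Ps (J Un inside J)"
  "Ps ` (J Un inside J) = ga ` J Un inside (ga ` J)" "\<And>z. z \<in> J ==> Ps z = ga z"
proof -
 define J' where "J' = ga ` J"
 have J': "Jordan J'" unfolding J'_def by (rule Jordan_image[OF J ga])
 obtain o1 o2 where o: "o1 \<in> inside J" "o2 \<in> inside J'" using Jordan_facts(6) J J' by blast
 obtain G :: "complex => complex" where G: "continuous_on (J Un inside J) G" "inj_on G (J Un inside J)"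
  "G ` (J Un inside J) = cball 0 1" "G ` J = sphere 0 1" by (rule Jordan_disc_coordinates[OF J o(1)]) blast
 obtain G' :: "complex => complex" where G': "continuous_on (J' Un inside J') G'" "inj_on G' (J' Un inside J')"
  "G' ` (J' Un inside J') = cball 0 1" "G' ` J' = sphere 0 1" by (rule Jordan_disc_coordinates[OF J' o(2)]) blast
 define H where "H = inv_into (J Un inside J) G"
 define H' where "H' = inv_into (J' Un inside J') G'"
 have HG: "H (G z) = z" if "z \<in> J Un inside J" for z unfolding H_def using inv_into_f_f[OF G(2)] that by blast
 have HG': "H' (G' z) = z" if "z \<in> J' Un inside J'" for z unfolding H'_def using inv_into_f_f[OF G'(2)] that by blast
 have H: "continuous_on (cball 0 1) H" unfolding G(3)[symmetric]
  by (rule continuous_on_inv[OF G(1) Jordan_facts(9)[OF J]]) (use HG in blast)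
 have H': "continuous_on (cball 0 1) H'" unfolding G'(3)[symmetric]
  by (rule continuous_on_inv[OF G'(1) Jordan_facts(9)[OF J']]) (use HG' in blast)
 have HJ: "H ` sphere 0 1 = J" unfolding G(4)[symmetric] image_image using HG by auto
 have injH: "inj_on H (cball 0 1)" unfolding H_def by (rule inj_on_inv_into) (simp add: G(3))
 have HJ': "H' ` cball 0 1 = J' Un inside J'" unfolding G'(3)[symmetric] image_image using HG' by auto
 have injH': "inj_on H' (cball 0 1)" unfolding H'_def by (rule inj_on_inv_into) (simp add: G'(3))
 define b where "b = G' \<circ> ga \<circ> H"
 have bc: "continuous_on (sphere 0 1) b" unfolding b_def
  by (intro continuous_on_compose continuous_on_subset[OF H] continuous_on_subset[OF ga(1)] continuous_on_subset[OF G'(1)])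
   (auto simp: HJ J'_def)
 have binj: "inj_on b (sphere 0 1)" unfolding b_def
  by (intro comp_inj_on inj_on_subset[OF injH] inj_on_subset[OF ga(2)] inj_on_subset[OF G'(2)])
   (auto simp: HJ J'_def)
 have bim: "b ` sphere 0 1 = sphere 0 1" unfolding b_def image_comp[symmetric] HJ J'_def[symmetric] G'(4) ..
 define E where "E = (\<lambda>z. norm z *\<^sub>R b (sgn z))"
 have E: "norm (E z) = norm z" "inj E" "norm w = 1 ==> E w = b w" "surj E" for z w
  using cone_bij[OF binj bim] by (simp_all add: E_def)
 have Ec: "continuous_on UNIV E"
 proof -
  have c1: "continuous_on ({0} \<times> sphere 0 1) (\<lambda>x. (\<lambda>_::real. b) (fst x) (snd x))"
   by (intro continuous_on_compose2[OF bc] continuous_intros) auto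
  have "norm (b z) = 1" if "norm z = 1" for z using bim that by (metis imageI mem_sphere_0)
  from cone_continuous[OF c1 this]
  have "continuous_on ({0::real} \<times> UNIV) (\<lambda>x. E (snd x))" unfolding E_def by simp
  moreover have "continuous_on UNIV (\<lambda>z::complex. (0::real, z))" by (intro continuous_intros)
  ultimately have "continuous_on UNIV (\<lambda>z. E (snd (0::real, z)))"
   by (rule continuous_on_compose2) auto
  thus ?thesis by simp
 qed
 have Eim: "E ` cball 0 1 = cball 0 1"
 proof (intro equalityI subsetI)
  fix w :: complex assume w: "w \<in> cball 0 1"
  obtain z where "w = E z" using E(4) by (metis surjD)
  thus "w \<in> E ` cball 0 1" using E(1)[of z] w by auto
 qed (use E(1) in auto)
 define Ps where "Ps = H' \<circ> E \<circ> G"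
 show thesis
 proof
  show "continuous_on (J Un inside J) Ps" unfolding Ps_def
   by (intro continuous_on_compose G(1) continuous_on_subset[OF H'] continuous_on_subset[OF Ec]) (simp_all only: G(3) Eim subset_UNIV order_refl)
  show "inj_on Ps (J Un inside J)" unfolding Ps_def
   by (intro comp_inj_on G(2) inj_on_subset[OF injH'] inj_on_subset[OF E(2)]) (simp_all only: G(3) Eim subset_UNIV order_refl image_comp[symmetric])
  show "Ps ` (J Un inside J) = ga ` J Un inside (ga ` J)"
   unfolding Ps_def image_comp[symmetric] G(3) Eim HJ' J'_def ..
  fix z assume z: "z \<in> J"
  hence "norm (G z) = 1" using G(4) by (metis imageI mem_sphere_0)
  hence "E (G z) = G' (ga (H (G z)))" using E(3)[of "G z"] by (simp add: b_def)
  also have "\<dots> = G' (ga z)" using HG[of z] z by simp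
  finally show "Ps z = ga z" using HG'[of "ga z"] z by (simp add: Ps_def J'_def)
 qed
qed

definition chord :: "complex set => complex set => bool" where
 "chord J c \<longleftrightarrow> (\<exists>a b. is_arc c a b & c \<inter> J = {a, b} & c - J <= inside J)"

text \<open>Without its ends \<open>d\<close> is a connected subset of the two disjoint open sets
  into which \<open>c\<close> divides the domain, so it lies in one of them; its ends lie in the
  closure of that one.\<close>

lemma chord_side:
 assumes "chord (A Un B) d" and AB: "is_arc A a b" "is_arc B a b" "A \<inter> B = {a, b}"
  and c: "is_arc c a b" "c \<inter> (A Un B) = {a, b}" "c - (A Un B) <= inside (A Un B)" and disj: "d \<inter> c = {}"
 shows "chord (A Un c) d & d \<inter> B = {} \<or> chord (B Un c) d & d \<inter> A = {}"
proof -
 note th = theta_split[OF AB(1,2) c(1) AB(3) c(2,3)]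
 obtain u v where d: "is_arc d u v" "d \<inter> (A Un B) = {u, v}" "d - (A Un B) <= inside (A Un B)"
  using assms(1) by (auto simp: chord_def)
 note df = arc_facts[OF d(1)]
 have ends: "a \<in> c" "b \<in> c" using arc_facts(3,4)[OF c(1)] by auto
 have dm: "d - (A Un B) = d - {u, v}" using d(2) by blast
 have sub: "d - {u, v} <= inside (A Un c) Un inside (B Un c)" using d(3) th(4) disj dm by blast
 have J: "Jordan (A Un B)" using Jordan_join[OF AB] .
 have key: "chord (A Un c) d & d \<inter> B = {}"
  if AB: "A \<inter> B = {a, b}" "Jordan (A Un c)" "d - {u, v} <= inside (A Un c)" "d \<inter> (A Un B) = {u, v}"
   "inside (A Un c) \<inter> (A Un B) = {}" for A B
 proof -
  have "d <= closure (inside (A Un c))" using df(8) closure_mono[OF that(3)] by blast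
  hence "d <= A Un c Un inside (A Un c)" using Jordan_facts(8)[OF that(2)] by simp
  hence inA: "x \<in> A" if "x \<in> d" "x \<in> A Un B" for x
   using that disj \<open>inside (A Un c) \<inter> (A Un B) = {}\<close> by blast
  have uvAB: "u \<in> A Un B" "v \<in> A Un B" using that(4) by blast+
  have uv: "u \<in> A" "v \<in> A" using inA df(3,4) uvAB by simp_all
  have "d \<inter> (A Un c) = d \<inter> A" using disj by blast
  moreover have "d \<inter> A <= {u, v}" using that(4) by blast
  ultimately have "d \<inter> (A Un c) = {u, v}" using uv df(3,4) by blast
  moreover from this have "d - (A Un c) <= inside (A Un c)" using that(3) by blast
  ultimately have "chord (A Un c) d" unfolding chord_def using d(1) by blast
  moreover have "d \<inter> B = {}"
  proof (rule ccontr)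
   assume "d \<inter> B ~= {}"
   then obtain x where x: "x \<in> d" "x \<in> B" by blast
   hence "x \<in> A \<inter> B" using inA[of x] by blast
   hence "x \<in> c" unfolding that(1) using ends by blast
   thus False using disj x(1) by blast
  qed
  ultimately show ?thesis by blast
 qed
 have nin: "inside (A Un c) \<inter> (A Un B) = {}" "inside (B Un c) \<inter> (A Un B) = {}"
  using th(4) Jordan_facts(10)[OF J] by blast+
 have "inside (A Un c) \<inter> (d - {u, v}) = {} \<or> inside (B Un c) \<inter> (d - {u, v}) = {}"
  by (rule connectedD[OF df(6) Jordan_facts(3)[OF th(1)] Jordan_facts(3)[OF th(2)] _ sub]) (simp add: th(3))
 then consider "d - {u, v} <= inside (A Un c)" | "d - {u, v} <= inside (B Un c)" using sub by blast
 thus ?thesis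
 proof cases
  case 1 show ?thesis using key[OF AB(3) th(1) 1 d(2) nin(1)] by blast
 next
  case 2
  have "chord (B Un c) d & d \<inter> A = {}"
   by (rule key[of B A]) (simp_all only: AB(3) th(2) 2 d(2) nin(2) Int_commute[of B A] Un_commute[of B A])
  thus ?thesis by blast
 qed
qed

text \<open>Induction on the number of chords: one chord \<open>c\<close> divides the domain in two,
  each remaining chord falls to one side, and the two extensions agree with \<open>ga\<close> on
  \<open>c\<close>. On the image side, the chords must be seen to fall to the corresponding sides;
  this is the fact \<open>side'\<close> in the proof.\<close>

theorem chord_system_extension:
 fixes ga :: "complex => complex"
 assumes "finite CC" "Jordan J" "\<And>c. c \<in> CC ==> chord J c" "pairwise disjnt CC"
  "continuous_on (J Un \<Union>CC) ga" "inj_on ga (J Un \<Union>CC)"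
  "\<And>c. c \<in> CC ==> ga ` (c - J) <= inside (ga ` J)"
 shows "\<exists>Ps. continuous_on (J Un inside J) Ps & inj_on Ps (J Un inside J) &
  Ps ` (J Un inside J) = ga ` J Un inside (ga ` J) & (\<forall>z\<in>J Un \<Union>CC. Ps z = ga z)"
 using assms
proof (induction "card CC" arbitrary: CC J rule: less_induct)
 case less
 show ?case
 proof (cases "CC = {}")
  case True
  obtain Ps where "continuous_on (J Un inside J) Ps" "inj_on Ps (J Un inside J)"
   "Ps ` (J Un inside J) = ga ` J Un inside (ga ` J)" "\<And>z. z \<in> J ==> Ps z = ga z"
   by (rule Jordan_extension[OF less.prems(2), of ga]) (use less.prems(5,6) True in auto)
  thus ?thesis using True by auto
 next
  case False
  then obtain c where cC: "c \<in> CC" by blast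
  note J = less.prems(2)
  obtain a b where c: "is_arc c a b" "c \<inter> J = {a, b}" "c - J <= inside J"
   using less.prems(3)[OF cC] by (auto simp: chord_def)
  have cc: "compact c" "a ~= b" using arc_facts[OF c(1)] by auto
  have abJ: "a \<in> J" "b \<in> J" using c(2) by blast+
  obtain A B where AB: "is_arc A a b" "is_arc B a b" "A \<inter> B = {a, b}" "A Un B = J"
   by (rule Jordan_split[OF J abJ cc(2)])
  have cAB: "c \<inter> (A Un B) = {a, b}" "c - (A Un B) <= inside (A Un B)" using c AB(4) by auto
  note th = theta_split[OF AB(1,2) c(1) AB(3) cAB]
  define dom where "dom = J Un \<Union>CC"
  have cont: "continuous_on S ga" if "S <= dom" for S
   using less.prems(5) that unfolding dom_def by (rule continuous_on_subset)
  have inj: "inj_on ga S" if "S <= dom" for S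
   using less.prems(6) that unfolding dom_def by (rule inj_on_subset)
  have sub: "A <= dom" "B <= dom" "c <= dom" "J <= dom" using AB(4) cC by (auto simp: dom_def)
  define A' B' c' where "A' = ga ` A" and "B' = ga ` B" and "c' = ga ` c"
  have gi: "ga ` (X \<inter> Y) = ga ` X \<inter> ga ` Y" if "X <= dom" "Y <= dom" for X Y
   by (rule inj_on_image_Int[OF inj[of dom]]) (use that in auto)
  have ar: "is_arc A' (ga a) (ga b)" "is_arc B' (ga a) (ga b)" "is_arc c' (ga a) (ga b)"
   unfolding A'_def B'_def c'_def
   by (rule is_arc_image[OF AB(1) cont inj] is_arc_image[OF AB(2) cont inj] is_arc_image[OF c(1) cont inj]; rule sub)+
  have AB': "A' \<inter> B' = {ga a, ga b}" unfolding A'_def B'_def using gi[OF sub(1,2)] AB(3) by simp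
  have J': "A' Un B' = ga ` J" using AB(4) by (auto simp: A'_def B'_def)
  have cAB': "c' \<inter> (A' Un B') = {ga a, ga b}" unfolding J' c'_def using gi[OF sub(3,4)] c(2) by simp
  have "c' - ga ` J = ga ` (c - J)" unfolding c'_def
   by (rule inj_on_image_set_diff[OF inj[of dom], symmetric]) (use sub in auto)
  hence cAB'': "c' - (A' Un B') <= inside (A' Un B')" unfolding J' using less.prems(7)[OF cC] by simp
  note th' = theta_split[OF ar(1,2,3) AB' cAB' cAB'']
  have dis: "d \<inter> c = {}" if "d \<in> CC - {c}" for d
   using less.prems(4) that cC by (auto simp: pairwise_def disjnt_def)
  define C1 where "C1 = {d \<in> CC - {c}. chord (A Un c) d & d \<inter> B = {}}"
  define C2 where "C2 = {d \<in> CC - {c}. chord (B Un c) d & d \<inter> A = {}}"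
  have CC: "CC = insert c (C1 Un C2)"
  proof -
   have "d \<in> C1 Un C2" if "d \<in> CC - {c}" for d
   proof -
    have "chord (A Un B) d" using less.prems(3)[of d] that AB(4) by simp
    from chord_side[OF this AB(1-3) c(1) cAB dis[OF that]] show ?thesis
     using that unfolding C1_def C2_def by blast
   qed
   thus ?thesis using cC by (auto simp: C1_def C2_def)
  qed
  have subC: "C1 <= CC - {c}" "C2 <= CC - {c}" by (auto simp: C1_def C2_def)
  \<comment> \<open>The image of \<open>d\<close> misses the image of \<open>B\<close>, but its ends
    lie on the image of \<open>J\<close>, hence on the image of \<open>A\<close>. This excludes the
    wrong side for it.\<close>
  have side': "ga ` (d - J) <= inside (ga ` (A Un c)) & d - (A Un c) = d - J"
   if "d \<in> CC - {c}" "d \<inter> B = {}" "A Un B = J" "is_arc A a b" "is_arc B a b" "A \<inter> B = {a, b}" for d A B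
  proof -
   have sub2: "A <= dom" "B <= dom" "d <= dom" using sub that by (auto simp: dom_def)
   have dc: "d \<inter> c = {}" by (rule dis[OF that(1)])
   have im: "ga ` A Un ga ` B = ga ` J" "ga ` A \<inter> ga ` B = {ga a, ga b}"
    using that(3) gi[OF sub2(1,2)] that(6) by auto
   have "chord J d" using less.prems(3) that by auto
   then obtain u v where d: "is_arc d u v" "d \<inter> J = {u, v}" "d - J <= inside J" by (auto simp: chord_def)
   have dd1: "ga ` d - ga ` J = ga ` (d - J)"
    by (rule inj_on_image_set_diff[OF inj[of dom], symmetric]) (use sub2 sub in auto)
   have dd2: "ga ` d \<inter> ga ` J = {ga u, ga v}" unfolding gi[OF sub2(3) sub(4), symmetric] d(2) by simp
   have dd3: "ga ` d \<inter> ga ` c = {}" unfolding gi[OF sub2(3) sub(3), symmetric] dc by simp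
   have dd4: "ga ` d \<inter> ga ` B = {}" unfolding gi[OF sub2(3,2), symmetric] that(2) by simp
   have dd5: "ga ` (d - J) <= inside (ga ` J)" using less.prems(7) that(1) by blast
   have ch: "chord (ga ` A Un ga ` B) (ga ` d)" unfolding chord_def im(1)
   proof (intro exI conjI)
    show "is_arc (ga ` d) (ga u) (ga v)" by (rule is_arc_image[OF d(1) cont[OF sub2(3)] inj[OF sub2(3)]])
   qed (simp_all only: dd1 dd2 dd5)
   have "chord (ga ` A Un ga ` c) (ga ` d) & ga ` d \<inter> ga ` B = {} \<or> chord (ga ` B Un ga ` c) (ga ` d) & ga ` d \<inter> ga ` A = {}"
   proof (rule chord_side[OF ch _ _ im(2) _ _ _ dd3])
    show "is_arc (ga ` A) (ga a) (ga b)" by (rule is_arc_image[OF that(4) cont[OF sub2(1)] inj[OF sub2(1)]])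
    show "is_arc (ga ` B) (ga a) (ga b)" by (rule is_arc_image[OF that(5) cont[OF sub2(2)] inj[OF sub2(2)]])
    show "is_arc (ga ` c) (ga a) (ga b)" using ar(3) by (simp only: c'_def)
    show "ga ` c \<inter> (ga ` A Un ga ` B) = {ga a, ga b}" "ga ` c - (ga ` A Un ga ` B) <= inside (ga ` A Un ga ` B)"
     using cAB' cAB'' by (simp_all only: c'_def im(1) J')
   qed
   moreover have "\<not> (ga ` d \<inter> ga ` A = {})" 
   proof -
    have "ga u \<in> ga ` d" "ga u \<in> ga ` A Un ga ` B" using dd2 unfolding im(1) by (metis IntE insertI1)+
    thus ?thesis using dd4 by blast
   qed
   ultimately have "chord (ga ` A Un ga ` c) (ga ` d)" by blast
   hence "ga ` d - (ga ` A Un ga ` c) <= inside (ga ` A Un ga ` c)" by (auto simp: chord_def)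
   moreover have "X - (Y Un W) = X - (Y Un Z)" if "X \<inter> W = {}" "X \<inter> Z = {}" for X Y Z W :: "complex set"
    using that by blast
   from this[OF dd3 dd4] have "ga ` d - (ga ` A Un ga ` c) = ga ` (d - J)" by (simp only: im(1) dd1)
   moreover have "d - (A Un c) = d - J" using that(2,3) dc by blast
   ultimately show ?thesis by (simp only: image_Un)
  qed
  have fin: "finite C1" "finite C2" "card C1 < card CC" "card C2 < card CC"
   using less.prems(1) subC cC by (auto intro: finite_subset psubset_card_mono)
  have "\<exists>Ps. continuous_on ((A Un c) Un inside (A Un c)) Ps & inj_on Ps ((A Un c) Un inside (A Un c)) &
   Ps ` ((A Un c) Un inside (A Un c)) = ga ` (A Un c) Un inside (ga ` (A Un c)) & (\<forall>z\<in>(A Un c) Un \<Union>C1. Ps z = ga z)"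
  proof (rule less.hyps[OF fin(3,1) th(1)])
   show "chord (A Un c) d" if "d \<in> C1" for d using that by (simp add: C1_def)
   show "pairwise disjnt C1" using less.prems(4) subC pairwise_subset by blast
   have "A Un c Un \<Union>C1 \<subseteq> dom" using sub subC by (auto simp: dom_def)
   thus "continuous_on (A Un c Un \<Union>C1) ga" "inj_on ga (A Un c Un \<Union>C1)" using cont inj by blast+
   show "ga ` (d - (A Un c)) <= inside (ga ` (A Un c))" if "d \<in> C1" for d
    using side'[of d B A] that AB by (simp add: C1_def)
  qed
  then obtain P1 where PP: "continuous_on ((A Un c) Un inside (A Un c)) P1 & inj_on P1 ((A Un c) Un inside (A Un c)) &
   P1 ` ((A Un c) Un inside (A Un c)) = ga ` (A Un c) Un inside (ga ` (A Un c)) & (\<forall>z\<in>(A Un c) Un \<Union>C1. P1 z = ga z)"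
   by (rule exE)
  have P1: "continuous_on ((A Un c) Un inside (A Un c)) P1" "inj_on P1 ((A Un c) Un inside (A Un c))"
   "P1 ` ((A Un c) Un inside (A Un c)) = (A' Un c') Un inside (A' Un c')"
   "z\<in>(A Un c) Un \<Union>C1 ==> P1 z = ga z" for z
   using PP by (simp_all only: A'_def c'_def image_Un)
  have "\<exists>Ps. continuous_on ((B Un c) Un inside (B Un c)) Ps & inj_on Ps ((B Un c) Un inside (B Un c)) &
   Ps ` ((B Un c) Un inside (B Un c)) = ga ` (B Un c) Un inside (ga ` (B Un c)) & (\<forall>z\<in>(B Un c) Un \<Union>C2. Ps z = ga z)"
  proof (rule less.hyps[OF fin(4,2) th(2)])
   show "chord (B Un c) d" if "d \<in> C2" for d using that by (simp add: C2_def)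
   show "pairwise disjnt C2" using less.prems(4) subC pairwise_subset by blast
   have "B Un c Un \<Union>C2 \<subseteq> dom" using sub subC by (auto simp: dom_def)
   thus "continuous_on (B Un c Un \<Union>C2) ga" "inj_on ga (B Un c Un \<Union>C2)" using cont inj by blast+
   show "ga ` (d - (B Un c)) <= inside (ga ` (B Un c))" if "d \<in> C2" for d
    using side'[of d A B] that AB by (auto simp: C2_def)
  qed
  then obtain P2 where PP: "continuous_on ((B Un c) Un inside (B Un c)) P2 & inj_on P2 ((B Un c) Un inside (B Un c)) &
   P2 ` ((B Un c) Un inside (B Un c)) = ga ` (B Un c) Un inside (ga ` (B Un c)) & (\<forall>z\<in>(B Un c) Un \<Union>C2. P2 z = ga z)"
   by (rule exE)
  have P2: "continuous_on ((B Un c) Un inside (B Un c)) P2" "inj_on P2 ((B Un c) Un inside (B Un c))"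
   "P2 ` ((B Un c) Un inside (B Un c)) = (B' Un c') Un inside (B' Un c')"
   "z\<in>(B Un c) Un \<Union>C2 ==> P2 z = ga z" for z
   using PP by (simp_all only: B'_def c'_def image_Un)
  define K1 K2 where "K1 = (A Un c) Un inside (A Un c)" and "K2 = (B Un c) Un inside (B Un c)"
  have K: "K1 Un K2 = J Un inside J" "K1 \<inter> K2 = c"
   using theta_cells[OF AB(1,2) c(1) AB(3) cAB] unfolding K1_def K2_def by (simp_all only: AB(4))
  have PK: "continuous_on K1 P1" "inj_on P1 K1" "P1 ` K1 = (A' Un c') Un inside (A' Un c')"
   "continuous_on K2 P2" "inj_on P2 K2" "P2 ` K2 = (B' Un c') Un inside (B' Un c')"
   using P1(1-3) P2(1-3) unfolding K1_def K2_def by simp_all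
  have K': "((A' Un c') Un inside (A' Un c')) Un ((B' Un c') Un inside (B' Un c')) = ga ` J Un inside (ga ` J)"
   "((A' Un c') Un inside (A' Un c')) \<inter> ((B' Un c') Un inside (B' Un c')) = c'"
   using theta_cells[OF ar AB' cAB' cAB''] by (simp_all only: J')
  define Ps where "Ps = (\<lambda>z. if z \<in> K1 then P1 z else P2 z)"
  have Pc: "P1 z = ga z" "P2 z = ga z" if "z \<in> c" for z using P1(4) P2(4) that by auto
  have Ps1: "Ps z = P1 z" if "z \<in> K1" for z using that by (simp add: Ps_def)
  have Ps2: "Ps z = P2 z" if "z \<in> K2" for z using that Pc K(2) by (auto simp: Ps_def)
  have cl: "closed K1" "closed K2" using Jordan_facts(9)[OF th(1)] Jordan_facts(9)[OF th(2)]
   by (auto simp: K1_def K2_def compact_imp_closed)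
  have "continuous_on (K1 Un K2) Ps"
  proof (rule continuous_on_closed_Un[OF cl])
   show "continuous_on K1 Ps" using PK(1) Ps1 by (simp cong: continuous_on_cong)
   show "continuous_on K2 Ps" using PK(4) Ps2 by (simp cong: continuous_on_cong)
  qed
  moreover have "inj_on Ps (K1 Un K2)"
  proof (rule inj_onI)
   have mix: "x = y" if "x \<in> K1" "y \<in> K2" "P1 x = P2 y" for x y
   proof -
    have "P1 x \<in> P1 ` K1" "P1 x \<in> P2 ` K2" using that by (metis imageI)+
    hence "P1 x \<in> c'" unfolding PK(3,6) using K'(2) by blast
    then obtain z where z: "z \<in> c" "P1 x = ga z" unfolding c'_def by (rule imageE) 
    have zK: "z \<in> K1" "z \<in> K2" using z(1) K(2) by blast+
    have "x = z" using inj_onD[OF PK(2), of x z] z Pc(1) that zK by simp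
    moreover have "y = z" using inj_onD[OF PK(5), of y z] z Pc(2) that zK by simp
    ultimately show ?thesis by simp
   qed
   fix x y assume xy: "x \<in> K1 Un K2" "y \<in> K1 Un K2" "Ps x = Ps y"
   consider "x \<in> K1" "y \<in> K1" | "x \<in> K1" "y \<in> K2" | "x \<in> K2" "y \<in> K1" | "x \<in> K2" "y \<in> K2" using xy by blast
   thus "x = y"
   proof cases
    case 1 thus ?thesis using inj_onD[OF PK(2)] Ps1 xy(3) by simp
   next
    case 2 thus ?thesis using mix[of x y] Ps1 Ps2 xy(3) by simp
   next
    case 3 thus ?thesis using mix[of y x] Ps1 Ps2 xy(3) by simp
   next
    case 4 thus ?thesis using inj_onD[OF PK(5)] Ps2 xy(3) by simp
   qed
  qed
  moreover have "Ps ` (K1 Un K2) = ga ` J Un inside (ga ` J)"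
  proof -
   have "Ps ` K1 = P1 ` K1" "Ps ` K2 = P2 ` K2" using Ps1 Ps2 by (auto intro: image_cong)
   thus ?thesis using PK(3,6) K'(1) by (simp only: image_Un)
  qed
  moreover have "Ps z = ga z" if z: "z \<in> J Un \<Union>CC" for z
  proof -
   have "z \<in> (A Un c Un \<Union>C1) \<or> z \<in> (B Un c Un \<Union>C2)" using z unfolding CC AB(4)[symmetric] by auto
   moreover have "A Un c Un \<Union>C1 \<subseteq> K1" unfolding C1_def K1_def chord_def by blast
   moreover have "B Un c Un \<Union>C2 \<subseteq> K2" unfolding C2_def K2_def chord_def by blast
   ultimately show ?thesis using Ps1[of z] Ps2[of z] P1(4)[of z] P2(4)[of z] by (metis subsetD)
  qed
  ultimately show ?thesis unfolding K(1) by blast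
 qed
qed

section \<open>Alexander's trick\<close>

text \<open>At time \<open>t\<close> the disc of radius \<open>t\<close> carries a rescaled copy of
  \<open>a\<close>, and the circle of radius \<open>r >= t\<close> carries the boundary isotopy at
  time \<open>t / r\<close>. For \<open>r = t\<close> this is \<open>b 1\<close>, which agrees with
  \<open>a\<close>; for \<open>r = 1\<close> it is \<open>b t\<close>; for \<open>t = 0\<close> it
  is the identity.\<close>

definition alexander :: "(real => complex => complex) => (complex => complex) => real => complex => complex" where
 "alexander b a t z = (if norm z <= t then t *\<^sub>R a (z /\<^sub>R t) else norm z *\<^sub>R b (t / norm z) (sgn z))"

lemma alexander_isotopy:
 fixes a :: "complex => complex" and b :: "real => complex => complex"
 assumes a: "continuous_on (cball 0 1) a" "inj_on a (cball 0 1)" "a ` cball 0 1 = cball 0 1"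
  and b: "joint_cont (sphere 0 1) b"
   "\<And>t. t \<in> {0..1} ==> inj_on (b t) (sphere 0 1)" "\<And>t. t \<in> {0..1} ==> b t ` sphere 0 1 = sphere 0 1"
   "\<And>z. z \<in> sphere 0 1 ==> b 0 z = z" "\<And>z. z \<in> sphere 0 1 ==> b 1 z = a z"
 shows "continuous_on ({0..1} \<times> cball 0 1) (\<lambda>x. alexander b a (fst x) (snd x))"
  "\<And>t. t \<in> {0..1} ==> inj_on (alexander b a t) (cball 0 1)"
  "\<And>t. t \<in> {0..1} ==> alexander b a t ` cball 0 1 = cball 0 1"
  "\<And>t z. t \<in> {0..1} ==> z \<in> sphere 0 1 ==> alexander b a t z = b t z"
  "\<And>z. z \<in> cball 0 1 ==> alexander b a 0 z = z" "\<And>z. z \<in> cball 0 1 ==> alexander b a 1 z = a z"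
  "\<And>t. t \<in> {0..1} ==> a 0 = 0 ==> alexander b a t 0 = 0"
proof -
 let ?A = "alexander b a"
 have na: "norm (a z) <= 1" if "norm z <= 1" for z using a(3) that by (metis imageI mem_cball_0)
 have nb: "norm (b t z) = 1" if "t \<in> {0..1}" "norm z = 1" for t z using b(3)[OF that(1)] that(2) by (metis imageI mem_sphere_0)
 have asph: "a ` sphere 0 1 = sphere 0 1" using b(3)[of 1] b(5) by (metis (no_types, lifting) atLeastAtMost_iff image_cong le_numeral_extra(4) zero_le_one)
 have aS: "norm (a z) = 1 \<longleftrightarrow> norm z = 1" if "norm z <= 1" for z
 proof
  assume "norm (a z) = 1"
  hence "a z \<in> a ` sphere 0 1" unfolding asph by simp
  then obtain y where "norm y = 1" "a z = a y" by auto
  thus "norm z = 1" using inj_onD[OF a(2), of z y] that by simp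
 next
  assume "norm z = 1" thus "norm (a z) = 1" using asph by (metis imageI mem_sphere_0)
 qed
 have outer: "?A t z = norm z *\<^sub>R b (t / norm z) (sgn z)" if "t <= norm z" "t \<in> {0..1}" for t z
 proof (cases "norm z = t & t ~= 0")
  case True
  hence "sgn z = z /\<^sub>R t" "norm (sgn z) = 1" by (auto simp: sgn_div_norm)
  thus ?thesis using True b(5)[of "sgn z"] by (simp add: alexander_def)
 next
  case False thus ?thesis using that by (auto simp: alexander_def)
 qed
 have inner: "?A t z = t *\<^sub>R a (z /\<^sub>R t)" if "norm z <= t" for t z using that by (simp add: alexander_def)
 have nout: "norm (?A t z) = norm z" if "t <= norm z" "t \<in> {0..1}" for t z
  using outer[OF that] nb[of "t / norm z" "sgn z"] that by (cases "z = 0") (auto simp: norm_sgn)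
 have nin: "norm (?A t z) <= t" if "norm z <= t" "t \<in> {0..1}" for t z
  using inner[OF that(1)] na[of "z /\<^sub>R t"] that by (cases "t = 0") (auto simp: field_simps mult_left_le)
 define S1 where "S1 = {x \<in> {0..1} \<times> cball (0::complex) 1. norm (snd x) <= fst x}"
 define S2 where "S2 = {x \<in> {0..1} \<times> cball (0::complex) 1. fst x <= norm (snd x)}"
 have cS: "closed S1" "closed S2" unfolding S1_def S2_def
  by (intro closed_Collect_conj[where P = "\<lambda>x. x \<in> {0..1} \<times> cball (0::complex) 1", simplified]
    closed_Collect_le continuous_intros closed_Times closed_cball closed_atLeastAtMost; simp)+
 have c1: "continuous_on S1 (\<lambda>x. fst x *\<^sub>R a (snd x /\<^sub>R fst x))"
 proof (rule cont_scaleR_bdd)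
  show "continuous_on S1 fst" by (intro continuous_intros)
  show "continuous_on {x \<in> S1. fst x ~= 0} (\<lambda>x. a (snd x /\<^sub>R fst x))"
   by (rule continuous_on_compose2[OF a(1)]) (auto simp: S1_def field_simps intro!: continuous_intros)
  show "norm (a (snd x /\<^sub>R fst x)) <= 1" if "x \<in> S1" "fst x ~= 0" for x
   by (rule na) (use that in \<open>auto simp: S1_def field_simps\<close>)
 qed
 have c2: "continuous_on S2 (\<lambda>x. norm (snd x) *\<^sub>R b (fst x / norm (snd x)) (sgn (snd x)))"
 proof (rule cont_scaleR_bdd)
  show "continuous_on S2 (\<lambda>x. norm (snd x))" by (intro continuous_intros)
  have "continuous_on {x \<in> S2. norm (snd x) ~= 0} (\<lambda>x. (fst x / norm (snd x), sgn (snd x)))"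
   unfolding sgn_div_norm by (intro continuous_intros) auto
  moreover have "(\<lambda>x. (fst x / norm (snd x), sgn (snd x))) ` {x \<in> S2. norm (snd x) ~= 0} <= {0..1} \<times> sphere 0 1"
   by (auto simp: norm_sgn S2_def)
  ultimately show "continuous_on {x \<in> S2. norm (snd x) ~= 0} (\<lambda>x. b (fst x / norm (snd x)) (sgn (snd x)))"
   using continuous_on_compose2[OF b(1)] by fastforce
  show "norm (b (fst x / norm (snd x)) (sgn (snd x))) <= 1" if "x \<in> S2" "norm (snd x) ~= 0" for x
   using nb[of "fst x / norm (snd x)" "sgn (snd x)"] that by (auto simp: S2_def norm_sgn)
 qed
 have S12: "{0..1} \<times> cball 0 1 = S1 Un S2" by (auto simp: S1_def S2_def)
 show "continuous_on ({0..1} \<times> cball 0 1) (\<lambda>x. ?A (fst x) (snd x))"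
  unfolding S12
 proof (rule continuous_on_closed_Un[OF cS])
  show "continuous_on S1 (\<lambda>x. ?A (fst x) (snd x))"
   using c1 by (rule continuous_on_eq) (auto simp: S1_def inner)
  show "continuous_on S2 (\<lambda>x. ?A (fst x) (snd x))"
   using c2 by (rule continuous_on_eq) (auto simp: S2_def outer)
 qed
 show bd: "?A t z = b t z" if "t \<in> {0..1}" "z \<in> sphere 0 1" for t z
  using outer[of t z] that by (simp add: sgn_div_norm)
 show "?A 0 z = z" if "z \<in> cball 0 1" for z
  using outer[of 0 z] b(4)[of "sgn z"] by (cases "z = 0") (auto simp: norm_sgn sgn_div_norm)
 show "?A 1 z = a z" if "z \<in> cball 0 1" for z using inner[of z 1] that by simp
 show "?A t 0 = 0" if "t \<in> {0..1}" "a 0 = 0" for t using inner[of 0 t] that by simp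
 show "inj_on (?A t) (cball 0 1)" if t: "t \<in> {0..1}" for t
 proof (rule inj_onI)
  fix x y assume xy: "x \<in> cball 0 1" "y \<in> cball 0 1" "?A t x = ?A t y"
  have out: "x = y" if "t <= norm x" "t <= norm y" "?A t x = ?A t y" for x y
  proof -
   have n: "norm x = norm y" using nout[of t x] nout[of t y] that t by simp
   show ?thesis
   proof (cases "x = 0")
    case False
    have "norm x *\<^sub>R b (t / norm x) (sgn x) = norm x *\<^sub>R b (t / norm x) (sgn y)"
     using that(3) unfolding outer[OF that(1) t] outer[OF that(2) t] n .
    hence "b (t / norm x) (sgn x) = b (t / norm x) (sgn y)" using False by simp
    moreover have "t / norm x \<in> {0..1}" using that t False by simp
    moreover have "norm (sgn x) = 1" "norm (sgn y) = 1" using n False by (auto simp: norm_sgn)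
    ultimately have "sgn x = sgn y" using inj_onD[OF b(2)] by simp
    hence "norm x *\<^sub>R sgn x = norm y *\<^sub>R sgn y" using n by simp
    thus ?thesis using False n by (auto simp: sgn_div_norm)
   qed (use n in auto)
  qed
  have inn: "x = y" if "norm x <= t" "norm y <= t" "?A t x = ?A t y" for x y
  proof (cases "t = 0")
   case False
   hence "a (x /\<^sub>R t) = a (y /\<^sub>R t)" using that by (simp add: inner)
   hence "x /\<^sub>R t = y /\<^sub>R t" by (rule inj_onD[OF a(2)]) (use that t False in \<open>auto simp: field_simps\<close>)
   thus ?thesis using False by simp
  qed (use that in auto)
  have mix: "x = y" if "norm x < t" "t <= norm y" "?A t x = ?A t y" for x y
  proof -
   have "norm (?A t x) <= t" using nin[of x t] that t by simp
   hence "norm y = t" using nout[of t y] that t by simp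
   thus ?thesis using inn[of x y] that by simp
  qed
  consider "norm x < t" "norm y < t" | "norm x < t" "t <= norm y" | "t <= norm x" "norm y < t" | "t <= norm x" "t <= norm y"
   by linarith
  thus "x = y"
  proof cases
   case 3 thus ?thesis using mix[of y x] xy by simp
  qed (use out inn mix xy in auto)
 qed
 show "?A t ` cball 0 1 = cball 0 1" if t: "t \<in> {0..1}" for t
 proof (intro equalityI subsetI)
  fix w assume "w \<in> ?A t ` cball 0 1"
  then obtain z where z: "norm z <= 1" "w = ?A t z" by auto
  thus "w \<in> cball 0 1" using nin[of z t] nout[of t z] t by (cases "norm z <= t") auto
 next
  fix w :: complex assume w: "w \<in> cball 0 1"
  show "w \<in> ?A t ` cball 0 1"
  proof (cases "norm w <= t")
   case True
   show ?thesis
   proof (cases "t = 0")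
    case False
    hence "w /\<^sub>R t \<in> cball 0 1" using True t by (simp add: field_simps)
    hence "w /\<^sub>R t \<in> a ` cball 0 1" using a(3) by simp
    then obtain v where v: "norm v <= 1" "a v = w /\<^sub>R t" by auto
    have "?A t (t *\<^sub>R v) = w" using inner[of "t *\<^sub>R v" t] v t False by (simp add: mult_left_le)
    moreover have "norm (t *\<^sub>R v) <= 1" using v t by (simp add: mult_le_one)
    ultimately show ?thesis by (metis imageI mem_cball_0)
   next
    case True2: True
    hence "w = 0" using True by simp
    thus ?thesis using inner[of 0 t] True2 by (intro image_eqI[of _ _ 0]) auto
   qed
  next
   case False
   hence w0: "w ~= 0" using t by auto
   hence "sgn w \<in> b (t / norm w) ` sphere 0 1" using b(3)[of "t / norm w"] False t by (simp add: norm_sgn)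
   then obtain v where v: "norm v = 1" "b (t / norm w) v = sgn w" by auto
   have nv: "norm (norm w *\<^sub>R v) = norm w" "sgn (norm w *\<^sub>R v) = v" using v w0 by (auto simp: sgn_div_norm)
   have "?A t (norm w *\<^sub>R v) = norm w *\<^sub>R sgn w" using outer[of t "norm w *\<^sub>R v"] nv v False t by simp
   also have "\<dots> = w" using w0 by (simp add: sgn_div_norm)
   finally show ?thesis using nv(1) w by (metis imageI mem_cball_0)
  qed
 qed
qed

text \<open>The trick on the unit disc, conjugated by disc coordinates that send \<open>o1\<close>
  to the origin. The fixed origin becomes the fixed point \<open>o1\<close>, by which a puncture
  inside a cell is kept in place.\<close>

lemma Jordan_alexander:
 fixes a :: "complex => complex" and b :: "real => complex => complex" and J :: "complex set"
 defines "K \<equiv> J Un inside J"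
 assumes J: "Jordan J" and o1: "o1 \<in> inside J"
  and a: "continuous_on K a" "inj_on a K" "a ` K = K"
  and b: "joint_cont J b"
   "\<And>t. t \<in> {0..1} ==> inj_on (b t) J" "\<And>t. t \<in> {0..1} ==> b t ` J = J"
   "\<And>z. z \<in> J ==> b 0 z = z" "\<And>z. z \<in> J ==> b 1 z = a z"
 obtains A where "joint_cont K A"
  "\<And>t. t \<in> {0..1} ==> inj_on (A t) K" "\<And>t. t \<in> {0..1} ==> A t ` K = K"
  "\<And>t z. t \<in> {0..1} ==> z \<in> J ==> A t z = b t z"
  "\<And>z. z \<in> K ==> A 0 z = z" "\<And>z. z \<in> K ==> A 1 z = a z"
  "\<And>t. t \<in> {0..1} ==> a o1 = o1 ==> A t o1 = o1"
proof -
 obtain G :: "complex => complex" where G: "continuous_on K G" "inj_on G K"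
  "G ` K = cball 0 1" "G ` J = sphere 0 1" "G o1 = 0" unfolding K_def by (rule Jordan_disc_coordinates[OF J o1])
 define H where "H = inv_into K G"
 have HG: "H (G z) = z" if "z \<in> K" for z unfolding H_def using inv_into_f_f[OF G(2) that] .
 have GH: "G (H w) = w" if "w \<in> cball 0 1" for w unfolding H_def using f_inv_into_f that G(3) by metis
 have cK: "compact K" unfolding K_def by (rule Jordan_facts(9)[OF J])
 have JK: "J <= K" "o1 \<in> K" using o1 by (auto simp: K_def)
 have H: "continuous_on (cball 0 1) H" unfolding G(3)[symmetric]
  by (rule continuous_on_inv[OF G(1) cK]) (use HG in blast)
 have Him: "H ` cball 0 1 = K" "H ` sphere 0 1 = J"
  unfolding G(3,4)[symmetric] image_image using HG JK by force+
 have Hinj: "inj_on H S" if "S <= cball 0 1" for S using GH that by (metis inj_on_def subsetD)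
 have Gsph: "G z \<in> sphere 0 1" if "z \<in> J" for z using G(4) that by blast
 have Gcb: "G z \<in> cball 0 1" if "z \<in> K" for z using G(3) that by blast
 have HK: "H w \<in> K" if "w \<in> cball 0 1" for w using Him(1) that by blast
 have HJ: "H w \<in> J" if "w \<in> sphere 0 1" for w using Him(2) that by blast
 have sub: "sphere (0::complex) 1 <= cball 0 1" by auto
 define a' where "a' = (\<lambda>w. G (a (H w)))"
 define b' where "b' = (\<lambda>t w. G (b t (H w)))"
 have a': "continuous_on (cball 0 1) a'" "inj_on a' (cball 0 1)" "a' ` cball 0 1 = cball 0 1"
 proof -
  show "continuous_on (cball 0 1) a'" unfolding a'_def
   by (intro continuous_on_compose2[OF G(1)] continuous_on_compose2[OF a(1)] H) (use HK a(3) in blast)+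
  show "inj_on a' (cball 0 1)"
  proof (rule inj_onI)
   fix x y assume xy: "x \<in> cball 0 1" "y \<in> cball 0 1" "a' x = a' y"
   have "a (H x) \<in> K" "a (H y) \<in> K" using HK xy a(3) by blast+
   hence "a (H x) = a (H y)" using inj_onD[OF G(2)] xy(3) by (simp add: a'_def)
   hence "H x = H y" using inj_onD[OF a(2)] HK xy by blast
   thus "x = y" using GH xy by metis
  qed
  have "a' ` cball 0 1 = G ` a ` H ` cball 0 1" by (simp add: a'_def image_image)
  thus "a' ` cball 0 1 = cball 0 1" by (simp only: Him a(3) G(3))
 qed
 have b': "joint_cont (sphere 0 1) b'"
   "\<And>t. t \<in> {0..1} ==> inj_on (b' t) (sphere 0 1)" "\<And>t. t \<in> {0..1} ==> b' t ` sphere 0 1 = sphere 0 1"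
   "\<And>z. z \<in> sphere 0 1 ==> b' 0 z = z" "\<And>z. z \<in> sphere 0 1 ==> b' 1 z = a' z"
 proof -
  have "continuous_on ({0..1} \<times> sphere 0 1) (\<lambda>x. (fst x, H (snd x)))"
   by (intro continuous_intros continuous_on_compose2[OF H]) auto
  from continuous_on_compose2[OF b(1) this]
  have c: "continuous_on ({0..1} \<times> sphere 0 1) (\<lambda>x. b (fst x) (H (snd x)))" using HJ by fastforce
  show "joint_cont (sphere 0 1) b'" unfolding b'_def
  proof (rule continuous_on_compose2[OF G(1) c])
   show "(\<lambda>x. b (fst x) (H (snd x))) ` ({0..1} \<times> sphere 0 1) <= K"
   proof clarify
    fix t :: real and w :: complex assume "t \<in> {0..1}" "w \<in> sphere 0 1"
    thus "b (fst (t, w)) (H (snd (t, w))) \<in> K" using b(3)[of t] HJ[of w] JK(1) by auto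
   qed
  qed
  show "inj_on (b' t) (sphere 0 1)" if "t \<in> {0..1}" for t
  proof (rule inj_onI)
   fix x y assume xy: "x \<in> sphere 0 1" "y \<in> sphere 0 1" "b' t x = b' t y"
   have "b t (H x) \<in> K" "b t (H y) \<in> K" using HJ xy b(3)[OF that] JK by blast+
   hence "b t (H x) = b t (H y)" using inj_onD[OF G(2)] xy(3) by (simp add: b'_def)
   hence "H x = H y" using inj_onD[OF b(2)[OF that]] HJ xy by blast
   moreover have "G (H x) = x" "G (H y) = y" using GH xy(1,2) sub by blast+
   ultimately show "x = y" by metis
  qed
  show "b' t ` sphere 0 1 = sphere 0 1" if "t \<in> {0..1}" for t
  proof -
   have "b' t ` sphere 0 1 = G ` b t ` H ` sphere 0 1" by (simp add: b'_def image_image)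
   thus ?thesis by (simp only: Him b(3)[OF that] G(4))
  qed
  show "b' 0 z = z" if "z \<in> sphere 0 1" for z using b(4)[OF HJ[OF that]] GH[of z] that by (simp add: b'_def)
  show "b' 1 z = a' z" if "z \<in> sphere 0 1" for z using b(5)[OF HJ[OF that]] by (simp add: b'_def a'_def)
 qed
 note al = alexander_isotopy[OF a' b', simplified simp_thms implies_True_equals triv_forall_equality True_implies_equals]
 define A where "A = (\<lambda>t z. H (alexander b' a' t (G z)))"
 show thesis
 proof
  have "continuous_on ({0..1} \<times> K) (\<lambda>x. (fst x, G (snd x)))"
   by (intro continuous_intros continuous_on_compose2[OF G(1)]) auto
  from continuous_on_compose2[OF al(1) this]
  have c: "continuous_on ({0..1} \<times> K) (\<lambda>x. alexander b' a' (fst x) (G (snd x)))" using Gcb by fastforce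
  show "joint_cont K A" unfolding A_def
  proof (rule continuous_on_compose2[OF H c])
   show "(\<lambda>x. alexander b' a' (fst x) (G (snd x))) ` ({0..1} \<times> K) <= cball 0 1"
   proof clarify
    fix t :: real and w :: complex assume "t \<in> {0..1}" "w \<in> K"
    hence "alexander b' a' t (G w) \<in> alexander b' a' t ` cball 0 1" by (intro imageI Gcb)
    thus "alexander b' a' (fst (t, w)) (G (snd (t, w))) \<in> cball 0 1"
     by (simp only: al(3)[OF \<open>t \<in> {0..1}\<close>] fst_conv snd_conv)
   qed
  qed
  show "inj_on (A t) K" if "t \<in> {0..1}" for t
  proof (rule inj_onI)
   fix x y assume xy: "x \<in> K" "y \<in> K" "A t x = A t y"
   have "alexander b' a' t (G x) \<in> cball 0 1" "alexander b' a' t (G y) \<in> cball 0 1"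
    using al(3)[OF that] Gcb xy by blast+
   hence "alexander b' a' t (G x) = alexander b' a' t (G y)" using GH xy(3) by (metis A_def)
   hence "G x = G y" using inj_onD[OF al(2)[OF that]] Gcb xy by blast
   thus "x = y" using inj_onD[OF G(2)] xy by blast
  qed
  show "A t ` K = K" if "t \<in> {0..1}" for t
  proof -
   have "A t ` K = H ` alexander b' a' t ` G ` K" by (simp add: A_def image_image)
   thus ?thesis by (simp only: Him al(3)[OF that] G(3))
  qed
  show "A t z = b t z" if "t \<in> {0..1}" "z \<in> J" for t z
  proof -
   have "A t z = H (G (b t z))" using al(4)[OF that(1) Gsph[OF that(2)]] HG[of z] that(2) JK(1)
    by (auto simp: A_def b'_def)
   moreover have "b t z \<in> K" using b(3)[OF that(1)] that(2) JK(1) by blast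
   ultimately show ?thesis using HG by simp
  qed
  show "A 0 z = z" if "z \<in> K" for z using al(5)[OF Gcb[OF that]] HG[OF that] by (simp add: A_def)
  show "A 1 z = a z" if "z \<in> K" for z
  proof -
   have "a z \<in> K" using a(3) that by blast
   thus ?thesis using al(6)[OF Gcb[OF that]] HG that by (simp add: A_def a'_def)
  qed
  show "A t o1 = o1" if "t \<in> {0..1}" "a o1 = o1" for t
  proof -
   have "H 0 = o1" using HG[OF JK(2)] G(5) by simp
   hence "a' 0 = 0" using that(2) G(5) by (simp add: a'_def)
   thus ?thesis using al(7)[OF that(1)] G(5) \<open>H 0 = o1\<close> by (simp add: A_def)
  qed
 qed
qed


section \<open>Isotopies of the plane and braid homeomorphisms\<close>

text \<open>The loops \<open>H t (circle) - H t z\<close> avoid 0 because \<open>H t\<close> is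
  injective, so they are homotopic in the punctured plane and have the same winding number about
  0.\<close>

lemma orientation_preserving_isotopy:
 fixes H :: "real => complex => complex"
 assumes cont: "joint_cont UNIV H"
  and inj: "\<And>t. t \<in> {0..1} ==> inj (H t)" and op: "orientation_preserving (H 0)" and s: "s \<in> {0..1}"
 shows "orientation_preserving (H s)"
 unfolding orientation_preserving_def
proof (intro allI impI)
 fix z :: complex and r :: real assume r: "r > 0"
 define q where "q = (\<lambda>t u. H t (circlepath z r u) - H t z)"
 have wn: "winding_number (H t \<circ> circlepath z r) (H t z) = winding_number (q t) 0" for t
  by (subst winding_number_offset) (simp add: q_def o_def)
 have "homotopic_loops (- {0}) (q 0) (q s)"
  unfolding homotopic_loops
 proof (intro exI[of _ "\<lambda>x. q (s * fst x) (snd x)"] conjI ballI)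
  have cc: "continuous_on UNIV (circlepath z r)" unfolding circlepath_def part_circlepath_def
   by (intro continuous_intros) 
  have c1: "continuous_on ({0..1} \<times> {0..1}) (\<lambda>x. (s * fst x, circlepath z r (snd x)))"
   by (intro continuous_intros continuous_on_compose2[OF cc]) auto
  have c2: "continuous_on ({0..1} \<times> {0..1::real}) (\<lambda>x. (s * fst x, z))" by (intro continuous_intros)
  have st: "s * t \<in> {0..1}" if "t \<in> {0..1}" for t using s that by (auto simp: mult_le_one)
  have "continuous_on ({0..1} \<times> {0..1}) (\<lambda>x. H (s * fst x) (circlepath z r (snd x)))"
   using continuous_on_compose2[OF cont c1] st by fastforce
  moreover have "continuous_on ({0..1} \<times> {0..1::real}) (\<lambda>x. H (s * fst x) z)"
   using continuous_on_compose2[OF cont c2] st by fastforce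
  ultimately show "continuous_on ({0..1} \<times> {0..1}) (\<lambda>x. q (s * fst x) (snd x))"
   unfolding q_def by (rule continuous_on_diff)
  have "circlepath z r u ~= z" for u using r by (simp add: circlepath)
  thus "(\<lambda>x. q (s * fst x) (snd x)) \<in> {0..1} \<times> {0..1} \<rightarrow> - {0}"
   using inj st by (auto simp: q_def Pi_iff) (metis injD)
 qed (auto simp: pathfinish_def pathstart_def q_def circlepath)
 hence "winding_number (q 0) 0 = winding_number (q s) 0" by (rule winding_number_homotopic_loops)
 thus "winding_number (H s \<circ> circlepath z r) (H s z) = 1"
 proof -
  have "winding_number (H 0 \<circ> circlepath z r) (H 0 z) = 1"
   using op r unfolding orientation_preserving_def by blast
  thus ?thesis using \<open>winding_number (q 0) 0 = winding_number (q s) 0\<close> by (simp only: wn)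
 qed
qed

text \<open>Two properties of the intermediate maps come for free: the inverse is continuous by
  invariance of domain, and orientation is inherited from \<open>H 0\<close>.\<close>

lemma braid_isotopyI:
 fixes H :: "real => complex => complex"
 assumes cont: "joint_cont UNIV H"
  and inj: "\<And>t. t \<in> {0..1} ==> inj (H t)" and surj: "\<And>t. t \<in> {0..1} ==> surj (H t)"
  and H0: "H 0 \<in> braid_homeos n p"
  and P: "\<And>t. t \<in> {0..1} ==> H t ` punctures n p = punctures n p"
  and C: "\<And>t. t \<in> {0..1} ==> H t ` sphere 0 1 = sphere 0 1"
  and pm: "\<And>t. t \<in> {0..1} ==> H t 1 = 1" "\<And>t. t \<in> {0..1} ==> H t (-1) = -1"
 shows "(H 0, H 1) \<in> braid_isotopy n p"
proof -
 have mem: "H t \<in> braid_homeos n p" if t: "t \<in> {0..1}" for t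
 proof -
  have c: "continuous_on UNIV (H t)"
   using continuous_on_compose2[OF cont, of UNIV "\<lambda>z. (t, z)"] t by (simp add: continuous_on_Pair image_subset_iff)
  obtain g where "homeomorphism UNIV (range (H t)) (H t) g"
   using invariance_of_domain_homeomorphism[OF open_UNIV c _ inj[OF t]] by auto
  hence "homeomorphism UNIV UNIV (H t) g" using surj[OF t] by simp
  moreover have "orientation_preserving (H t)"
   by (rule orientation_preserving_isotopy[OF cont inj _ t]) (use H0 in \<open>simp_all add: braid_homeos_def\<close>)
  ultimately show ?thesis using P[OF t] C[OF t] pm[OF t] unfolding braid_homeos_def mem_Collect_eq by (intro conjI exI)
 qed
 have "homotopic_with_canon (\<lambda>f. f \<in> braid_homeos n p) UNIV UNIV (H 0) (H 1)"
  unfolding homotopic_with_def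
 proof (intro exI[of _ "\<lambda>x. H (fst x) (snd x)"] conjI ballI)
  have "prod_topology (top_of_set {0..1::real}) (top_of_set (UNIV :: complex set)) = top_of_set ({0..1} \<times> UNIV)"
   by (simp only: subtopology_Times[symmetric] prod_topology_euclidean)
  thus "continuous_map (prod_topology (top_of_set {0..1}) (top_of_set UNIV)) (top_of_set UNIV) (\<lambda>x. H (fst x) (snd x))"
   using cont by simp
 qed (use mem in auto)
 thus ?thesis by (simp add: braid_isotopy_def)
qed

lemma bhD:
 assumes "h \<in> braid_homeos n p"
 shows "continuous_on S h" "inj_on h S" "surj h" "h ` punctures n p = punctures n p" "h ` sphere 0 1 = sphere 0 1"
  "h 1 = 1" "h (-1) = -1" "orientation_preserving h"
proof -
 have h: "(\<exists>g. homeomorphism UNIV UNIV h g) & orientation_preserving h &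
    h ` punctures n p = punctures n p & h ` sphere 0 1 = sphere 0 1 & h 1 = 1 & h (-1) = -1"
  using assms unfolding braid_homeos_def by (rule CollectD)
 then obtain g where "homeomorphism UNIV UNIV h g" by (elim conjE exE)
 hence g: "continuous_on UNIV h" "range h = UNIV" "\<And>x. g (h x) = x" unfolding homeomorphism_def by simp_all
 show "continuous_on S h" using g(1) by (rule continuous_on_subset) simp
 show "inj_on h S" by (rule inj_on_inverseI[where g = g]) (rule g(3))
 show "surj h" by (rule g(2))
 show "h ` punctures n p = punctures n p" "h ` sphere 0 1 = sphere 0 1"
  "h 1 = 1" "h (-1) = -1" "orientation_preserving h"
  using h by simp_all
qed

text \<open>The images of the open disc and of the exterior are connected and avoid the circle. The
  exterior goes to the exterior, since otherwise the range would be bounded; then the disc goes to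
  the disc, as some point has to be mapped to 0.\<close>

lemma bh_norm:
 assumes h: "h \<in> braid_homeos n p"
 shows "norm (h z) < 1 \<longleftrightarrow> norm z < 1" "norm (h z) = 1 \<longleftrightarrow> norm z = 1" "norm (h z) <= 1 \<longleftrightarrow> norm z <= 1"
proof -
 note hD = bhD[OF h]
 show sph: "norm (h z) = 1 \<longleftrightarrow> norm z = 1" for z
 proof
  assume "norm (h z) = 1"
  hence "h z \<in> h ` sphere 0 1" unfolding hD(5) by simp
  then obtain y where "norm y = 1" "h z = h y" by auto
  thus "norm z = 1" using injD[OF hD(2)] by metis
 next
  assume "norm z = 1" thus "norm (h z) = 1" using hD(5) by (metis imageI mem_sphere_0)
 qed
 have split: "S <= ball 0 1 \<or> S <= - cball 0 1" if "connected S" "S \<inter> sphere 0 1 = {}" for S :: "complex set"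
 proof (rule ccontr)
  assume "\<not> ?thesis"
  then obtain x y where xy: "x \<in> S" "x \<notin> ball 0 1" "y \<in> S" "y \<in> cball 0 1" by blast
  have "y \<notin> sphere 0 1" using xy(3) that(2) by blast
  hence "y \<in> ball 0 1" using xy(4) by (simp add: less_le)
  hence "S \<inter> ball 0 1 ~= {}" "S - ball 0 1 ~= {}" using xy by blast+
  hence "S \<inter> frontier (ball 0 1) ~= {}" using connected_Int_frontier[OF that(1)] by blast
  thus False using that(2) by simp
 qed
 have con: "connected (- cball (0::complex) 1)"
  by (rule connected_complement_bounded_convex) auto
 have B: "h ` ball 0 1 <= ball 0 1 \<or> h ` ball 0 1 <= - cball 0 1"
 proof (rule split)
  show "connected (h ` ball 0 1)" by (intro connected_continuous_image hD(1) convex_connected convex_ball)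
  show "h ` ball 0 1 \<inter> sphere 0 1 = {}" using sph by force
 qed
 have E: "h ` (- cball 0 1) <= ball 0 1 \<or> h ` (- cball 0 1) <= - cball 0 1"
 proof (rule split)
  show "connected (h ` (- cball 0 1))" by (intro connected_continuous_image hD(1) con)
  show "h ` (- cball 0 1) \<inter> sphere 0 1 = {}" using sph by force
 qed
 have "compact (h ` cball 0 1)" by (intro compact_continuous_image hD(1)) auto
 hence bdd: "bounded (h ` cball 0 1)" by (rule compact_imp_bounded)
 have unb: "\<not> bounded (- cball (0::complex) 1)" by (simp add: cobounded_imp_unbounded)
 have E2: "h ` (- cball 0 1) <= - cball 0 1"
 proof (rule ccontr)
  assume "\<not> ?thesis"
  hence "h ` (- cball 0 1) <= ball 0 1" using E by blast
  hence "bounded (h ` (- cball 0 1))" by (rule bounded_subset[OF bounded_ball])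
  hence "bounded (h ` (- cball 0 1) Un h ` cball 0 1)" using bdd by simp
  moreover have "h ` (- cball 0 1) Un h ` cball 0 1 = range h" by blast
  ultimately show False using hD(3) not_bounded_UNIV by metis
 qed
 have B2: "h ` ball 0 1 <= ball 0 1"
 proof (rule ccontr)
  assume "\<not> ?thesis"
  hence B3: "h ` ball 0 1 <= - cball 0 1" using B by blast
  obtain z where z: "0 = h z" using surjD[OF hD(3)] by blast
  consider "norm z < 1" | "norm z = 1" | "norm z > 1" by linarith
  thus False
  proof cases
   case 1
   hence "h z \<in> - cball 0 1" using B3 by (simp add: image_subset_iff)
   thus False using z[symmetric] by simp
  next
   case 2 thus False using sph[of z] z[symmetric] by simp
  next
   case 3
   hence "h z \<in> - cball 0 1" using E2 by (simp add: image_subset_iff)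
   thus False using z[symmetric] by simp
  qed
 qed
 show "norm (h z) < 1 \<longleftrightarrow> norm z < 1"
 proof
  assume "norm z < 1" thus "norm (h z) < 1" using B2 by (simp add: image_subset_iff)
 next
  assume "norm (h z) < 1"
  moreover from this have "norm z ~= 1" using sph[of z] by auto
  moreover have "\<not> norm z > 1"
  proof
   assume "norm z > 1"
   hence "h z \<in> - cball 0 1" using E2 by (simp add: image_subset_iff)
   thus False using calculation(1) by simp
  qed
  ultimately show "norm z < 1" by linarith
 qed
 thus "norm (h z) <= 1 \<longleftrightarrow> norm z <= 1" using sph[of z] by (auto simp: less_eq_real_def)
qed

lemma bh_inv:
 assumes h: "h \<in> braid_homeos n p"
 shows "inv h (h z) = z" "h (inv h w) = w" "continuous_on S (inv h)" "inj_on (inv h) S"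
proof -
 note hD = bhD[OF h]
 show 1: "inv h (h z) = z" for z by (rule inv_f_f[OF hD(2)])
 show 2: "h (inv h w) = w" for w by (rule surj_f_inv_f[OF hD(3)])
 show "inj_on (inv h) S" by (rule inj_on_inverseI[where g = h]) (rule 2)
 obtain g where g: "homeomorphism UNIV UNIV h g" using h unfolding braid_homeos_def by blast
 have "inv h = g"
 proof
  fix w
  have "h (g w) = w" using g unfolding homeomorphism_def by simp
  thus "inv h w = g w" using 1[of "g w"] by simp
 qed
 hence "continuous_on UNIV (inv h)" using g unfolding homeomorphism_def by simp
 thus "continuous_on S (inv h)" by (rule continuous_on_subset) simp
qed

lemma braid_homeo_cball:
 assumes h: "h \<in> braid_homeos n p"
 shows "h ` cball 0 1 = cball 0 1"
proof (intro equalityI subsetI)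
 fix w :: complex assume "w \<in> cball 0 1"
 hence "norm (h (inv h w)) <= 1" by (simp add: bh_inv(2)[OF h])
 hence "inv h w \<in> cball 0 1" using bh_norm(3)[OF h] by simp
 thus "w \<in> h ` cball 0 1" using bh_inv(2)[OF h] by (metis imageI)
next
 fix w assume "w \<in> h ` cball 0 1"
 then obtain z where "w = h z" "norm z <= 1" by auto
 thus "w \<in> cball 0 1" using bh_norm(3)[OF h, of z] by simp
qed

text \<open>Keeps \<open>k\<close> on the closed disc and continues its values on the circle
  homogeneously to the outside, so that the restriction to the disc determines everything.\<close>

definition radial :: "(complex => complex) => complex => complex" where
 "radial k z = (if norm z <= 1 then k z else norm z *\<^sub>R k (sgn z))"

lemma radial_isotopy:
 fixes k :: "real => complex => complex"
 assumes cont: "joint_cont (cball 0 1) k"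
  and inj: "\<And>t. t \<in> {0..1} ==> inj_on (k t) (cball 0 1)"
  and im: "\<And>t. t \<in> {0..1} ==> k t ` cball 0 1 = cball 0 1"
  and C: "\<And>t. t \<in> {0..1} ==> k t ` sphere 0 1 = sphere 0 1"
 shows "continuous_on ({0..1} \<times> UNIV) (\<lambda>x. radial (k (fst x)) (snd x))"
  "\<And>t. t \<in> {0..1} ==> inj (radial (k t))" "\<And>t. t \<in> {0..1} ==> surj (radial (k t))"
  "\<And>t z. t \<in> {0..1} ==> norm z \<ge> 1 ==> norm (radial (k t) z) = norm z"
proof -
 let ?E = "\<lambda>t z. norm z *\<^sub>R k t (sgn z)"
 have out: "radial (k t) z = ?E t z" if "norm z \<ge> 1" for t z
  using that by (auto simp: radial_def sgn_div_norm)
 have sub: "sphere (0::complex) 1 <= cball 0 1" by auto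
 have nk: "norm (k t z) = 1" if "t \<in> {0..1}" "norm z = 1" for t z using C[OF that(1)] that(2) by (metis imageI mem_sphere_0)
 have Un: "{0..1} \<times> (UNIV :: complex set) = ({0..1} \<times> cball 0 1) Un ({0..1} \<times> {z. 1 <= norm z})" by auto
 show "continuous_on ({0..1} \<times> UNIV) (\<lambda>x. radial (k (fst x)) (snd x))" unfolding Un
 proof (rule continuous_on_closed_Un)
  have "closed {z::complex. 1 <= norm z}" by (intro closed_Collect_le continuous_intros)
  thus "closed ({0..1::real} \<times> cball (0::complex) 1)" "closed ({0..1::real} \<times> {z::complex. 1 <= norm z})"
   by (auto intro: closed_Times)
  show "continuous_on ({0..1} \<times> cball 0 1) (\<lambda>x. radial (k (fst x)) (snd x))"
   using cont by (rule continuous_on_eq) (auto simp: radial_def)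
  have "continuous_on ({0..1} \<times> UNIV) (\<lambda>x. ?E (fst x) (snd x))"
   by (rule cone_continuous) (use nk in \<open>auto intro!: continuous_on_subset[OF cont]\<close>)
  hence "continuous_on ({0..1} \<times> {z. 1 <= norm z}) (\<lambda>x. ?E (fst x) (snd x))"
   by (rule continuous_on_subset) auto
  thus "continuous_on ({0..1} \<times> {z. 1 <= norm z}) (\<lambda>x. radial (k (fst x)) (snd x))"
   by (rule continuous_on_eq) (auto simp: out)
 qed
 fix t :: real assume t: "t \<in> {0..1}"
 note cb = cone_bij[OF inj_on_subset[OF inj[OF t] sub] C[OF t]]
 show nE: "norm (radial (k t) z) = norm z" if "norm z \<ge> 1" for z using out[OF that] cb(1)[of z] by simp
 have kin: "norm (k t z) <= 1" if "norm z <= 1" for z using im[OF t] that by (metis imageI mem_cball_0)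
 show "inj (radial (k t))"
 proof (rule injI)
  fix x y assume eq: "radial (k t) x = radial (k t) y"
  have mix: False if "norm x <= 1" "norm y > 1" "radial (k t) x = radial (k t) y" for x y
   using nE[of y] kin[of x] that by (auto simp: radial_def)
  consider "norm x <= 1" "norm y <= 1" | "norm x > 1" "norm y > 1" | "norm x <= 1" "norm y > 1" | "norm x > 1" "norm y <= 1"
   by linarith
  thus "x = y"
  proof cases
   case 1 thus ?thesis using inj_onD[OF inj[OF t], of x y] eq by (simp add: radial_def)
  next
   case 2 thus ?thesis using injD[OF cb(2), of x y] eq out by simp
  qed (use mix eq in \<open>metis+\<close>)
 qed
 have "\<exists>z. w = radial (k t) z" for w
 proof (cases "norm w <= 1")
  case True
  hence "w \<in> k t ` cball 0 1" using im[OF t] by simp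
  then obtain z where "norm z <= 1" "w = k t z" by auto
  thus ?thesis by (intro exI[of _ z]) (simp add: radial_def)
 next
  case False
  obtain z where z: "w = ?E t z" using surjD[OF cb(4), of w] by blast
  hence "norm w = norm z" using cb(1)[of z] by (simp only:)
  hence "norm z \<ge> 1" using False by simp
  thus ?thesis using out[of z t] z by (intro exI[of _ z]) simp
 qed
 thus "surj (radial (k t))" unfolding surj_def by blast
qed

lemma punctures_in_ball:
 assumes "valid_punctures n p" "z \<in> punctures n p"
 shows "norm z < 1"
proof -
 obtain j where j: "j \<in> {1..n}" "z = complex_of_real (p j)" using assms(2) by (auto simp: punctures_def)
 hence "p j \<in> {-1<..<1}" using assms(1) unfolding valid_punctures_def by blast
 thus ?thesis using j by (simp add: abs_less_iff)
qed

text \<open>Alexander's trick from outside: \<open>h\<^sup>-\<^sup>1 \<circ> radial h\<close> is the identity on the closed disc.\<close>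

lemma isotopic_radial:
 assumes v: "valid_punctures n p" and h: "h \<in> braid_homeos n p"
 shows "(h, radial h) \<in> braid_isotopy n p"
proof -
 note hD = bhD[OF h] and hi = bh_inv[OF h]
 have "continuous_on ({0..1} \<times> cball 0 1) (\<lambda>x. h (snd x))"
  by (intro continuous_on_compose2[OF hD(1)[of UNIV]] continuous_intros) auto
 note rad = radial_isotopy[of "\<lambda>_. h", OF this hD(2) braid_homeo_cball[OF h] hD(5)]
 define g where "g = (\<lambda>z. inv h (radial h z))"
 have "continuous_on UNIV (\<lambda>z::complex. (0::real, z))" by (intro continuous_intros)
 hence "continuous_on UNIV (\<lambda>z. radial h (snd (0::real, z)))" by (rule continuous_on_compose2[OF rad(1)]) auto
 hence gc: "continuous_on UNIV g" unfolding g_def by (intro continuous_on_compose2[OF hi(3)[of UNIV]]) simp_all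
 have hg: "h (g z) = radial h z" for z unfolding g_def by (rule hi(2))
 have gid: "g z = z" if "norm z <= 1" for z using that by (simp add: g_def radial_def hi(1))
 have gi: "g x = g y \<longleftrightarrow> x = y" for x y using hg injD[OF rad(2)[of 0]] by (metis atLeastAtMost_iff order_refl zero_le_one)
 have gs: "\<exists>x. y = g x" for y
 proof -
  obtain x where "h y = radial h x" using surjD[OF rad(3)[of 0], of "h y"] by auto
  hence "g x = inv h (h y)" by (simp add: g_def)
  thus ?thesis using hi(1) by metis
 qed
 \<comment> \<open>The map \<open>g\<close>, conjugated by the scaling with \<open>t\<close>. Since
   \<open>g\<close> is the identity on the disc, \<open>A t\<close> is the identity on
   \<open>norm z <= 1 / t\<close>; hence the continuity at \<open>t = 0\<close>, where it becomes
   the identity of the plane.\<close>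
 define A where "A = (\<lambda>t z. if t * norm z <= 1 then z else g (t *\<^sub>R z) /\<^sub>R t)"
 have A: "A t z = g (t *\<^sub>R z) /\<^sub>R t" if "0 < t" for t z using that gid[of "t *\<^sub>R z"] by (simp add: A_def)
 have Ain: "A t z = z" if "t \<in> {0..1}" "norm z <= 1" for t z using that mult_le_one[of t "norm z"] by (simp add: A_def)
 have "joint_cont UNIV A"
 proof -
  define T where "T = (\<lambda>S::real set. {0..1::real} \<times> (UNIV::complex set) \<inter> {x. fst x * norm (snd x) \<in> S})"
  have S: "{0..1} \<times> (UNIV::complex set) = T {..1} Un T {1..}" by (auto simp: T_def)
  have "closed {x. fst x * norm (snd x::complex) \<in> S}" if "closed S" for S :: "real set"
   using closed_vimage[OF that, of "\<lambda>x. fst x * norm (snd x::complex)"] by (simp add: vimage_def continuous_intros)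
  hence cl: "closed (T S)" if "closed S" for S using that unfolding T_def by (intro closed_Int closed_Times) auto
  show ?thesis unfolding S
  proof (rule continuous_on_closed_Un)
   show "continuous_on (T {..1}) (\<lambda>x. A (fst x) (snd x))"
    by (rule continuous_on_eq[OF continuous_on_snd[OF continuous_on_id]]) (auto simp: T_def A_def)
   have "continuous_on (T {1..}) (\<lambda>x. g (fst x *\<^sub>R snd x) /\<^sub>R fst x)"
    by (intro continuous_intros continuous_on_compose2[OF gc]) (auto simp: T_def)
   thus "continuous_on (T {1..}) (\<lambda>x. A (fst x) (snd x))"
    by (rule continuous_on_eq) (auto simp: T_def intro!: A[symmetric] simp: zero_less_mult_iff dest: less_le_trans[OF zero_less_one])
  qed (simp_all add: cl)
 qed
 hence cont: "continuous_on ({0..1} \<times> UNIV) (\<lambda>x. h (A (fst x) (snd x)))"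
  by (rule continuous_on_compose2[OF hD(1)[of UNIV]]) simp
 have Q: "h (A 0 z) = h z" "h (A 1 z) = radial h z" for z using A[of 1 z] by (simp_all add: A_def hg)
 have "((\<lambda>t z. h (A t z)) 0, (\<lambda>t z. h (A t z)) 1) \<in> braid_isotopy n p"
 proof (rule braid_isotopyI)
  show "(\<lambda>z. h (A 0 z)) \<in> braid_homeos n p" using h Q(1) by simp
  fix t :: real assume t: "t \<in> {0..1}"
  have bij: "inj (A t) & surj (A t)"
  proof (cases "t = 0")
   case True
   hence "A t = id" by (simp add: A_def fun_eq_iff)
   thus ?thesis by simp
  next
   case False
   hence t0: "0 < t" using t by simp
   have "\<exists>x. y = A t x" for y
   proof -
    obtain x where "t *\<^sub>R y = g x" using gs by blast
    thus ?thesis using t0 A[OF t0, of "x /\<^sub>R t"] by (intro exI[of _ "x /\<^sub>R t"]) (metis inverse_nonzero_iff_nonzero less_irrefl scaleR_left_imp_eq scaleR_one scaleR_scaleR right_inverse left_inverse)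
   qed
   thus ?thesis using t0 by (auto simp: inj_def surj_def A gi)
  qed
  show "inj (\<lambda>z. h (A t z))" using inj_compose[OF hD(2) conjunct1[OF bij]] by (simp add: o_def)
  show "surj (\<lambda>z. h (A t z))" using comp_surj[OF conjunct2[OF bij] hD(3)] by (simp add: o_def)
  have im: "(\<lambda>z. h (A t z)) ` S = h ` S" if "\<And>z. z \<in> S ==> norm z <= 1" for S
   by (rule image_cong[OF refl]) (simp add: Ain[OF t that])
  show "(\<lambda>z. h (A t z)) ` punctures n p = punctures n p" using im[of "punctures n p"] punctures_in_ball[OF v] hD(4) by (simp add: less_imp_le)
  show "(\<lambda>z. h (A t z)) ` sphere 0 1 = sphere 0 1" using im[of "sphere 0 1"] hD(5) by simp
  show "h (A t 1) = 1" "h (A t (-1)) = -1" using Ain[OF t, of 1] Ain[OF t, of "-1"] hD(6,7) by simp_all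
 qed (use cont in simp)
 thus ?thesis using Q by simp
qed

lemma radial_cong: "(\<And>z. norm z <= 1 ==> k z = k' z) ==> radial k = radial k'"
proof (rule ext)
 fix z assume k: "\<And>z. norm z <= 1 ==> k z = k' z"
 show "radial k z = radial k' z"
  using k[of z] k[of "sgn z"] by (simp add: radial_def norm_sgn)
qed

text \<open>Reduces isotopies of the plane to isotopies of the closed disc: \<open>h\<close> is
  first replaced by its radial version, after which the disc isotopy is continued radially at each
  time.\<close>

lemma disc_isotopy:
 fixes k :: "real => complex => complex"
 assumes v: "valid_punctures n p" and h: "h \<in> braid_homeos n p"
  and cont: "joint_cont (cball 0 1) k"
  and inj: "\<And>t. t \<in> {0..1} ==> inj_on (k t) (cball 0 1)"
  and im: "\<And>t. t \<in> {0..1} ==> k t ` cball 0 1 = cball 0 1"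
  and C: "\<And>t. t \<in> {0..1} ==> k t ` sphere 0 1 = sphere 0 1"
  and P: "\<And>t. t \<in> {0..1} ==> k t ` punctures n p = punctures n p"
  and pm: "\<And>t. t \<in> {0..1} ==> k t 1 = 1" "\<And>t. t \<in> {0..1} ==> k t (-1) = -1"
  and k0: "\<And>z. norm z <= 1 ==> k 0 z = h z"
 shows "(h, radial (k 1)) \<in> braid_isotopy n p"
proof -
 have "radial (k 0) = radial h" using k0 by (rule radial_cong)
 hence 1: "(h, radial (k 0)) \<in> braid_isotopy n p" using isotopic_radial[OF v h] by simp
 hence r0: "radial (k 0) \<in> braid_homeos n p"
  using equiv_braid_isotopy[of n p] unfolding equiv_def refl_on_def by blast
 have Pc: "punctures n p <= cball 0 1" using punctures_in_ball[OF v] by (force simp: less_imp_le)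
 have rim: "radial (k t) ` S = k t ` S" if "S <= cball 0 1" for S t
  using that by (intro image_cong) (auto simp: radial_def)
 note rad = radial_isotopy[OF cont inj im C, simplified simp_thms implies_True_equals triv_forall_equality True_implies_equals]
 have "((\<lambda>t. radial (k t)) 0, (\<lambda>t. radial (k t)) 1) \<in> braid_isotopy n p"
 proof (rule braid_isotopyI[of "\<lambda>t. radial (k t)"])
  fix t :: real assume t: "t \<in> {0..1}"
  show "inj (radial (k t))" "surj (radial (k t))" using rad(2,3)[OF t] .
  show "radial (k t) ` punctures n p = punctures n p" using rim[OF Pc] P[OF t] by simp
  show "radial (k t) ` sphere 0 1 = sphere 0 1" using rim[of "sphere 0 1"] C[OF t] by auto
  show "radial (k t) 1 = 1" "radial (k t) (-1) = -1" using pm[OF t] by (auto simp: radial_def)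
 qed (use rad(1) r0 in simp_all)
 thus ?thesis using 1 equiv_braid_isotopy[of n p] unfolding equiv_def trans_def by blast
qed

section \<open>Convex cells and isotopies cell by cell\<close>

text \<open>A compact convex body is homeomorphic to the disc, and by invariance of domain interior
  corresponds to interior, so the frontier corresponds to the circle. The half-discs and the parts
  of the strips in the disc are Jordan domains for this reason.\<close>

lemma convex_Jordan:
 fixes S :: "complex set"
 assumes S: "compact S" "convex S" "interior S ~= {}"
 shows "Jordan (frontier S)" "inside (frontier S) = interior S" "frontier S Un inside (frontier S) = S"
proof -
 have "S homeomorphic cball (0::complex) 1"
  using homeomorphic_convex_compact_cball[OF S(2,1,3), of 1 0] by simp
 hence "cball (0::complex) 1 homeomorphic S" by (rule homeomorphic_sym[THEN iffD1])
 then obtain f g where fg: "homeomorphism (cball (0::complex) 1) S f g" unfolding homeomorphic_def by blast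
 have f: "continuous_on (cball 0 1) f" "f ` cball 0 1 = S" "\<And>x. x \<in> cball 0 1 ==> g (f x) = x"
  and g: "continuous_on S g" "g ` S = cball 0 1" "\<And>y. y \<in> S ==> f (g y) = y"
  using fg unfolding homeomorphism_def by blast+
 have fi: "inj_on f (cball 0 1)" by (rule inj_on_inverseI[where g = g]) (rule f(3))
 have gi: "inj_on g S" by (rule inj_on_inverseI[where g = f]) (rule g(3))
 have sub: "ball (0::complex) 1 <= cball 0 1" "sphere (0::complex) 1 <= cball 0 1" by auto
 have "open (f ` ball 0 1)"
  by (rule invariance_of_domain[OF continuous_on_subset[OF f(1) sub(1)] open_ball inj_on_subset[OF fi sub(1)]])
 hence 1: "f ` ball 0 1 <= interior S" using f(2) sub(1) by (intro interior_maximal) auto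
 have "open (g ` interior S)"
  by (rule invariance_of_domain[OF continuous_on_subset[OF g(1) interior_subset] open_interior inj_on_subset[OF gi interior_subset]])
 moreover have "g ` interior S <= cball 0 1" using g(2) interior_subset[of S] by blast
 ultimately have "g ` interior S <= interior (cball 0 1)" by (intro interior_maximal)
 hence 2: "g ` interior S <= ball 0 1" by simp
 have fr: "frontier S = S - interior S" using S(1) by (simp add: frontier_def compact_imp_closed closure_closed)
 have sph: "f ` sphere 0 1 = frontier S"
 proof (intro equalityI subsetI)
  fix y assume "y \<in> f ` sphere 0 1"
  then obtain x where x: "x \<in> sphere 0 1" "y = f x" by blast
  have "y \<in> S" using f(2) x sub(2) by blast
  moreover have "y \<notin> interior S"
  proof
   assume "y \<in> interior S"
   hence "g y \<in> ball 0 1" using 2 by blast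
   moreover have "g y = x" using f(3)[of x] x sub(2) by blast
   ultimately show False using x(1) by simp
  qed
  ultimately show "y \<in> frontier S" unfolding fr by blast
 next
  fix y assume "y \<in> frontier S"
  hence y: "y \<in> S" "y \<notin> interior S" unfolding fr by auto
  have "g y \<in> cball 0 1" using g(2) y(1) by blast
  moreover have "g y \<notin> ball 0 1"
  proof
   assume "g y \<in> ball 0 1"
   hence "f (g y) \<in> interior S" using 1 by blast
   thus False using g(3) y by simp
  qed
  ultimately have "g y \<in> sphere 0 1" by simp
  thus "y \<in> f ` sphere 0 1" using g(3)[OF y(1)] by (metis imageI)
 qed
 have "Jordan (sphere (0::complex) 1)" unfolding Jordan_def
  by (intro exI[of _ "circlepath 0 1"]) (simp add: simple_path_circlepath)
 thus "Jordan (frontier S)" unfolding sph[symmetric]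
  by (rule Jordan_image) (use continuous_on_subset[OF f(1) sub(2)] inj_on_subset[OF fi sub(2)] in simp_all)
 show ins: "inside (frontier S) = interior S"
  by (rule inside_frontier_eq_interior) (use S compact_imp_bounded in auto)
 show "frontier S Un inside (frontier S) = S" by (simp only: ins) (use fr interior_subset[of S] in blast)
qed

text \<open>Cell-wise Alexander trick: a homeomorphism of the disc preserving the cells of a finite decomposition is isotopic
 to the identity as soon as its restriction to the 1-skeleton is.\<close>

lemma cell_isotopy:
 fixes J :: "'i => complex set" and a :: "complex => complex" and b :: "real => complex => complex"
 defines "K \<equiv> \<lambda>i. J i Un inside (J i)"
 assumes I: "finite I" and J: "\<And>i. i \<in> I ==> Jordan (J i)" and D: "(\<Union>i\<in>I. K i) = D"
  and disj: "\<And>i k. i \<in> I ==> k \<in> I ==> i ~= k ==> inside (J i) \<inter> K k = {}"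
  and a: "continuous_on D a" "inj_on a D" "\<And>i. i \<in> I ==> a ` K i = K i"
  and b: "joint_cont ((\<Union>i\<in>I. J i)) b"
   "\<And>t. t \<in> {0..1} ==> inj_on (b t) (\<Union>i\<in>I. J i)" "\<And>t i. t \<in> {0..1} ==> i \<in> I ==> b t ` J i = J i"
   "\<And>z. z \<in> (\<Union>i\<in>I. J i) ==> b 0 z = z" "\<And>z. z \<in> (\<Union>i\<in>I. J i) ==> b 1 z = a z"
  and c: "\<And>i. i \<in> I ==> c i \<in> inside (J i)"
 obtains A where "joint_cont D A"
  "\<And>t. t \<in> {0..1} ==> inj_on (A t) D" "\<And>t. t \<in> {0..1} ==> A t ` D = D"
  "\<And>t z. t \<in> {0..1} ==> z \<in> (\<Union>i\<in>I. J i) ==> A t z = b t z"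
  "\<And>z. z \<in> D ==> A 0 z = z" "\<And>z. z \<in> D ==> A 1 z = a z"
  "\<And>t i. t \<in> {0..1} ==> i \<in> I ==> a (c i) = c i ==> A t (c i) = c i"
proof -
 have KD: "K i <= D" if "i \<in> I" for i using D that by blast
 have JK: "J i <= K i" for i by (simp add: K_def)
 have JU: "J i <= (\<Union>i\<in>I. J i)" if "i \<in> I" for i using that by blast
 have "\<forall>i\<in>I. \<exists>A. joint_cont (K i) A &
  (\<forall>t\<in>{0..1}. inj_on (A t) (K i)) & (\<forall>t\<in>{0..1}. A t ` K i = K i) &
  (\<forall>t\<in>{0..1}. \<forall>z\<in>J i. A t z = b t z) & (\<forall>z\<in>K i. A 0 z = z) & (\<forall>z\<in>K i. A 1 z = a z) &
  (\<forall>t\<in>{0..1}. a (c i) = c i \<longrightarrow> A t (c i) = c i)"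
 proof
  fix i assume i: "i \<in> I"
  obtain A where "joint_cont ((J i Un inside (J i))) A"
   "\<And>t. t \<in> {0..1} ==> inj_on (A t) (J i Un inside (J i))" "\<And>t. t \<in> {0..1} ==> A t ` (J i Un inside (J i)) = (J i Un inside (J i))"
   "\<And>t z. t \<in> {0..1} ==> z \<in> J i ==> A t z = b t z"
   "\<And>z. z \<in> (J i Un inside (J i)) ==> A 0 z = z" "\<And>z. z \<in> (J i Un inside (J i)) ==> A 1 z = a z"
   "\<And>t. t \<in> {0..1} ==> a (c i) = c i ==> A t (c i) = c i"
  proof (rule Jordan_alexander[OF J[OF i] c[OF i], of a b])
   show "continuous_on (J i Un inside (J i)) a" "inj_on a (J i Un inside (J i))" "a ` (J i Un inside (J i)) = J i Un inside (J i)"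
    using continuous_on_subset[OF a(1) KD[OF i]] inj_on_subset[OF a(2) KD[OF i]] a(3)[OF i] by (simp_all only: K_def)
   show "joint_cont (J i) b"
    by (rule continuous_on_subset[OF b(1)]) (use i in auto)
   show "inj_on (b t) (J i)" if "t \<in> {0..1}" for t by (rule inj_on_subset[OF b(2)[OF that] JU[OF i]])
   show "b t ` J i = J i" if "t \<in> {0..1}" for t by (rule b(3)[OF that i])
   show "b 0 z = z" if "z \<in> J i" for z using b(4) JU[OF i] that by blast
   show "b 1 z = a z" if "z \<in> J i" for z using b(5) JU[OF i] that by blast
  qed blast
  thus "\<exists>A. joint_cont (K i) A &
  (\<forall>t\<in>{0..1}. inj_on (A t) (K i)) & (\<forall>t\<in>{0..1}. A t ` K i = K i) &
  (\<forall>t\<in>{0..1}. \<forall>z\<in>J i. A t z = b t z) & (\<forall>z\<in>K i. A 0 z = z) & (\<forall>z\<in>K i. A 1 z = a z) &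
  (\<forall>t\<in>{0..1}. a (c i) = c i \<longrightarrow> A t (c i) = c i)"
   unfolding K_def by (intro exI[of _ A] conjI ballI impI)
 qed
 from bchoice[OF this] obtain F where F: "\<forall>i\<in>I. continuous_on ({0..1} \<times> K i) (\<lambda>x. F i (fst x) (snd x)) &
  (\<forall>t\<in>{0..1}. inj_on (F i t) (K i)) & (\<forall>t\<in>{0..1}. F i t ` K i = K i) &
  (\<forall>t\<in>{0..1}. \<forall>z\<in>J i. F i t z = b t z) & (\<forall>z\<in>K i. F i 0 z = z) & (\<forall>z\<in>K i. F i 1 z = a z) &
  (\<forall>t\<in>{0..1}. a (c i) = c i \<longrightarrow> F i t (c i) = c i)" by (rule exE)
 have Fc: "continuous_on ({0..1} \<times> K i) (\<lambda>x. F i (fst x) (snd x))" if "i \<in> I" for i using F that by simp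
 have Fi: "inj_on (F i t) (K i)" "F i t ` K i = K i" if "i \<in> I" "t \<in> {0..1}" for i t using F that by simp_all
 have Fb: "F i t z = b t z" if "i \<in> I" "t \<in> {0..1}" "z \<in> J i" for i t z using F that by simp
 have F01: "F i 0 z = z" "F i 1 z = a z" if "i \<in> I" "z \<in> K i" for i z using F that by simp_all
 have Fcen: "F i t (c i) = c i" if "i \<in> I" "t \<in> {0..1}" "a (c i) = c i" for i t using F that by simp
 have ov: "z \<in> J i" if "i \<in> I" "k \<in> I" "i ~= k" "z \<in> K i" "z \<in> K k" for i k z
  using disj[OF that(1-3)] that(4,5) unfolding K_def by blast
 \<comment> \<open>The choice of the cell is immaterial: distinct cells overlap only along their
   boundary curves, where every \<open>F i t\<close> agrees with \<open>b t\<close>.\<close>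
 define A where "A = (\<lambda>t z. F (SOME i. i \<in> I & z \<in> K i) t z)"
 have AF: "A t z = F i t z" if "i \<in> I" "z \<in> K i" "t \<in> {0..1}" for i t z
 proof -
  define k where "k = (SOME i. i \<in> I & z \<in> K i)"
  have k: "k \<in> I" "z \<in> K k" unfolding k_def using someI[of "\<lambda>i. i \<in> I & z \<in> K i" i] that by auto
  show ?thesis
  proof (cases "k = i")
   case False
   have "z \<in> J i" "z \<in> J k" using ov[of i k z] ov[of k i z] k that False by simp_all
   thus ?thesis using Fb[OF that(1,3)] Fb[OF k(1) that(3)] by (simp add: A_def k_def)
  qed (simp add: A_def k_def)
 qed
 have inK: "\<exists>i\<in>I. z \<in> K i" if "z \<in> D" for z using that D by blast
 have Fin: "F i t z \<in> inside (J i)" if "i \<in> I" "t \<in> {0..1}" "z \<in> inside (J i)" for i t z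
 proof -
  have zK: "z \<in> K i" using that(3) by (simp add: K_def)
  hence "F i t z \<in> K i" using Fi(2)[OF that(1,2)] by blast
  moreover have "F i t z \<notin> J i"
  proof
   assume "F i t z \<in> J i"
   hence "F i t z \<in> b t ` J i" using b(3)[OF that(2,1)] by simp
   then obtain y where y: "y \<in> J i" "F i t z = b t y" by blast
   hence "F i t z = F i t y" using Fb[OF that(1,2)] by simp
   hence "z = y" using inj_onD[OF Fi(1)[OF that(1,2)]] zK y(1) JK[of i] by blast
   thus False using y(1) that(3) Jordan_facts(10)[OF J[OF that(1)]] by blast
  qed
  ultimately show ?thesis by (simp add: K_def)
 qed
 show thesis
 proof
  show bA: "A t z = b t z" if t: "t \<in> {0..1}" and z: "z \<in> (\<Union>i\<in>I. J i)" for t z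
  proof -
   obtain i where i: "i \<in> I" "z \<in> J i" using z by blast
   thus ?thesis using AF[OF i(1) _ t, of z] Fb[OF i(1) t i(2)] by (simp add: K_def)
  qed
  have "continuous_on (\<Union>i\<in>I. {0..1} \<times> K i) (\<lambda>x. A (fst x) (snd x))"
  proof (rule continuous_on_closed_Union[OF I])
   fix i assume i: "i \<in> I"
   have "closed (K i)" using Jordan_facts(9)[OF J[OF i]] by (simp add: K_def compact_imp_closed)
   thus "closed ({0..1::real} \<times> K i)" by (intro closed_Times closed_atLeastAtMost)
   show "joint_cont (K i) A"
    using Fc[OF i] by (rule continuous_on_eq) (use AF[OF i] in \<open>simp add: mem_Times_iff\<close>)
  qed
  moreover have "(\<Union>i\<in>I. {0..1::real} \<times> K i) = {0..1} \<times> D" using D by blast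
  ultimately show "joint_cont D A" by simp
  show "inj_on (A t) D" if t: "t \<in> {0..1}" for t
  proof (rule inj_onI)
   fix x y assume xy: "x \<in> D" "y \<in> D" "A t x = A t y"
   have step: "x = y" if x: "i \<in> I" "x \<in> inside (J i)" and y: "y \<in> D" "A t x = A t y" for x y i
   proof -
    obtain k where k: "k \<in> I" "y \<in> K k" using inK y(1) by blast
    have xK: "x \<in> K i" using x(2) by (simp add: K_def)
    have "F i t x \<in> inside (J i)" by (rule Fin[OF x(1) t x(2)])
    moreover have e: "F i t x = F k t y" using y(2) AF[OF x(1) xK t] AF[OF k t] by simp
    moreover have "F k t y \<in> K k" using Fi(2)[OF k(1) t] k(2) by blast
    ultimately have "k = i" using disj[OF x(1) k(1)] by auto
    thus ?thesis using inj_onD[OF Fi(1)[OF x(1) t]] e xK k(2) by simp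
   qed
   obtain i k where ik: "i \<in> I" "x \<in> K i" "k \<in> I" "y \<in> K k" using inK xy by blast
   show "x = y"
   proof (cases "x \<in> J i & y \<in> J k")
    case True
    hence "x \<in> (\<Union>i\<in>I. J i)" "y \<in> (\<Union>i\<in>I. J i)" using ik by blast+
    thus ?thesis using bA[OF t] xy(3) inj_onD[OF b(2)[OF t]] by simp
   next
    case False
    then consider "x \<in> inside (J i)" | "y \<in> inside (J k)" using ik by (auto simp: K_def)
    thus ?thesis
    proof cases
     case 1 thus ?thesis using step[of i x y] ik xy by simp
    next
     case 2 thus ?thesis using step[of k y x] ik xy by simp
    qed
   qed
  qed
  show "A t ` D = D" if t: "t \<in> {0..1}" for t
  proof -
   have "A t ` K i = K i" if "i \<in> I" for i
    using Fi(2)[OF that t] AF[OF that _ t] by (metis (no_types, lifting) image_cong)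
   hence "(\<Union>i\<in>I. A t ` K i) = (\<Union>i\<in>I. K i)" by simp
   thus ?thesis using D by (simp add: image_UN[symmetric])
  qed
  show "A 0 z = z" "A 1 z = a z" if z: "z \<in> D" for z
  proof -
   obtain i where i: "i \<in> I" "z \<in> K i" using inK z by blast
   show "A 0 z = z" "A 1 z = a z" using AF[OF i] F01[OF i] by simp_all
  qed
  show "A t (c i) = c i" if "t \<in> {0..1}" "i \<in> I" "a (c i) = c i" for t i
   using AF[of i "c i" t] Fcen[OF that(2,1,3)] c[OF that(2)] that by (simp add: K_def)
 qed
qed

section \<open>The upper and lower half-disc, and orientation on the circle\<close>

text \<open>Here \<open>sd\<close> is the sign \<open>1\<close> or \<open>-1\<close> of the upper or
  lower half. The diameter, whose image is the curve, lies on the boundary of both halves, so the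
  preimages of pieces of lines between the crossings become chords.\<close>

definition hdisc :: "real => complex set" where
 "hdisc sd = {z. norm z <= 1 & 0 <= sd * Im z}"

definition hrim :: "real => complex set" where
 "hrim sd = {z. norm z <= 1 & 0 <= sd * Im z & (norm z = 1 \<or> Im z = 0)}"

lemma hd_Jordan:
 assumes sd: "sd = 1 \<or> sd = -1"
 shows "Jordan (hrim sd)" "inside (hrim sd) = {z. norm z < 1 & 0 < sd * Im z}"
  "hrim sd Un inside (hrim sd) = hdisc sd"
proof -
 define a where "a = sd *\<^sub>R \<i>"
 have a0: "a ~= 0" and ai: "a \<bullet> z = sd * Im z" for z using sd by (auto simp: a_def inner_complex_def)
 have S: "hdisc sd = cball 0 1 \<inter> {z. a \<bullet> z \<ge> 0}" by (auto simp: hdisc_def ai)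
 have int: "interior (hdisc sd) = {z. norm z < 1 & 0 < sd * Im z}"
 proof -
  have "interior {z. a \<bullet> z \<ge> 0} = {z. a \<bullet> z > 0}" by (rule interior_halfspace_ge[OF a0])
  thus ?thesis unfolding S interior_Int interior_cball by (simp only: ai) auto
 qed
 have cpt: "compact (hdisc sd)" unfolding S
  by (rule compact_Int_closed[OF compact_cball closed_halfspace_ge])
 have conv: "convex (hdisc sd)" unfolding S by (intro convex_Int convex_cball convex_halfspace_ge)
 have "sd *\<^sub>R (\<i> / 2) \<in> interior (hdisc sd)" unfolding int using sd by auto
 hence ne: "interior (hdisc sd) ~= {}" by blast
 have "frontier (hdisc sd) = hdisc sd - interior (hdisc sd)"
  using cpt by (simp add: frontier_def compact_imp_closed)
 hence fr: "frontier (hdisc sd) = hrim sd"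
 proof -
  have "z \<in> hdisc sd - {z. norm z < 1 & 0 < sd * Im z} \<longleftrightarrow> z \<in> hrim sd" for z
  proof -
   have "sd * Im z = 0 \<longleftrightarrow> Im z = 0" using sd by auto
   thus ?thesis
    by (cases "norm z = 1"; cases "Im z = 0") (auto simp: hdisc_def hrim_def less_le)
  qed
  thus ?thesis using \<open>frontier (hdisc sd) = hdisc sd - interior (hdisc sd)\<close> unfolding int by blast
 qed
 show "Jordan (hrim sd)" "inside (hrim sd) = {z. norm z < 1 & 0 < sd * Im z}"
  "hrim sd Un inside (hrim sd) = hdisc sd"
  using convex_Jordan[OF cpt conv ne] unfolding fr int by simp_all
qed

text \<open>Otherwise complex conjugation after \<open>h\<close> would have degree 1 on the unit circle.\<close>

lemma braid_homeo_sign: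
 assumes h: "h \<in> braid_homeos n p" and sd0: "sd0 = 1 \<or> sd0 = -1" and z: "norm z = 1" "0 < sd0 * Im z"
 shows "0 < sd0 * Im (h z)"
proof -
 note hD = bhD[OF h] and hn = bh_norm[OF h]
 define U where "U = (\<lambda>sd. {z::complex. norm z = 1 & 0 < sd * Im z})"
 have real1: "z = 1 \<or> z = -1" if "norm z = 1" "Im z = 0" for z :: complex
 proof -
  have "\<bar>Re z\<bar> = 1" using that by (simp add: cmod_eq_Re)
  thus ?thesis using that(2) by (auto simp: complex_eq_iff abs_if split: if_splits)
 qed
 have hne: "h z ~= 1 & h z ~= -1" if "Im z ~= 0" for z
  using injD[OF hD(2), of z 1] injD[OF hD(2), of z "-1"] hD(6,7) that by auto
 have him: "Im (h z) ~= 0" if "norm z = 1" "Im z ~= 0" for z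
  using real1[of "h z"] hn(2)[of z] hne that by auto
 have par: "U sd = (\<lambda>x. Complex x (sd * sqrt (1 - x\<^sup>2))) ` {-1<..<1}" if sd: "sd = 1 \<or> sd = -1" for sd
 proof (intro equalityI subsetI)
  fix z assume "z \<in> U sd"
  hence z: "(Re z)\<^sup>2 + (Im z)\<^sup>2 = 1" "0 < sd * Im z" by (auto simp: U_def cmod_def)
  have "(Im z)\<^sup>2 > 0" using z(2) sd by auto
  hence "(Re z)\<^sup>2 < 1" using z(1) by linarith
  hence "Re z \<in> {-1<..<1}" by (simp add: abs_square_less_1 abs_less_iff)
  moreover have "sqrt (1 - (Re z)\<^sup>2) = sd * Im z"
   using z sd by (intro real_sqrt_unique) (auto simp: algebra_simps)
  hence "sd * sqrt (1 - (Re z)\<^sup>2) = Im z" using sd by auto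
  hence "z = Complex (Re z) (sd * sqrt (1 - (Re z)\<^sup>2))" by (simp add: complex_eq_iff)
  ultimately show "z \<in> (\<lambda>x. Complex x (sd * sqrt (1 - x\<^sup>2))) ` {-1<..<1}" by blast
 next
  fix z assume "z \<in> (\<lambda>x. Complex x (sd * sqrt (1 - x\<^sup>2))) ` {-1<..<1}"
  then obtain x where x: "x \<in> {-1<..<1}" "z = Complex x (sd * sqrt (1 - x\<^sup>2))" by blast
  hence "x\<^sup>2 < 1" by (simp add: abs_square_less_1 abs_less_iff)
  thus "z \<in> U sd" using x sd by (auto simp: U_def cmod_def power_mult_distrib)
 qed
 have con: "connected (U sd)" if sd: "sd = 1 \<or> sd = -1" for sd
  unfolding par[OF sd] by (intro connected_continuous_image continuous_on_Complex continuous_intros connected_Ioo)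
 have side: "h ` U sd <= U 1 \<or> h ` U sd <= U (-1)" if sd: "sd = 1 \<or> sd = -1" for sd
 proof -
  have "connected (h ` U sd)" by (intro connected_continuous_image hD(1) con sd)
  moreover have "h ` U sd <= {z. Im z < 0} Un {z. Im z > 0}" using him sd by (fastforce simp: U_def)
  moreover have "{z. Im z < 0} \<inter> {z. Im z > 0} \<inter> h ` U sd = {}" by auto
  ultimately have "{z. Im z < 0} \<inter> h ` U sd = {} \<or> {z. Im z > 0} \<inter> h ` U sd = {}"
   by (intro connectedD) (auto simp: open_halfspace_Im_lt open_halfspace_Im_gt)
  moreover have "norm w = 1 & Im w ~= 0" if "w \<in> h ` U sd" for w
   using that hn(2) him sd by (auto simp: U_def)
  ultimately have "(\<forall>w\<in>h ` U sd. norm w = 1 & 0 < Im w) \<or> (\<forall>w\<in>h ` U sd. norm w = 1 & Im w < 0)"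
   by (metis (no_types, lifting) IntI empty_iff linorder_neqE_linordered_idom mem_Collect_eq)
  thus ?thesis unfolding U_def by auto
 qed
 have opp: "h ` U (- sd) <= U (- ta)" if st: "sd = 1 \<or> sd = -1" "ta = 1 \<or> ta = -1" "h ` U sd <= U ta" for sd ta
 proof (rule ccontr)
  assume "\<not> ?thesis"
  moreover have "- sd = 1 \<or> - sd = -1" using st(1) by auto
  note side[OF this]
  ultimately have lo: "h ` U (- sd) <= U ta" using st(2) by (elim disjE) simp_all
  have "- ta *\<^sub>R \<i> \<in> h ` sphere 0 1" unfolding hD(5) using st(2) by auto
  then obtain y where y: "norm y = 1" "- ta *\<^sub>R \<i> = h y" by auto
  have "Im y ~= 0"
  proof
   assume "Im y = 0"
   hence "h y = 1 \<or> h y = -1" using real1[OF y(1)] hD(6,7) by auto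
   thus False using y(2) st(2) by (auto simp: complex_eq_iff)
  qed
  hence "y \<in> U sd \<or> y \<in> U (- sd)" using y(1) st(1) by (auto simp: U_def)
  hence "h y \<in> U ta" using st(3) lo by blast
  thus False unfolding y(2)[symmetric] using st(2) by (auto simp: U_def)
 qed
 have "h ` U 1 <= U 1"
 proof (rule ccontr)
  assume "\<not> ?thesis"
  hence up: "h ` U 1 <= U (-1)" using side[of 1] by blast
  hence low: "h ` U (-1) <= U 1" using opp[of 1 "-1"] by simp
  define q where "q = cnj \<circ> (h \<circ> circlepath 0 1)"
  have cp: "path (h \<circ> circlepath 0 1)" by (intro path_continuous_image hD(1)) simp
  have pq: "path q" unfolding q_def by (intro path_continuous_image cp continuous_intros)
  have nz: "0 \<notin> path_image (h \<circ> circlepath 0 1)"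
  proof
   assume "0 \<in> path_image (h \<circ> circlepath 0 1)"
   then obtain y where "norm y = 1" "h y = 0" by (auto simp: path_image_compose)
   thus False using hn(2)[of y] by simp
  qed
  \<comment> \<open>The straight homotopy passes through 0 only if \<open>q t\<close> is opposite to
    \<open>y\<close>. Then \<open>h y\<close> and \<open>y\<close> would have the same imaginary
    part, although \<open>h\<close> is assumed to exchange the two semicircles; at the real points
    \<open>h y = y\<close> excludes it.\<close>
  have "homotopic_loops (- {0}) q (circlepath 0 1)"
  proof (rule homotopic_loops_linear[OF pq])
   fix t :: real and x :: 'a assume t: "t \<in> {0..1}"
   define y where "y = circlepath 0 1 t"
   have y: "norm y = 1" by (simp add: y_def circlepath)
   have qt: "q t = cnj (h y)" by (simp add: q_def y_def)
   have "0 \<notin> closed_segment (q t) y"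
   proof
    assume "0 \<in> closed_segment (q t) y"
    then obtain s where s: "0 <= s" "s <= 1" "0 = (1 - s) *\<^sub>R q t + s *\<^sub>R y" by (auto simp: closed_segment_def)
    have nq: "norm (q t) = 1" using hn(2)[of y] y by (simp add: qt)
    have e: "(1 - s) *\<^sub>R q t = - (s *\<^sub>R y)" using s(3) by (simp add: eq_neg_iff_add_eq_0)
    have "norm ((1 - s) *\<^sub>R q t) = norm (- (s *\<^sub>R y))" using e by simp
    hence s2: "s = 1/2" using s nq y by simp
    have "(1/2::real) *\<^sub>R q t = (1/2::real) *\<^sub>R (- y)" using e unfolding s2 by (simp only: scaleR_minus_right) simp
    hence "q t = - y" by (metis scaleR_cancel_left zero_neq_one divide_eq_0_iff zero_neq_numeral)
    hence hy: "cnj (h y) = - y" using qt by simp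
    show False
    proof (cases "Im y = 0")
     case True thus ?thesis using real1[OF y True] hy hD(6,7) by auto
    next
     case False
     hence "y \<in> U 1 \<or> y \<in> U (-1)" using y by (auto simp: U_def)
     moreover have "Im (h y) = Im y" using hy by (metis complex_cnj minus_equation_iff complex.sel(2) complex_surj neg_equal_iff_equal uminus_complex.sel(2) cnj.sel(2))
     ultimately show ?thesis using up low by (auto simp: U_def image_subset_iff)
    qed
   qed
   thus "closed_segment (q t) (circlepath 0 1 t) <= - {0}" unfolding y_def by blast
  qed (auto simp: q_def pathstart_compose pathfinish_compose)
  hence "winding_number q 0 = winding_number (circlepath 0 1) 0" by (rule winding_number_homotopic_loops)
  hence "winding_number q 0 = 1" by (simp add: winding_number_circlepath_centre)
  moreover have "winding_number q 0 = - cnj (winding_number (h \<circ> circlepath 0 1) 0)"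
   using winding_number_cnj[OF cp nz] by (simp add: q_def)
  moreover have "winding_number (h \<circ> circlepath 0 1) 0 = winding_number (h \<circ> circlepath 0 1) (h 0)"
  proof (rule winding_number_eq[OF cp, of _ "ball 0 1"])
   show "h 0 \<in> ball 0 1" using hn(1)[of 0] by simp
   have "norm w = 1" if "w \<in> path_image (h \<circ> circlepath 0 1)" for w
   proof -
    have "w \<in> h ` sphere 0 1" using that by (simp add: path_image_compose)
    thus ?thesis unfolding hD(5) by simp
   qed
   thus "ball 0 1 \<inter> path_image (h \<circ> circlepath 0 1) = {}" by fastforce
  qed (auto simp: pathstart_compose pathfinish_compose convex_connected)
  moreover have "winding_number (h \<circ> circlepath 0 1) (h 0) = 1"
   using hD(8) unfolding orientation_preserving_def by (metis zero_less_one)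
  ultimately show False by simp
 qed
 hence "h ` U sd0 <= U sd0" using opp[of 1 1] sd0 by auto
 thus ?thesis using z by (auto simp: U_def)
qed


section \<open>Disjoint curves in a strip do not interlace\<close>

lemma fashoda_interlace_complex:
 fixes f g :: "real => complex"
 assumes "path f" "path g" "path_image f <= cbox a b" "path_image g <= cbox a b"
  "Im (pathstart f) = Im a" "Im (pathfinish f) = Im a" "Im (pathstart g) = Im a" "Im (pathfinish g) = Im a"
  "Re (pathstart f) < Re (pathstart g)" "Re (pathstart g) < Re (pathfinish f)" "Re (pathfinish f) < Re (pathfinish g)"
 obtains z where "z \<in> path_image f" "z \<in> path_image g"
proof -
 define v :: "complex => real^2" where "v = (\<lambda>z. \<chi> i. if i = 1 then Re z else Im z)"
 have v12: "v z $ 1 = Re z" "v z $ 2 = Im z" for z by (simp_all add: v_def)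
 have cv: "continuous_on S v" for S
  unfolding v_def
 proof (rule continuous_on_vec_lambda)
  show "continuous_on S (\<lambda>z. if i = 1 then Re z else Im z)" for i :: 2
   by (cases "i = 1") (auto intro!: continuous_intros)
 qed
 have vbox: "v z \<in> cbox (v a) (v b)" if "z \<in> cbox a b" for z
  using that by (simp add: mem_box_cart forall_2 v12 in_cbox_complex_iff)
 obtain z where "z \<in> path_image (v \<circ> f)" "z \<in> path_image (v \<circ> g)"
 proof (rule fashoda_interlace[of "v \<circ> f" "v \<circ> g" "v a" "v b"])
  show "path (v \<circ> f)" "path (v \<circ> g)" using assms cv by (auto intro: path_continuous_image)
 qed (use assms vbox in \<open>auto simp: path_image_compose pathstart_compose pathfinish_compose v12\<close>)
 then obtain x y where "x \<in> path_image f" "y \<in> path_image g" "v x = v y"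
  by (auto simp: path_image_compose)
 moreover from this have "x = y" by (metis complex_eqI v12)
 ultimately show thesis using that by blast
qed

text \<open>The exponential map sends the strip to the upper half plane, with both boundary lines on the real axis; the
 right-hand line comes first, with descending height.\<close>

lemma strip_noncrossing:
 fixes f g :: "real => complex"
 defines "key \<equiv> \<lambda>r z. if Re z = r then - exp (Im z) else exp (Im z)"
 assumes lr: "l < r" and f: "path f" "\<And>z. z \<in> path_image f ==> l <= Re z & Re z <= r"
  and g: "path g" "\<And>z. z \<in> path_image g ==> l <= Re z & Re z <= r"
  and disj: "path_image f \<inter> path_image g = {}"
  and ends: "Re (pathstart f) \<in> {l, r}" "Re (pathfinish f) \<in> {l, r}" "Re (pathstart g) \<in> {l, r}" "Re (pathfinish g) \<in> {l, r}"
  and order: "key r (pathstart f) < key r (pathstart g)" "key r (pathstart g) < key r (pathfinish f)"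
   "key r (pathfinish f) < key r (pathfinish g)"
 shows False
proof -
 define c where "c = pi / (r - l)"
 have c: "c > 0" "c * (r - l) = pi" using lr by (auto simp: c_def)
 define W where "W = (\<lambda>z. exp (Complex (c * Im z) (c * (Re z - l))))"
 have ReW: "Re (W z) = exp (c * Im z) * cos (c * (Re z - l))"
  and ImW: "Im (W z) = exp (c * Im z) * sin (c * (Re z - l))"
  and nW: "norm (W z) = exp (c * Im z)" for z by (simp_all add: W_def Re_exp Im_exp)
 have ang: "0 <= c * (Re z - l) & c * (Re z - l) <= pi" if "l <= Re z & Re z <= r" for z
  using that c mult_left_mono[of "Re z - l" "r - l" c] by simp
 have contW: "continuous_on S W" for S
  unfolding W_def by (intro continuous_on_exp continuous_on_Complex continuous_intros)
 have injW: "x = y" if "l <= Re x & Re x <= r" "l <= Re y & Re y <= r" "W x = W y" for x y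
 proof -
  have "exp (c * Im x) = exp (c * Im y)" unfolding nW[symmetric] that(3) by (rule refl)
  hence "c * Im x = c * Im y" by (simp only: exp_inj_iff)
  hence "Im x = Im y" using c(1) by simp
  moreover from this have "cos (c * (Re x - l)) = cos (c * (Re y - l))" using ReW[of x] ReW[of y] that(3) by simp
  hence "c * (Re x - l) = c * (Re y - l)" using ang[OF that(1)] ang[OF that(2)] cos_inj_pi by blast
  hence "Re x = Re y" using c by simp
  ultimately show ?thesis by (simp add: complex_eq_iff)
 qed
 have bnd: "Im (W z) = 0" "Re (W z) = (if Re z = r then - exp (c * Im z) else exp (c * Im z))"
  if "Re z \<in> {l, r}" for z
  using that c lr by (auto simp: ReW ImW)
 have lt: "Re (W x) < Re (W y)" if "Re x \<in> {l, r}" "Re y \<in> {l, r}" "key r x < key r y" for x y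
 proof -
  have pos: "- exp u < exp v" "\<not> exp u < - exp v" for u v :: real
   using exp_gt_zero[of u] exp_gt_zero[of v] by linarith+
  show ?thesis using that(3) c(1) unfolding bnd(2)[OF that(1)] bnd(2)[OF that(2)] key_def
   by (cases "Re x = r"; cases "Re y = r") (simp_all add: pos)
 qed
 have cpt: "compact (path_image (W \<circ> f) Un path_image (W \<circ> g))"
  by (rule compact_Un; rule compact_path_image; rule path_continuous_image) (use f g contW in simp_all)
 then obtain B where B: "B > 0" "\<And>z. z \<in> path_image (W \<circ> f) Un path_image (W \<circ> g) ==> norm z <= B"
  using bounded_pos compact_imp_bounded by metis
 have box: "W z \<in> cbox (Complex (-B) 0) (Complex B B)" if "z \<in> path_image f Un path_image g" for z
 proof -
  have "W z \<in> path_image (W \<circ> f) Un path_image (W \<circ> g)" using that by (auto simp: path_image_compose)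
  hence "norm (W z) <= B" by (rule B(2))
  hence "\<bar>Re (W z)\<bar> <= B" "\<bar>Im (W z)\<bar> <= B" using abs_Re_le_cmod[of "W z"] abs_Im_le_cmod[of "W z"] by linarith+
  moreover have "l <= Re z & Re z <= r" using f(2) g(2) that by blast
  hence "Im (W z) \<ge> 0" unfolding ImW using ang[of z] sin_ge_zero by simp
  ultimately show ?thesis by (simp add: in_cbox_complex_iff abs_le_iff)
 qed
 obtain w where w: "w \<in> path_image (W \<circ> f)" "w \<in> path_image (W \<circ> g)"
 proof (rule fashoda_interlace_complex[of "W \<circ> f" "W \<circ> g" "Complex (-B) 0" "Complex B B"])
  show "path (W \<circ> f)" "path (W \<circ> g)" using f g contW by (auto intro: path_continuous_image)
  show "path_image (W \<circ> f) <= cbox (Complex (-B) 0) (Complex B B)" "path_image (W \<circ> g) <= cbox (Complex (-B) 0) (Complex B B)"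
   using box unfolding path_image_compose by blast+
 qed (use ends order in \<open>simp_all add: pathstart_compose pathfinish_compose bnd(1) lt\<close>)
 then obtain x y where xy: "x \<in> path_image f" "y \<in> path_image g" "W x = W y"
  unfolding path_image_compose by fastforce
 hence "x = y" using injW f(2) g(2) by blast
 thus False using xy disj by blast
qed

section \<open>Bigons and touching points\<close>

text \<open>The tent function \<open>max 0 (1 - |v| / et)\<close> has Lipschitz constant
  \<open>1 / et\<close>, so a multiple of it by less than \<open>et\<close> cannot reverse the
  order.\<close>

lemma shear_strict_mono:
 fixes k :: real
 assumes "\<bar>k\<bar> < et" "v < w"
 shows "v + k * max 0 (1 - \<bar>v\<bar> / et) < w + k * max 0 (1 - \<bar>w\<bar> / et)"
proof -
 have et: "et > 0" using assms(1) by linarith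
 have "\<bar>max 0 (1 - \<bar>v\<bar> / et) - max 0 (1 - \<bar>w\<bar> / et)\<bar> <= \<bar>\<bar>w\<bar> / et - \<bar>v\<bar> / et\<bar>" by linarith
 also have "\<dots> = \<bar>\<bar>w\<bar> - \<bar>v\<bar>\<bar> / et" using et by (simp add: diff_divide_distrib[symmetric])
 also have "\<dots> <= (w - v) / et" using et assms(2) by (intro divide_right_mono) auto
 finally have 1: "\<bar>max 0 (1 - \<bar>v\<bar> / et) - max 0 (1 - \<bar>w\<bar> / et)\<bar> <= (w - v) / et" .
 have "k * (max 0 (1 - \<bar>v\<bar> / et) - max 0 (1 - \<bar>w\<bar> / et)) <= \<bar>k\<bar> * \<bar>max 0 (1 - \<bar>v\<bar> / et) - max 0 (1 - \<bar>w\<bar> / et)\<bar>"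
  by (metis abs_ge_self abs_mult)
 also have "\<dots> <= \<bar>k\<bar> * ((w - v) / et)" using 1 by (intro mult_left_mono) auto
 also have "\<dots> < et * ((w - v) / et)" using assms et by (intro mult_strict_right_mono) auto
 also have "\<dots> = w - v" using et by simp
 finally show ?thesis by (simp add: right_diff_distrib)
qed

lemma shear_surj:
 fixes k :: real
 assumes "\<bar>k\<bar> < et"
 shows "\<exists>v. y = v + k * max 0 (1 - \<bar>v\<bar> / et)"
proof -
 have et: "et > 0" using assms by linarith
 define B where "B = \<bar>y\<bar> + et"
 have B: "B \<ge> et" "- B <= y" "y <= B" using et by (auto simp: B_def)
 have "1 <= B / et" using B(1) et by simp
 hence "max 0 (1 - \<bar>B\<bar> / et) = 0" "max 0 (1 - \<bar>-B\<bar> / et) = 0" using B et by auto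
 hence "\<exists>v. - B <= v & v <= B & v + k * max 0 (1 - \<bar>v\<bar> / et) = y"
  using B et by (intro IVT') (auto intro!: continuous_intros)
 thus ?thesis by auto
qed

lemma braid_isotopy_sym: "(h, g) \<in> braid_isotopy n p ==> (g, h) \<in> braid_isotopy n p"
 using equiv_braid_isotopy[of n p] unfolding equiv_def by (metis symD)

lemma braid_isotopy_trans: "(h, g) \<in> braid_isotopy n p ==> (g, k) \<in> braid_isotopy n p ==> (h, k) \<in> braid_isotopy n p"
 using equiv_braid_isotopy[of n p] unfolding equiv_def by (metis transD)

lemma braid_isotopy_mem: assumes "(h, g) \<in> braid_isotopy n p" shows "h \<in> braid_homeos n p" "g \<in> braid_homeos n p"
 using homotopic_with_imp_property[of "\<lambda>f. f \<in> braid_homeos n p" _ _ h g] assms unfolding braid_isotopy_def by auto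

lemma braid_isotopy_refl: "h \<in> braid_homeos n p ==> (h, h) \<in> braid_isotopy n p"
 using equiv_braid_isotopy[of n p] unfolding equiv_def by (metis refl_onD)

section \<open>Lamination lines, crossings, and pushes of the diagram\<close>

locale punctured_disc =
 fixes n :: nat and p :: "nat => real"
 assumes n2: "2 <= n" and valid: "valid_punctures n p"
begin

abbreviation "H \<equiv> braid_homeos n p"

text \<open>The values \<open>-1\<close> and \<open>1\<close> at the ends add two lines that touch
  the disc at the ends of the curve. Then strip \<open>s\<close>, between \<open>m (s - 1)\<close>
  and \<open>m s\<close>, contains exactly the puncture \<open>p s\<close>, and the outer strips
  need no separate treatment.\<close>

definition m :: "nat => real" where
 "m j = (if j = 0 then -1 else if j = n then 1 else (p j + p (j + 1)) / 2)"

lemma p_bounds: "s \<in> {1..n} ==> -1 < p s & p s < 1"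
 using valid unfolding valid_punctures_def by (auto simp: image_subset_iff)

lemma p_less: "1 <= i ==> i < j ==> j <= n ==> p i < p j"
 using valid unfolding valid_punctures_def strict_mono_on_def by auto

lemma m_p: assumes "s \<in> {1..n}" shows "m (s - 1) < p s" "p s < m s"
 using assms p_bounds[of s] p_less[of "s - 1" s] p_less[of s "s + 1"] n2
 by (cases "s = 1"; cases "s = n"; auto simp: m_def)+

lemma m_less: assumes "i < j" "j <= n" shows "m i < m j"
 using assms
proof (induction j)
 case (Suc j)
 have "m j < m (Suc j)" using m_p[of "Suc j"] Suc.prems by simp
 thus ?case using Suc by (cases "i = j") auto
qed simp

lemma m_eq: assumes "i <= n" "j <= n" shows "m i = m j \<longleftrightarrow> i = j"
 using m_less[of i j] m_less[of j i] assms by (metis less_irrefl linorder_neqE_nat)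

lemma m_le: "i <= j ==> j <= n ==> m i <= m j"
 using m_less[of i j] by (cases "i = j") auto

lemma m_ends: "m 0 = -1" "m n = 1" using n2 by (auto simp: m_def)

lemma m_ne_p: "s \<in> {1..n} ==> j <= n ==> m j ~= p s"
proof (cases "j < s")
 assume s: "s \<in> {1..n}" and "j < s"
 hence "m j <= m (s - 1)" by (intro m_le) auto
 thus "m j ~= p s" using m_p(1)[OF s] by simp
next
 assume s: "s \<in> {1..n}" and "j <= n" "\<not> j < s"
 hence "m s <= m j" by (intro m_le) auto
 thus "m j ~= p s" using m_p(2)[OF s] by simp
qed

lemma m_bounds: assumes "1 <= j" "j <= n - 1" shows "-1 < m j & m j < 1"
proof -
 have "m 0 < m j" "m j < m n" using assms n2 by (auto intro!: m_less)
 thus ?thesis by (simp add: m_ends)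
qed

lemma strip_index:
 assumes "-1 <= r" "r <= 1"
 obtains s where "s \<in> {1..n}" "m (s - 1) <= r" "r <= m s"
proof -
 define s where "s = (LEAST s. s \<ge> 1 & r <= m s)"
 have s: "s \<ge> 1 & r <= m s" unfolding s_def by (rule LeastI[of _ n]) (use assms m_ends n2 in auto)
 have "s <= n" unfolding s_def by (rule Least_le) (use assms m_ends n2 in auto)
 moreover have "m (s - 1) <= r"
 proof (cases "s = 1")
  case True thus ?thesis using assms m_ends by simp
 next
  case False
  hence "\<not> (s - 1 \<ge> 1 & r <= m (s - 1))" using s not_less_Least[of "s - 1"] unfolding s_def
   by (metis (no_types, lifting) diff_less less_le_trans zero_less_one)
  thus ?thesis using False s by auto
 qed
 ultimately show thesis using that s by auto
qed

abbreviation "M \<equiv> m ` {0..n}"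

text \<open>Crossings are recorded by their parameters in the source. As \<open>m 0\<close> and
  \<open>m n\<close> are included, the ends \<open>-1\<close> and \<open>1\<close> belong to
  \<open>X h\<close>, and the cardinality exceeds the intersection number by 2.\<close>

definition X :: "(complex => complex) => real set" where
 "X h = {x. -1 <= x & x <= 1 & Re (h (of_real x)) \<in> M}"

lemma trivial_lamination_eq: "trivial_lamination n p = {z. Re z \<in> m ` {1..n - 1}}"
proof -
 have m: "(p j + p (j + 1)) / 2 = m j" if "j \<in> {1..n - 1}" for j using that by (auto simp: m_def)
 have "trivial_lamination n p = (\<Union>j\<in>{1..n - 1}. {z. Re z = m j})"
  unfolding trivial_lamination_def by (rule SUP_cong) (simp_all only: m)
 thus ?thesis by blast
qed

lemma M_inner: assumes "r \<in> M" "-1 < r" "r < 1" shows "r \<in> m ` {1..n - 1}"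
proof -
 obtain j where j: "j <= n" "r = m j" using assms(1) by auto
 have "j ~= 0" "j ~= n" using j(2) assms(2,3) m_ends by (metis less_irrefl)+
 hence "j \<in> {1..n - 1}" using j(1) by auto
 thus ?thesis using j(2) by (rule rev_image_eqI)
qed

lemma norm_inner:
 assumes "h \<in> H" "-1 < x" "x < 1" shows "norm (h (of_real x)) < 1"
 using bh_norm(1)[OF assms(1), of "of_real x"] assms by simp

lemma Re_inner:
 assumes "norm z < 1" shows "-1 < Re z" "Re z < 1"
 using abs_Re_le_cmod[of z] assms by linarith+

lemma X_ends: assumes "h \<in> H" shows "-1 \<in> X h" "1 \<in> X h"
proof -
 have "-1 \<in> M" "1 \<in> M" using m_ends by (metis atLeastAtMost_iff imageI order_refl zero_le)+
 thus "-1 \<in> X h" "1 \<in> X h" using bhD(6,7)[OF assms] by (auto simp: X_def)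
qed

lemma X_puncture: assumes h: "h \<in> H" and s: "s \<in> {1..n}" shows "p s \<notin> X h"
proof
 assume x: "p s \<in> X h"
 have "h (of_real (p s)) \<in> punctures n p" using bhD(4)[OF h] s unfolding punctures_def by blast
 then obtain r where "r \<in> {1..n}" "h (of_real (p s)) = of_real (p r)" unfolding punctures_def by blast
 then obtain j where j: "j <= n" "p r = m j" "r \<in> {1..n}" using x by (auto simp: X_def)
 thus False using m_ne_p[of r j] by simp
qed

lemma lamination_card:
 assumes h: "h \<in> H"
 shows "ecard (h ` closed_segment (-1) 1 \<inter> trivial_lamination n p) = (if finite (X h) then enat (card (X h) - 2) else \<infinity>)"
proof -
 have seg: "closed_segment (-1) 1 = complex_of_real ` {-1..1}"
  using closed_segment_of_real[of "-1" 1] by (simp add: closed_segment_eq_real_ivl)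
 have eq: "h ` closed_segment (-1) 1 \<inter> trivial_lamination n p = (\<lambda>x. h (of_real x)) ` (X h - {-1, 1})"
 proof (intro equalityI subsetI)
  fix z assume z: "z \<in> h ` closed_segment (-1) 1 \<inter> trivial_lamination n p"
  then obtain x where x: "-1 <= x" "x <= 1" "z = h (of_real x)" unfolding seg by auto
  obtain j where j: "j \<in> {1..n-1}" "Re z = m j" using z unfolding trivial_lamination_eq by auto
  have "-1 < Re z & Re z < 1" using m_bounds[of j] j by auto
  hence "x ~= -1" "x ~= 1" using x(3) bhD(6,7)[OF h] by auto
  moreover have "j \<in> {0..n}" using j by auto
  ultimately show "z \<in> (\<lambda>x. h (of_real x)) ` (X h - {-1, 1})" using x j by (auto simp: X_def)
 next
  fix z assume "z \<in> (\<lambda>x. h (of_real x)) ` (X h - {-1, 1})"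
  then obtain x where x: "x \<in> X h" "x ~= -1" "x ~= 1" "z = h (of_real x)" by blast
  hence x1: "-1 < x" "x < 1" "Re z \<in> M" by (auto simp: X_def)
  have "Re z \<in> m ` {1..n-1}" using M_inner[OF x1(3)] Re_inner[OF norm_inner[OF h x1(1,2)]] x(4) by simp
  thus "z \<in> h ` closed_segment (-1) 1 \<inter> trivial_lamination n p"
   unfolding seg trivial_lamination_eq using x x1 by auto
 qed
 have inj: "inj_on (\<lambda>x. h (of_real x)) S" for S
  using injD[OF bhD(2)[OF h]] by (intro inj_onI) (metis of_real_eq_iff)
 have "finite (X h) \<longleftrightarrow> finite (X h - {-1, 1})" using finite_Diff2[of "{-1, 1::real}" "X h"] by simp
 moreover have "card (X h - {-1, 1}) = card (X h) - 2" if "finite (X h)"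
  using X_ends[OF h] that by (subst card_Diff_subset) auto
 ultimately show ?thesis unfolding eq ecard_def using finite_image_iff[OF inj] card_image[OF inj] by auto
qed

text \<open>\<open>h\<close> is precomposed with a vertical shear that moves the segment over
  \<open>(a,b)\<close> onto the graph of \<open>sd * ta\<close>. The tent factor in the imaginary
  part confines the motion to a box inside the disc. If \<open>h\<close> maps the graph away from
  the lines, all crossings in \<open>(a,b)\<close> disappear and no new ones arise.\<close>

lemma push:
 assumes h: "h \<in> H" and sd: "sd = 1 \<or> sd = -1" and noP: "\<And>s. s \<in> {1..n} ==> p s \<notin> {a<..<b}"
  and ta: "continuous_on UNIV ta" "\<And>u. 0 <= ta u" "\<And>u. u \<notin> {a<..<b} ==> ta u = 0" "\<And>u. ta u < et"
  and box: "\<And>u v. u \<in> {a<..<b} ==> \<bar>v\<bar> <= et ==> norm (Complex u v) < 1"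
  and free: "\<And>u. u \<in> {a<..<b} ==> Re (h (Complex u (sd * ta u))) \<notin> M"
 shows "\<exists>h2. (h, h2) \<in> braid_isotopy n p & X h2 = X h - {a<..<b}"
proof -
 note hD = bhD[OF h]
 have et: "et > 0" using ta(2,4) by (meson le_less_trans)
 define \<theta> where "\<theta> = (\<lambda>t z. Complex (Re z) (Im z + (t * sd * ta (Re z)) * max 0 (1 - \<bar>Im z\<bar> / et)))"
 have k: "\<bar>t * sd * ta u\<bar> < et" if "t \<in> {0..1}" for t u
 proof -
  have "\<bar>t * sd * ta u\<bar> = t * ta u" using sd that ta(2)[of u] by (auto simp: abs_mult)
  also have "\<dots> <= ta u" using that ta(2)[of u] by (simp add: mult_left_le_one_le)
  finally show ?thesis using ta(4)[of u] by simp
 qed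
 have fixd: "\<theta> t z = z" if "\<not> (Re z \<in> {a<..<b} & \<bar>Im z\<bar> < et)" for t z
 proof (cases "Re z \<in> {a<..<b}")
  case False thus ?thesis using ta(3)[of "Re z"] by (simp add: \<theta>_def)
 next
  case True
  hence "1 - \<bar>Im z\<bar> / et <= 0" using that et by simp
  thus ?thesis by (simp add: \<theta>_def max_def)
 qed
 have fixC: "\<theta> t z = z" if "norm z = 1" for t z
  using fixd[of z t] box[of "Re z" "Im z"] that by fastforce
 have fixP: "\<theta> t z = z" if "z \<in> punctures n p" for t z
  using that fixd[of z t] noP unfolding punctures_def by fastforce
 have c\<theta>: "continuous_on ({0..1} \<times> UNIV) (\<lambda>x. \<theta> (fst x) (snd x))"
  unfolding \<theta>_def using et by (intro continuous_on_Complex continuous_intros continuous_on_compose2[OF ta(1)]) auto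
 define k where "k = (\<lambda>t. h \<circ> \<theta> t)"
 have "(k 0, k 1) \<in> braid_isotopy n p"
 proof (rule braid_isotopyI[of k])
  show "joint_cont UNIV k"
   unfolding k_def o_def by (rule continuous_on_compose2[OF hD(1)[of UNIV] c\<theta>]) simp
  show "k 0 \<in> H" using h by (simp add: k_def \<theta>_def o_def)
 next
  fix t :: real assume t: "t \<in> {0..1}"
  have "inj (\<theta> t)"
  proof (rule injI)
   fix x y assume e: "\<theta> t x = \<theta> t y"
   hence R: "Re x = Re y" by (simp add: \<theta>_def)
   have I: "Im x + (t * sd * ta (Re x)) * max 0 (1 - \<bar>Im x\<bar> / et) = Im y + (t * sd * ta (Re x)) * max 0 (1 - \<bar>Im y\<bar> / et)"
    using e R unfolding \<theta>_def by simp
   have "Im x = Im y"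
    using shear_strict_mono[OF k[OF t], of "Im x" "Im y" "Re x"] shear_strict_mono[OF k[OF t], of "Im y" "Im x" "Re x"] I
    by (cases "Im x" "Im y" rule: linorder_cases) auto
   thus "x = y" using R by (simp add: complex_eq_iff)
  qed
  thus "inj (k t)" unfolding k_def using hD(2) by (rule inj_compose[rotated])
  have "\<exists>z. w = \<theta> t z" for w
  proof -
   obtain v where "Im w = v + (t * sd * ta (Re w)) * max 0 (1 - \<bar>v\<bar> / et)" using shear_surj[OF k[OF t]] by blast
   thus ?thesis by (intro exI[of _ "Complex (Re w) v"]) (simp add: \<theta>_def complex_eq_iff)
  qed
  hence "surj (\<theta> t)" unfolding surj_def by blast
  thus "surj (k t)" unfolding k_def using hD(3) by (rule comp_surj)
  have "\<theta> t ` punctures n p = punctures n p" using fixP by force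
  thus "k t ` punctures n p = punctures n p" unfolding k_def image_comp[symmetric] using hD(4) by simp
  have "\<theta> t ` sphere 0 1 = sphere 0 1" using fixC by force
  thus "k t ` sphere 0 1 = sphere 0 1" unfolding k_def image_comp[symmetric] using hD(5) by simp
  show "k t 1 = 1" "k t (-1) = -1" using fixC[of 1 t] fixC[of "-1" t] hD(6,7) by (simp_all add: k_def)
 qed
 moreover have "k 0 = h" by (simp add: k_def \<theta>_def o_def)
 moreover have "X (k 1) = X h - {a<..<b}"
 proof -
  have "k 1 (of_real x) = h (Complex x (sd * ta x))" for x by (simp add: k_def \<theta>_def)
  moreover have "Complex x (sd * ta x) = of_real x" if "x \<notin> {a<..<b}" for x
   using ta(3)[OF that] by (simp add: complex_eq_iff)
  ultimately have "x \<in> X (k 1) \<longleftrightarrow> x \<in> X h - {a<..<b}" for x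
   using free[of x] by (cases "x \<in> {a<..<b}") (auto simp: X_def)
  thus ?thesis by blast
 qed
 ultimately show ?thesis by metis
qed

definition reducible :: "(complex => complex) => bool" where
 "reducible h \<longleftrightarrow> (\<exists>h2. (h, h2) \<in> braid_isotopy n p & finite (X h2) & card (X h2) < card (X h))"

text \<open>The diagram near \<open>x\<close> is pushed into the free half of the small disc, and
  the crossing at \<open>x\<close> disappears.\<close>

lemma free_hdisc_reducible:
 assumes h: "h \<in> H" and fin: "finite (X h)" and x: "x \<in> X h" "-1 < x" "x < 1" and sd: "sd = 1 \<or> sd = -1" and "ro > 0"
  and free: "\<And>z. norm (z - of_real x) < ro ==> sd * Im z > 0 ==> Re (h z) \<notin> M"
 shows "reducible h"
proof -
 have "finite (p ` {1..n})" by simp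
 from finite_set_avoid[OF this, of x] obtain d where d: "d > 0" "\<And>y. y \<in> p ` {1..n} ==> y ~= x ==> d <= dist x y"
  by blast
 define eps where "eps = min d (min (ro / 2) ((1 - \<bar>x\<bar>) / 2)) / 2"
 have eps: "0 < eps" "eps <= d" "2 * eps < ro" "\<bar>x\<bar> + 2 * eps < 1"
  using d(1) \<open>ro > 0\<close> x by (auto simp: eps_def min_def abs_if field_simps split: if_splits)
 \<comment> \<open>A parabolic cap over the interval of half-width \<open>eps\<close> about
   \<open>x\<close>, of height \<open>eps / 2\<close>: its graph stays within
   \<open>2 eps < ro\<close> of \<open>x\<close>, and its values stay below the height
   \<open>eps\<close> of the box.\<close>
 define ta where "ta = (\<lambda>u. max 0 (eps\<^sup>2 - (u - x)\<^sup>2) / (2 * eps))"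
 have tale: "ta u <= eps / 2" for u
 proof -
  have "max 0 (eps\<^sup>2 - (u - x)\<^sup>2) <= eps\<^sup>2" by simp
  hence "ta u <= eps\<^sup>2 / (2 * eps)" unfolding ta_def using eps by (intro divide_right_mono) auto
  thus ?thesis using eps by (simp add: power2_eq_square)
 qed
 have sq: "(u - x)\<^sup>2 < eps\<^sup>2 \<longleftrightarrow> u \<in> {x - eps<..<x + eps}" for u
  using abs_le_square_iff[of eps "u - x"] eps(1) by (auto simp: abs_if not_le[symmetric] split: if_splits)
 have tapos: "ta u > 0" if "u \<in> {x - eps<..<x + eps}" for u
  using that sq[of u] eps(1) by (simp add: ta_def)
 have "\<exists>h2. (h, h2) \<in> braid_isotopy n p & X h2 = X h - {x - eps<..<x + eps}"
 proof (rule push[OF h sd, of _ _ ta eps])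
  show "p s \<notin> {x - eps<..<x + eps}" if "s \<in> {1..n}" for s
  proof -
   have "p s ~= x" using X_puncture[OF h that] x(1) by auto
   hence "d <= dist x (p s)" using d(2) that by blast
   thus ?thesis using eps(2) by (auto simp: dist_real_def)
  qed
  show "continuous_on UNIV ta" unfolding ta_def using eps(1) by (intro continuous_intros) auto
  show "0 <= ta u" for u unfolding ta_def using eps(1) by simp
  show "ta u = 0" if "u \<notin> {x - eps<..<x + eps}" for u 
  proof -
   have "eps\<^sup>2 - (u - x)\<^sup>2 <= 0" using that sq[of u] by (metis not_less diff_le_0_iff_le)
   thus ?thesis by (simp add: ta_def)
  qed
  show "ta u < eps" for u using tale[of u] eps(1) by linarith
  show "norm (Complex u v) < 1" if "u \<in> {x - eps<..<x + eps}" "\<bar>v\<bar> <= eps" for u v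
  proof -
   have "norm (Complex u v) <= \<bar>u\<bar> + \<bar>v\<bar>" using cmod_le[of "Complex u v"] by simp
   moreover have "\<bar>u\<bar> < \<bar>x\<bar> + eps" using that(1) by auto
   ultimately show ?thesis using that(2) eps(4) by linarith
  qed
  show "Re (h (Complex u (sd * ta u))) \<notin> M" if "u \<in> {x - eps<..<x + eps}" for u
  proof (rule free)
   have "norm (Complex u (sd * ta u) - of_real x) <= \<bar>u - x\<bar> + \<bar>sd * ta u\<bar>"
    using cmod_le[of "Complex u (sd * ta u) - of_real x"] by simp
   also have "\<dots> < eps + eps" using that tale[of u] tapos[OF that] sd eps(1) by (auto simp: abs_mult abs_if)
   finally show "norm (Complex u (sd * ta u) - of_real x) < ro" using eps(3) by simp
   show "sd * Im (Complex u (sd * ta u)) > 0" using sd tapos[OF that] by auto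
  qed
 qed
 then obtain h2 where h2: "(h, h2) \<in> braid_isotopy n p" "X h2 = X h - {x - eps<..<x + eps}" by blast
 have "x \<notin> X h2" using h2(2) eps(1) by simp
 hence "X h2 \<subset> X h" using h2(2) x(1) by blast
 thus ?thesis unfolding reducible_def using h2(1) psubset_card_mono[OF fin] finite_subset[OF _ fin] by blast
qed

lemma M_gap: "\<exists>de>0. \<forall>i\<le>n. \<forall>j\<le>n. \<bar>m i - m j\<bar> < de \<longrightarrow> i = j"
proof -
 define S where "S = (\<lambda>(i, j). \<bar>m i - m j\<bar>) ` {(i, j). i <= n & j <= n & i ~= j}"
 have "{(i, j). i <= n & j <= n & i ~= j} <= {..n} \<times> {..n}" by auto
 hence "finite S" unfolding S_def by (intro finite_imageI) (erule finite_subset, intro finite_SigmaI finite_atMost)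
 from finite_set_avoid[OF this, of 0] obtain de where de: "de > 0" "\<And>y. y \<in> S ==> y ~= 0 ==> de <= dist 0 y" by blast
 show ?thesis
 proof (intro exI conjI allI impI)
  show "de > 0" by (rule de(1))
  fix i j assume ij: "i <= n" "j <= n" "\<bar>m i - m j\<bar> < de"
  show "i = j"
  proof (rule ccontr)
   assume "i ~= j"
   hence "\<bar>m i - m j\<bar> \<in> S" "m i ~= m j" using ij m_eq by (auto simp: S_def)
   hence "de <= dist 0 \<bar>m i - m j\<bar>" by (intro de(2)) auto
   thus False using ij(3) by (simp add: dist_real_def)
  qed
 qed
qed

text \<open>Near \<open>x\<close> the preimage of the line lies on the side \<open>sd\<close> of the
  diagram, and the other lines are too far away, so the half-disc on the opposite side is
  free.\<close>

lemma lamination_touch_reducible: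
 assumes h: "h \<in> H" and fin: "finite (X h)" and x: "x \<in> X h" "-1 < x" "x < 1" and j: "j <= n" "Re (h (of_real x)) = m j"
  and sd: "sd = 1 \<or> sd = -1" and "eps > 0"
  and touch: "\<And>v. 0 < \<bar>v - Im (h (of_real x))\<bar> ==> \<bar>v - Im (h (of_real x))\<bar> < eps ==> sd * Im (inv h (Complex (m j) v)) > 0"
 shows "reducible h"
proof -
 obtain de where de: "de > 0" "\<And>i j. i <= n ==> j <= n ==> \<bar>m i - m j\<bar> < de ==> i = j" using M_gap by metis
 have "continuous_on UNIV h" using bhD(1)[OF h] .
 then obtain ro where ro: "ro > 0" "\<And>z. dist z (of_real x) < ro ==> dist (h z) (h (of_real x)) < min eps de"
  using \<open>eps > 0\<close> de(1) unfolding continuous_on_iff by (metis UNIV_I min_less_iff_conj)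
 show ?thesis
 proof (rule free_hdisc_reducible[OF h fin x _ ro(1), of "- sd"])
  show "- sd = 1 \<or> - sd = -1" using sd by auto
  fix z assume z: "norm (z - of_real x) < ro" "- sd * Im z > 0"
  show "Re (h z) \<notin> M"
  proof
   assume "Re (h z) \<in> M"
   then obtain i where i: "i <= n" "Re (h z) = m i" by auto
   have d: "norm (h z - h (of_real x)) < min eps de" using ro(2)[of z] z(1) by (simp add: dist_norm)
   have "\<bar>m i - m j\<bar> <= norm (h z - h (of_real x))" using abs_Re_le_cmod[of "h z - h (of_real x)"] i j by simp
   hence "\<bar>m i - m j\<bar> < de" using d by linarith
   hence ij: "i = j" using de(2) i(1) j(1) by blast
   have hz: "h z = Complex (m j) (Im (h z))" using i ij by (simp add: complex_eq_iff)
   have "Im (h z) ~= Im (h (of_real x))"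
   proof
    assume "Im (h z) = Im (h (of_real x))"
    hence "h z = h (of_real x)" using i ij j by (simp add: complex_eq_iff)
    hence "z = of_real x" by (rule injD[OF bhD(2)[OF h]])
    thus False using z(2) by simp
   qed
   moreover have "\<bar>Im (h z) - Im (h (of_real x))\<bar> < eps"
    using abs_Im_le_cmod[of "h z - h (of_real x)"] d by simp
   ultimately have "sd * Im (inv h (h z)) > 0" using touch[of "Im (h z)"] hz by simp
   thus False using z(2) bh_inv(1)[OF h] by simp
  qed
 qed
qed

text \<open>Near the touching point the diagram lies on one side of the line. The half-ball on the
  other side, together with the line but without the touching point, is connected and avoids the
  diagram, so \<open>inv h\<close> maps it to one side of the real axis. Hence the small half-disc
  at \<open>x\<close> on the other side of the axis contains no preimage of the line.\<close>

lemma diagram_touch_reducible: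
 assumes h: "h \<in> H" and fin: "finite (X h)" and x: "x \<in> X h" "-1 < x" "x < 1" and j: "j <= n" "Re (h (of_real x)) = m j"
  and ta: "ta = 1 \<or> ta = -1" and "eps > 0"
  and touch: "\<And>u. 0 < \<bar>u - x\<bar> ==> \<bar>u - x\<bar> < eps ==> ta * (Re (h (of_real u)) - m j) < 0"
 shows "reducible h"
proof -
 note hD = bhD[OF h] and hi = bh_inv[OF h]
 define z0 where "z0 = h (of_real x)"
 obtain de1 where de1: "de1 > 0" "\<And>i j. i <= n ==> j <= n ==> \<bar>m i - m j\<bar> < de1 ==> i = j" using M_gap by metis
 define F where "F = (\<lambda>u. h (of_real u)) ` ({-1..1} - {x - eps<..<x + eps})"
 have "compact ({-1..1} - {x - eps<..<x + eps})" by (intro compact_diff) auto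
 hence "compact F" unfolding F_def
  by (intro compact_continuous_image continuous_on_compose2[OF hD(1)[of UNIV]] continuous_intros) auto
 moreover have "z0 \<notin> F" 
 proof
  assume "z0 \<in> F"
  then obtain u where u: "u \<notin> {x - eps<..<x + eps}" "h (of_real u) = h (of_real x)" unfolding F_def z0_def by force
  have "complex_of_real u = of_real x" by (rule injD[OF hD(2) u(2)])
  thus False using u(1) \<open>eps > 0\<close> by simp
 qed
 ultimately obtain de2 where de2: "de2 > 0" "ball z0 de2 <= - F"
  using open_contains_ball[of "- F"] by (metis ComplI compact_imp_closed open_Compl)
 have "norm z0 < 1" unfolding z0_def by (rule norm_inner[OF h x(2,3)])
 hence "z0 \<in> ball 0 1" by simp
 then obtain de3 where de3: "de3 > 0" "ball z0 de3 <= ball 0 1" using open_contains_ball[of "ball 0 1"] by blast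
 define de where "de = min de1 (min de2 de3)"
 have de: "de > 0" "de <= de1" "ball z0 de <= - F" "ball z0 de <= ball 0 1"
  using de1 de2 de3 subset_ball[of de de2 z0] subset_ball[of de de3 z0] by (auto simp: de_def)
 have Rez0: "Re z0 = m j" using j by (simp add: z0_def)
 define T0 where "T0 = ball z0 de \<inter> {w. 0 < ta * (Re w - m j)}"
 define T where "T = ball z0 de \<inter> {w. 0 <= ta * (Re w - m j)} - {z0}"
 have "convex {w. 0 < ta * (Re w - m j)}"
  using ta convex_halfspace_Re_gt[of "m j"] convex_halfspace_Re_lt[of "m j"] by auto
 hence conT0: "connected T0" unfolding T0_def by (intro convex_connected convex_Int convex_ball)
 have sub: "T0 <= T" using Rez0 by (auto simp: T0_def T_def)
 have "T <= closure T0"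
 proof
  fix w assume w: "w \<in> T"
  hence wd: "dist z0 w < de" "0 <= ta * (Re w - m j)" by (auto simp: T_def)
  show "w \<in> closure T0" unfolding closure_approachable
  proof (intro allI impI)
   fix e :: real assume "e > 0"
   define r where "r = min e (de - dist z0 w) / 2"
   have r: "r > 0" "r < e" "r < de - dist z0 w" using \<open>e > 0\<close> wd by (auto simp: r_def min_def field_simps)
   have dw: "dist w (w + of_real (ta * r)) = r" using ta r by (auto simp: dist_norm)
   have "dist z0 (w + of_real (ta * r)) < de" using dist_triangle[of z0 "w + of_real (ta * r)" w] dw r(3) by linarith
   moreover have "ta * (Re (w + of_real (ta * r)) - m j) = ta * (Re w - m j) + r" using ta by (auto simp: algebra_simps)
   ultimately have "w + of_real (ta * r) \<in> T0" using wd(2) r(1) by (simp add: T0_def)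
   thus "\<exists>y\<in>T0. dist y w < e" using dw r(2) by (metis dist_commute)
  qed
 qed
 hence conT: "connected T" using connected_intermediate_closure[OF conT0 sub] by blast
 have TA: "Im (inv h w) ~= 0" if w: "w \<in> T" for w
 proof
  assume I0: "Im (inv h w) = 0"
  define u where "u = Re (inv h w)"
  have wu: "inv h w = of_real u" using I0 by (simp add: u_def complex_eq_iff)
  hence hw: "w = h (of_real u)" using hi(2)[of w] by simp
  have wb: "w \<in> ball z0 de" "0 <= ta * (Re w - m j)" "w ~= z0" using w by (auto simp: T_def)
  have "norm w < 1" using wb(1) de(4) by auto
  hence "norm (complex_of_real u) < 1" using bh_norm(1)[OF h] hw by metis
  hence u1: "u \<in> {-1..1}" by auto
  have "w \<notin> F" using wb(1) de(3) by blast
  hence "\<bar>u - x\<bar> < eps" using hw u1 by (auto simp: F_def abs_less_iff)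
  moreover have "u ~= x" using wb(3) hw by (auto simp: z0_def)
  ultimately have "ta * (Re w - m j) < 0" using touch[of u] hw by simp
  thus False using wb(2) by simp
 qed
 have "connected (inv h ` T)" by (intro connected_continuous_image hi(3) conT)
 moreover have "inv h ` T <= {z. Im z < 0} Un {z. Im z > 0}" using TA by force
 moreover have "{z. Im z < 0} \<inter> {z. Im z > 0} \<inter> inv h ` T = {}" by auto
 ultimately have "{z. Im z < 0} \<inter> inv h ` T = {} \<or> {z. Im z > 0} \<inter> inv h ` T = {}"
  by (intro connectedD) (simp_all add: open_halfspace_Im_lt open_halfspace_Im_gt)
 then obtain sd :: real where sd: "sd = 1 \<or> sd = -1" "\<And>w. w \<in> T ==> sd * Im (inv h w) <= 0"
 proof
  assume e: "{z. Im z < 0} \<inter> inv h ` T = {}"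
  have "Im (inv h w) \<ge> 0" if "w \<in> T" for w using e imageI[OF that, of "inv h"] unfolding disjoint_iff by (metis mem_Collect_eq not_less)
  thus thesis using that[of "-1"] by simp
 next
  assume e: "{z. Im z > 0} \<inter> inv h ` T = {}"
  have "Im (inv h w) <= 0" if "w \<in> T" for w using e imageI[OF that, of "inv h"] unfolding disjoint_iff by (metis mem_Collect_eq not_less)
  thus thesis using that[of 1] by simp
 qed
 have "continuous_on UNIV h" using hD(1) .
 then obtain ro where ro: "ro > 0" "\<And>z. dist z (of_real x) < ro ==> dist (h z) z0 < de"
  using de(1) unfolding continuous_on_iff z0_def by (metis UNIV_I)
 show ?thesis
 proof (rule free_hdisc_reducible[OF h fin x sd(1) ro(1)])
  fix z assume z: "norm (z - of_real x) < ro" "sd * Im z > 0"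
  have b: "dist z0 (h z) < de" using ro(2)[of z] z(1) by (simp add: dist_norm norm_minus_commute)
  have "h z ~= z0"
  proof
   assume "h z = z0"
   hence "z = of_real x" unfolding z0_def by (rule injD[OF hD(2)])
   thus False using z(2) by simp
  qed
  hence nT: "\<not> 0 <= ta * (Re (h z) - m j)" using sd(2)[of "h z"] z(2) hi(1)[of z] b by (auto simp: T_def)
  show "Re (h z) \<notin> M"
  proof
   assume "Re (h z) \<in> M"
   then obtain i where i: "i <= n" "Re (h z) = m i" by auto
   have "\<bar>m i - m j\<bar> <= dist (h z) z0" using abs_Re_le_cmod[of "h z - z0"] i Rez0 by (simp add: dist_norm)
   hence "i = j" using de1(2)[OF i(1) j(1)] b de(2) by (simp add: dist_commute)
   thus False using nT i by simp
  qed
 qed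
qed


definition consec :: "real set => real => real => bool" where
 "consec S v w \<longleftrightarrow> v \<in> S & w \<in> S & v < w & S \<inter> {v<..<w} = {}"

lemma consec_around:
 assumes "finite S" "a \<in> S" "b \<in> S" "a < x" "x < b" "x \<notin> S"
 obtains v w where "consec S v w" "v < x" "x < w"
proof -
 define v where "v = Max {u \<in> S. u < x}"
 define w where "w = Min {u \<in> S. x < u}"
 have v: "v \<in> {u \<in> S. u < x}" unfolding v_def using assms by (intro Max_in) auto
 have w: "w \<in> {u \<in> S. x < u}" unfolding w_def using assms by (intro Min_in) auto
 have "u <= v" if "u \<in> S" "u < x" for u unfolding v_def using assms(1) that by (intro Max_ge) auto
 moreover have "w <= u" if "u \<in> S" "x < u" for u unfolding w_def using assms(1) that by (intro Min_le) auto
 ultimately have "S \<inter> {v<..<w} = {}" using assms(6) by (fastforce simp: not_less[symmetric])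
 thus thesis using that[of v w] v w by (simp add: consec_def)
qed

section \<open>Heights of crossings on a line and chords of the half-discs\<close>

definition tp :: "nat => real" where "tp j = sqrt (1 - (m j)\<^sup>2)"

lemma norm_line:
 assumes j: "j \<in> {1..n - 1}"
 shows "tp j > 0" "norm (Complex (m j) v) < 1 \<longleftrightarrow> \<bar>v\<bar> < tp j" "norm (Complex (m j) v) = 1 \<longleftrightarrow> \<bar>v\<bar> = tp j"
proof -
 have "\<bar>m j\<bar> < 1" using m_bounds[of j] j by auto
 hence mj: "(m j)\<^sup>2 < 1" by (simp add: abs_square_less_1)
 thus tp: "tp j > 0" by (simp add: tp_def)
 have e: "(norm (Complex (m j) v))\<^sup>2 = 1 - ((tp j)\<^sup>2 - v\<^sup>2)" using mj by (simp add: cmod_power2 tp_def)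
 have "norm (Complex (m j) v) < 1 \<longleftrightarrow> (norm (Complex (m j) v))\<^sup>2 < 1" by (simp add: abs_square_less_1)
 also have "\<dots> \<longleftrightarrow> v\<^sup>2 < (tp j)\<^sup>2" unfolding e by simp
 also have "\<dots> \<longleftrightarrow> \<bar>v\<bar> < tp j" using abs_le_square_iff[of "tp j" v] tp by linarith
 finally show "norm (Complex (m j) v) < 1 \<longleftrightarrow> \<bar>v\<bar> < tp j" .
 have "norm (Complex (m j) v) = 1 \<longleftrightarrow> (norm (Complex (m j) v))\<^sup>2 = 1" 
  by (metis abs_norm_cancel abs_square_eq_1)
 also have "\<dots> \<longleftrightarrow> v\<^sup>2 = (tp j)\<^sup>2" unfolding e by linarith
 also have "\<dots> \<longleftrightarrow> \<bar>v\<bar> = tp j" using power2_eq_iff[of v "tp j"] tp by auto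
 finally show "norm (Complex (m j) v) = 1 \<longleftrightarrow> \<bar>v\<bar> = tp j" .
qed

text \<open>The heights of the crossings on line \<open>j\<close>, and the heights of its two points
  on the unit circle. With these included, consecutive heights bound all pieces of the line in the
  disc, also those that end on the circle.\<close>

definition V :: "(complex => complex) => nat => real set" where
 "V h j = {v. \<bar>v\<bar> <= tp j & (\<bar>v\<bar> = tp j \<or> Im (inv h (Complex (m j) v)) = 0)}"

lemma V_cases:
 assumes h: "h \<in> H" and j: "j \<in> {1..n - 1}" and v: "v \<in> V h j" "\<bar>v\<bar> ~= tp j"
 obtains x where "x \<in> X h" "-1 < x" "x < 1" "h (of_real x) = Complex (m j) v" "inv h (Complex (m j) v) = of_real x"
proof -
 define x where "x = Re (inv h (Complex (m j) v))"
 have ix: "inv h (Complex (m j) v) = of_real x" using v by (simp add: V_def x_def complex_eq_iff)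
 hence hx: "h (of_real x) = Complex (m j) v" using bh_inv(2)[OF h, of "Complex (m j) v"] by simp
 have "norm (h (of_real x)) < 1" unfolding hx norm_line(2)[OF j] using v by (auto simp: V_def)
 hence "norm (complex_of_real x) < 1" using bh_norm(1)[OF h] by blast
 hence "-1 < x" "x < 1" by auto
 moreover have "m j \<in> M" using j by auto
 ultimately show thesis using that[OF _ _ _ hx ix] by (simp add: X_def hx)
qed

lemma V_I:
 assumes h: "h \<in> H" and j: "j \<in> {1..n - 1}" and x: "x \<in> X h" "Re (h (of_real x)) = m j"
 shows "Im (h (of_real x)) \<in> V h j" "\<bar>Im (h (of_real x))\<bar> < tp j" "-1 < x" "x < 1"
proof -
 have e: "Complex (m j) (Im (h (of_real x))) = h (of_real x)" using x(2) by (simp add: complex_eq_iff)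
 have "x ~= -1" "x ~= 1" using m_bounds[of j] j x(2) bhD(6,7)[OF h] by auto
 thus x1: "-1 < x" "x < 1" using x(1) by (auto simp: X_def)
 show l: "\<bar>Im (h (of_real x))\<bar> < tp j"
  using norm_inner[OF h x1] norm_line(2)[OF j, of "Im (h (of_real x))"] unfolding e by blast
 show "Im (h (of_real x)) \<in> V h j" unfolding V_def using l e bh_inv(1)[OF h] by auto
qed

lemma V_finite:
 assumes h: "h \<in> H" "finite (X h)" and j: "j \<in> {1..n - 1}"
 shows "finite (V h j)" "tp j \<in> V h j" "- tp j \<in> V h j" "V h j <= {- tp j..tp j}"
proof -
 have "V h j <= {tp j, - tp j} Un (\<lambda>x. Im (h (of_real x))) ` X h"
 proof
  fix v assume v: "v \<in> V h j"
  show "v \<in> {tp j, - tp j} Un (\<lambda>x. Im (h (of_real x))) ` X h"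
  proof (cases "\<bar>v\<bar> = tp j")
   case False
   obtain x where "x \<in> X h" "h (of_real x) = Complex (m j) v" by (rule V_cases[OF h(1) j v False])
   thus ?thesis by (intro UnI2 rev_image_eqI[of x]) auto
  qed (auto simp: abs_if split: if_splits)
 qed
 thus "finite (V h j)" by (rule finite_subset) (use h(2) in simp)
 show "tp j \<in> V h j" "- tp j \<in> V h j" "V h j <= {- tp j..tp j}" using norm_line(1)[OF j] by (auto simp: V_def)
qed

lemma consec_side:
 assumes h: "h \<in> H" and j: "j \<in> {1..n - 1}" and vw: "consec (V h j) v w"
 shows "\<exists>sd::real. (sd = 1 \<or> sd = -1) & (\<forall>u. v < u \<longrightarrow> u < w \<longrightarrow> 0 < sd * Im (inv h (Complex (m j) u)))"
proof -
 define f where "f = (\<lambda>u. Im (inv h (Complex (m j) u)))"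
 have "continuous_on {v<..<w} f" unfolding f_def
  by (intro continuous_intros continuous_on_compose2[OF bh_inv(3)[OF h, of UNIV]]) auto
 hence con: "connected (f ` {v<..<w})" by (intro connected_continuous_image) auto
 have v0: "\<bar>v\<bar> <= tp j" "\<bar>w\<bar> <= tp j" "v < w" using vw by (auto simp: consec_def V_def)
 have nz: "f u ~= 0" if "v < u" "u < w" for u
 proof
  assume "f u = 0"
  hence "u \<in> V h j" using that v0 by (simp add: V_def f_def)
  thus False using that vw by (auto simp: consec_def)
 qed
 define u0 where "u0 = (v + w) / 2"
 have u0: "v < u0" "u0 < w" using v0 by (auto simp: u0_def)
 have "0 < sgn (f u0) * f u" if u: "v < u" "u < w" for u
 proof (rule ccontr)
  assume c: "\<not> 0 < sgn (f u0) * f u"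
  have "f u \<in> f ` {v<..<w}" "f u0 \<in> f ` {v<..<w}" using u u0 by auto
  moreover have "f u <= 0 & 0 <= f u0 \<or> f u0 <= 0 & 0 <= f u" using c nz[OF u0] by (auto simp: sgn_if split: if_splits)
  ultimately have "0 \<in> f ` {v<..<w}" using connectedD_interval[OF con] by metis
  thus False using nz by force
 qed
 moreover have "sgn (f u0) = 1 \<or> sgn (f u0) = -1" using nz[OF u0] by (auto simp: sgn_if)
 ultimately show ?thesis unfolding f_def by blast
qed

text \<open>For consecutive heights this is a chord of one half-disc. Such chords form the skeleton
  along which homeomorphisms of the half-disc are prescribed.\<close>

definition ch :: "(complex => complex) => nat => real => real => complex set" where
 "ch h j v w = (\<lambda>u. inv h (Complex (m j) u)) ` {v..w}"

definition chords :: "(complex => complex) => real => complex set set" where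
 "chords h sd = {ch h j v w |j v w. j \<in> {1..n - 1} & consec (V h j) v w &
  (\<forall>u. v < u \<longrightarrow> u < w \<longrightarrow> 0 < sd * Im (inv h (Complex (m j) u)))}"

lemma finite_chords:
 assumes "h \<in> H" "finite (X h)"
 shows "finite (chords h sd)"
proof -
 have "chords h sd <= (\<Union>j\<in>{1..n - 1}. (\<lambda>(v, w). ch h j v w) ` (V h j \<times> V h j))"
  unfolding chords_def consec_def by fastforce
 moreover have "finite (\<Union>j\<in>{1..n - 1}. (\<lambda>(v, w). ch h j v w) ` (V h j \<times> V h j))"
  by (intro finite_UN_I finite_imageI finite_cartesian_product V_finite(1)[OF assms]) auto
 ultimately show ?thesis by (rule finite_subset)
qed

lemma vline_arc: "v < w ==> is_arc (Complex r ` {v..w}) (Complex r v) (Complex r w)"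
proof -
 assume vw: "v < w"
 have "Complex r ` {v..w} = closed_segment (Complex r v) (Complex r w)"
 proof -
  have "(\<lambda>t. Complex r ((1 - t) * v + t * w)) ` {0..1} = Complex r ` ((\<lambda>t. (1 - t) * v + t * w) ` {0..1})"
   by (simp add: image_image)
  also have "(\<lambda>t. (1 - t) * v + t * w) ` {0..1} = {v..w}"
   using closed_segment_eq_real_ivl1[of v w] vw by (simp add: closed_segment_image_interval)
  finally have "Complex r ` {v..w} = (\<lambda>t. Complex r ((1 - t) * v + t * w)) ` {0..1}" ..
  also have "\<dots> = closed_segment (Complex r v) (Complex r w)"
   unfolding closed_segment_image_interval by (intro image_cong) (auto simp: complex_eq_iff algebra_simps)
  finally show ?thesis .
 qed
 moreover have "Complex r v ~= Complex r w" using vw by simp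
 ultimately show ?thesis using is_arc_segment by metis
qed

lemma ch_arc:
 assumes "h \<in> H" "v < w"
 shows "is_arc (ch h j v w) (inv h (Complex (m j) v)) (inv h (Complex (m j) w))"
 using is_arc_image[OF vline_arc[OF assms(2)] bh_inv(3,4)[OF assms(1)]] by (simp add: ch_def image_image)

lemma chord_ends_rim:
 assumes h: "h \<in> H" and j: "j \<in> {1..n - 1}" and vw: "v < w" and sd: "sd = 1 \<or> sd = -1"
  and side: "\<And>u. v < u ==> u < w ==> 0 < sd * Im (inv h (Complex (m j) u))"
  and e: "e = v \<or> e = w" "e \<in> V h j"
 shows "inv h (Complex (m j) e) \<in> hrim sd"
proof -
 have "{v<..<w} <= {u. 0 <= sd * Im (inv h (Complex (m j) u))}" using side by (auto intro: less_imp_le)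
 moreover have "closed {u. 0 <= sd * Im (inv h (Complex (m j) u))}"
  by (intro closed_Collect_le continuous_intros continuous_on_compose2[OF bh_inv(3)[OF h, of UNIV]]) auto
 ultimately have "closure {v<..<w} <= {u. 0 <= sd * Im (inv h (Complex (m j) u))}" by (rule closure_minimal)
 moreover have "e \<in> closure {v<..<w}" using e(1) vw by auto
 ultimately have 0: "0 <= sd * Im (inv h (Complex (m j) e))" by blast
 have n: "norm (h (inv h (Complex (m j) e))) = norm (Complex (m j) e)" by (simp add: bh_inv(2)[OF h])
 have "\<bar>e\<bar> <= tp j" "\<bar>e\<bar> = tp j \<or> Im (inv h (Complex (m j) e)) = 0" using e(2) by (auto simp: V_def)
 moreover have "norm (inv h (Complex (m j) e)) = 1 \<longleftrightarrow> \<bar>e\<bar> = tp j"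
  using bh_norm(2)[OF h, of "inv h (Complex (m j) e)"] n norm_line(3)[OF j, of e] by simp
 moreover have "norm (inv h (Complex (m j) e)) < 1 \<longleftrightarrow> \<bar>e\<bar> < tp j"
  using bh_norm(1)[OF h, of "inv h (Complex (m j) e)"] n norm_line(2)[OF j, of e] by simp
 ultimately show ?thesis using 0 by (auto simp: hrim_def less_le)
qed

lemma chord_interior:
 assumes h: "h \<in> H" and j: "j \<in> {1..n - 1}" and vw: "consec (V h j) v w" and u: "v < u" "u < w"
 shows "norm (inv h (Complex (m j) u)) < 1"
proof -
 have "\<bar>u\<bar> < tp j" using vw u by (auto simp: consec_def V_def)
 thus ?thesis using bh_norm(1)[OF h, of "inv h (Complex (m j) u)"] norm_line(2)[OF j, of u]
  by (simp add: bh_inv(2)[OF h])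
qed

lemma chords_chord:
 assumes h: "h \<in> H" and sd: "sd = 1 \<or> sd = -1" and c: "c \<in> chords h sd"
 shows "chord (hrim sd) c"
proof -
 obtain j v w where j: "j \<in> {1..n - 1}" and vw: "consec (V h j) v w" and c: "c = ch h j v w"
  and side: "\<And>u. v < u ==> u < w ==> 0 < sd * Im (inv h (Complex (m j) u))"
  using c unfolding chords_def by blast
 have lt: "v < w" and V: "v \<in> V h j" "w \<in> V h j" using vw by (auto simp: consec_def)
 note rim = chord_ends_rim[OF h j lt sd side, simplified simp_thms implies_True_equals triv_forall_equality True_implies_equals]
 have 1: "inv h (Complex (m j) v) \<in> hrim sd" "inv h (Complex (m j) w) \<in> hrim sd" using rim V by simp_all
 have 2: "inv h (Complex (m j) u) \<in> inside (hrim sd)" if "v < u" "u < w" for u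
  using chord_interior[OF h j vw that] side[OF that] by (simp add: hd_Jordan(2)[OF sd])
 have 3: "inside (hrim sd) \<inter> hrim sd = {}" by (simp add: inside_no_overlap)
 have 4: "u = v \<or> u = w \<or> v < u & u < w" if "u \<in> {v..w}" for u using that by auto
 have "c - hrim sd <= inside (hrim sd)" unfolding c ch_def using 1 2 4 by blast
 moreover have "c \<inter> hrim sd = {inv h (Complex (m j) v), inv h (Complex (m j) w)}"
 proof
  show "c \<inter> hrim sd <= {inv h (Complex (m j) v), inv h (Complex (m j) w)}" unfolding c ch_def using 2 3 4 by blast
  show "{inv h (Complex (m j) v), inv h (Complex (m j) w)} <= c \<inter> hrim sd" unfolding c ch_def using 1 lt by auto
 qed
 ultimately show ?thesis unfolding chord_def using ch_arc[OF h lt] c by blast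
qed

lemma chords_cover:
 assumes h: "h \<in> H" "finite (X h)" and sd: "sd = 1 \<or> sd = -1" and z: "norm z < 1" "0 < sd * Im z" "Re (h z) \<in> M"
 shows "z \<in> \<Union>(chords h sd)"
proof -
 have n: "norm (h z) < 1" using z(1) bh_norm(1)[OF h(1)] by blast
 then obtain j where j: "j \<in> {1..n - 1}" "Re (h z) = m j" using M_inner[OF z(3)] Re_inner[OF n] by auto
 have e: "Complex (m j) (Im (h z)) = h z" using j(2) by (simp add: complex_eq_iff)
 have iz: "inv h (Complex (m j) (Im (h z))) = z" unfolding e by (rule bh_inv(1)[OF h(1)])
 have b: "\<bar>Im (h z)\<bar> < tp j" using n norm_line(2)[OF j(1), of "Im (h z)"] unfolding e by blast
 hence "Im (h z) \<notin> V h j" using z(2) iz by (auto simp: V_def)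
 note V = V_finite[OF h j(1)]
 obtain v w where vw: "consec (V h j) v w" "v < Im (h z)" "Im (h z) < w"
  using consec_around[OF V(1,3,2), of "Im (h z)"] b \<open>Im (h z) \<notin> V h j\<close> by (auto simp: abs_less_iff)
 obtain sd' where sd': "sd' = 1 \<or> sd' = -1" "\<And>u. v < u ==> u < w ==> 0 < sd' * Im (inv h (Complex (m j) u))"
  using consec_side[OF h(1) j(1) vw(1)] by metis
 have "0 < sd' * Im z" using sd'(2)[OF vw(2,3)] unfolding iz .
 hence "sd' = sd" using z(2) sd sd'(1) by auto
 hence "ch h j v w \<in> chords h sd" unfolding chords_def using j(1) vw(1) sd'(2) by blast
 moreover have "z \<in> ch h j v w" unfolding ch_def using iz vw(2,3) by (intro rev_image_eqI[of "Im (h z)"]) auto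
 ultimately show ?thesis by blast
qed

text \<open>At the height \<open>b\<close> the line then touches the diagram without crossing
  it.\<close>

lemma same_side_reducible:
 assumes h: "h \<in> H" "finite (X h)" and j: "j \<in> {1..n - 1}" and a: "consec (V h j) a b" "consec (V h j) b e"
  and sd: "sd = 1 \<or> sd = -1" and s: "\<And>u. a < u ==> u < b ==> 0 < sd * Im (inv h (Complex (m j) u))"
   "\<And>u. b < u ==> u < e ==> 0 < sd * Im (inv h (Complex (m j) u))"
 shows "reducible h"
proof -
 have b: "a < b" "b < e" "\<bar>a\<bar> <= tp j" "\<bar>e\<bar> <= tp j" "b \<in> V h j" using a by (auto simp: consec_def V_def)
 hence "\<bar>b\<bar> ~= tp j" by linarith
 then obtain x where x: "x \<in> X h" "-1 < x" "x < 1" "h (of_real x) = Complex (m j) b"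
  by (rule V_cases[OF h(1) j b(5)])
 show "reducible h"
 proof (rule lamination_touch_reducible[OF h(1,2) x(1,2,3) _ _ sd, of j "min (b - a) (e - b)"])
  show "j <= n" "Re (h (of_real x)) = m j" "min (b - a) (e - b) > 0" using j x(4) b by auto
  fix u assume u: "0 < \<bar>u - Im (h (of_real x))\<bar>" "\<bar>u - Im (h (of_real x))\<bar> < min (b - a) (e - b)"
  hence "a < u & u < b \<or> b < u & u < e" unfolding x(4) by (auto simp: abs_if split: if_splits)
  thus "0 < sd * Im (inv h (Complex (m j) u))" using s by blast
 qed
qed

text \<open>Two pieces can meet only if they belong to the same line, and then only in a common end.
  Lying in the same half-disc, they would make the line touch the diagram there.\<close>

lemma chords_disjoint:
 assumes h: "h \<in> H" "finite (X h)" "\<not> reducible h" and sd: "sd = 1 \<or> sd = -1"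
 shows "pairwise disjnt (chords h sd)"
proof (rule pairwiseI)
 fix c d assume c: "c \<in> chords h sd" and d: "d \<in> chords h sd" and ne: "c ~= d"
 obtain j v w where j: "j \<in> {1..n - 1}" and vw: "consec (V h j) v w" and c: "c = ch h j v w"
  and side: "\<And>u. v < u ==> u < w ==> 0 < sd * Im (inv h (Complex (m j) u))"
  using c unfolding chords_def by blast
 obtain j' v' w' where j': "j' \<in> {1..n - 1}" and vw': "consec (V h j') v' w'" and d: "d = ch h j' v' w'"
  and side': "\<And>u. v' < u ==> u < w' ==> 0 < sd * Im (inv h (Complex (m j') u))"
  using d unfolding chords_def by blast
 show "disjnt c d"
 proof (rule ccontr)
  assume "\<not> disjnt c d"
  then obtain z where z: "z \<in> c" "z \<in> d" by (auto simp: disjnt_def)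
  obtain u where u: "u \<in> {v..w}" "z = inv h (Complex (m j) u)" using z(1) unfolding c ch_def by blast
  obtain u' where u': "u' \<in> {v'..w'}" "z = inv h (Complex (m j') u')" using z(2) unfolding d ch_def by blast
  have "Complex (m j) u = Complex (m j') u'" using u(2) u'(2) injD[OF bh_inv(4)[OF h(1)]] by metis
  hence e: "u' = u" "m j = m j'" by simp_all
  have "j <= n" "j' <= n" using j j' by auto
  hence jj: "j' = j" using e(2) m_eq[of j j'] by blast
  have i: "v \<in> V h j" "w \<in> V h j" "v < w" "V h j \<inter> {v<..<w} = {}" using vw by (simp_all add: consec_def)
  have i': "v' \<in> V h j" "w' \<in> V h j" "v' < w'" "V h j \<inter> {v'<..<w'} = {}" using vw' jj by (simp_all add: consec_def)
  have "\<not> (v < v' & v' < w)" "\<not> (v < w' & w' < w)" using i(4) i'(1,2) by auto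
  moreover have "\<not> (v' < v & v < w')" "\<not> (v' < w & w < w')" using i'(4) i(1,2) by auto
  ultimately consider "v = v'" "w = w'" | "w = v'" | "w' = v" using i(3) i'(3) u(1) u'(1) e(1) by fastforce
  thus False
  proof cases
   case 1 thus False using ne c d jj by simp
  next
   case 2 thus False using same_side_reducible[OF h(1,2) j vw, of w' sd] h(3) sd vw' jj side side' by simp
  next
   case 3 thus False using same_side_reducible[OF h(1,2) j, of v' v w sd] h(3) sd vw vw' jj side side' by simp
  qed
 qed
qed

end

lemma is_arc_homeo:
 assumes A: "is_arc A a b" and B: "is_arc B a' b'"
 obtains f where "continuous_on A f" "inj_on f A" "f ` A = B" "f a = a'" "f b = b'"
proof -
 obtain g where g: "arc g" "path_image g = A" "pathstart g = a" "pathfinish g = b" using A unfolding is_arc_def by blast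
 obtain k where k: "arc k" "path_image k = B" "pathstart k = a'" "pathfinish k = b'" using B unfolding is_arc_def by blast
 obtain g' where "homeomorphism {0..1} A g g'" using homeomorphism_arc[OF g(1)] g(2) by blast
 hence h: "continuous_on A g'" "g' ` A = {0..1}" "\<And>t. t \<in> {0..1} ==> g' (g t) = t" "\<And>z. z \<in> A ==> g (g' z) = z"
  unfolding homeomorphism_def by simp_all
 have k': "continuous_on {0..1} k" "inj_on k {0..1}" "k ` {0..1} = B" using k unfolding arc_def path_def path_image_def by simp_all
 show thesis
 proof (rule that[of "k \<circ> g'"])
  show "continuous_on A (k \<circ> g')" using continuous_on_compose[OF h(1)] k'(1) h(2) by simp
  have "inj_on g' A" by (rule inj_on_inverseI[where g = g]) (rule h(4))
  thus "inj_on (k \<circ> g') A" using k'(2) h(2) by (intro comp_inj_on) simp_all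
  show "(k \<circ> g') ` A = B" unfolding image_comp[symmetric] h(2) by (rule k'(3))
  show "(k \<circ> g') a = a'" "(k \<circ> g') b = b'"
   using h(3)[of 0] h(3)[of 1] g(3,4) k(3,4) by (auto simp: pathstart_def pathfinish_def)
 qed
qed

section \<open>Gluing over the half-discs, and removal of bigons\<close>

context punctured_disc begin

lemma chord_in_disc:
 assumes sd: "sd = 1 \<or> sd = -1" and c: "chord (hrim sd) c"
 shows "c <= hdisc sd" "compact c"
proof -
 obtain a b where c: "is_arc c a b" "c - hrim sd <= inside (hrim sd)" using c unfolding chord_def by blast
 show "compact c" by (rule arc_facts(1)[OF c(1)])
 show "c <= hdisc sd" using c(2) unfolding hd_Jordan(3)[OF sd, symmetric] by blast
qed

text \<open>If points of the two halves have the same image, this image is real, so by the last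
  assumption one of the points is real. It belongs to both halves, and injectivity on one half
  applies.\<close>

lemma hdisc_glue:
 fixes F :: "complex => complex"
 assumes F: "\<And>sd. sd = 1 \<or> sd = -1 ==> continuous_on (hdisc sd) F & inj_on F (hdisc sd) & F ` hdisc sd = hdisc sd"
  and real: "\<And>z. norm z <= 1 ==> Im (F z) = 0 ==> Im z = 0"
 shows "continuous_on (cball 0 1) F" "inj_on F (cball 0 1)" "F ` cball 0 1 = cball 0 1"
proof -
 note hd = hd_Jordan[of 1, simplified] and hd' = hd_Jordan[of "-1", simplified]
 have DD: "hdisc 1 Un hdisc (-1) = cball 0 1" by (auto simp: hdisc_def)
 show "F ` cball 0 1 = cball 0 1" unfolding DD[symmetric] image_Un using F by simp
 show "continuous_on (cball 0 1) F" unfolding DD[symmetric]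
 proof (rule continuous_on_closed_Un)
  show "closed (hdisc 1)" "closed (hdisc (-1))"
   unfolding hd(3)[symmetric] hd'(3)[symmetric] using Jordan_facts(9)[OF hd(1)] Jordan_facts(9)[OF hd'(1)]
   by (auto intro: compact_imp_closed)
 qed (use F in auto)
 show "inj_on F (cball 0 1)"
 proof -
  have same: "z = z'" if "z \<in> hdisc sd" "z' \<in> hdisc sd" "F z = F z'" "sd = 1 \<or> sd = -1" for z z' sd
   using F[OF that(4)] that(1-3) by (meson inj_onD)
  have mixed: "z = z'" if z: "z \<in> hdisc 1" "z' \<in> hdisc (-1)" "F z = F z'" for z z'
  proof -
   have "F z \<in> hdisc 1" "F z' \<in> hdisc (-1)" using F[of 1] F[of "-1"] imageI[OF z(1), of F] imageI[OF z(2), of F] by simp_all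
   hence "Im (F z') = 0" using z(3) by (simp add: hdisc_def)
   hence "Im z' = 0" using real[of z'] z(2) by (simp add: hdisc_def)
   thus ?thesis using same[of z 1 z'] z by (simp add: hdisc_def)
  qed
  show ?thesis unfolding DD[symmetric]
  proof (rule inj_onI)
   fix z z' assume "z \<in> hdisc 1 Un hdisc (-1)" "z' \<in> hdisc 1 Un hdisc (-1)" and e: "F z = F z'"
   then consider "z \<in> hdisc 1" "z' \<in> hdisc 1" | "z \<in> hdisc (-1)" "z' \<in> hdisc (-1)"
    | "z \<in> hdisc 1" "z' \<in> hdisc (-1)" | "z \<in> hdisc (-1)" "z' \<in> hdisc 1" by blast
   thus "z = z'"
   proof cases
    case 1 thus ?thesis using same[of z 1 z'] e by simp
   next
    case 2 thus ?thesis using same[of z "-1" z'] e by simp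
   next
    case 3 thus ?thesis using mixed e by simp
   next
    case 4 thus ?thesis using mixed[of z' z] e by simp
   qed
  qed
 qed
qed

text \<open>The cells are the two half-discs. All punctures lie on the diameter, hence in the
  skeleton, so it suffices to deform the values of \<open>F\<close> on the diameter and the circle
  to the identity while the punctures and \<open>1\<close>, \<open>-1\<close> stay fixed.\<close>

lemma precompose_isotopy:
 fixes F :: "complex => complex" and b :: "real => complex => complex"
 assumes h: "h \<in> H"
  and F: "\<And>sd. sd = 1 \<or> sd = -1 ==> continuous_on (hdisc sd) F & inj_on F (hdisc sd) & F ` hdisc sd = hdisc sd"
  and real: "\<And>z. norm z <= 1 ==> Im (F z) = 0 ==> Im z = 0"
  and b: "joint_cont ((hrim 1 Un hrim (-1))) b"
   "\<And>t. t \<in> {0..1} ==> inj_on (b t) (hrim 1 Un hrim (-1))"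
   "\<And>t sd. t \<in> {0..1} ==> sd = 1 \<or> sd = -1 ==> b t ` hrim sd = hrim sd"
   "\<And>z. z \<in> hrim 1 Un hrim (-1) ==> b 0 z = z" "\<And>z. z \<in> hrim 1 Un hrim (-1) ==> b 1 z = F z"
  and fixed: "\<And>t z. t \<in> {0..1} ==> z \<in> punctures n p Un {1, -1} ==> b t z = z"
  and circ: "\<And>t. t \<in> {0..1} ==> b t ` sphere 0 1 = sphere 0 1"
 shows "(h, radial (\<lambda>z. h (F z))) \<in> braid_isotopy n p"
proof -
 note hd = hd_Jordan[of 1, simplified] and hd' = hd_Jordan[of "-1", simplified]
 have R: "(\<Union>i\<in>{1, -1}. hrim i) = hrim 1 Un hrim (-1)" by simp
 have DD: "hdisc 1 Un hdisc (-1) = cball 0 1" by (auto simp: hdisc_def)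
 have glue: "continuous_on (cball 0 1) F" "inj_on F (cball 0 1)"
  by (rule hdisc_glue[OF F real]; assumption)+
 obtain A :: "real => complex => complex" where A: "joint_cont (cball 0 1) A"
  "\<And>t. t \<in> {0..1} ==> inj_on (A t) (cball 0 1)" "\<And>t. t \<in> {0..1} ==> A t ` cball 0 1 = cball 0 1"
  "\<And>t z. t \<in> {0..1} ==> z \<in> (\<Union>i\<in>{1::real, -1}. hrim i) ==> A t z = b t z"
  "\<And>z. z \<in> cball 0 1 ==> A 0 z = z" "\<And>z. z \<in> cball 0 1 ==> A 1 z = F z"
 proof (rule cell_isotopy[of "{1, -1}" hrim "cball 0 1" F b "\<lambda>i. \<i> * of_real (i / 2)"])
  show "finite {1, -1::real}" by simp
  show "Jordan (hrim i)" if "i \<in> {1, -1}" for i using that hd(1) hd'(1) by auto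
  show "(\<Union>i\<in>{1, -1}. hrim i Un inside (hrim i)) = cball 0 1" using hd(3) hd'(3) DD by simp
  show "inside (hrim i) \<inter> (hrim k Un inside (hrim k)) = {}" if "i \<in> {1, -1}" "k \<in> {1, -1}" "i ~= k" for i k
   using hd_Jordan(2)[of i] hd_Jordan(3)[of k] that by (auto simp: hdisc_def)
  show "F ` (hrim i Un inside (hrim i)) = hrim i Un inside (hrim i)" if "i \<in> {1, -1}" for i
   using hd_Jordan(3)[of i] F[of i] that by auto
  show "\<i> * of_real (i / 2) \<in> inside (hrim i)" if "i \<in> {1, -1}" for i
   using hd_Jordan(2)[of i] that by auto
  show "joint_cont ((\<Union>i\<in>{1, -1}. hrim i)) b" unfolding R by (rule b(1))
  show "inj_on (b t) (\<Union>i\<in>{1, -1}. hrim i)" if "t \<in> {0..1}" for t unfolding R by (rule b(2)[OF that])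
  show "b t ` hrim i = hrim i" if "t \<in> {0..1}" "i \<in> {1, -1}" for t i using b(3)[of t i] that by blast
  show "b 0 z = z" "b 1 z = F z" if "z \<in> (\<Union>i\<in>{1, -1}. hrim i)" for z using that b(4,5) unfolding R by blast+
  show "continuous_on (cball 0 1) F" "inj_on F (cball 0 1)" by (fact glue)+
  fix A :: "real => complex => complex" assume "joint_cont (cball 0 1) A"
   "\<And>t. t \<in> {0..1} ==> inj_on (A t) (cball 0 1)" "\<And>t. t \<in> {0..1} ==> A t ` cball 0 1 = cball 0 1"
   "\<And>t z. t \<in> {0..1} ==> z \<in> (\<Union>i\<in>{1, -1}. hrim i) ==> A t z = b t z"
   "\<And>z. z \<in> cball 0 1 ==> A 0 z = z" "\<And>z. z \<in> cball 0 1 ==> A 1 z = F z"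
  thus thesis by (rule that[of A])
 qed
 have rims: "z \<in> (\<Union>i\<in>{1, -1}. hrim i)" if "norm z <= 1" "norm z = 1 \<or> Im z = 0" for z
  using that unfolding R hrim_def by auto
 define k where "k = (\<lambda>t z. h (A t z))"
 note hD = bhD[OF h]
 have "(h, radial (k 1)) \<in> braid_isotopy n p"
 proof (rule disc_isotopy[OF valid h])
  show "joint_cont (cball 0 1) k" unfolding k_def
   by (rule continuous_on_compose2[OF hD(1)[of UNIV] A(1)]) simp
  show "k 0 z = h z" if "norm z <= 1" for z using A(5)[of z] that by (simp add: k_def)
  fix t :: real assume t: "t \<in> {0..1}"
  have kk: "k t ` S = h ` A t ` S" for S by (simp add: k_def image_image)
  show "inj_on (k t) (cball 0 1)" unfolding k_def
   using comp_inj_on[OF A(2)[OF t] inj_on_subset[OF hD(2) subset_UNIV]] by (simp add: o_def)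
  show "k t ` cball 0 1 = cball 0 1"
   unfolding kk A(3)[OF t] by (rule braid_homeo_cball[OF h])
  have "A t ` sphere 0 1 = b t ` sphere 0 1" by (intro image_cong A(4)[OF t rims]) auto
  thus "k t ` sphere 0 1 = sphere 0 1" unfolding kk using circ[OF t] hD(5) by simp
  have fA: "A t z = z" if z: "z \<in> punctures n p Un {1, -1}" for z
  proof -
   have "norm z <= 1 & Im z = 0" using z punctures_in_ball[OF valid, of z] by (auto simp: punctures_def)
   thus ?thesis using A(4)[OF t rims] fixed[OF t z] by simp
  qed
  have "A t ` punctures n p = punctures n p" using fA by simp
  thus "k t ` punctures n p = punctures n p" unfolding kk using hD(4) by simp
  show "k t 1 = 1" "k t (-1) = -1" using fA[of 1] fA[of "-1"] hD(6,7) by (simp_all add: k_def)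
 qed
 moreover have "radial (k 1) = radial (\<lambda>z. h (F z))" by (rule radial_cong) (simp add: k_def A(6))
 ultimately show ?thesis by simp
qed

text \<open>Redraw the arc of the lamination bounding the bigon as a parabola close to the diagram, then push the
 diagram across it.\<close>

lemma bigon_reducible:
 assumes h: "h \<in> H" "finite (X h)" and xy: "consec (X h) x y" and noP: "\<And>s. s \<in> {1..n} ==> p s \<notin> {x<..<y}"
  and j: "j \<in> {1..n - 1}" "Re (h (of_real x)) = m j" "Re (h (of_real y)) = m j"
  and vw: "consec (V h j) v w" "{v, w} = {Im (h (of_real x)), Im (h (of_real y))}"
 shows "reducible h"
proof (rule ccontr)
 assume tight: "\<not> reducible h"
 have x: "x \<in> X h" and y: "y \<in> X h" and lt: "x < y" and gap: "X h \<inter> {x<..<y} = {}" using xy by (auto simp: consec_def)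
 note Vx = V_I[OF h(1) j(1) x j(2)] and Vy = V_I[OF h(1) j(1) y j(3)]
 obtain sd :: real where sd: "sd = 1 \<or> sd = -1" and side: "\<And>u. v < u ==> u < w ==> 0 < sd * Im (inv h (Complex (m j) u))"
  using consec_side[OF h(1) j(1) vw(1)] by metis
 note hd = hd_Jordan[OF sd]
 define c where "c = ch h j v w"
 define OT where "OT = chords h sd - {c}"
 have c: "c \<in> chords h sd" unfolding chords_def c_def using j(1) vw(1) side by blast
 have vlw: "v < w" using vw(1) by (simp add: consec_def)
 have cch: "chord (hrim sd) c" by (rule chords_chord[OF h(1) sd c])
 have xyrim: "of_real x \<in> hrim sd" "of_real y \<in> hrim sd" using Vx(3,4) Vy(3,4) by (auto simp: hrim_def)
 have xyc: "of_real u \<in> c" if u: "u = x \<or> u = y" for u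
 proof -
  have "Im (h (of_real u)) \<in> {v, w}" using vw(2) u by auto
  hence "Im (h (of_real u)) \<in> {v..w}" using vlw by auto
  moreover have "Complex (m j) (Im (h (of_real u))) = h (of_real u)" using u j(2,3) by (auto simp: complex_eq_iff)
  hence "inv h (Complex (m j) (Im (h (of_real u)))) = of_real u" by (simp add: bh_inv(1)[OF h(1)])
  ultimately show ?thesis unfolding c_def ch_def by force
 qed
 obtain A B where AB: "is_arc c A B" "c \<inter> hrim sd = {A, B}" and cins: "c - hrim sd <= inside (hrim sd)"
  using cch unfolding chord_def by blast
 have "of_real x \<in> {A, B}" "of_real y \<in> {A, B}" using AB(2) xyc xyrim by blast+
 hence "A = of_real x & B = of_real y \<or> A = of_real y & B = of_real x" using lt by auto
 hence carc: "is_arc c (of_real x) (of_real y)" and crim: "c \<inter> hrim sd = {of_real x, of_real y}"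
  using AB is_arc_sym[OF AB(1)] by auto
 have OTc: "chord (hrim sd) e" if "e \<in> OT" for e using chords_chord[OF h(1) sd] that by (simp add: OT_def)
 have dj: "pairwise disjnt (chords h sd)" by (rule chords_disjoint[OF h tight sd])
 have OTdj: "\<Union>OT \<inter> c = {}" using dj c unfolding OT_def pairwise_def disjnt_def by blast
 have OTfin: "finite OT" using finite_chords[OF h] by (simp add: OT_def)
 have OTcpt: "compact (\<Union>OT)" using OTfin chord_in_disc(2)[OF sd OTc] by (intro compact_Union)
 have OTreal: "of_real ` {x..y} \<inter> \<Union>OT = {}"
 proof (rule ccontr)
  assume "of_real ` {x..y} \<inter> \<Union>OT \<noteq> {}"
  then obtain u e where u: "x <= u" "u <= y" "of_real u \<in> e" "e \<in> OT" by auto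
  then obtain i a b where i: "i \<in> {1..n - 1}" "e = ch h i a b" unfolding OT_def chords_def by blast
  then obtain r where "of_real u = inv h (Complex (m i) r)" using u(3) unfolding ch_def by blast
  hence "h (of_real u) = Complex (m i) r" by (simp add: bh_inv(2)[OF h(1)])
  moreover have "m i \<in> M" using i(1) by auto
  ultimately have "u \<in> X h" unfolding X_def using u(1,2) Vx(3) Vy(4) by auto
  hence "u = x \<or> u = y" using gap u(1,2) by (auto simp: less_le)
  hence "of_real u \<in> c" by (rule xyc)
  thus False using OTdj u(3,4) by blast
 qed
 have "compact (complex_of_real ` {x..y})" by (intro compact_continuous_image continuous_intros) auto
 then obtain d where d: "d > 0" "\<And>u z. x <= u ==> u <= y ==> z \<in> \<Union>OT ==> d <= dist (complex_of_real u) z"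
  using separate_compact_closed[OF _ compact_imp_closed[OF OTcpt] OTreal] by (metis atLeastAtMost_iff imageI)
 obtain d' where d': "d' > 0" "\<And>s. s \<in> {1..n} ==> d' <= \<bar>x - p s\<bar> & d' <= \<bar>y - p s\<bar>"
 proof -
  have f: "finite (p ` {1..n})" by simp
  obtain d1 where d1: "d1 > 0" "\<forall>q\<in>p ` {1..n}. q ~= x \<longrightarrow> d1 <= dist x q" using finite_set_avoid[OF f, of x] by blast
  obtain d2 where d2: "d2 > 0" "\<forall>q\<in>p ` {1..n}. q ~= y \<longrightarrow> d2 <= dist y q" using finite_set_avoid[OF f, of y] by blast
  have "min d1 d2 <= \<bar>x - p s\<bar> & min d1 d2 <= \<bar>y - p s\<bar>" if s: "s \<in> {1..n}" for s
  proof -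
   have "p s ~= x" "p s ~= y" using X_puncture[OF h(1) s] x y by auto
   hence "d1 <= dist x (p s)" "d2 <= dist y (p s)" using d1(2) d2(2) s by auto
   thus ?thesis by (simp add: dist_real_def min_le_iff_disj)
  qed
  thus thesis using d1(1) d2(1) by (intro that[of "min d1 d2"]) auto
 qed
 define b0 where "b0 = min (1 - \<bar>x\<bar>) (1 - \<bar>y\<bar>)"
 have b0: "b0 > 0" "b0 <= 1" using Vx(3,4) Vy(3,4) by (auto simp: b0_def)
 \<comment> \<open>With \<open>d'\<close> the interval enlarged by \<open>eps\<close> still misses
   the punctures, with \<open>b0\<close> the box over it lies in the disc, and with \<open>d\<close>
   the graphs of height at most \<open>eps / 2\<close> miss the other chords.\<close>
 define eps where "eps = min d' (min b0 d) / 4"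
 have eps: "eps > 0" "eps < d'" "eps <= b0 / 4" "eps <= d / 4" using d(1) d'(1) b0 by (auto simp: eps_def min_def)
 \<comment> \<open>As \<open>b - a < 4\<close>, the product \<open>(u - a) * (b - u)\<close> is at
   most 16, so this factor bounds \<open>ta\<close> by \<open>eps / 2\<close>.\<close>
 define s where "s = eps / 32"
 have s: "s > 0" "32 * s = eps" using eps(1) by (auto simp: s_def)
 define a b where "a = x - eps" and "b = y + eps"
 define ta where "ta = (\<lambda>u. s * max 0 ((u - a) * (b - u)))"
 have len: "b - a < 4" using Vx(3,4) Vy(3,4) eps(3) b0(2) by (simp add: a_def b_def)
 have quad: "ta u <= eps / 2" for u
 proof -
  have "(u - a) * (b - u) <= 16"
  proof (cases "a <= u & u <= b")
   case True
   hence "(u - a) * (b - u) <= 4 * 4" using len by (intro mult_mono) auto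
   thus ?thesis by simp
  next
   case False
   have "a < b" using lt eps(1) by (simp add: a_def b_def)
   hence "(u - a) * (b - u) <= 0" using False by (auto simp: mult_le_0_iff)
   thus ?thesis by simp
  qed
  hence "ta u <= s * 16" unfolding ta_def using s(1) by (intro mult_left_mono) auto
  thus ?thesis using s(2) by simp
 qed
 have ta0: "ta u \<ge> 0" for u unfolding ta_def using s(1) by simp
 have tapos: "ta u > 0" if "u \<in> {a<..<b}" for u unfolding ta_def using s(1) that by simp
 have big: "s * ((u - x) * (y - u)) < ta u" if "x <= u" "u <= y" for u
 proof -
  have "(u - x) * (y - u) < (u - a) * (b - u)" using that eps(1) by (intro mult_strict_mono) (auto simp: a_def b_def)
  hence "s * ((u - x) * (y - u)) < s * ((u - a) * (b - u))" using s(1) by simp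
  also have "\<dots> <= ta u" unfolding ta_def using s(1) by (intro mult_left_mono) auto
  finally show ?thesis .
 qed
 \<comment> \<open>The parabola with zeros \<open>x\<close> and \<open>y\<close>, which replaces the
   chord \<open>c\<close>. The parabola \<open>ta\<close> has the same leading coefficient and the
   zeros \<open>a < x\<close> and \<open>b > y\<close>, so it passes strictly beyond
   \<open>q\<close>; this is \<open>big\<close>.\<close>
 define q where "q = (\<lambda>u. sd * (s * ((u - x) * (y - u))))"
 define c' where "c' = (\<lambda>u. Complex u (q u)) ` {x..y}"
 have qb: "\<bar>q u\<bar> <= eps / 2" "0 <= sd * q u" if "x <= u" "u <= y" for u
 proof -
  have 0: "0 <= s * ((u - x) * (y - u))" using that s(1) by simp
  have "sd * q u = s * ((u - x) * (y - u))" using sd by (auto simp: q_def)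
  thus "0 <= sd * q u" using 0 by simp
  have "\<bar>q u\<bar> = s * ((u - x) * (y - u))" using sd 0 by (auto simp: q_def)
  thus "\<bar>q u\<bar> <= eps / 2" using big[OF that] quad[of u] by simp
 qed
 have box: "norm (Complex u v) < 1" if "u \<in> {a<..<b}" "\<bar>v\<bar> <= eps" for u v
 proof -
  have "norm (Complex u v) <= \<bar>u\<bar> + \<bar>v\<bar>" using cmod_le[of "Complex u v"] by simp
  moreover have "\<bar>u\<bar> < 1 - b0 + eps" using that(1) by (auto simp: a_def b_def b0_def abs_if min_def)
  ultimately show ?thesis using that(2) eps(1,3) b0(1) by linarith
 qed
 have far: "Complex u r \<notin> \<Union>OT" if u: "u \<in> {a<..<b}" "\<bar>r\<bar> <= eps / 2" for u r
 proof
  assume "Complex u r \<in> \<Union>OT"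
  define u0 where "u0 = max x (min y u)"
  have u0: "x <= u0" "u0 <= y" "\<bar>u0 - u\<bar> <= eps" using lt u(1) eps(1) by (auto simp: u0_def a_def b_def)
  have "d <= dist (complex_of_real u0) (Complex u r)" by (rule d(2)[OF u0(1,2)]) fact
  also have "\<dots> <= \<bar>u0 - u\<bar> + \<bar>r\<bar>" using cmod_le[of "of_real u0 - Complex u r"] by (simp add: dist_norm)
  finally show False using u0(3) u(2) eps(1,4) d(1) by linarith
 qed
 have ab: "u \<in> {a<..<b}" if "x <= u" "u <= y" for u using that eps(1) by (auto simp: a_def b_def)
 have c'OT: "c' \<inter> \<Union>OT = {}" unfolding c'_def using far[OF ab qb(1)] by fastforce
 have c'in: "Complex u (q u) \<in> inside (hrim sd)" if u: "x < u" "u < y" for u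
 proof -
  have "norm (Complex u (q u)) < 1" using box[OF ab, of u "q u"] qb(1)[of u] u eps(1) by simp
  moreover have "sd * q u = s * ((u - x) * (y - u))" using sd by (auto simp: q_def)
  moreover have "0 < s * ((u - x) * (y - u))" using u s(1) by simp
  ultimately show ?thesis by (simp add: hd(2))
 qed
 have qe: "Complex x (q x) = of_real x" "Complex y (q y) = of_real y" by (simp_all add: q_def complex_eq_iff)
 have io: "inside (hrim sd) \<inter> hrim sd = {}" by (simp add: inside_no_overlap)
 have c'rim: "z = of_real x \<or> z = of_real y" if z: "z \<in> c'" "z \<in> hrim sd" for z
 proof -
  obtain u where u: "u \<in> {x..y}" "z = Complex u (q u)" using z(1) unfolding c'_def by blast
  hence "\<not> (x < u & u < y)" using c'in z(2) io by blast
  hence "u = x \<or> u = y" using u(1) by auto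
  thus ?thesis using u(2) qe by auto
 qed
 have c'J: "c' - hrim sd <= inside (hrim sd)"
 proof
  fix z assume z: "z \<in> c' - hrim sd"
  then obtain u where u: "u \<in> {x..y}" "z = Complex u (q u)" unfolding c'_def by blast
  hence "u ~= x" "u ~= y" using z qe xyrim by auto
  thus "z \<in> inside (hrim sd)" using c'in[of u] u by auto
 qed
 have c'arc: "is_arc c' (of_real x) (of_real y)"
 proof -
  have "is_arc (complex_of_real ` {x..y}) (of_real x) (of_real y)"
   using is_arc_segment[of "complex_of_real x" "of_real y"] lt closed_segment_of_real[of x y, where 'a = complex]
   by (simp add: closed_segment_eq_real_ivl1)
  hence "is_arc ((\<lambda>z. Complex (Re z) (q (Re z))) ` complex_of_real ` {x..y}) (Complex x (q x)) (Complex y (q y))"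
   by (drule_tac is_arc_image[where f = "\<lambda>z. Complex (Re z) (q (Re z))"])
    (auto simp: inj_on_def q_def intro!: continuous_intros)
  thus ?thesis unfolding c'_def image_image qe by simp
 qed
 have xyc': "of_real x \<in> c'" "of_real y \<in> c'" using arc_facts(3,4)[OF c'arc] .
 have c'chord: "chord (hrim sd) c'"
  unfolding chord_def using c'arc c'J c'rim xyc' xyrim by blast
 define CC where "CC = insert c' OT"
 obtain f where f: "continuous_on c' f" "inj_on f c'" "f ` c' = c" "f (of_real x) = of_real x" "f (of_real y) = of_real y"
  by (rule is_arc_homeo[OF c'arc carc])
 \<comment> \<open>Maps \<open>c'\<close> onto \<open>c\<close> and fixes the boundary and all other
   chords. Precomposing \<open>h\<close> with an extension of it turns the preimage \<open>c\<close>
   of the piece of line into \<open>c'\<close>.\<close>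
 define ga where "ga = (\<lambda>z. if z \<in> c' then f z else z)"
 have gaid: "ga z = z" if "z \<in> hrim sd Un \<Union>OT" for z
 proof (cases "z \<in> c'")
  case True
  hence "z = of_real x \<or> z = of_real y" using c'rim c'OT that by blast
  thus ?thesis using True f(4,5) by (auto simp: ga_def)
 qed (simp add: ga_def)
 have gac': "ga z = f z" if "z \<in> c'" for z using that by (simp add: ga_def)
 have UCC: "hrim sd Un \<Union>CC = c' Un (hrim sd Un \<Union>OT)" by (auto simp: CC_def)
 have cl: "closed c'" "closed (hrim sd Un \<Union>OT)"
  using arc_facts(1)[OF c'arc] Jordan_facts(1)[OF hd(1)] OTcpt by (auto intro: compact_imp_closed closed_Un)
 have gacont: "continuous_on (hrim sd Un \<Union>CC) ga" unfolding UCC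
 proof (rule continuous_on_closed_Un[OF cl])
  show "continuous_on c' ga" by (rule continuous_on_eq[OF f(1)]) (simp add: gac')
  show "continuous_on (hrim sd Un \<Union>OT) ga"
   by (rule continuous_on_eq[OF continuous_on_id]) (simp add: gaid)
 qed
 have gainj: "inj_on ga (hrim sd Un \<Union>CC)"
 proof -
  have i1: "inj_on ga c'" using inj_on_cong[of c' ga f, OF gac'] f(2) by simp
  have i2: "inj_on ga (hrim sd Un \<Union>OT)" by (rule inj_onI) (simp add: gaid)
  have i3: "z = z'" if z: "z \<in> c'" "z' \<in> hrim sd Un \<Union>OT" "ga z = ga z'" for z z'
  proof -
   have e: "z' = f z" using z(3) gac'[OF z(1)] gaid[OF z(2)] by simp
   have "f z \<in> c" using f(3) z(1) by blast
   hence "z' \<in> c \<inter> hrim sd" using z(2) e OTdj by blast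
   hence "f z = f z'" "z' \<in> c'" unfolding crim using e f(4,5) xyc' by auto
   thus ?thesis using inj_onD[OF f(2)] z(1) by blast
  qed
  show ?thesis unfolding UCC
  proof (rule inj_onI)
   fix z z' assume "z \<in> c' Un (hrim sd Un \<Union>OT)" "z' \<in> c' Un (hrim sd Un \<Union>OT)" and e: "ga z = ga z'"
   then consider "z \<in> c'" "z' \<in> c'" | "z \<in> hrim sd Un \<Union>OT" "z' \<in> hrim sd Un \<Union>OT"
    | "z \<in> c'" "z' \<in> hrim sd Un \<Union>OT" | "z' \<in> c'" "z \<in> hrim sd Un \<Union>OT" by blast
   thus "z = z'"
   proof cases
    case 1 thus ?thesis using inj_onD[OF i1 e] by blast
   next
    case 2 thus ?thesis using inj_onD[OF i2 e] by blast
   next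
    case 3 thus ?thesis using i3[OF _ _ e] by blast
   next
    case 4 thus ?thesis using i3[OF _ _ e[symmetric]] by blast
   qed
  qed
 qed
 have gaJ: "ga ` hrim sd = hrim sd" using gaid by force
 obtain Ps :: "complex => complex" where Ps: "continuous_on (hdisc sd) Ps" "inj_on Ps (hdisc sd)"
  "Ps ` hdisc sd = hdisc sd" "\<And>z. z \<in> hrim sd Un \<Union>CC ==> Ps z = ga z"
 proof -
  have "\<exists>Ps. continuous_on (hrim sd Un inside (hrim sd)) Ps & inj_on Ps (hrim sd Un inside (hrim sd)) &
   Ps ` (hrim sd Un inside (hrim sd)) = ga ` hrim sd Un inside (ga ` hrim sd) & (\<forall>z\<in>hrim sd Un \<Union>CC. Ps z = ga z)"
  proof (rule chord_system_extension[OF _ hd(1) _ _ gacont gainj])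
   show "finite CC" using OTfin by (simp add: CC_def)
   show "chord (hrim sd) e" if "e \<in> CC" for e using that c'chord OTc by (auto simp: CC_def)
   show "pairwise disjnt CC" unfolding CC_def
    using c'OT pairwise_subset[OF dj, of OT] by (auto simp: pairwise_insert OT_def disjnt_def)
   show "ga ` (e - hrim sd) <= inside (ga ` hrim sd)" if e: "e \<in> CC" for e unfolding gaJ
   proof (cases "e = c'")
    case True
    show "ga ` (e - hrim sd) <= inside (hrim sd)"
    proof (rule image_subsetI)
     fix z assume z: "z \<in> e - hrim sd"
     hence zc: "z \<in> c'" "z ~= of_real x" "z ~= of_real y" using True xyrim by auto
     hence "f z ~= of_real x" "f z ~= of_real y" using inj_onD[OF f(2) _ zc(1)] f(4,5) xyc' by metis+
     moreover have "f z \<in> c" using f(3) zc(1) by blast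
     ultimately show "ga z \<in> inside (hrim sd)" using gac'[OF zc(1)] cins crim by auto
    qed
   next
    case False
    hence "e \<in> OT" using e by (simp add: CC_def)
    hence "e - hrim sd <= inside (hrim sd)" using OTc unfolding chord_def by blast
    moreover have "ga z = z" if "z \<in> e" for z using gaid that \<open>e \<in> OT\<close> by blast
    ultimately show "ga ` (e - hrim sd) <= inside (hrim sd)" by auto
   qed
  qed
  thus thesis unfolding gaJ hd(3) using that by blast
 qed
 have Psrim: "Ps z = z" if "z \<in> hrim sd" for z using Ps(4)[of z] gaid[of z] that by simp
 define A1 where "A1 = (\<lambda>z. if 0 <= sd * Im z then Ps z else z)"
 have A1Ps: "A1 z = Ps z" if "z \<in> hdisc sd" for z using that by (simp add: A1_def hdisc_def)
 have A1id: "A1 z = z" if z: "z \<in> hdisc (- sd) Un hrim sd Un hrim (- sd)" for z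
 proof (cases "0 <= sd * Im z")
  case True
  hence "z \<in> hrim sd" using z sd by (auto simp: hdisc_def hrim_def)
  thus ?thesis using True Psrim by (simp add: A1_def)
 qed (simp add: A1_def)
 define h1 where "h1 = radial (\<lambda>z. h (A1 z))"
 have iso1: "(h, h1) \<in> braid_isotopy n p" unfolding h1_def
 proof (rule precompose_isotopy[where b = "\<lambda>t z. z", OF h(1)])
  fix sd' :: real assume "sd' = 1 \<or> sd' = -1"
  hence "sd' = sd \<or> sd' = - sd" using sd by auto
  then obtain G where G: "continuous_on (hdisc sd') G" "inj_on G (hdisc sd')" "G ` hdisc sd' = hdisc sd'"
   "\<And>z. z \<in> hdisc sd' ==> A1 z = G z"
  proof
   assume "sd' = sd"
   thus thesis using Ps(1-3) A1Ps that by simp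
  next
   assume "sd' = - sd"
   thus thesis using A1id that[of id] by simp
  qed
  have "continuous_on (hdisc sd') A1" by (rule continuous_on_eq[OF G(1)]) (simp add: G(4))
  thus "continuous_on (hdisc sd') A1 & inj_on A1 (hdisc sd') & A1 ` hdisc sd' = hdisc sd'"
   using G(2,3) inj_on_cong[of "hdisc sd'" A1 G, OF G(4)] image_cong[OF refl, of "hdisc sd'" A1 G, OF G(4)] by simp
 next
  fix z assume z: "norm z <= 1" "Im (A1 z) = 0"
  show "Im z = 0"
  proof (cases "0 <= sd * Im z")
   case True
   hence zD: "z \<in> hdisc sd" and e: "A1 z = Ps z" using z(1) by (simp_all add: hdisc_def A1_def)
   have P: "Ps z \<in> hdisc sd" using Ps(3) zD by blast
   hence "Ps z \<in> hrim sd" using z(2) unfolding e by (simp add: hdisc_def hrim_def)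
   hence "Ps (Ps z) = Ps z" by (rule Psrim)
   hence "Ps z = z" using inj_onD[OF Ps(2)] P zD by blast
   thus ?thesis using z(2) e by simp
  next
   case False thus ?thesis using z(2) by (simp add: A1_def)
  qed
 next
  fix z assume "z \<in> hrim 1 Un hrim (-1)"
  thus "z = A1 z" using A1id[of z] sd by auto
 qed (simp_all add: continuous_on_snd)
 have h1: "h1 \<in> H" using braid_isotopy_mem(2)[OF iso1] .
 have h1e: "h1 z = h (A1 z)" if "norm z <= 1" for z using that by (simp add: h1_def radial_def)
 have Xh1: "X h1 = X h"
 proof -
  have "h1 (of_real u) = h (of_real u)" if "-1 <= u" "u <= 1" for u
   using h1e[of "of_real u"] A1id[of "of_real u"] that by (auto simp: hrim_def abs_le_iff)
  thus ?thesis unfolding X_def by auto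
 qed
 \<comment> \<open>After the redrawing, the preimage of the lamination in the open half-disc is
   contained in the other chords and \<open>c'\<close>. The graph of \<open>ta\<close> misses all of
   these, so the diagram can be pushed onto it.\<close>
 have free: "Re (h1 z) \<notin> M" if z: "norm z < 1" "0 < sd * Im z" "z \<notin> \<Union>OT" "z \<notin> c'" for z
 proof
  assume "Re (h1 z) \<in> M"
  have zD: "z \<in> hdisc sd" using z by (simp add: hdisc_def)
  have zr: "z \<notin> hrim sd" using z by (auto simp: hrim_def)
  have "Ps z \<in> hdisc sd" using Ps(3) zD by blast
  moreover have "Ps z \<notin> hrim sd"
  proof
   assume r: "Ps z \<in> hrim sd"
   have "Ps (Ps z) = Ps z" using Psrim[OF r] .
   hence "Ps z = z" using inj_onD[OF Ps(2)] \<open>Ps z \<in> hdisc sd\<close> zD by blast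
   thus False using r zr by simp
  qed
  ultimately have "Ps z \<in> inside (hrim sd)" using hd(3) by blast
  hence "norm (Ps z) < 1" "0 < sd * Im (Ps z)" by (simp_all add: hd(2))
  moreover have "Re (h (Ps z)) \<in> M" using \<open>Re (h1 z) \<in> M\<close> h1e[of z] A1Ps[OF zD] z(1) by simp
  ultimately have "Ps z \<in> \<Union>(chords h sd)" by (intro chords_cover[OF h sd])
  then consider "Ps z \<in> \<Union>OT" | "Ps z \<in> c" by (auto simp: OT_def)
  thus False
  proof cases
   case 1
   hence "Ps (Ps z) = Ps z" using Ps(4)[of "Ps z"] gaid[of "Ps z"] by (auto simp: CC_def)
   hence "Ps z = z" using inj_onD[OF Ps(2)] \<open>Ps z \<in> hdisc sd\<close> zD by blast
   thus False using 1 z(3) by simp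
  next
   case 2
   then obtain z0 where z0: "z0 \<in> c'" "Ps z = f z0" using f(3) by blast
   hence "Ps z0 = Ps z" using Ps(4)[of z0] gac' by (auto simp: CC_def)
   moreover have "z0 \<in> hdisc sd" using z0(1) chord_in_disc(1)[OF sd c'chord] by blast
   ultimately have "z0 = z" using inj_onD[OF Ps(2)] zD by blast
   thus False using z0(1) z(4) by simp
  qed
 qed
 have "\<exists>h2. (h1, h2) \<in> braid_isotopy n p & X h2 = X h1 - {a<..<b}"
 proof (rule push[OF h1 sd, of a b ta eps])
  show "p i \<notin> {a<..<b}" if i: "i \<in> {1..n}" for i
   using noP[OF i] d'(2)[OF i] eps(1,2) by (auto simp: a_def b_def abs_if split: if_splits)
  show "continuous_on UNIV ta" unfolding ta_def by (intro continuous_intros)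
  show "0 <= ta u" for u by (rule ta0)
  show "ta u < eps" for u using quad[of u] eps(1) by linarith
  show "ta u = 0" if "u \<notin> {a<..<b}" for u
  proof -
   have "(u - a) * (b - u) <= 0" using that lt eps(1) by (auto simp: mult_le_0_iff a_def b_def)
   thus ?thesis by (simp add: ta_def)
  qed
  show "norm (Complex u v) < 1" if "u \<in> {a<..<b}" "\<bar>v\<bar> <= eps" for u v by (rule box[OF that])
  show "Re (h1 (Complex u (sd * ta u))) \<notin> M" if u: "u \<in> {a<..<b}" for u
  proof (rule free)
   have t: "\<bar>sd * ta u\<bar> = ta u" using sd ta0[of u] by (auto simp: abs_mult)
   hence t2: "\<bar>sd * ta u\<bar> <= eps / 2" using quad[of u] by simp
   show "norm (Complex u (sd * ta u)) < 1" by (rule box[OF u]) (use t2 eps(1) in linarith)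
   show "0 < sd * Im (Complex u (sd * ta u))" using sd tapos[OF u] by auto
   show "Complex u (sd * ta u) \<notin> \<Union>OT" by (rule far[OF u t2])
   show "Complex u (sd * ta u) \<notin> c'"
   proof
    assume "Complex u (sd * ta u) \<in> c'"
    hence "x <= u" "u <= y" "sd * ta u = q u" by (auto simp: c'_def)
    thus False using big[of u] sd by (auto simp: q_def)
   qed
  qed
 qed
 then obtain h2 where h2: "(h1, h2) \<in> braid_isotopy n p" "X h2 = X h - {a<..<b}" unfolding Xh1 by blast
 have "x \<notin> X h2" using h2(2) ab[of x] lt by simp
 hence ss: "X h2 \<subset> X h" using h2(2) x by blast
 have "reducible h" unfolding reducible_def
 proof (intro exI conjI)
  show "(h, h2) \<in> braid_isotopy n p" by (rule braid_isotopy_trans[OF iso1 h2(1)])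
  show "finite (X h2)" using ss h(2) finite_subset by blast
  show "card (X h2) < card (X h)" by (rule psubset_card_mono[OF h(2) ss])
 qed
 thus False using tight by simp
qed

end

section \<open>Diagrams with the same crossings\<close>

text \<open>Points are added in increasing order: to the right of the last one the function is
  continued affinely to the next prescribed value.\<close>

lemma strict_mono_extension:
 fixes e :: "real => real"
 assumes "finite S" "strict_mono_on S e"
 shows "\<exists>f. strict_mono f & continuous_on UNIV f & (\<forall>x\<in>S. f x = e x)"
 using assms
proof (induction S rule: finite_linorder_max_induct)
 case empty
 show ?case by (intro exI[of _ id]) (simp add: strict_mono_def continuous_on_id')
next
 case (insert b S)
 then obtain f where f: "strict_mono f" "continuous_on UNIV f" "\<And>x. x \<in> S ==> f x = e x"
  by (meson monotone_on_subset subset_insertI)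
 define a where "a = (if S = {} then b - 1 else Max S)"
 have ab: "a < b" using insert.hyps by (simp add: a_def)
 have Sa: "x <= a" if "x \<in> S" for x
 proof -
  have "S ~= {}" using that by blast
  thus ?thesis using insert.hyps(1) that by (simp add: a_def)
 qed
 define f0 where "f0 = (if S = {} then (\<lambda>x. f x + (e b - f b)) else f)"
 have f0: "strict_mono f0" "continuous_on UNIV f0" "\<And>x. x \<in> S ==> f0 x = e x"
  using f by (auto simp: f0_def strict_mono_def intro!: continuous_intros)
 define g where "g = (if S = {} then f0 else (\<lambda>x. if x <= a then f0 x else f0 a + (e b - f0 a) / (b - a) * (x - a)))"
 have "strict_mono g & continuous_on UNIV g & (\<forall>x\<in>insert b S. g x = e x)"
 proof (cases "S = {}")
  case True thus ?thesis using f0 by (simp add: g_def f0_def)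
 next
  case False
  hence aS: "a \<in> S" using insert.hyps(1) by (simp add: a_def)
  have "e a < e b" using insert.prems ab aS by (auto simp: strict_mono_on_def)
  hence k: "0 < (e b - f0 a) / (b - a)" using ab f0(3)[OF aS] by simp
  have ge: "g = (\<lambda>x. if x <= a then f0 x else f0 a + (e b - f0 a) / (b - a) * (x - a))" using False by (simp add: g_def)
  have "strict_mono g"
  proof (rule strict_monoI)
   fix x y :: real assume xy: "x < y"
   show "g x < g y"
   proof (cases "x <= a")
    case x: True
    show ?thesis
    proof (cases "y <= a")
     case True thus ?thesis using f0(1) xy by (simp add: ge strict_mono_less)
    next
     case False
     have "f0 x <= f0 a" using f0(1) x by (simp add: strict_mono_less_eq)
     moreover have "0 < (e b - f0 a) / (b - a) * (y - a)" using k False by (intro mult_pos_pos) auto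
     ultimately show ?thesis using x False unfolding ge by simp
    qed
   next
    case False
    have "(e b - f0 a) / (b - a) * (x - a) < (e b - f0 a) / (b - a) * (y - a)"
     using xy by (intro mult_strict_left_mono k) simp
    thus ?thesis using False xy unfolding ge by simp
   qed
  qed
  moreover have "continuous_on ({..a} Un {a..}) g" unfolding ge
  proof (rule continuous_on_cases)
   show "continuous_on {..a} f0" using f0(2) continuous_on_subset by blast
  qed (use ab in \<open>auto intro!: continuous_intros\<close>)
  moreover have "{..a} Un {a..} = UNIV" by auto
  moreover have "g b = e b" using ab unfolding ge by simp
  moreover have "g x = e x" if "x \<in> S" for x using that Sa[OF that] f0(3) unfolding ge by simp
  ultimately show ?thesis by simp
 qed
 thus ?case by blast
qed

lemma strict_mono_image_interval:
 fixes f :: "real => real"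
 assumes "strict_mono f" "continuous_on UNIV f" "a <= b"
 shows "f ` {a..b} = {f a..f b}"
proof
 show "f ` {a..b} <= {f a..f b}" using assms(1) by (auto simp: strict_mono_less_eq)
 show "{f a..f b} <= f ` {a..b}"
 proof
  fix y assume "y \<in> {f a..f b}"
  hence "\<exists>x\<ge>a. x <= b & f x = y"
   using assms by (intro IVT') (auto intro: continuous_on_subset)
  thus "y \<in> f ` {a..b}" by auto
 qed
qed

lemma strict_mono_on_onto_id:
 fixes e :: "real => real"
 assumes "finite S" "strict_mono_on S e" "e ` S = S" "x \<in> S"
 shows "e x = x"
proof (rule ccontr)
 assume "e x ~= x"
 define y where "y = Min {x \<in> S. e x ~= x}"
 have "y \<in> {x \<in> S. e x ~= x}" unfolding y_def using assms \<open>e x ~= x\<close> by (intro Min_in) auto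
 hence y: "y \<in> S" "e y ~= y" by auto
 have small: "e z = z" if "z \<in> S" "z < y" for z
 proof (rule ccontr)
  assume "e z ~= z"
  hence "y <= z" unfolding y_def using assms(1) that(1) by (intro Min_le) auto
  thus False using that(2) by simp
 qed
 note mono = strict_mono_onD[OF assms(2)]
 show False
 proof (cases "e y < y")
  case True
  have "e y \<in> S" using assms(3) y(1) by blast
  thus False using mono[of "e y" y] small[of "e y"] y(1) True by simp
 next
  case False
  obtain z where z: "z \<in> S" "y = e z" using assms(3) y(1) by blast
  consider "z < y" | "z = y" | "y < z" by linarith
  thus False
  proof cases
   case 1 thus False using small[OF z(1)] z(2) by simp
  next
   case 2 thus False using z(2) y(2) by simp
  next
   case 3 thus False using mono[OF y(1) z(1)] z(2) False by simp
  qed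
 qed
qed

context punctured_disc begin

definition Y :: "(complex => complex) => real set" where
 "Y h = X h Un p ` {1..n}"

lemma Y_bounds: assumes "x \<in> Y h" shows "-1 <= x & x <= 1"
proof (cases "x \<in> X h")
 case False
 then obtain s where "s \<in> {1..n}" "x = p s" using assms by (auto simp: Y_def)
 thus ?thesis using p_bounds[of s] by simp
qed (simp add: X_def)

text \<open>A crossing is coded by its line and its rank from below on that line. For a puncture the
  set is empty, as no crossing has the abscissa of a puncture; so its code has second component 0,
  and the first tells to which puncture it is mapped.\<close>

definition code :: "(complex => complex) => real => real \<times> nat" where
 "code h x = (Re (h (of_real x)),
  card {y \<in> X h. Re (h (of_real y)) = Re (h (of_real x)) & Im (h (of_real y)) <= Im (h (of_real x))})"

text \<open>At the top of each lamination line \<open>h\<^sup>-\<^sup>1\<close> lies above the diagram, and without touching points the two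
 sides alternate along the line.\<close>

lemma side_parity:
 assumes h: "h \<in> H" "finite (X h)" "\<not> reducible h" and j: "j \<in> {1..n - 1}" and vw: "consec (V h j) v w"
  and u: "v < u" "u < w"
 shows "0 < (-1) ^ card {u \<in> V h j. w < u} * Im (inv h (Complex (m j) u))"
 using vw u
proof (induction "card {u \<in> V h j. w < u}" arbitrary: v w u)
 case 0
 note V = V_finite[OF h(1,2) j]
 have "{u \<in> V h j. w < u} = {}" using 0(1) V(1) by simp
 hence "\<not> w < tp j" using V(2) by blast
 moreover have "w <= tp j" using 0(2) V(4) by (auto simp: consec_def)
 ultimately have w: "w = tp j" by simp
 define f where "f = (\<lambda>u. Im (inv h (Complex (m j) u)))"
 obtain sd :: real where sd: "sd = 1 \<or> sd = -1" "\<And>u. v < u ==> u < w ==> 0 < sd * f u"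
  using consec_side[OF h(1) j 0(2)] unfolding f_def by metis
 have cont: "continuous_on UNIV f" unfolding f_def
  by (intro continuous_intros continuous_on_compose2[OF bh_inv(3)[OF h(1), of UNIV]]) auto
 have n1: "norm (Complex (m j) w) = 1" using norm_line(1,3)[OF j] w by simp
 have ii: "h (inv h (Complex (m j) w)) = Complex (m j) w" by (rule bh_inv(2)[OF h(1)])
 have n2: "norm (inv h (Complex (m j) w)) = 1" using bh_norm(2)[OF h(1)] n1 ii by metis
 have wpos: "w > 0" using w norm_line(1)[OF j] by simp
 have "f w > 0"
 proof (rule ccontr)
  assume "\<not> f w > 0"
  then consider "f w = 0" | "0 < - 1 * f w" by linarith
  thus False
  proof cases
   case 1
   hence "inv h (Complex (m j) w) = 1 \<or> inv h (Complex (m j) w) = -1"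
    using n2 by (auto simp: f_def complex_eq_iff cmod_def abs_if split: if_splits)
   hence "Complex (m j) w = 1 \<or> Complex (m j) w = -1" using ii bhD(6,7)[OF h(1)] by metis
   thus False using wpos by (auto simp: complex_eq_iff)
  next
   case 2
   hence "0 < - 1 * Im (Complex (m j) w)" using braid_homeo_sign[OF h(1) _ n2, of "-1"] unfolding f_def ii by simp
   thus False using wpos by simp
  qed
 qed
 have "{v<..<w} <= {u. 0 <= sd * f u}" using sd(2) by (auto intro: less_imp_le)
 moreover have "closed {u. 0 <= sd * f u}" by (intro closed_Collect_le continuous_intros cont)
 ultimately have "closure {v<..<w} <= {u. 0 <= sd * f u}" by (rule closure_minimal)
 moreover have "w \<in> closure {v<..<w}" using 0(3,4) by auto
 ultimately have "0 <= sd * f w" by blast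
 hence "sd = 1" using sd(1) \<open>f w > 0\<close> by auto
 thus ?case unfolding \<open>{u \<in> V h j. w < u} = {}\<close> using sd(2)[OF 0(3,4)] by (simp add: f_def)
next
 case (Suc k)
 note V = V_finite[OF h(1,2) j]
 define S where "S = {u \<in> V h j. w < u}"
 have "card S ~= 0" using Suc(2) unfolding S_def by simp
 hence fS: "finite S" "S ~= {}" by (metis card.infinite, force)
 define w' where "w' = Min S"
 have w': "w' \<in> S" unfolding w'_def using fS by (rule Min_in)
 have mn: "w' <= u" if "u \<in> S" for u unfolding w'_def using fS(1) that by (rule Min_le)
 have ww: "consec (V h j) w w'" using w' mn Suc(3) by (fastforce simp: consec_def S_def)
 have "{u \<in> V h j. w' < u} = S - {w'}" using w' mn by (force simp: S_def)
 hence c: "card {u \<in> V h j. w' < u} = k" using Suc(2) w' fS(1) by (simp add: S_def)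
 note IH = Suc(1)[OF c[symmetric] ww, unfolded c]
 obtain sd :: real where sd: "sd = 1 \<or> sd = -1" "\<And>u. v < u ==> u < w ==> 0 < sd * Im (inv h (Complex (m j) u))"
  using consec_side[OF h(1) j Suc(3)] by metis
 have "sd ~= (-1) ^ k"
 proof
  assume "sd = (-1) ^ k"
  hence "reducible h" using same_side_reducible[OF h(1,2) j Suc(3) ww sd] IH by blast
  thus False using h(3) by simp
 qed
 moreover have "(-1::real) ^ k = 1 \<or> (-1::real) ^ k = -1" using neg_one_even_power neg_one_odd_power by blast
 ultimately have "sd = (-1) ^ Suc k" using sd(1) by auto
 thus ?case using sd(2)[OF Suc(4,5)] Suc(2) by simp
qed

end

section \<open>Matching the crossings of two tight diagrams\<close>

text \<open>\<open>e\<close> pairs the marked points of the two diagrams in the order in which the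
  curves run through them, and paired points have the same code: order in the source and order on
  each line both agree.\<close>

locale matching_diagrams = punctured_disc +
 fixes h h' :: "complex => complex" and e :: "real => real"
 assumes h: "h \<in> H" "finite (X h)" "\<not> reducible h" and h': "h' \<in> H" "finite (X h')" "\<not> reducible h'"
  and e: "strict_mono_on (Y h) e" "e ` Y h = Y h'" and code: "\<And>x. x \<in> Y h ==> code h' (e x) = code h x"
begin

lemma Re_e: "x \<in> Y h ==> Re (h' (of_real (e x))) = Re (h (of_real x))"
 using code by (simp add: code_def)

lemma e_X: assumes "x \<in> Y h" shows "e x \<in> X h' \<longleftrightarrow> x \<in> X h"
proof -
 have "e x \<in> Y h'" using e(2) assms by blast
 thus ?thesis using Y_bounds[OF assms] Y_bounds[of "e x" h'] Re_e[OF assms] by (simp add: X_def)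
qed

lemma e_image_X: "e ` X h = X h'"
proof
 have XY: "X h <= Y h" by (simp add: Y_def)
 show "e ` X h <= X h'" using e_X XY by blast
 show "X h' <= e ` X h"
 proof
  fix y assume y: "y \<in> X h'"
  hence "y \<in> e ` Y h" using e(2) by (simp add: Y_def)
  then obtain x where "x \<in> Y h" "y = e x" by blast
  thus "y \<in> e ` X h" using e_X y by blast
 qed
qed

text \<open>By the codes, \<open>e\<close> takes non-crossings to non-crossings. It is therefore an
  increasing bijection of the finite set of punctures onto itself, so each puncture stays
  fixed.\<close>

lemma e_p: assumes "s \<in> {1..n}" shows "e (p s) = p s"
proof (rule strict_mono_on_onto_id[of "p ` {1..n}"])
 have PY: "p ` {1..n} <= Y h" by (simp add: Y_def)
 show "strict_mono_on (p ` {1..n}) e" using e(1) PY by (rule monotone_on_subset)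
 have P: "Y h - X h = p ` {1..n}" "Y h' - X h' = p ` {1..n}"
  using X_puncture[OF h(1)] X_puncture[OF h'(1)] unfolding Y_def by blast+
 show "e ` p ` {1..n} = p ` {1..n}"
 proof
  show "e ` p ` {1..n} <= p ` {1..n}"
  proof
   fix y assume "y \<in> e ` p ` {1..n}"
   then obtain x where "x \<in> p ` {1..n}" "y = e x" by blast
   thus "y \<in> p ` {1..n}" using P e_X[of x] e(2) by blast
  qed
  show "p ` {1..n} <= e ` p ` {1..n}"
  proof
   fix y assume "y \<in> p ` {1..n}"
   hence "y \<in> e ` Y h" "y \<notin> X h'" using e(2) P by blast+
   then obtain x where "x \<in> Y h" "y = e x" by blast
   thus "y \<in> e ` p ` {1..n}" using e_X[of x] \<open>y \<notin> X h'\<close> P(1) by blast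
  qed
 qed
qed (use assms in auto)

lemma e_ends: "e (-1) = -1" "e 1 = 1"
proof -
 have unit: "z = of_real r" if "norm z <= 1" "Re z = r" "r = 1 \<or> r = -1" for z :: complex and r
 proof -
  have "(cmod z)\<^sup>2 <= 1" using that(1) by (simp add: power_le_one)
  hence "(Im z)\<^sup>2 <= 0" using that(2,3) unfolding cmod_power2 by auto
  hence "Im z = 0" by simp
  thus ?thesis using that by (simp add: complex_eq_iff)
 qed
 have r: "e r = r" if r: "r = 1 \<or> r = -1" for r
 proof -
  have rX: "r \<in> X h" using X_ends[OF h(1)] r by auto
  hence "e r \<in> X h'" using e_image_X by blast
  hence n: "norm (h' (of_real (e r))) <= 1" unfolding bh_norm(3)[OF h'(1)] by (auto simp: X_def)
  have hr: "h (of_real r) = of_real r" "h' (of_real r) = of_real r"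
   using r bhD(6,7)[OF h(1)] bhD(6,7)[OF h'(1)] by auto
  hence "Re (h' (of_real (e r))) = r" using Re_e[of r] rX by (simp add: Y_def)
  hence "h' (of_real (e r)) = h' (of_real r)" using unit[OF n _ r] hr by simp
  thus ?thesis using injD[OF bhD(2)[OF h'(1)]] of_real_eq_iff by blast
 qed
 show "e (-1) = -1" "e 1 = 1" using r by simp_all
qed

text \<open>The codes give equal real parts, and both images are punctures, so they are
  real.\<close>

lemma same_punctures: assumes "s \<in> {1..n}" shows "h' (of_real (p s)) = h (of_real (p s))"
proof -
 have "Im (h (of_real (p s))) = 0" if "h \<in> H" for h
 proof -
  have "h (of_real (p s)) \<in> punctures n p" using bhD(4)[OF that] assms unfolding punctures_def by blast
  thus ?thesis by (auto simp: punctures_def)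
 qed
 thus ?thesis using Re_e[of "p s"] e_p[OF assms] assms h(1) h'(1) by (auto simp: complex_eq_iff Y_def)
qed

definition B :: "real => real" where
 "B = (SOME f. strict_mono f & continuous_on UNIV f & (\<forall>x\<in>Y h. f x = e x))"

lemma B: "strict_mono B" "continuous_on UNIV B" "x \<in> Y h ==> B x = e x"
proof -
 have "finite (Y h)" using h(2) by (simp add: Y_def)
 from someI_ex[OF strict_mono_extension[OF this e(1)]]
 show "strict_mono B" "continuous_on UNIV B" "x \<in> Y h ==> B x = e x" unfolding B_def by blast+
qed

lemma B_ends: "B (-1) = -1" "B 1 = 1" "s \<in> {1..n} ==> B (p s) = p s" "B ` {-1..1} = {-1..1}"
proof -
 show 1: "B (-1) = -1" "B 1 = 1" using B(3) e_ends X_ends[OF h(1)] by (simp_all add: Y_def)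
 show "s \<in> {1..n} ==> B (p s) = p s" using B(3) e_p by (simp add: Y_def)
 show "B ` {-1..1} = {-1..1}" using strict_mono_image_interval[OF B(1,2), of "-1" 1] 1 by simp
qed

text \<open>\<open>inv h\<close> finds the parameter of the crossing at this height,
  \<open>e\<close> the paired parameter, and \<open>h'\<close> its height; the two ends of the line
  are kept.\<close>

definition vmap :: "nat => real => real" where
 "vmap j v = (if \<bar>v\<bar> = tp j then v else Im (h' (of_real (e (Re (inv h (Complex (m j) v)))))))"

lemma vmap_X:
 assumes j: "j \<in> {1..n - 1}" and x: "x \<in> X h" "Re (h (of_real x)) = m j"
 shows "vmap j (Im (h (of_real x))) = Im (h' (of_real (e x)))" "e x \<in> X h'" "Re (h' (of_real (e x))) = m j"
proof -
 have "Complex (m j) (Im (h (of_real x))) = h (of_real x)" using x(2) by (simp add: complex_eq_iff)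
 thus "vmap j (Im (h (of_real x))) = Im (h' (of_real (e x)))"
  using V_I(2)[OF h(1) j x] by (simp add: vmap_def bh_inv(1)[OF h(1)])
 show "e x \<in> X h'" using e_image_X x(1) by blast
 show "Re (h' (of_real (e x))) = m j" using Re_e[of x] x by (simp add: Y_def)
qed

text \<open>Among inner heights, the second components of the codes say that ranks on the line are
  preserved; inner heights stay strictly between the ends.\<close>

lemma vmap_mono: assumes j: "j \<in> {1..n - 1}" shows "strict_mono_on (V h j) (vmap j)"
proof (rule strict_mono_onI)
 fix v w assume v: "v \<in> V h j" and w: "w \<in> V h j" and vw: "v < w"
 have inner: "\<exists>x. x \<in> X h & Re (h (of_real x)) = m j & v = Im (h (of_real x)) & \<bar>vmap j v\<bar> < tp j"
  if v: "v \<in> V h j" "\<bar>v\<bar> ~= tp j" for v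
 proof -
  obtain x where x: "x \<in> X h" "h (of_real x) = Complex (m j) v" by (rule V_cases[OF h(1) j v])
  hence r: "Re (h (of_real x)) = m j" "v = Im (h (of_real x))" by simp_all
  have "\<bar>vmap j v\<bar> < tp j" unfolding r(2) vmap_X(1)[OF j x(1) r(1)] by (rule V_I(2)[OF h'(1) j vmap_X(2,3)[OF j x(1) r(1)]])
  thus ?thesis using x(1) r by blast
 qed
 have vb: "\<bar>v\<bar> <= tp j" "\<bar>w\<bar> <= tp j" using v w by (auto simp: V_def)
 show "vmap j v < vmap j w"
 proof (cases "\<bar>v\<bar> = tp j \<or> \<bar>w\<bar> = tp j")
  case True
  show ?thesis
  proof (cases "\<bar>v\<bar> = tp j")
   case v': True
   hence v': "v = - tp j" "vmap j v = v" using vb vw by (auto simp: vmap_def abs_if split: if_splits)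
   show ?thesis
   proof (cases "\<bar>w\<bar> = tp j")
    case True thus ?thesis using v' vw by (simp add: vmap_def)
   next
    case False thus ?thesis using inner[OF w False] v' by (auto simp: abs_less_iff)
   qed
  next
   case False
   hence "\<bar>w\<bar> = tp j" using True by simp
   hence w': "w = tp j" "vmap j w = w" using vb vw False by (auto simp: vmap_def abs_if split: if_splits)
   thus ?thesis using inner[OF v False] by (auto simp: abs_less_iff)
  qed
 next
  case False
  obtain x where x: "x \<in> X h" "Re (h (of_real x)) = m j" "v = Im (h (of_real x))" using inner[OF v] False by blast
  obtain y where y: "y \<in> X h" "Re (h (of_real y)) = m j" "w = Im (h (of_real y))" using inner[OF w] False by blast
  note vx = vmap_X[OF j x(1,2)] and vy = vmap_X[OF j y(1,2)]
  define R where "R = (\<lambda>h v. {y \<in> X h. Re (h (of_real y)) = m j & Im (h (of_real y)) <= v})"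
  have eq: "card (R h' (vmap j v)) = card (R h v)" "card (R h' (vmap j w)) = card (R h w)"
   using code[of x] code[of y] x y vx vy by (simp_all add: code_def R_def Y_def)
  have "y \<in> R h w" "y \<notin> R h v" "R h v <= R h w" using vw y by (auto simp: R_def)
  hence "R h v \<subset> R h w" by blast
  hence "card (R h v) < card (R h w)" using h(2) by (intro psubset_card_mono) (auto simp: R_def)
  hence "card (R h' (vmap j v)) < card (R h' (vmap j w))" using eq by simp
  moreover have "card (R h' (vmap j w)) <= card (R h' (vmap j v))" if "vmap j w <= vmap j v"
   using h'(2) that by (intro card_mono) (auto simp: R_def)
  ultimately show ?thesis by linarith
 qed
qed

lemma vmap_image: assumes j: "j \<in> {1..n - 1}" shows "vmap j ` V h j = V h' j"
proof (intro equalityI subsetI)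
 fix w assume "w \<in> vmap j ` V h j"
 then obtain v where v: "v \<in> V h j" "w = vmap j v" by blast
 show "w \<in> V h' j"
 proof (cases "\<bar>v\<bar> = tp j")
  case True thus ?thesis using v by (simp add: vmap_def V_def)
 next
  case False
  obtain x where x: "x \<in> X h" "h (of_real x) = Complex (m j) v" by (rule V_cases[OF h(1) j v(1) False])
  hence r: "Re (h (of_real x)) = m j" "v = Im (h (of_real x))" by simp_all
  show ?thesis unfolding v(2) r(2) vmap_X(1)[OF j x(1) r(1)] by (rule V_I(1)[OF h'(1) j vmap_X(2,3)[OF j x(1) r(1)]])
 qed
next
 fix w assume w: "w \<in> V h' j"
 show "w \<in> vmap j ` V h j"
 proof (cases "\<bar>w\<bar> = tp j")
  case True thus ?thesis by (intro rev_image_eqI[of w]) (simp_all add: vmap_def V_def)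
 next
  case False
  obtain y where y: "y \<in> X h'" "h' (of_real y) = Complex (m j) w" by (rule V_cases[OF h'(1) j w False])
  obtain x where x: "x \<in> X h" "y = e x" using y(1) e_image_X by blast
  have r: "Re (h (of_real x)) = m j" using Re_e[of x] x y(2) by (simp add: Y_def)
  have "vmap j (Im (h (of_real x))) = w" using vmap_X(1)[OF j x(1) r] x(2) y(2) by simp
  thus ?thesis using V_I(1)[OF h(1) j x(1) r] by blast
 qed
qed

definition lam :: "nat => real => real" where
 "lam j = (SOME f. strict_mono f & continuous_on UNIV f & (\<forall>v\<in>V h j. f v = vmap j v))"

lemma lam:
 assumes j: "j \<in> {1..n - 1}"
 shows "strict_mono (lam j)" "continuous_on UNIV (lam j)" "v \<in> V h j ==> lam j v = vmap j v"
proof -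
 from someI_ex[OF strict_mono_extension[OF V_finite(1)[OF h(1,2) j] vmap_mono[OF j]]]
 show "strict_mono (lam j)" "continuous_on UNIV (lam j)" "v \<in> V h j ==> lam j v = vmap j v" unfolding lam_def by blast+
qed

lemma lam_ends: assumes j: "j \<in> {1..n - 1}" shows "\<bar>v\<bar> = tp j ==> lam j v = v" "\<bar>lam j v\<bar> < tp j \<longleftrightarrow> \<bar>v\<bar> < tp j"
proof -
 show 1: "lam j v = v" if "\<bar>v\<bar> = tp j" for v using lam(3)[OF j, of v] that by (simp add: V_def vmap_def)
 have "lam j (tp j) = tp j" "lam j (- tp j) = - tp j" using 1[of "tp j"] 1[of "- tp j"] norm_line(1)[OF j] by auto
 hence "lam j v < tp j \<longleftrightarrow> v < tp j" "- tp j < lam j v \<longleftrightarrow> - tp j < v"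
  using strict_mono_less[OF lam(1)[OF j]] by metis+
 thus "\<bar>lam j v\<bar> < tp j \<longleftrightarrow> \<bar>v\<bar> < tp j" by (auto simp: abs_less_iff)
qed

lemma lam_consec:
 assumes j: "j \<in> {1..n - 1}" and vw: "consec (V h j) v w"
 shows "consec (V h' j) (lam j v) (lam j w)" "card {u \<in> V h' j. lam j w < u} = card {u \<in> V h j. w < u}"
proof -
 have im: "lam j ` V h j = V h' j" using vmap_image[OF j] lam(3)[OF j] by (metis (no_types, lifting) image_cong)
 note less = strict_mono_less[OF lam(1)[OF j]]
 have vw': "v \<in> V h j" "w \<in> V h j" "v < w" "\<And>u. u \<in> V h j ==> \<not> (v < u & u < w)" using vw by (auto simp: consec_def)
 show "consec (V h' j) (lam j v) (lam j w)"
  unfolding consec_def im[symmetric] using vw' by (auto simp: less)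
 have "{u \<in> V h' j. lam j w < u} = lam j ` {u \<in> V h j. w < u}" unfolding im[symmetric] by (auto simp: less)
 thus "card {u \<in> V h' j. lam j w < u} = card {u \<in> V h j. w < u}"
  using card_image[OF strict_mono_on_imp_inj_on[of "{u \<in> V h j. w < u}" "lam j"]] lam(1)[OF j]
  by (metis monotone_on_subset subset_UNIV)
qed

text \<open>In both diagrams the side of a piece is given by the parity of the number of marked
  heights above it, and \<open>lam\<close> preserves this number.\<close>

lemma lam_side:
 assumes j: "j \<in> {1..n - 1}" and vw: "consec (V h j) v w" and u: "v < u" "u < w" and sd: "sd = 1 \<or> sd = -1"
  and s: "0 < sd * Im (inv h (Complex (m j) u))"
 shows "0 < sd * Im (inv h' (Complex (m j) (lam j u)))"
proof -
 define k where "k = card {u \<in> V h j. w < u}"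
 have 1: "0 < (-1) ^ k * Im (inv h (Complex (m j) u))" unfolding k_def by (rule side_parity[OF h j vw u])
 have "lam j v < lam j u" "lam j u < lam j w" using u strict_mono_less[OF lam(1)[OF j]] by auto
 hence 2: "0 < (-1) ^ k * Im (inv h' (Complex (m j) (lam j u)))"
  unfolding k_def lam_consec(2)[OF j vw, symmetric] by (rule side_parity[OF h' j lam_consec(1)[OF j vw]])
 have "(-1::real) ^ k = 1 \<or> (-1::real) ^ k = -1" using neg_one_even_power neg_one_odd_power by blast
 hence "(-1) ^ k = sd" using 1 s sd by auto
 thus ?thesis using 2 by simp
qed

end

text \<open>Linear interpolation between the identity and an increasing map stays increasing: this
  is the source of all isotopies on the one-dimensional skeletons.\<close>

lemma lin_path:
 fixes g :: "real => real"
 assumes ab: "a <= b" and g: "continuous_on {a..b} g" "strict_mono_on {a..b} g" "g a = a" "g b = b" and t: "t \<in> {0..1}"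
 shows "strict_mono_on {a..b} (\<lambda>x. (1 - t) * x + t * g x)" "(\<lambda>x. (1 - t) * x + t * g x) ` {a..b} = {a..b}"
proof -
 define k where "k = (\<lambda>x. (1 - t) * x + t * g x)"
 have k: "k x < k y" if "x \<in> {a..b}" "y \<in> {a..b}" "x < y" for x y
 proof -
  have "g x < g y" using strict_mono_onD[OF g(2)] that by blast
  show ?thesis
  proof (cases "t = 0")
   case False
   hence "t * g x < t * g y" "(1 - t) * x <= (1 - t) * y" using t that \<open>g x < g y\<close> by (auto intro: mult_left_mono)
   thus ?thesis by (simp add: k_def)
  qed (use that in \<open>simp add: k_def\<close>)
 qed
 thus "strict_mono_on {a..b} (\<lambda>x. (1 - t) * x + t * g x)" unfolding k_def by (rule strict_mono_onI)
 have ke: "k a = a" "k b = b" using g(3,4) by (simp_all add: k_def algebra_simps)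
 show "k ` {a..b} = {a..b}"
 proof
  show "k ` {a..b} <= {a..b}"
  proof
   fix y assume "y \<in> k ` {a..b}"
   then obtain x where x: "x \<in> {a..b}" "y = k x" by blast
   have "k a <= k x" using k[of a x] x(1) by (cases "x = a") auto
   moreover have "k x <= k b" using k[of x b] x(1) by (cases "x = b") auto
   ultimately show "y \<in> {a..b}" using ke x(2) by simp
  qed
  show "{a..b} <= k ` {a..b}"
  proof
   fix y assume y: "y \<in> {a..b}"
   have "continuous_on {a..b} k" unfolding k_def using g(1) by (intro continuous_intros)
   hence "\<exists>x\<ge>a. x <= b & k x = y" using ab y ke by (intro IVT') auto
   thus "y \<in> k ` {a..b}" by auto
  qed
 qed
qed

lemma inv_sign:
 assumes h: "h \<in> braid_homeos n p" and sd: "sd = 1 \<or> sd = -1" and z: "norm w = 1" "0 < sd * Im w"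
 shows "norm (inv h w) = 1" "0 < sd * Im (inv h w)"
proof -
 have hi: "h (inv h w) = w" by (rule bh_inv(2)[OF h])
 show n1: "norm (inv h w) = 1" using bh_norm(2)[OF h, of "inv h w"] z(1) unfolding hi by simp
 show "0 < sd * Im (inv h w)"
 proof (rule ccontr)
  assume "\<not> 0 < sd * Im (inv h w)"
  then consider "Im (inv h w) = 0" | "0 < - sd * Im (inv h w)" using sd by force
  thus False
  proof cases
   case 1
   hence "inv h w = 1 \<or> inv h w = -1" using n1 by (auto simp: complex_eq_iff cmod_def abs_if split: if_splits)
   hence "w = 1 \<or> w = -1" using hi bhD(6,7)[OF h] by metis
   thus False using z(2) by auto
  next
   case 2
   hence "0 < - sd * Im w" using braid_homeo_sign[OF h _ n1, of "- sd"] sd unfolding hi by auto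
   thus False using z(2) by simp
  qed
 qed
qed

text \<open>The semicircle on the side \<open>sd\<close>, parametrized by the abscissa, so that maps
  of it become maps of \<open>[-1,1]\<close>.\<close>

definition rimpt :: "real => real => complex" where "rimpt sd x = Complex x (sd * sqrt (1 - x\<^sup>2))"

lemma rimpt:
 assumes sd: "sd = 1 \<or> sd = -1" and x: "x \<in> {-1..1}"
 shows "norm (rimpt sd x) = 1" "Re (rimpt sd x) = x" "0 <= sd * Im (rimpt sd x)" "Im (rimpt sd x) = 0 \<longleftrightarrow> x = 1 \<or> x = -1"
proof -
 have "\<bar>x\<bar> <= 1" using x by auto
 hence x2: "x\<^sup>2 <= 1" by (simp add: abs_square_le_1)
 have s2: "sd * sd = 1" using sd by auto
 show "norm (rimpt sd x) = 1" using x2 sd by (auto simp: rimpt_def cmod_def)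
 show "Re (rimpt sd x) = x" by (simp add: rimpt_def)
 show "0 <= sd * Im (rimpt sd x)" using x2 s2 by (simp add: rimpt_def mult.assoc[symmetric])
 have "Im (rimpt sd x) = 0 \<longleftrightarrow> x\<^sup>2 = 1" using sd by (auto simp: rimpt_def)
 thus "Im (rimpt sd x) = 0 \<longleftrightarrow> x = 1 \<or> x = -1" by (simp add: power2_eq_1_iff)
qed

lemma rimpt_eq:
 assumes sd: "sd = 1 \<or> sd = -1" and z: "norm z = 1" "0 <= sd * Im z"
 shows "z = rimpt sd (Re z)" "Re z \<in> {-1..1}"
proof -
 have e: "(Im z)\<^sup>2 = 1 - (Re z)\<^sup>2" using z(1) cmod_power2[of z] by simp
 have "sqrt (1 - (Re z)\<^sup>2) = \<bar>Im z\<bar>" unfolding e[symmetric] by simp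
 thus "z = rimpt sd (Re z)" using sd z(2) by (auto simp: rimpt_def complex_eq_iff)
 show "Re z \<in> {-1..1}" using abs_Re_le_cmod[of z] z(1) by auto
qed

lemma hrim_eq:
 assumes sd: "sd = 1 \<or> sd = -1"
 shows "hrim sd = of_real ` {-1..1} Un rimpt sd ` {-1..1}"
proof (intro equalityI subsetI)
 fix z assume z: "z \<in> hrim sd"
 show "z \<in> of_real ` {-1..1} Un rimpt sd ` {-1..1}"
 proof (cases "norm z = 1")
  case True
  hence "z = rimpt sd (Re z)" "Re z \<in> {-1..1}" using rimpt_eq[OF sd True] z by (simp_all add: hrim_def)
  thus ?thesis by blast
 next
  case False
  hence "Im z = 0" "norm z <= 1" using z by (simp_all add: hrim_def)
  hence "z = of_real (Re z)" "Re z \<in> {-1..1}" using abs_Re_le_cmod[of z] by (auto simp: complex_eq_iff)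
  thus ?thesis by blast
 qed
next
 fix z assume "z \<in> of_real ` {-1..1} Un rimpt sd ` {-1..1}"
 then consider x where "x \<in> {-1..1}" "z = of_real x" | x where "x \<in> {-1..1}" "z = rimpt sd x" by blast
 thus "z \<in> hrim sd"
 proof cases
  case 1 thus ?thesis by (auto simp: hrim_def abs_le_iff)
 next
  case 2 thus ?thesis using rimpt[OF sd 2(1)] by (simp add: hrim_def)
 qed
qed

lemma inj_interval_strict_mono:
 fixes g :: "real => real"
 assumes g: "continuous_on {a..b} g" "inj_on g {a..b}" "g a < g b"
 shows "strict_mono_on {a..b} g"
proof (rule strict_mono_onI)
 fix x y assume x: "x \<in> {a..b}" and y: "y \<in> {a..b}" and xy: "x < y"
 have *: "g a < g y" if "y \<in> {a..b}" "a < y" for y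
 proof (cases "y = b")
  case False
  thus ?thesis using continuous_inj_imp_mono[OF that(2) _ g(1,2)] that g(3) by auto
 qed (use g(3) in simp)
 show "g x < g y"
 proof (cases "x = a")
  case True thus ?thesis using *[OF y] xy by simp
 next
  case False
  have "continuous_on {a..y} g" "inj_on g {a..y}"
   using y g by (auto intro: continuous_on_subset inj_on_subset)
  thus ?thesis using continuous_inj_imp_mono[of a x y g] False x xy *[OF y] by auto
 qed
qed

section \<open>The map of the skeleton in the source and its extension\<close>

context matching_diagrams begin

text \<open>Moves the points along the inner lamination lines and is the identity elsewhere. This is
  not continuous on the plane; what counts are its values on the lines and on the unit circle, which
  it fixes.\<close>

definition Lam :: "complex => complex" where
 "Lam w = (if Re w \<in> m ` {1..n - 1} then Complex (Re w) (lam (inv_into {1..n - 1} m (Re w)) (Im w)) else w)"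

lemma Lam_line: assumes j: "j \<in> {1..n - 1}" shows "Lam (Complex (m j) u) = Complex (m j) (lam j u)"
proof -
 have "inj_on m {1..n - 1}" by (rule inj_onI) (use m_eq in auto)
 thus ?thesis using j by (simp add: Lam_def)
qed

lemma Re_Lam: "Re (Lam w) = Re w" by (simp add: Lam_def)

lemma Lam_circle: assumes "norm w = 1" shows "Lam w = w"
proof (cases "Re w \<in> m ` {1..n - 1}")
 case True
 then obtain j where j: "j \<in> {1..n - 1}" "Re w = m j" by blast
 have w: "w = Complex (m j) (Im w)" using j(2) by (simp add: complex_eq_iff)
 hence "\<bar>Im w\<bar> = tp j" using norm_line(3)[OF j(1), of "Im w"] assms by simp
 hence "lam j (Im w) = Im w" by (rule lam_ends(1)[OF j(1)])
 thus ?thesis using Lam_line[OF j(1), of "Im w"] w by simp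
qed (simp add: Lam_def)

lemma Lam_inj: "inj Lam"
proof (rule injI)
 fix w w' assume e: "Lam w = Lam w'"
 have R: "Re w = Re w'" using e Re_Lam by metis
 show "w = w'"
 proof (cases "Re w \<in> m ` {1..n - 1}")
  case True
  then obtain j where j: "j \<in> {1..n - 1}" "Re w = m j" by blast
  have w: "w = Complex (m j) (Im w)" "w' = Complex (m j) (Im w')" using j(2) R by (simp_all add: complex_eq_iff)
  have "lam j (Im w) = lam j (Im w')" using e Lam_line[OF j(1)] w by (metis complex.inject)
  hence "Im w = Im w'" using strict_mono_eq[OF lam(1)[OF j(1)]] by blast
  thus ?thesis using R by (simp add: complex_eq_iff)
 qed (use e R in \<open>simp add: Lam_def\<close>)
qed

text \<open>On the circle and on the chords \<open>gam\<close> is conjugate to \<open>Lam\<close>,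
  so that it carries the preimages of the lines under \<open>h\<close> to those under
  \<open>h'\<close>; on the diameter it follows the pairing of the crossings.\<close>

definition gam :: "complex => complex" where
 "gam z = (if Im z = 0 then of_real (B (Re z)) else inv h' (Lam (h z)))"

lemma gam_circle: assumes "norm z = 1" shows "gam z = inv h' (h z)"
proof (cases "Im z = 0")
 case True
 hence "z = 1 \<or> z = -1" using assms by (auto simp: complex_eq_iff cmod_def abs_if split: if_splits)
 moreover have "inv h' 1 = 1" "inv h' (-1) = -1"
  using bhD(6,7)[OF h'(1)] bh_inv(1)[OF h'(1), of 1] bh_inv(1)[OF h'(1), of "-1"] by simp_all
 ultimately show ?thesis using B_ends(1,2) bhD(6,7)[OF h(1)] by (auto simp: gam_def)
next
 case False
 have "norm (h z) = 1" using bh_norm(2)[OF h(1)] assms by blast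
 thus ?thesis using False by (simp add: gam_def Lam_circle)
qed

text \<open>At a crossing the two clauses of \<open>gam\<close> agree: \<open>lam\<close> moves the
  height of a crossing to the height of the paired crossing, and \<open>B\<close> moves its
  parameter to the paired parameter.\<close>

lemma gam_line:
 assumes j: "j \<in> {1..n - 1}" and z: "norm z <= 1" "Re (h z) = m j"
 shows "gam z = inv h' (Lam (h z))"
proof (cases "Im z = 0")
 case True
 define x where "x = Re z"
 have zx: "z = of_real x" using True by (simp add: x_def complex_eq_iff)
 have "\<bar>x\<bar> <= 1" using z(1) zx by simp
 moreover have "m j \<in> M" using j by auto
 ultimately have x: "x \<in> X h" using z(2) zx by (auto simp: X_def)
 note vx = vmap_X[OF j x z(2)[unfolded zx]]
 have hz: "h z = Complex (m j) (Im (h z))" using z(2) by (simp add: complex_eq_iff)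
 have "Lam (h z) = Complex (m j) (lam j (Im (h z)))" using Lam_line[OF j, of "Im (h z)"] hz by simp
 also have "lam j (Im (h z)) = Im (h' (of_real (e x)))"
  using lam(3)[OF j V_I(1)[OF h(1) j x z(2)[unfolded zx]]] vx(1) zx by simp
 also have "Complex (m j) (Im (h' (of_real (e x)))) = h' (of_real (e x))" using vx(3) by (simp add: complex_eq_iff)
 finally have "inv h' (Lam (h z)) = of_real (e x)" by (simp add: bh_inv(1)[OF h'(1)])
 moreover have "B x = e x" using B(3) x by (simp add: Y_def)
 ultimately show ?thesis using True by (simp add: gam_def x_def)
qed (simp add: gam_def)

abbreviation "Gam sd \<equiv> hrim sd Un \<Union>(chords h sd)"

text \<open>\<open>gam\<close> preserves the open half-discs on the skeleton: on the circle because
  \<open>h\<close> and \<open>inv h'\<close> preserve the semicircles, on the chords by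
  \<open>lam_side\<close>.\<close>

lemma gam_side:
 assumes sd: "sd = 1 \<or> sd = -1" and z: "z \<in> Gam sd" "Im z ~= 0"
 shows "0 < sd * Im (gam z) & norm z <= 1 & norm (gam z) <= 1 & (norm (gam z) = 1 \<longleftrightarrow> norm z = 1)"
proof -
 have rim: "0 < sd * Im (gam z) & norm z <= 1 & norm (gam z) <= 1 & (norm (gam z) = 1 \<longleftrightarrow> norm z = 1)" if z: "z \<in> hrim sd" "Im z ~= 0" for z
 proof -
  have n1: "norm z = 1" "0 < sd * Im z" using z sd by (auto simp: hrim_def less_le)
  have "norm (h z) = 1" using bh_norm(2)[OF h(1)] n1(1) by blast
  thus "0 < sd * Im (gam z) & norm z <= 1 & norm (gam z) <= 1 & (norm (gam z) = 1 \<longleftrightarrow> norm z = 1)" unfolding gam_circle[OF n1(1)]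
   using inv_sign[OF h'(1) sd _ braid_homeo_sign[OF h(1) sd n1]] n1(1) by simp
 qed
 show ?thesis
 proof (cases "z \<in> hrim sd")
  case True thus ?thesis using rim z(2) by blast
 next
  case False
  then obtain j v w where j: "j \<in> {1..n - 1}" and vw: "consec (V h j) v w" and c: "z \<in> ch h j v w"
   and side: "\<And>u. v < u ==> u < w ==> 0 < sd * Im (inv h (Complex (m j) u))"
   using z(1) unfolding chords_def by blast
  obtain u where u: "u \<in> {v..w}" "z = inv h (Complex (m j) u)" using c unfolding ch_def by blast
  have lt: "v < w" "v \<in> V h j" "w \<in> V h j" using vw by (simp_all add: consec_def)
  have "u ~= v" "u ~= w" using chord_ends_rim[OF h(1) j lt(1) sd side, of u] False u(2) lt by auto
  hence u': "v < u" "u < w" using u(1) by auto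
  have hz: "h z = Complex (m j) u" unfolding u(2) by (rule bh_inv(2)[OF h(1)])
  have nz: "norm z < 1" unfolding u(2) by (rule chord_interior[OF h(1) j vw u'])
  have gz: "gam z = inv h' (Complex (m j) (lam j u))"
   using gam_line[OF j, of z] nz hz Lam_line[OF j] by simp
  have "\<bar>u\<bar> < tp j" using nz bh_norm(1)[OF h(1), of z] norm_line(2)[OF j, of u] hz by simp
  hence "norm (Complex (m j) (lam j u)) < 1" unfolding norm_line(2)[OF j] lam_ends(2)[OF j] .
  hence "norm (gam z) < 1" unfolding gz
   using bh_norm(1)[OF h'(1), of "inv h' (Complex (m j) (lam j u))"] bh_inv(2)[OF h'(1)] by simp
  moreover have "0 < sd * Im (gam z)" unfolding gz by (rule lam_side[OF j vw u' sd side[OF u']])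
  ultimately show ?thesis using nz by simp
 qed
qed

lemma gam_cont: assumes sd: "sd = 1 \<or> sd = -1" shows "continuous_on (Gam sd) gam"
proof -
 define I :: "complex set" where "I = of_real ` {-1..1}"
 define T where "T = {z. norm z = 1 & 0 <= sd * Im z}"
 have "rimpt sd ` {-1..1} = T"
 proof (intro equalityI subsetI)
  fix z assume "z \<in> T" thus "z \<in> rimpt sd ` {-1..1}" using rimpt_eq[OF sd, of z] unfolding T_def by blast
 qed (use rimpt[OF sd] in \<open>auto simp: T_def\<close>)
 hence R: "Gam sd = (\<Union>c\<in>{I, T} Un chords h sd. c)" unfolding hrim_eq[OF sd] I_def by auto
 have ccont: "continuous_on UNIV (inv h')" "continuous_on UNIV h" using bh_inv(3)[OF h'(1)] bhD(1)[OF h(1)] .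
 show ?thesis unfolding R
 proof (rule continuous_on_closed_Union)
  show "finite ({I, T} Un chords h sd)" using finite_chords[OF h(1,2)] by simp
  fix c assume "c \<in> {I, T} Un chords h sd"
  then consider "c = I" | "c = T" | "c \<in> chords h sd" by blast
  hence "closed c & continuous_on c gam"
  proof cases
   case 1
   have "compact I" unfolding I_def by (intro compact_continuous_image continuous_intros) auto
   moreover have "continuous_on I (\<lambda>z. complex_of_real (B (Re z)))"
    by (intro continuous_intros continuous_on_compose2[OF B(2)]) auto
   hence "continuous_on I gam" by (rule continuous_on_eq) (auto simp: I_def gam_def)
   ultimately show ?thesis using 1 by (simp add: compact_imp_closed)
  next
   case 2
   have "T = sphere 0 1 \<inter> {z. 0 <= sd * Im z}" by (auto simp: T_def)
   moreover have "closed {z. 0 <= sd * Im z}" by (intro closed_Collect_le continuous_intros)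
   ultimately have "closed T" by (simp add: closed_Int)
   moreover have "continuous_on T (\<lambda>z. inv h' (h z))"
    by (rule continuous_on_compose2[OF ccont(1) continuous_on_subset[OF ccont(2)]]) auto
   hence "continuous_on T gam" by (rule continuous_on_eq) (simp add: T_def gam_circle)
   ultimately show ?thesis using 2 by simp
  next
   case 3
   note ch3 = chords_chord[OF h(1) sd 3]
   obtain j v w where j: "j \<in> {1..n - 1}" and c: "c = ch h j v w" using 3 unfolding chords_def by blast
   have "continuous_on c (\<lambda>z. inv h' (Complex (m j) (lam j (Im (h z)))))"
    by (intro continuous_on_compose2[OF ccont(1)] continuous_on_Complex continuous_on_const
      continuous_on_compose2[OF lam(2)[OF j]] continuous_on_Im continuous_on_subset[OF ccont(2)]) auto
   moreover have "inv h' (Complex (m j) (lam j (Im (h z)))) = gam z" if z: "z \<in> c" for z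
   proof -
    obtain u where "z = inv h (Complex (m j) u)" using z unfolding c ch_def by blast
    hence hz: "h z = Complex (m j) u" by (simp add: bh_inv(2)[OF h(1)])
    have "norm z <= 1" using chord_in_disc(1)[OF sd ch3] z by (auto simp: hdisc_def)
    thus ?thesis using gam_line[OF j, of z] hz Lam_line[OF j] by simp
   qed
   ultimately have "continuous_on c gam" by (rule continuous_on_eq)
   thus ?thesis using chord_in_disc(2)[OF sd ch3] by (simp add: compact_imp_closed)
  qed
  thus "closed c" "continuous_on c gam" by auto
 qed
qed

lemma gam_inj: assumes sd: "sd = 1 \<or> sd = -1" shows "inj_on gam (Gam sd)"
proof (rule inj_onI)
 fix z z' assume z: "z \<in> Gam sd" "z' \<in> Gam sd" and e: "gam z = gam z'"
 have r: "Im (gam z) = 0 \<longleftrightarrow> Im z = 0" if "z \<in> Gam sd" for z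
 proof (cases "Im z = 0")
  case False thus ?thesis using gam_side[OF sd that] by auto
 qed (simp add: gam_def)
 show "z = z'"
 proof (cases "Im z = 0")
  case True
  hence "Im z' = 0" using r[OF z(1)] r[OF z(2)] e by simp
  hence "B (Re z) = B (Re z')" using True e by (simp add: gam_def)
  hence "Re z = Re z'" using strict_mono_eq[OF B(1)] by blast
  thus ?thesis using True \<open>Im z' = 0\<close> by (simp add: complex_eq_iff)
 next
  case False
  hence "Im z' ~= 0" using r[OF z(1)] r[OF z(2)] e by simp
  hence "inv h' (Lam (h z)) = inv h' (Lam (h z'))" using False e by (simp add: gam_def)
  hence "Lam (h z) = Lam (h z')" by (rule injD[OF bh_inv(4)[OF h'(1)]])
  hence "h z = h z'" by (rule injD[OF Lam_inj])
  thus ?thesis by (rule injD[OF bhD(2)[OF h(1)]])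
 qed
qed

lemma gam_real: "gam (of_real x) = of_real (B x)" by (simp add: gam_def)

text \<open>In the abscissa, the homeomorphism of the upper or lower unit semicircle induced by \<open>gam\<close>.\<close>

definition G :: "real => real => real" where "G sd x = Re (gam (rimpt sd x))"

lemma G:
 assumes sd: "sd = 1 \<or> sd = -1"
 shows "x \<in> {-1..1} ==> gam (rimpt sd x) = rimpt sd (G sd x)" "continuous_on {-1..1} (G sd)" "strict_mono_on {-1..1} (G sd)"
  "G sd (-1) = -1" "G sd 1 = 1"
proof -
 have sub: "rimpt sd ` {-1..1} <= Gam sd" unfolding hrim_eq[OF sd] by blast
 show 1: "gam (rimpt sd x) = rimpt sd (G sd x)" if x: "x \<in> {-1..1}" for x
 proof (cases "Im (rimpt sd x) = 0")
  case True
  hence "x = 1 \<or> x = -1" using rimpt(4)[OF sd x] by simp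
  hence "rimpt sd x = of_real x" "B x = x" using B_ends(1,2) by (auto simp: rimpt_def complex_eq_iff)
  thus ?thesis by (simp add: gam_real G_def)
 next
  case False
  thus ?thesis using gam_side[OF sd _ False] rimpt(1)[OF sd x] x sub rimpt_eq(1)[OF sd, of "gam (rimpt sd x)"]
   unfolding G_def by (simp add: less_imp_le image_subset_iff)
 qed
 have "rimpt sd 1 = of_real 1" "rimpt sd (-1) = of_real (-1)" by (simp_all add: rimpt_def complex_eq_iff)
 thus e: "G sd (-1) = -1" "G sd 1 = 1" using gam_real[of 1] gam_real[of "-1"] B_ends(1,2) by (simp_all add: G_def)
 have "continuous_on {-1..1} (rimpt sd)" unfolding rimpt_def by (intro continuous_intros)
 thus c: "continuous_on {-1..1} (G sd)" unfolding G_def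
  by (intro continuous_on_Re continuous_on_compose2[OF continuous_on_subset[OF gam_cont[OF sd] sub]]) auto
 have "inj_on (G sd) {-1..1}"
 proof (rule inj_onI)
  fix x y assume x: "x \<in> {-1..1}" and y: "y \<in> {-1..1}" and e: "G sd x = G sd y"
  hence "gam (rimpt sd x) = gam (rimpt sd y)" using 1 by simp
  hence "rimpt sd x = rimpt sd y" using inj_onD[OF gam_inj[OF sd]] sub x y by blast
  thus "x = y" by (simp add: rimpt_def)
 qed
 thus "strict_mono_on {-1..1} (G sd)" using e by (intro inj_interval_strict_mono[OF c]) auto
qed

lemma gam_rim: assumes sd: "sd = 1 \<or> sd = -1" shows "gam ` hrim sd = hrim sd"
proof -
 have "G sd ` {-1..1} = {-1..1}" using lin_path(2)[OF _ G(2-5)[OF sd], of 1] by simp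
 moreover have "gam ` rimpt sd ` {-1..1} = rimpt sd ` G sd ` {-1..1}"
  unfolding image_image by (rule image_cong[OF refl]) (rule G(1)[OF sd])
 moreover have "gam ` of_real ` {-1..1} = of_real ` {-1..1}"
  using B_ends(4) unfolding image_image gam_real by (metis image_image)
 ultimately show ?thesis unfolding hrim_eq[OF sd] image_Un by simp
qed

text \<open>The skeleton map is extended over each half-disc as a map prescribed on disjoint chords;
  on the diameter both extensions equal \<open>gam\<close>.\<close>

lemma extend_gam:
 "\<exists>Ps. \<forall>sd. sd = 1 \<or> sd = -1 \<longrightarrow> continuous_on (hdisc sd) Ps & inj_on Ps (hdisc sd) &
  Ps ` hdisc sd = hdisc sd & (\<forall>z\<in>Gam sd. Ps z = gam z)"
proof -
 have ex: "\<exists>Ps. continuous_on (hdisc sd) Ps & inj_on Ps (hdisc sd) &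
  Ps ` hdisc sd = hdisc sd & (\<forall>z\<in>Gam sd. Ps z = gam z)" if sd: "sd = 1 \<or> sd = -1" for sd
 proof -
  note hd = hd_Jordan[OF sd]
  have "\<exists>Ps. continuous_on (hrim sd Un inside (hrim sd)) Ps & inj_on Ps (hrim sd Un inside (hrim sd)) &
   Ps ` (hrim sd Un inside (hrim sd)) = gam ` hrim sd Un inside (gam ` hrim sd) & (\<forall>z\<in>Gam sd. Ps z = gam z)"
  proof (rule chord_system_extension[OF finite_chords[OF h(1,2)] hd(1) chords_chord[OF h(1) sd] chords_disjoint[OF h sd]
     gam_cont[OF sd] gam_inj[OF sd]])
   fix c assume c: "c \<in> chords h sd"
   show "gam ` (c - hrim sd) <= inside (gam ` hrim sd)" unfolding gam_rim[OF sd]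
   proof (rule image_subsetI)
    fix z assume z: "z \<in> c - hrim sd"
    hence "z \<in> inside (hrim sd)" using chords_chord[OF h(1) sd c] unfolding chord_def by blast
    hence "norm z < 1" "Im z ~= 0" unfolding hd(2) by auto
    moreover have "z \<in> Gam sd" using z c by blast
    ultimately show "gam z \<in> inside (hrim sd)" unfolding hd(2) using gam_side[OF sd, of z] by (simp add: less_le)
   qed
  qed
  thus ?thesis unfolding hd(3) gam_rim[OF sd] .
 qed
 obtain Ps1 where 1: "continuous_on (hdisc 1) Ps1" "inj_on Ps1 (hdisc 1)" "Ps1 ` hdisc 1 = hdisc 1"
  "\<And>z. z \<in> Gam 1 ==> Ps1 z = gam z" using ex[of 1] by auto
 obtain Ps2 where 2: "continuous_on (hdisc (-1)) Ps2" "inj_on Ps2 (hdisc (-1))" "Ps2 ` hdisc (-1) = hdisc (-1)"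
  "\<And>z. z \<in> Gam (-1) ==> Ps2 z = gam z" using ex[of "-1"] by auto
 define Ps where "Ps = (\<lambda>z. if 0 <= Im z then Ps1 z else Ps2 z)"
 have e1: "Ps z = Ps1 z" if "z \<in> hdisc 1" for z using that by (simp add: Ps_def hdisc_def)
 have e2: "Ps z = Ps2 z" if z: "z \<in> hdisc (-1)" for z
 proof (cases "Im z = 0")
  case True
  hence "z \<in> hrim 1" "z \<in> hrim (-1)" using z by (auto simp: hdisc_def hrim_def)
  thus ?thesis using 1(4)[of z] 2(4)[of z] True by (simp add: Ps_def)
 qed (use z in \<open>auto simp: Ps_def hdisc_def\<close>)
 have cd: "c <= hdisc sd" if "sd = 1 \<or> sd = -1" "c \<in> chords h sd" for c sd
  using chord_in_disc(1)[OF that(1) chords_chord[OF h(1) that]] .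
 have rd: "hrim sd <= hdisc sd" for sd by (auto simp: hrim_def hdisc_def)
 have gd: "Gam sd <= hdisc sd" if "sd = 1 \<or> sd = -1" for sd using cd[OF that] rd[of sd] by blast
 have "Ps z = gam z" if "z \<in> Gam 1" for z using e1[OF subsetD[OF gd that]] 1(4)[OF that] by simp
 moreover have "Ps z = gam z" if "z \<in> Gam (-1)" for z using e2[OF subsetD[OF gd that]] 2(4)[OF that] by simp
 moreover have "continuous_on (hdisc 1) Ps" "continuous_on (hdisc (-1)) Ps"
  by (rule continuous_on_eq[OF 1(1)], simp add: e1, rule continuous_on_eq[OF 2(1)], simp add: e2)
 moreover have "inj_on Ps (hdisc 1)" "inj_on Ps (hdisc (-1))" "Ps ` hdisc 1 = hdisc 1" "Ps ` hdisc (-1) = hdisc (-1)"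
  using 1(2,3) 2(2,3) inj_on_cong[of "hdisc 1" Ps Ps1, OF e1] inj_on_cong[of "hdisc (-1)" Ps Ps2, OF e2]
   image_cong[OF refl, of "hdisc 1" Ps Ps1, OF e1] image_cong[OF refl, of "hdisc (-1)" Ps Ps2, OF e2] by simp_all
 ultimately show ?thesis by (intro exI[of _ Ps]) blast
qed

end

context matching_diagrams begin

definition Psi :: "complex => complex" where
 "Psi = (SOME Ps. \<forall>sd. sd = 1 \<or> sd = -1 \<longrightarrow> continuous_on (hdisc sd) Ps & inj_on Ps (hdisc sd) &
  Ps ` hdisc sd = hdisc sd & (\<forall>z\<in>Gam sd. Ps z = gam z))"

lemma Psi:
 assumes "sd = 1 \<or> sd = -1"
 shows "continuous_on (hdisc sd) Psi & inj_on Psi (hdisc sd) & Psi ` hdisc sd = hdisc sd"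
  "z \<in> Gam sd ==> Psi z = gam z"
proof -
 have "\<forall>sd. sd = 1 \<or> sd = -1 \<longrightarrow> continuous_on (hdisc sd) Psi & inj_on Psi (hdisc sd) &
  Psi ` hdisc sd = hdisc sd & (\<forall>z\<in>Gam sd. Psi z = gam z)"
  unfolding Psi_def by (rule someI_ex[OF extend_gam])
 from this[rule_format, OF assms]
 show "continuous_on (hdisc sd) Psi & inj_on Psi (hdisc sd) & Psi ` hdisc sd = hdisc sd"
  "z \<in> Gam sd ==> Psi z = gam z" by (simp_all only:)
qed

lemma Psi_gam:
 assumes z: "norm z <= 1" "Im z = 0 \<or> norm z = 1 \<or> Re (h z) \<in> M"
 shows "Psi z = gam z"
proof -
 define sd :: real where "sd = (if 0 <= Im z then 1 else -1)"
 have sd: "sd = 1 \<or> sd = -1" and s: "0 <= sd * Im z" by (auto simp: sd_def)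
 have "z \<in> Gam sd"
 proof (cases "Im z = 0 \<or> norm z = 1")
  case True thus ?thesis using z(1) s by (auto simp: hrim_def)
 next
  case False
  have "norm z < 1" using z(1) False by simp
  moreover have "sd * Im z ~= 0" using sd False by auto
  hence "0 < sd * Im z" using s by linarith
  moreover have "Re (h z) \<in> M" using z(2) False by blast
  ultimately show ?thesis using chords_cover[OF h(1,2) sd] by blast
 qed
 thus ?thesis by (rule Psi(2)[OF sd])
qed

text \<open>A real value of \<open>Psi\<close> is already attained at a real point, since
  \<open>B\<close> maps the diameter onto itself; injectivity on the half-disc that contains
  \<open>z\<close> identifies \<open>z\<close> with that point.\<close>

lemma Psi_real: assumes z: "norm z <= 1" "Im (Psi z) = 0" shows "Im z = 0"
proof -
 define sd :: real where "sd = (if 0 <= Im z then 1 else -1)"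
 have sd: "sd = 1 \<or> sd = -1" and zd: "z \<in> hdisc sd" using z(1) by (auto simp: sd_def hdisc_def)
 note P = Psi(1)[OF sd]
 have "Psi z \<in> hdisc sd" using P zd by blast
 hence "Re (Psi z) \<in> {-1..1}" using abs_Re_le_cmod[of "Psi z"] by (auto simp: hdisc_def)
 then obtain x where x: "x \<in> {-1..1}" "Re (Psi z) = B x" using B_ends(4) by (metis imageE)
 have n: "norm (complex_of_real x) <= 1" using x(1) by auto
 have "Psi (of_real x) = of_real (B x)" using Psi_gam[OF n] by (simp add: gam_real)
 also have "\<dots> = Psi z" using x(2) z(2) by (simp add: complex_eq_iff)
 finally have "of_real x = z" using P zd n inj_onD[of Psi "hdisc sd" "of_real x" z] by (simp add: hdisc_def)
 thus ?thesis by auto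
qed

lemma Psi_glue: "continuous_on (cball 0 1) Psi" "inj_on Psi (cball 0 1)" "Psi ` cball 0 1 = cball 0 1"
proof -
 note g = hdisc_glue[of Psi, OF Psi(1) Psi_real]
 show "continuous_on (cball 0 1) Psi" by (rule g(1); assumption)
 show "inj_on Psi (cball 0 1)" by (rule g(2); assumption)
 show "Psi ` cball 0 1 = cball 0 1" by (rule g(3); assumption)
qed

text \<open>Here \<open>rimpt 0\<close> parametrizes the diameter and \<open>G 0\<close> is \<open>B\<close>.\<close>

lemma G_all:
 assumes s: "s \<in> {0, 1, -1}"
 shows "x \<in> {-1..1} ==> gam (rimpt s x) = rimpt s (G s x)" "continuous_on {-1..1} (G s)" "strict_mono_on {-1..1} (G s)"
  "G s (-1) = -1" "G s 1 = 1"
proof -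
 have r: "rimpt 0 = of_real" by (simp add: rimpt_def fun_eq_iff complex_eq_iff)
 have "x \<in> {-1..1} \<longrightarrow> gam (rimpt s x) = rimpt s (G s x)" "continuous_on {-1..1} (G s) & strict_mono_on {-1..1} (G s) & G s (-1) = -1 & G s 1 = 1"
 proof -
  have *: "G 0 = B" by (simp add: G_def r gam_real fun_eq_iff)
  have "continuous_on {-1..1} B" "strict_mono_on {-1..1} B"
   using continuous_on_subset[OF B(2)] strict_mono_less[OF B(1)] by (auto intro: strict_mono_onI)
  thus "x \<in> {-1..1} \<longrightarrow> gam (rimpt s x) = rimpt s (G s x)" "continuous_on {-1..1} (G s) & strict_mono_on {-1..1} (G s) & G s (-1) = -1 & G s 1 = 1"
   using s G[of s] B_ends(1,2) gam_real by (cases "s = 0"; auto simp: * r)+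
 qed
 thus "x \<in> {-1..1} ==> gam (rimpt s x) = rimpt s (G s x)" "continuous_on {-1..1} (G s)" "strict_mono_on {-1..1} (G s)"
  "G s (-1) = -1" "G s 1 = 1" by blast+
qed

text \<open>The diameter and both semicircles are preserved by \<open>Psi\<close>, and in the
  abscissa it acts on each as an increasing map. Interpolating these three maps with the identity
  deforms the values on the skeleton, and the punctures, fixed by \<open>B\<close>, stay
  fixed.\<close>

lemma diagram_isotopy: "(h', radial (\<lambda>z. h' (Psi z))) \<in> braid_isotopy n p"
proof -
 define S :: "real set" where "S = {0, 1, -1}"
 define R where "R = hrim 1 Un hrim (-1)"
 define k where "k = (\<lambda>s t x. (1 - t) * x + t * G s x)"
 \<comment> \<open>The sign of the imaginary part selects the arc. At \<open>1\<close> and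
   \<open>-1\<close>, which belong to all three arcs, the sign selects the diameter, and all
   interpolations fix these points.\<close>
 define b where "b = (\<lambda>t z. rimpt (sgn (Im z)) (k (sgn (Im z)) t (Re z)))"
 note G = G_all[folded S_def]
 have K: "strict_mono_on {-1..1} (k s t)" "k s t ` {-1..1} = {-1..1}" "k s t 1 = 1" "k s t (-1) = -1"
  if s: "s \<in> S" and t: "t \<in> {0..1}" for s t
  using lin_path[OF _ G(2-5)[OF s] t] G(4,5)[OF s] unfolding k_def by simp_all
 have r1: "rimpt s x = of_real x" if "x = 1 \<or> x = -1" for s x using that by (auto simp: rimpt_def complex_eq_iff)
 have r0: "rimpt 0 x = of_real x" for x by (simp add: rimpt_def complex_eq_iff)
 have sg: "sgn (Im (rimpt s x)) = s" if s: "s \<in> S" and x: "x \<in> {-1..1}" "x ~= 1" "x ~= -1" for s x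
 proof -
  have "\<bar>x\<bar> < 1" using x by auto
  hence "0 < sqrt (1 - x\<^sup>2)" by (simp add: abs_square_less_1)
  thus ?thesis using s by (auto simp: S_def rimpt_def sgn_mult)
 qed
 have b: "b t (rimpt s x) = rimpt s (k s t x)" if s: "s \<in> S" and t: "t \<in> {0..1}" and x: "x \<in> {-1..1}" for s t x
 proof (cases "x = 1 \<or> x = -1")
  case True
  thus ?thesis using K(3,4)[OF s t] K(3,4)[of 0 t, OF _ t] r1[OF True] by (auto simp: b_def S_def r0)
 next
  case False thus ?thesis using sg[OF s x] by (simp add: b_def rimpt_def)
 qed
 have hr: "hrim sd = rimpt 0 ` {-1..1} Un rimpt sd ` {-1..1}" if "sd = 1 \<or> sd = -1" for sd
  unfolding hrim_eq[OF that] r0 ..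
 have RS: "R = (\<Union>s\<in>S. rimpt s ` {-1..1})" unfolding R_def hr[of 1, simplified] hr[of "-1", simplified] S_def by auto
 have bim: "b t ` rimpt s ` {-1..1} = rimpt s ` {-1..1}" if s: "s \<in> S" and t: "t \<in> {0..1}" for s t
 proof -
  have "b t ` rimpt s ` {-1..1} = rimpt s ` k s t ` {-1..1}" unfolding image_image by (rule image_cong[OF refl]) (rule b[OF s t])
  thus ?thesis unfolding K(2)[OF s t] .
 qed
 have rep: "sgn (Im z) \<in> S" "Re z \<in> {-1..1}" "rimpt (sgn (Im z)) (Re z) = z" if z: "z \<in> R" for z
 proof -
  obtain s x where sx: "s \<in> S" "x \<in> {-1..1}" "z = rimpt s x" using z unfolding RS by blast
  have Rz: "Re z = x" using sx(3) by (simp add: rimpt_def)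
  show "Re z \<in> {-1..1}" "sgn (Im z) \<in> S" using sx(2) Rz by (auto simp: S_def sgn_if)
  show "rimpt (sgn (Im z)) (Re z) = z"
  proof (cases "x = 1 \<or> x = -1")
   case True
   hence "z = of_real x" using sx(3) r1 by simp
   thus ?thesis by (simp add: r0)
  next
   case False thus ?thesis using sg[OF sx(1,2)] sx(3) Rz by simp
  qed
 qed
 have bs: "sgn (Im (b t z)) = sgn (Im z)" if z: "z \<in> R" and t: "t \<in> {0..1}" for z t
 proof (cases "Im z = 0")
  case False
  define s where "s = sgn (Im z)"
  have s: "s \<in> S" "rimpt s (Re z) = z" "s ~= 0" using rep[OF z] False by (simp_all add: s_def sgn_zero_iff)
  have "Im (rimpt s (Re z)) ~= 0" using s(2) False by simp
  hence ne: "Re z ~= 1" "Re z ~= -1" using r1[of "Re z" s] by auto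
  have "k s t (Re z) \<in> {-1..1}" using K(2)[OF s(1) t] rep(2)[OF z] by blast
  moreover have "k s t (Re z) ~= 1" "k s t (Re z) ~= -1"
   using inj_onD[OF strict_mono_on_imp_inj_on[OF K(1)[OF s(1) t]] _ rep(2)[OF z]] K(3,4)[OF s(1) t] ne by fastforce+
  ultimately have "sgn (Im (rimpt s (k s t (Re z)))) = s" by (rule sg[OF s(1)])
  thus ?thesis by (simp add: b_def s_def)
 qed (simp add: b_def r0)
 show ?thesis
 proof (rule precompose_isotopy[where b = b, OF h'(1) Psi(1) Psi_real], unfold R_def[symmetric])
  have "continuous_on (\<Union>s\<in>S. {0..1} \<times> rimpt s ` {-1..1}) (\<lambda>x. b (fst x) (snd x))"
  proof (rule continuous_on_closed_Union)
   fix s assume s: "s \<in> S"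
   have "compact (rimpt s ` {-1..1})" unfolding rimpt_def by (intro compact_continuous_image continuous_on_Complex continuous_intros compact_Icc)
   thus "closed ({0..1::real} \<times> rimpt s ` {-1..1})" by (intro closed_Times compact_imp_closed) auto
   have "continuous_on ({0..1} \<times> rimpt s ` {-1..1}) (\<lambda>x. rimpt s (k s (fst x) (Re (snd x))))" unfolding k_def rimpt_def
    by (intro continuous_on_Complex continuous_intros continuous_on_compose2[OF G(2)[OF s]]) (auto simp: rimpt_def)
   thus "joint_cont (rimpt s ` {-1..1}) b"
    by (rule continuous_on_eq) (use b[OF s] in \<open>auto simp: rimpt_def\<close>)
  qed (simp add: S_def)
  moreover have "(\<Union>s\<in>S. {0..1::real} \<times> rimpt s ` {-1..1}) = {0..1} \<times> R" unfolding RS by blast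
  ultimately show "joint_cont R b" by (simp only:)
 next
  fix t :: real assume t: "t \<in> {0..1}"
  show "inj_on (b t) R"
  proof (rule inj_onI)
   fix z z' assume z: "z \<in> R" "z' \<in> R" and e: "b t z = b t z'"
   have s: "sgn (Im z') = sgn (Im z)" using bs[OF z(1) t] bs[OF z(2) t] e by simp
   have "k (sgn (Im z)) t (Re z) = k (sgn (Im z)) t (Re z')" using arg_cong[OF e, of Re] s by (simp add: b_def rimpt_def)
   hence "Re z = Re z'" using inj_onD[OF strict_mono_on_imp_inj_on[OF K(1)[OF rep(1)[OF z(1)] t]]] rep(2) z by blast
   thus "z = z'" using rep(3)[OF z(1)] rep(3)[OF z(2)] s by simp
  qed
  have "sphere (0::complex) 1 = rimpt 1 ` {-1..1} Un rimpt (-1) ` {-1..1}"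
  proof (intro equalityI subsetI)
   fix z :: complex assume "z \<in> sphere 0 1"
   thus "z \<in> rimpt 1 ` {-1..1} Un rimpt (-1) ` {-1..1}" using rimpt_eq[of 1 z] rimpt_eq[of "-1" z] by (cases "0 <= Im z") auto
  qed (use rimpt(1) in auto)
  thus "b t ` sphere 0 1 = sphere 0 1" using bim[OF _ t] by (simp add: image_Un S_def)
  fix z assume "z \<in> punctures n p Un {1, -1}"
  then consider s where "s \<in> {1..n}" "z = of_real (p s)" | "z = of_real 1" | "z = of_real (-1)" by (auto simp: punctures_def)
  then obtain x where "z = of_real x" "B x = x" using B_ends(1-3) by metis
  thus "b t z = z" by (simp add: b_def r0 k_def G_def gam_real algebra_simps)
 next
  fix t sd :: real assume "t \<in> {0..1}" "sd = 1 \<or> sd = -1"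
  thus "b t ` hrim sd = hrim sd" using bim[of 0 t] bim[of sd t] by (auto simp: hr image_Un S_def)
 next
  fix z assume z: "z \<in> R"
  then obtain s x where sx: "s \<in> S" "x \<in> {-1..1}" "z = rimpt s x" unfolding RS by blast
  have "Psi z = gam z" by (rule Psi_gam) (use z in \<open>auto simp: R_def hrim_def\<close>)
  thus "b 0 z = z" "b 1 z = Psi z" using b[OF sx(1) _ sx(2)] G(1)[OF sx(1,2)] sx(3) by (simp_all add: k_def)
 qed
qed

section \<open>The homeomorphism of the disc that preserves the lines\<close>

text \<open>On the disc \<open>Psi\<close>, seen in the target. It carries the curve of
  \<open>h\<close> onto the curve of \<open>h'\<close>, as \<open>Psi\<close> preserves the
  diameter, and it acts on the lamination lines as \<open>Lam\<close>.\<close>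

definition phi :: "complex => complex" where "phi w = h' (Psi (inv h w))"

lemma phi_glue: "continuous_on (cball 0 1) phi" "inj_on phi (cball 0 1)" "phi ` cball 0 1 = cball 0 1"
proof -
 note hi = bh_inv[OF h(1)]
 have ic: "inv h ` cball 0 1 = cball 0 1"
 proof -
  have "inv h ` h ` cball 0 1 = cball 0 1" unfolding image_image hi(1) by simp
  thus ?thesis unfolding braid_homeo_cball[OF h(1)] .
 qed
 have "continuous_on (cball 0 1) (\<lambda>w. Psi (inv h w))"
  by (rule continuous_on_compose2[OF Psi_glue(1) hi(3)]) (simp add: ic)
 thus "continuous_on (cball 0 1) phi" unfolding phi_def
  by (rule continuous_on_compose2[OF bhD(1)[OF h'(1), of UNIV]]) simp
 show "inj_on phi (cball 0 1)"
 proof (rule inj_onI)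
  fix w w' assume w: "w \<in> cball 0 1" "w' \<in> cball 0 1" and "phi w = phi w'"
  hence "h' (Psi (inv h w)) = h' (Psi (inv h w'))" by (simp only: phi_def)
  hence "Psi (inv h w) = Psi (inv h w')" by (rule injD[OF bhD(2)[OF h'(1)]])
  moreover have "inv h w \<in> cball 0 1" "inv h w' \<in> cball 0 1" using ic w by blast+
  ultimately have "inv h w = inv h w'" using inj_onD[OF Psi_glue(2)] by blast
  thus "w = w'" by (rule injD[OF hi(4)])
 qed
 have "phi ` cball 0 1 = h' ` Psi ` inv h ` cball 0 1" unfolding phi_def image_image ..
 thus "phi ` cball 0 1 = cball 0 1" unfolding ic Psi_glue(3) braid_homeo_cball[OF h'(1)] .
qed

lemma phi_Lam:
 assumes w: "norm w <= 1" "norm w = 1 \<or> Re w \<in> m ` {1..n - 1}"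
 shows "phi w = Lam w"
proof -
 define z where "z = inv h w"
 have hz: "h z = w" unfolding z_def by (rule bh_inv(2)[OF h(1)])
 have nz: "norm z <= 1" using w(1) bh_norm(3)[OF h(1), of z] hz by simp
 have g: "gam z = inv h' (Lam w)"
 proof (cases "norm w = 1")
  case True
  hence "norm z = 1" using bh_norm(2)[OF h(1), of z] hz by simp
  thus ?thesis using gam_circle hz Lam_circle[OF True] by simp
 next
  case False
  then obtain j where "j \<in> {1..n - 1}" "Re w = m j" using w(2) by blast
  thus ?thesis using gam_line[of j z] nz hz by simp
 qed
 have "Psi z = gam z"
 proof (rule Psi_gam[OF nz])
  have "m ` {1..n - 1} <= M" by auto
  moreover have "norm w = 1 ==> norm z = 1" using bh_norm(2)[OF h(1), of z] hz by simp
  ultimately show "Im z = 0 \<or> norm z = 1 \<or> Re (h z) \<in> M" using w(2) hz by blast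
 qed
 thus ?thesis using g bh_inv(2)[OF h'(1)] by (simp add: phi_def z_def)
qed

text \<open>The preimage of a puncture under \<open>h\<close> is a puncture. It is fixed by
  \<open>Psi\<close>, and \<open>h\<close> and \<open>h'\<close> have the same value at it.\<close>

lemma phi_p: assumes s: "s \<in> {1..n}" shows "phi (of_real (p s)) = of_real (p s)"
proof -
 have "of_real (p s) \<in> punctures n p" using s by (simp add: punctures_def)
 hence "of_real (p s) \<in> h ` punctures n p" by (simp only: bhD(4)[OF h(1)])
 then obtain z where z: "z \<in> punctures n p" "h z = of_real (p s)" by (metis imageE)
 then obtain r where r: "r \<in> {1..n}" "h (of_real (p r)) = of_real (p s)" by (auto simp: punctures_def)
 hence i: "inv h (of_real (p s)) = of_real (p r)" using bh_inv(1)[OF h(1), of "of_real (p r)"] by simp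
 have "norm (complex_of_real (p r)) <= 1" using p_bounds[OF r(1)] by (simp add: abs_le_iff)
 hence "Psi (of_real (p r)) = gam (of_real (p r))" by (rule Psi_gam) simp
 hence "Psi (of_real (p r)) = of_real (p r)" using gam_real B_ends(3)[OF r(1)] by simp
 thus ?thesis using i same_punctures[OF r(1)] r(2) by (simp add: phi_def)
qed

definition K :: "nat => complex set" where "K s = {z. norm z <= 1 & m (s - 1) <= Re z & Re z <= m s}"

lemma K_Jordan:
 assumes s: "s \<in> {1..n}"
 shows "Jordan (frontier (K s))" "inside (frontier (K s)) = {z. norm z < 1 & m (s - 1) < Re z & Re z < m s}"
  "frontier (K s) Un inside (frontier (K s)) = K s"
  "frontier (K s) = {z \<in> K s. norm z = 1 \<or> Re z = m (s - 1) \<or> Re z = m s}"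
proof -
 have r1: "1 \<bullet> z = Re z" for z by (simp add: inner_complex_def)
 have Ke: "K s = cball 0 1 \<inter> ({z. 1 \<bullet> z \<ge> m (s - 1)} \<inter> {z. 1 \<bullet> z <= m s})" by (auto simp: K_def r1)
 have cpt: "compact (K s)" unfolding Ke by (intro compact_Int_closed compact_cball closed_Int closed_halfspace_ge closed_halfspace_le)
 have cvx: "convex (K s)" unfolding Ke by (intro convex_Int convex_cball convex_halfspace_ge convex_halfspace_le)
 have int: "interior (K s) = {z. norm z < 1 & m (s - 1) < Re z & Re z < m s}"
  unfolding Ke interior_Int interior_cball using interior_halfspace_ge[of "1::complex" "m (s - 1)"] interior_halfspace_le[of "1::complex" "m s"]
  by (auto simp: r1)
 have "of_real (p s) \<in> interior (K s)" unfolding int using m_p[OF s] p_bounds[OF s] by (simp add: abs_less_iff)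
 hence ne: "interior (K s) ~= {}" by blast
 show "Jordan (frontier (K s))" "inside (frontier (K s)) = {z. norm z < 1 & m (s - 1) < Re z & Re z < m s}"
  "frontier (K s) Un inside (frontier (K s)) = K s" using convex_Jordan[OF cpt cvx ne] int by simp_all
 have fr: "frontier (K s) = K s - interior (K s)" using cpt by (simp add: frontier_def compact_imp_closed)
 have "K s - {z. norm z < 1 & m (s - 1) < Re z & Re z < m s} = {z \<in> K s. norm z = 1 \<or> Re z = m (s - 1) \<or> Re z = m s}"
  unfolding K_def by auto
 thus "frontier (K s) = {z \<in> K s. norm z = 1 \<or> Re z = m (s - 1) \<or> Re z = m s}" using fr int by simp
qed

lemma line_cases:
 assumes w: "norm w <= 1" "Re w = m j" "j <= n"
 shows "norm w = 1 \<or> j \<in> {1..n - 1}"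
proof (cases "j = 0 \<or> j = n")
 case True
 hence "\<bar>Re w\<bar> = 1" using w(2) m_ends by auto
 thus ?thesis using abs_Re_le_cmod[of w] w(1) by simp
qed (use w(3) in auto)

lemma line_norm:
 assumes j: "j \<in> {1..n - 1}" and w: "Re w = m j"
 shows "norm w <= 1 \<longleftrightarrow> Im w \<in> {- tp j..tp j}" "norm w = 1 \<longleftrightarrow> \<bar>Im w\<bar> = tp j"
proof -
 have "w = Complex (m j) (Im w)" using w by (simp add: complex_eq_iff)
 hence "norm w < 1 \<longleftrightarrow> \<bar>Im w\<bar> < tp j" "norm w = 1 \<longleftrightarrow> \<bar>Im w\<bar> = tp j" using norm_line(2,3)[OF j, of "Im w"] by simp_all
 thus "norm w <= 1 \<longleftrightarrow> Im w \<in> {- tp j..tp j}" "norm w = 1 \<longleftrightarrow> \<bar>Im w\<bar> = tp j" by auto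
qed

text \<open>The isotopy of the boundary of the cells: heights on the lines are interpolated with
  those moved by \<open>Lam\<close>, and the unit circle stays fixed.\<close>

definition bt :: "real => complex => complex" where "bt t w = Complex (Re w) ((1 - t) * Im w + t * Im (Lam w))"

lemma bt_circle: "norm w = 1 ==> bt t w = w"
proof -
 assume "norm w = 1"
 hence L: "Lam w = w" by (rule Lam_circle)
 have "(1 - t) * Im w + t * Im w = Im w" by (simp add: left_diff_distrib)
 thus ?thesis unfolding bt_def L by simp
qed

lemma bt_line:
 assumes j: "j \<in> {1..n - 1}" and t: "t \<in> {0..1}"
 shows "Re w = m j ==> bt t w = Complex (m j) ((1 - t) * Im w + t * lam j (Im w))"
  "strict_mono (\<lambda>x. (1 - t) * x + t * lam j x)" "(\<lambda>x. (1 - t) * x + t * lam j x) ` {- tp j..tp j} = {- tp j..tp j}"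
proof -
 show "bt t w = Complex (m j) ((1 - t) * Im w + t * lam j (Im w))" if "Re w = m j"
 proof -
  have "w = Complex (m j) (Im w)" using that by (simp add: complex_eq_iff)
  hence "Lam w = Complex (m j) (lam j (Im w))" using Lam_line[OF j] by metis
  thus ?thesis using that by (simp add: bt_def)
 qed
 have e: "lam j (tp j) = tp j" "lam j (- tp j) = - tp j" using lam_ends(1)[OF j] norm_line(1)[OF j] by simp_all
 have mono: "strict_mono_on S (lam j)" for S using strict_mono_less[OF lam(1)[OF j]] by (auto intro: strict_mono_onI)
 show "(\<lambda>x. (1 - t) * x + t * lam j x) ` {- tp j..tp j} = {- tp j..tp j}"
  using norm_line(1)[OF j] by (intro lin_path(2) continuous_on_subset[OF lam(2)[OF j]] mono e t) auto
 show "strict_mono (\<lambda>x. (1 - t) * x + t * lam j x)"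
 proof (rule strict_monoI)
  fix x y :: real assume xy: "x < y"
  hence "lam j x < lam j y" using strict_mono_less[OF lam(1)[OF j]] by blast
  hence "t * lam j x <= t * lam j y" "(1 - t) * x <= (1 - t) * y" "t ~= 0 ==> t * lam j x < t * lam j y"
   using t xy by (auto intro: mult_left_mono mult_strict_left_mono)
  thus "(1 - t) * x + t * lam j x < (1 - t) * y + t * lam j y" using xy by (cases "t = 0") auto
 qed
qed

lemma bt_norm: assumes j: "j \<in> {1..n - 1}" "t \<in> {0..1}" "Re w = m j" "norm w <= 1" shows "norm (bt t w) <= 1"
proof -
 have "Im w \<in> {- tp j..tp j}" using line_norm(1)[OF j(1,3)] j(4) by blast
 hence "(1 - t) * Im w + t * lam j (Im w) \<in> {- tp j..tp j}" using bt_line(3)[OF j(1,2)] by blast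
 thus ?thesis unfolding bt_line(1)[OF j(1-3)] using line_norm(1)[OF j(1), of "Complex (m j) ((1 - t) * Im w + t * lam j (Im w))"] by simp
qed

lemma bt_surj:
 assumes w: "norm w <= 1" "Re w = m j" "j <= n" and t: "t \<in> {0..1}"
 shows "\<exists>z. norm z <= 1 & Re z = Re w & bt t z = w"
proof (cases "norm w = 1")
 case True thus ?thesis using bt_circle[OF True, of t] w(1) by blast
next
 case False
 hence j: "j \<in> {1..n - 1}" using line_cases[OF w] by blast
 have "Im w \<in> {- tp j..tp j}" using line_norm(1)[OF j w(2)] w(1) by blast
 then obtain u where u: "u \<in> {- tp j..tp j}" "Im w = (1 - t) * u + t * lam j u" using bt_line(3)[OF j t] by blast
 have "bt t (Complex (m j) u) = w" using bt_line(1)[OF j t, of "Complex (m j) u"] u(2) w(2) by (simp add: complex_eq_iff)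
 moreover have "norm (Complex (m j) u) <= 1" using line_norm(1)[OF j, of "Complex (m j) u"] u(1) by simp
 ultimately show ?thesis using w(2) by (intro exI[of _ "Complex (m j) u"]) simp
qed

lemma phi_bt: assumes w: "norm w <= 1" "Re w = m j \<or> norm w = 1" "j <= n" shows "phi w = bt 1 w"
proof -
 have "norm w = 1 \<or> Re w \<in> m ` {1..n - 1}" using line_cases[OF w(1) _ w(3)] w(2) by blast
 thus ?thesis using phi_Lam[OF w(1)] by (simp add: bt_def Re_Lam complex_eq_iff)
qed

lemma phi_boundary:
 assumes s: "s \<in> {1..n}" and w: "norm w <= 1" "Re w = m j" "j = s - 1 \<or> j = s"
 shows "w \<in> phi ` K s" "phi w \<in> K s"
proof -
 have j: "j <= n" using w(3) s by auto
 have m2: "m (s - 1) <= m s" by (rule m_le) (use s in auto)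
 obtain z where z: "norm z <= 1" "Re z = Re w" "bt 1 z = w" using bt_surj[OF w(1,2) j, of 1] by auto
 hence "phi z = w" using phi_bt[OF z(1) _ j] w(2) by simp
 moreover have "z \<in> K s" using z w m2 by (auto simp: K_def)
 ultimately show "w \<in> phi ` K s" by blast
 have "Re (phi w) = m j" using phi_bt[OF w(1) _ j] w(2) by (simp add: bt_def)
 moreover have "norm (phi w) <= 1" using phi_glue(3) w(1) by force
 ultimately show "phi w \<in> K s" using w(3) m2 by (auto simp: K_def)
qed

text \<open>The image of the open part of strip \<open>s\<close> is connected and contains the fixed
  puncture \<open>p s\<close>. It avoids the two bounding lines in the disc, since all points of
  these are images of points of the same lines; so it stays between them.\<close>

lemma phi_K_subset: assumes s: "s \<in> {1..n}" "w \<in> K s" shows "phi w \<in> K s"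
proof -
 note w = s(2) and s = s(1)
 define U where "U = {z. norm z <= 1 & m (s - 1) < Re z & Re z < m s}"
 have UK: "phi w \<in> K s" if w: "w \<in> U" for w
 proof -
  have cU: "convex U"
  proof -
   have "U = cball 0 1 \<inter> ({z. 1 \<bullet> z > m (s - 1)} \<inter> {z. 1 \<bullet> z < m s})" by (auto simp: U_def inner_complex_def)
   thus ?thesis using convex_Int convex_cball convex_halfspace_gt convex_halfspace_lt by metis
  qed
  have Ucb: "U <= cball 0 1" by (auto simp: U_def)
  have con: "connected ((\<lambda>w. Re (phi w)) ` U)"
   by (intro connected_continuous_image continuous_on_Re continuous_on_subset[OF phi_glue(1) Ucb] convex_connected cU)
  have avoid: "Re (phi z) ~= m j" if z: "z \<in> U" and j: "j = s - 1 \<or> j = s" for z j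
  proof
   assume e: "Re (phi z) = m j"
   have n1: "norm (phi z) <= 1" using phi_glue(3) z Ucb by force
   have jn: "j <= n" using j s by auto
   obtain y where y: "norm y <= 1" "Re y = m j" "bt 1 y = phi z" using bt_surj[OF n1 e jn, of 1] e by auto
   hence "phi y = phi z" using phi_bt[OF y(1) _ jn] by simp
   hence "y = z" using inj_onD[OF phi_glue(2)] y(1) z Ucb by auto
   thus False using y(2) z j by (auto simp: U_def)
  qed
  have n1: "norm (phi w) <= 1" using phi_glue(3) w Ucb by force
  have pU: "of_real (p s) \<in> U" using m_p[OF s] p_bounds[OF s] by (simp add: U_def abs_le_iff)
  have pI: "p s \<in> (\<lambda>w. Re (phi w)) ` U" by (rule rev_image_eqI[OF pU]) (simp add: phi_p[OF s])
  have wI: "Re (phi w) \<in> (\<lambda>w. Re (phi w)) ` U" using w by blast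
  have "m (s - 1) <= Re (phi w)"
  proof (rule ccontr)
   assume "\<not> m (s - 1) <= Re (phi w)"
   hence "m (s - 1) \<in> (\<lambda>w. Re (phi w)) ` U" using connectedD_interval[OF con wI pI, of "m (s - 1)"] m_p(1)[OF s] by simp
   thus False using avoid[of _ "s - 1"] by force
  qed
  moreover have "Re (phi w) <= m s"
  proof (rule ccontr)
   assume "\<not> Re (phi w) <= m s"
   hence "m s \<in> (\<lambda>w. Re (phi w)) ` U" using connectedD_interval[OF con pI wI, of "m s"] m_p(2)[OF s] by simp
   thus False using avoid[of _ s] by force
  qed
  ultimately show ?thesis using n1 by (simp add: K_def)
 qed
 have "w \<in> U \<or> Re w = m (s - 1) \<or> Re w = m s" using w by (auto simp: K_def U_def)
 moreover have "norm w <= 1" using w by (simp add: K_def)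
 ultimately show ?thesis using UK phi_boundary(2)[OF s, of w] by blast
qed

lemma phi_K: assumes s: "s \<in> {1..n}" shows "phi ` K s = K s"
proof
 show "phi ` K s <= K s" using phi_K_subset[OF s] by blast
 show "K s <= phi ` K s"
 proof
  fix w assume w: "w \<in> K s"
  hence nw: "norm w <= 1" by (simp add: K_def)
  show "w \<in> phi ` K s"
  proof (cases "Re w = m (s - 1) \<or> Re w = m s")
   case True thus ?thesis using phi_boundary(1)[OF s nw] by blast
  next
   case False
   hence i: "m (s - 1) < Re w" "Re w < m s" using w by (auto simp: K_def)
   have "w \<in> phi ` cball 0 1" unfolding phi_glue(3) using nw by simp
   then obtain z where z: "norm z <= 1" "w = phi z" by auto
   have "-1 <= Re z" "Re z <= 1" using abs_Re_le_cmod[of z] z(1) by auto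
   then obtain r where r: "r \<in> {1..n}" "m (r - 1) <= Re z" "Re z <= m r" by (rule strip_index)
   have zr: "z \<in> K r" using r z(1) by (simp add: K_def)
   hence w': "m (r - 1) <= Re w" "Re w <= m r" using phi_K_subset[OF r(1)] z(2) by (auto simp: K_def)
   have "\<not> r < s" using m_le[of r "s - 1"] s w'(2) i(1) by force
   moreover have "\<not> s < r" using m_le[of s "r - 1"] r(1) w'(1) i(2) by force
   ultimately show ?thesis using zr z(2) by simp
  qed
 qed
qed

text \<open>The cells are the parts of the strips in the disc, with the punctures as fixed centres.
  The isotopy from the identity to \<open>phi\<close> deforms \<open>h\<close> into a map equal to
  \<open>phi o h = h' o Psi\<close> on the disc, and \<open>diagram_isotopy\<close> leads from there
  to \<open>h'\<close>.\<close>

theorem matching_isotopic: "(h, h') \<in> braid_isotopy n p"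
proof -
 define R where "R = (\<Union>s\<in>{1..n}. frontier (K s))"
 define L where "L = (\<lambda>j. {w. norm w <= 1 & Re w = m j})"
 have Rcase: "norm w <= 1 & (norm w = 1 \<or> (\<exists>j\<in>{1..n - 1}. Re w = m j))" if wR: "w \<in> R" for w
 proof -
  obtain s where s: "s \<in> {1..n}" "w \<in> frontier (K s)" using wR unfolding R_def by blast
  hence w: "norm w <= 1" "norm w = 1 \<or> Re w = m (s - 1) \<or> Re w = m s" using K_Jordan(4)[OF s(1)] by (auto simp: K_def)
  thus ?thesis using line_cases[OF w(1), of "s - 1"] line_cases[OF w(1), of s] s(1) by fastforce
 qed
 have Rb: "phi w = bt 1 w" if w: "w \<in> R" for w using Rcase[OF w] phi_bt[of w] by force
 have sph: "sphere 0 1 <= R"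
 proof
  fix w :: complex assume "w \<in> sphere 0 1"
  hence w: "norm w = 1" by simp
  have "-1 <= Re w" "Re w <= 1" using abs_Re_le_cmod[of w] w by auto
  then obtain s where s: "s \<in> {1..n}" "m (s - 1) <= Re w" "Re w <= m s" by (rule strip_index)
  hence "w \<in> frontier (K s)" using K_Jordan(4)[OF s(1)] w by (simp add: K_def)
  thus "w \<in> R" using s(1) unfolding R_def by blast
 qed
 obtain A :: "real => complex => complex" where A: "joint_cont (cball 0 1) A"
  "\<And>t. t \<in> {0..1} ==> inj_on (A t) (cball 0 1)" "\<And>t. t \<in> {0..1} ==> A t ` cball 0 1 = cball 0 1"
  "\<And>t z. t \<in> {0..1} ==> z \<in> (\<Union>s\<in>{1..n}. frontier (K s)) ==> A t z = bt t z"
  "\<And>z. z \<in> cball 0 1 ==> A 0 z = z" "\<And>z. z \<in> cball 0 1 ==> A 1 z = phi z"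
  "\<And>t i. t \<in> {0..1} ==> i \<in> {1..n} ==> phi (of_real (p i)) = of_real (p i) ==> A t (of_real (p i)) = of_real (p i)"
 proof (rule cell_isotopy[of "{1..n}" "\<lambda>s. frontier (K s)" "cball 0 1" phi bt "\<lambda>s. of_real (p s)"])
  show "finite {1..n}" by simp
  fix s assume s: "s \<in> {1..n}"
  show "Jordan (frontier (K s))" by (rule K_Jordan(1)[OF s])
  show "phi ` (frontier (K s) Un inside (frontier (K s))) = frontier (K s) Un inside (frontier (K s))"
   unfolding K_Jordan(3)[OF s] by (rule phi_K[OF s])
  show "of_real (p s) \<in> inside (frontier (K s))"
   unfolding K_Jordan(2)[OF s] using m_p[OF s] p_bounds[OF s] by (simp add: abs_less_iff)
  fix r assume r: "r \<in> {1..n}" "s ~= r"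
  show "inside (frontier (K s)) \<inter> (frontier (K r) Un inside (frontier (K r))) = {}"
   unfolding K_Jordan(2)[OF s] K_Jordan(3)[OF r(1)]
  proof (cases "r < s")
   case True
   hence "m r <= m (s - 1)" using s by (intro m_le) auto
   thus "{z. cmod z < 1 & m (s - 1) < Re z & Re z < m s} \<inter> K r = {}" by (auto simp: K_def)
  next
   case False
   hence "m s <= m (r - 1)" using r by (intro m_le) auto
   thus "{z. cmod z < 1 & m (s - 1) < Re z & Re z < m s} \<inter> K r = {}" by (auto simp: K_def)
  qed
 next
  fix s and t :: real assume t: "t \<in> {0..1}" and s: "s \<in> {1..n}"
  note F = K_Jordan(4)[OF s]
  show "bt t ` frontier (K s) = frontier (K s)"
  proof (intro equalityI subsetI)
   fix w assume "w \<in> bt t ` frontier (K s)"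
   then obtain z where z: "z \<in> frontier (K s)" "w = bt t z" by blast
   show "w \<in> frontier (K s)"
   proof (cases "norm z = 1")
    case True thus ?thesis using z bt_circle by simp
   next
    case False
    then obtain j where j: "j \<in> {1..n - 1}" "Re z = m j" "norm z <= 1" using Rcase[of z] z(1) s unfolding R_def by blast
    have "norm w <= 1" "Re w = Re z" using bt_norm[OF j(1) t j(2,3)] z(2) by (simp_all add: bt_def)
    thus ?thesis using z(1) False unfolding F by (auto simp: K_def)
   qed
  next
   fix w assume w: "w \<in> frontier (K s)"
   show "w \<in> bt t ` frontier (K s)"
   proof (cases "norm w = 1")
    case True thus ?thesis using w bt_circle[OF True] by (metis imageI)
   next
    case False
    hence r: "Re w = m (s - 1) \<or> Re w = m s" and nw: "norm w <= 1" using w unfolding F by (auto simp: K_def)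
    then obtain j where "j <= n" "Re w = m j" using s by (metis atLeastAtMost_iff diff_le_self le_trans)
    then obtain z where z: "norm z <= 1" "Re z = Re w" "bt t z = w" using bt_surj[OF nw _ _ t] by blast
    have "z \<in> frontier (K s)" using z(1,2) w r unfolding F by (auto simp: K_def)
    thus ?thesis using z(3) by blast
   qed
  qed
 next
  fix t :: real assume t: "t \<in> {0..1}"
  show "inj_on (bt t) (\<Union>s\<in>{1..n}. frontier (K s))"
  proof (rule inj_onI)
   fix w w' assume e: "bt t w = bt t w'"
   hence R: "Re w = Re w'" by (simp add: bt_def)
   show "w = w'"
   proof (cases "Re w \<in> m ` {1..n - 1}")
    case True
    then obtain j where j: "j \<in> {1..n - 1}" "Re w = m j" by blast
    have "(1 - t) * Im w + t * lam j (Im w) = (1 - t) * Im w' + t * lam j (Im w')"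
     using e bt_line(1)[OF j(1) t, of w] bt_line(1)[OF j(1) t, of w'] j(2) R by simp
    hence "Im w = Im w'" using strict_mono_eq[OF bt_line(2)[OF j(1) t], of "Im w" "Im w'"] by simp
    thus ?thesis using R by (simp add: complex_eq_iff)
   next
    case False
    hence "Lam w = w" "Lam w' = w'" using R by (simp_all add: Lam_def)
    hence "Im w = Im w'" using e by (simp add: bt_def algebra_simps)
    thus ?thesis using R by (simp add: complex_eq_iff)
   qed
  qed
 next
  fix w assume w: "w \<in> (\<Union>s\<in>{1..n}. frontier (K s))"
  show "bt 0 w = w" by (simp add: bt_def complex_eq_iff)
  show "bt 1 w = phi w" using Rb[of w] w unfolding R_def by simp
 next
  show "continuous_on (cball 0 1) phi" "inj_on phi (cball 0 1)" using phi_glue by simp_all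
  have "(\<Union>s\<in>{1..n}. K s) = cball 0 1"
  proof (intro equalityI subsetI)
   fix w :: complex assume "w \<in> cball 0 1"
   hence w: "norm w <= 1" by simp
   have "-1 <= Re w" "Re w <= 1" using abs_Re_le_cmod[of w] w by auto
   then obtain s where s: "s \<in> {1..n}" "m (s - 1) <= Re w" "Re w <= m s" by (rule strip_index)
   thus "w \<in> (\<Union>s\<in>{1..n}. K s)" using w by (auto simp: K_def)
  qed (auto simp: K_def)
  thus "(\<Union>s\<in>{1..n}. frontier (K s) Un inside (frontier (K s))) = cball 0 1"
   using K_Jordan(3) by (metis (no_types, lifting) SUP_cong)
  \<comment> \<open>The skeleton is covered by the unit circle, at index 0, and the inner lines. On
    each of these closed sets \<open>bt\<close> has a continuous formula, although
    \<open>Lam\<close> is not continuous on the plane.\<close>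
  define U where "U = (\<lambda>i. {0..1::real} \<times> (if i = 0 then sphere 0 1 else L i))"
  have "continuous_on (\<Union>i\<in>{0..n - 1}. U i) (\<lambda>x. bt (fst x) (snd x))"
  proof (rule continuous_on_closed_Union)
   fix i assume i: "i \<in> {0..n - 1}"
   have "L i = cball 0 1 \<inter> {w. Re w = m i}" by (auto simp: L_def)
   moreover have "closed {w. Re w = m i}" by (intro closed_Collect_eq continuous_intros)
   ultimately have "closed (L i)" by (simp add: closed_Int)
   thus "closed (U i)" unfolding U_def by (intro closed_Times) auto
   show "continuous_on (U i) (\<lambda>x. bt (fst x) (snd x))"
   proof (cases "i = 0")
    case True
    have "continuous_on (U i) snd" by (rule continuous_on_snd[OF continuous_on_id])
    thus ?thesis by (rule continuous_on_eq) (use True in \<open>auto simp: U_def bt_circle\<close>)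
   next
    case False
    hence j: "i \<in> {1..n - 1}" using i by simp
    have "continuous_on (U i) (\<lambda>x. Complex (m i) ((1 - fst x) * Im (snd x) + fst x * lam i (Im (snd x))))"
     by (intro continuous_on_Complex continuous_intros continuous_on_compose2[OF lam(2)[OF j]]) auto
    thus ?thesis by (rule continuous_on_eq) (use False bt_line(1)[OF j] in \<open>auto simp: U_def L_def\<close>)
   qed
  qed simp
  moreover have "{0..1} \<times> (\<Union>s\<in>{1..n}. frontier (K s)) <= (\<Union>i\<in>{0..n - 1}. U i)"
  proof
   fix x assume "x \<in> {0..1::real} \<times> (\<Union>s\<in>{1..n}. frontier (K s))"
   hence x: "fst x \<in> {0..1}" "snd x \<in> R" unfolding R_def by auto
   show "x \<in> (\<Union>i\<in>{0..n - 1}. U i)"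
   proof (cases "norm (snd x) = 1")
    case True hence "x \<in> U 0" using x(1) by (simp add: U_def mem_Times_iff)
    thus ?thesis by force
   next
    case False
    then obtain j where j: "j \<in> {1..n - 1}" "Re (snd x) = m j" "norm (snd x) <= 1" using Rcase[OF x(2)] by blast
    hence "x \<in> U j" using x(1) by (simp add: U_def L_def mem_Times_iff)
    thus ?thesis using j(1) by force
   qed
  qed
  ultimately show "joint_cont ((\<Union>s\<in>{1..n}. frontier (K s))) bt" by (rule continuous_on_subset)
  fix A :: "real => complex => complex" assume "joint_cont (cball 0 1) A"
   "\<And>t. t \<in> {0..1} ==> inj_on (A t) (cball 0 1)" "\<And>t. t \<in> {0..1} ==> A t ` cball 0 1 = cball 0 1"
   "\<And>t z. t \<in> {0..1} ==> z \<in> (\<Union>s\<in>{1..n}. frontier (K s)) ==> A t z = bt t z"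
   "\<And>z. z \<in> cball 0 1 ==> A 0 z = z" "\<And>z. z \<in> cball 0 1 ==> A 1 z = phi z"
   "\<And>t i. t \<in> {0..1} ==> i \<in> {1..n} ==> phi (of_real (p i)) = of_real (p i) ==> A t (of_real (p i)) = of_real (p i)"
  thus thesis by (rule that[of A])
 qed
 define k where "k = (\<lambda>t z. A t (h z))"
 note hD = bhD[OF h(1)] and hcb = braid_homeo_cball[OF h(1)]
 have "(h, radial (k 1)) \<in> braid_isotopy n p"
 proof (rule disc_isotopy[OF valid h(1)])
  have "continuous_on ({0..1::real} \<times> cball 0 1) (\<lambda>x. (fst x, h (snd x)))"
   by (intro continuous_on_Pair continuous_on_fst continuous_on_id continuous_on_compose2[OF hD(1)[of UNIV]] continuous_on_snd) auto
  moreover have "(\<lambda>x. (fst x, h (snd x))) ` ({0..1::real} \<times> cball 0 1) <= {0..1} \<times> cball 0 1" using hcb by auto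
  ultimately have "continuous_on ({0..1} \<times> cball 0 1) ((\<lambda>x. A (fst x) (snd x)) \<circ> (\<lambda>x. (fst x, h (snd x))))"
   by (intro continuous_on_compose continuous_on_subset[OF A(1)])
  thus "joint_cont (cball 0 1) k" by (simp add: k_def o_def)
  show "k 0 z = h z" if "norm z <= 1" for z
   using A(5)[of "h z"] that bh_norm(3)[OF h(1), of z] by (simp add: k_def)
  fix t :: real assume t: "t \<in> {0..1}"
  have kk: "k t ` S = A t ` h ` S" for S by (simp add: k_def image_image)
  have "inj_on (A t \<circ> h) (cball 0 1)"
   by (rule comp_inj_on[OF inj_on_subset[OF hD(2)]]) (use hcb A(2)[OF t] in auto)
  thus "inj_on (k t) (cball 0 1)" by (simp add: k_def o_def)
  show "k t ` cball 0 1 = cball 0 1" unfolding kk hcb by (rule A(3)[OF t])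
  have At1: "A t z = z" if "norm z = 1" for z
  proof -
   have "z \<in> R" using sph that by auto
   thus ?thesis using A(4)[OF t, folded R_def, of z] bt_circle[OF that] by simp
  qed
  hence "A t ` sphere 0 1 = sphere 0 1" by simp
  thus "k t ` sphere 0 1 = sphere 0 1" unfolding kk hD(5) .
  have "A t z = z" if "z \<in> punctures n p" for z
   using that A(7)[OF t _ phi_p] unfolding punctures_def by auto
  hence "A t ` punctures n p = punctures n p" by simp
  thus "k t ` punctures n p = punctures n p" unfolding kk hD(4) .
  show "k t 1 = 1" "k t (-1) = -1" using At1[of 1] At1[of "-1"] hD(6,7) by (simp_all add: k_def)
 qed
 moreover have "radial (k 1) = radial (\<lambda>z. h' (Psi z))"
 proof (rule radial_cong)
  fix z :: complex assume "norm z <= 1"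
  hence "norm (h z) <= 1" using bh_norm(3)[OF h(1)] by blast
  thus "k 1 z = h' (Psi z)" using A(6)[of "h z"] by (simp add: k_def phi_def bh_inv(1)[OF h(1)])
 qed
 ultimately have "(h, radial (\<lambda>z. h' (Psi z))) \<in> braid_isotopy n p" by simp
 thus ?thesis using braid_isotopy_trans braid_isotopy_sym[OF diagram_isotopy] by blast
qed

end

section \<open>Noncrossing matchings\<close>

text \<open>Noncrossing perfect matchings of \<open>{1..N}\<close>, given as fixed point free involutions.\<close>

definition ncm :: "nat => (nat => nat) => bool" where
 "ncm N mm \<longleftrightarrow> (\<forall>i\<in>{1..N}. mm i \<in> {1..N} & mm i ~= i & mm (mm i) = i) &
  (\<forall>i\<in>{1..N}. \<forall>k\<in>{1..N}. \<not> (i < k & k < mm i & mm i < mm k))"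

definition openers :: "nat => (nat => nat) => nat set" where
 "openers N mm = {i \<in> {1..N}. i < mm i}"

lemma ncm_D:
 assumes "ncm N mm" "i \<in> {1..N}"
 shows "mm i \<in> {1..N}" "mm i ~= i" "mm (mm i) = i"
proof -
 have "mm i \<in> {1..N} & mm i ~= i & mm (mm i) = i" using assms(2) by (rule bspec[OF conjunct1[OF assms(1)[unfolded ncm_def]]])
 thus "mm i \<in> {1..N}" "mm i ~= i" "mm (mm i) = i" by simp_all
qed

lemma ncm_cross:
 assumes "ncm N mm" "i \<in> {1..N}" "k \<in> {1..N}" "i < k" "k < mm i"
 shows "mm k < mm i"
proof (rule ccontr)
 assume "\<not> mm k < mm i"
 moreover have "mm k ~= mm i" using ncm_D(3)[OF assms(1,2)] ncm_D(3)[OF assms(1,3)] assms(4) by auto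
 ultimately have "mm i < mm k" by simp
 thus False using assms unfolding ncm_def by blast
qed

text \<open>Otherwise the partner of the closer \<open>i + 1\<close> lies before \<open>i\<close>,
  and its arc crosses the arc that starts at \<open>i\<close>.\<close>

lemma ncm_adjacent:
 assumes mm: "ncm N mm" and i: "i \<in> openers N mm" "i + 1 \<in> {1..N}" "i + 1 \<notin> openers N mm"
 shows "mm i = i + 1"
proof (rule ccontr)
 assume ne: "mm i ~= i + 1"
 have io: "i \<in> {1..N}" "i < mm i" using i(1) by (auto simp: openers_def)
 have c: "mm (i + 1) < i + 1" using ncm_D(2)[OF mm i(2)] i(2,3) by (auto simp: openers_def)
 have "mm (i + 1) ~= i" using ncm_D(3)[OF mm i(2)] ne by auto
 hence c2: "mm (i + 1) < i" using c by simp
 have "i < mm (mm (i + 1))" using ncm_D(3)[OF mm i(2)] by simp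
 hence "mm i < mm (mm (i + 1))" by (rule ncm_cross[OF mm ncm_D(1)[OF mm i(2)] io(1) c2])
 thus False using ncm_D(3)[OF mm i(2)] io(2) by simp
qed

text \<open>The ballot inequality for parenthesis words: the partner of a closer is an earlier
  opener.\<close>

lemma closers_le_openers:
 assumes mm: "ncm N mm" and "k <= N"
 shows "card ({1..k} - openers N mm) <= card (openers N mm \<inter> {1..k})"
proof (rule card_inj_on_le[of mm])
 show "inj_on mm ({1..k} - openers N mm)"
  by (rule inj_on_inverseI[where g = mm]) (use ncm_D(3)[OF mm] assms(2) in auto)
 show "mm ` ({1..k} - openers N mm) <= openers N mm \<inter> {1..k}"
 proof (rule image_subsetI)
  fix i assume i: "i \<in> {1..k} - openers N mm"
  hence iN: "i \<in> {1..N}" using assms(2) by auto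
  hence "mm i < i" using i ncm_D(2)[OF mm iN] by (auto simp: openers_def)
  thus "mm i \<in> openers N mm \<inter> {1..k}" using ncm_D[OF mm iN] i by (auto simp: openers_def)
 qed
qed simp

lemma card_openers:
 assumes mm: "ncm N mm"
 shows "2 * card (openers N mm) = N"
proof -
 have "mm ` openers N mm = {1..N} - openers N mm"
 proof (intro equalityI subsetI)
  fix i assume i: "i \<in> {1..N} - openers N mm"
  hence iN: "i \<in> {1..N}" by simp
  hence "mm i \<in> openers N mm" using i ncm_D[OF mm iN] by (auto simp: openers_def)
  thus "i \<in> mm ` openers N mm" using ncm_D(3)[OF mm iN] by (metis imageI)
 next
  fix i assume "i \<in> mm ` openers N mm"
  then obtain k where k: "k \<in> {1..N}" "k < mm k" "i = mm k" by (auto simp: openers_def)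
  thus "i \<in> {1..N} - openers N mm" using ncm_D[OF mm k(1)] by (auto simp: openers_def)
 qed
 moreover have "inj_on mm (openers N mm)"
  by (rule inj_on_inverseI[where g = mm]) (use ncm_D(3)[OF mm] in \<open>auto simp: openers_def\<close>)
 ultimately have "card ({1..N} - openers N mm) = card (openers N mm)" using card_image by metis
 moreover have "card ({1..N} - openers N mm) = N - card (openers N mm)"
  by (subst card_Diff_subset) (auto simp: openers_def)
 moreover have "openers N mm <= {1..N}" by (auto simp: openers_def)
 hence "card (openers N mm) <= card {1..N}" by (rule card_mono[OF finite_atLeastAtMost])
 hence "card (openers N mm) <= N" by simp
 ultimately show ?thesis by simp
qed

text \<open>A parenthesis word has only one noncrossing matching. At the first closer
  \<open>c\<close> with different partners, let \<open>d\<close> be the later partner. In the other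
  matching \<open>d\<close> is an opener enclosed by the arc of \<open>c\<close>, so it closes
  before \<open>c\<close>; by minimality it closes there in both matchings, although one of them
  pairs it with \<open>c\<close>.\<close>

lemma ncm_determined:
 assumes mm: "ncm N mm" and \<nu>: "ncm N \<nu>" and eq: "openers N mm = openers N \<nu>" and i: "i \<in> {1..N}"
 shows "mm i = \<nu> i"
proof -
 have closer: "mm c = \<nu> c" if "c \<in> {1..N} - openers N mm" for c
  using that
 proof (induction c rule: less_induct)
  case (less c)
  have half: False if mm: "ncm N mm" and \<nu>: "ncm N \<nu>" and eq: "openers N mm = openers N \<nu>" and c: "c \<in> {1..N} - openers N mm"
   and IH: "\<And>y. y < c ==> y \<in> {1..N} - openers N mm ==> mm y = \<nu> y" and lt: "mm c < \<nu> c" for mm \<nu>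
  proof -
   have cN: "c \<in> {1..N}" using c by simp
   define d where "d = \<nu> c"
   have d: "d \<in> {1..N}" "\<nu> d = c" using ncm_D[OF \<nu> cN] by (auto simp: d_def)
   have "c \<notin> openers N \<nu>" using c eq by simp
   hence dc: "d < c" using ncm_D(2)[OF \<nu> cN] cN by (auto simp: openers_def d_def)
   hence "d \<in> openers N \<nu>" using d by (simp add: openers_def)
   hence od: "d < mm d" using eq by (auto simp: openers_def)
   have "mm (mm c) = c" by (rule ncm_D(3)[OF mm cN])
   hence mdc: "mm d < c" using ncm_cross[OF mm ncm_D(1)[OF mm cN] d(1)] lt dc by (simp add: d_def)
   have mdN: "mm d \<in> {1..N} - openers N mm" using ncm_D[OF mm d(1)] od by (auto simp: openers_def)
   have "\<nu> (mm d) = d" using IH[OF mdc mdN] ncm_D(3)[OF mm d(1)] by simp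
   hence "mm d = \<nu> d" using ncm_D(3)[OF \<nu>, of "mm d"] mdN by auto
   thus False using d(2) mdc by simp
  qed
  show ?case
  proof (rule ccontr)
   assume ne: "mm c ~= \<nu> c"
   show False
   proof (cases "mm c < \<nu> c")
    case True show False by (rule half[OF mm \<nu> eq less.prems less.IH True])
   next
    case False
    hence "\<nu> c < mm c" using ne by simp
    show False
    proof (rule half[OF \<nu> mm eq[symmetric] _ _ \<open>\<nu> c < mm c\<close>])
     show "c \<in> {1..N} - openers N \<nu>" using less.prems eq by simp
     show "\<nu> y = mm y" if "y < c" "y \<in> {1..N} - openers N \<nu>" for y using less.IH[of y] that eq by simp
    qed
   qed
  qed
 qed
 show ?thesis
 proof (cases "i \<in> openers N mm")
  case False thus ?thesis using closer i by simp
 next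
  case True
  have "mm i \<in> {1..N} - openers N mm" using ncm_D[OF mm i] True by (auto simp: openers_def)
  hence "\<nu> (mm i) = i" using closer[of "mm i"] ncm_D(3)[OF mm i] by simp
  thus ?thesis using ncm_D[OF mm i] ncm_D(3)[OF \<nu>, of "mm i"] by simp
 qed
qed

text \<open>The index sets of the smaller elements of the arc around the puncture, for a strip with \<open>a\<close> points on its left
 and \<open>b\<close> points on its right boundary line.\<close>

definition Tset :: "nat => nat => nat set" where
 "Tset a b = (if a = b then {1..b} else if a < b then {(b - a) div 2..b - (b - a) div 2}
  else {b + (a - b) div 2..2 * b + (a - b) div 2})"

text \<open>For \<open>a = 2 i + 1\<close> and \<open>b = 2 j + 1\<close> the bound is
  \<open>2 (min i j + 1)\<close>; the factors 2 of the \<open>n\<close> strips give the power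
  \<open>2 ^ n\<close> in the result.\<close>

lemma card_Tset: "even (a + b) ==> card (Tset a b) <= min a b + 1" "finite (Tset a b)"
proof -
 assume e: "even (a + b)"
 consider "a = b" | "a < b" | "b < a" by linarith
 thus "card (Tset a b) <= min a b + 1"
 proof cases
  case 2
  then obtain j where "b = a + 2 * j" using e by (metis dvd_add_right_iff even_add le_add_diff_inverse less_imp_le odd_add evenE)
  thus ?thesis using 2 by (simp add: Tset_def)
 next
  case 3
  thus ?thesis by (simp add: Tset_def)
 qed (simp add: Tset_def)
qed (simp add: Tset_def)

text \<open>An opener is followed by an opener except at \<open>b\<close> and \<open>t\<close>, so that the sequence of openers and closers has at
 most two descents.\<close>

lemma two_descents:
 assumes mm: "ncm (a + b) mm" and t: "t \<in> openers (a + b) mm" and a: "0 < a" and b: "0 < b"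
  and adj: "\<And>i. i \<in> {1..a + b} ==> mm i = i + 1 ==> i ~= b ==> i = t"
 shows "t \<in> Tset a b"
  "openers (a + b) mm = (if t <= b then {1..t} Un {b - ((a + b) div 2 - t) + 1..b} else {1..b} Un {t - ((a + b) div 2 - b) + 1..t})"
proof -
 define N where "N = a + b"
 define Op where "Op = openers N mm"
 have step: "i + 1 \<in> Op" if "i \<in> Op" "i ~= b" "i ~= t" "i < N" for i
 proof (rule ccontr)
  assume c: "i + 1 \<notin> Op"
  have i: "i \<in> {1..N}" using that(1) by (simp add: Op_def openers_def)
  have "mm i = i + 1" using ncm_adjacent[OF mm[folded N_def], of i] that c i by (simp add: Op_def)
  thus False using adj[of i] i that(2,3) by (simp add: N_def)
 qed
 have run: "k \<in> Op" if "i \<in> Op" "i <= k" "k <= N" "\<And>l. i <= l ==> l < k ==> l ~= b & l ~= t" for i k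
  using that(2,1,3,4)
 proof (induction k rule: dec_induct)
  case (step k) thus ?case using \<open>\<And>i. i \<in> Op ==> i ~= b ==> i ~= t ==> i < N ==> i + 1 \<in> Op\<close>[of k] by simp
 qed
 have N1: "1 \<in> {1..N}" "N \<in> {1..N}" using a by (auto simp: N_def)
 have "1 < mm 1" using ncm_D[OF mm[folded N_def] N1(1)] by auto
 hence O1: "1 \<in> Op" using N1 by (simp add: Op_def openers_def)
 have ON: "N \<notin> Op" using ncm_D(1)[OF mm[folded N_def] N1(2)] by (auto simp: Op_def openers_def)
 have tO: "t \<in> Op" "1 <= t" "t <= N" "t ~= N" using t ON by (auto simp: Op_def N_def openers_def)
 have sub: "Op <= {1..N}" by (auto simp: Op_def openers_def)
 define l r where "l = min t b" and "r = max t b"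
 have lr: "l <= r" "1 <= l" "r < N" using tO a b by (auto simp: l_def r_def N_def)
 have first: "{1..l} <= Op"
 proof
  fix k assume "k \<in> {1..l}"
  thus "k \<in> Op" using run[OF O1, of k] lr by (auto simp: l_def)
 qed
 have last: "k \<notin> Op" if "r < k" "k <= N" for k
 proof
  assume "k \<in> Op"
  hence "N \<in> Op" by (rule run) (use that in \<open>auto simp: r_def\<close>)
  thus False using ON by simp
 qed
 \<comment> \<open>Behind the descent at \<open>l\<close> the openers may resume, but once resumed
   they continue up to the descent at \<open>r\<close>. So \<open>c\<close>, the number of openers
   in this second run, describes all that remains.\<close>
 define c where "c = card (Op \<inter> {l + 1..r})"
 have mid: "Op \<inter> {l + 1..r} = {r - c + 1..r}" and cle: "c <= r - l"
 proof -
  show cle: "c <= r - l" unfolding c_def using card_mono[of "{l + 1..r}" "Op \<inter> {l + 1..r}"] by simp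
  show "Op \<inter> {l + 1..r} = {r - c + 1..r}"
  proof (cases "Op \<inter> {l + 1..r} = {}")
   case False
   define u where "u = Min (Op \<inter> {l + 1..r})"
   have u: "u \<in> Op \<inter> {l + 1..r}" unfolding u_def using False by (intro Min_in) auto
   have "Op \<inter> {l + 1..r} = {u..r}"
   proof (intro equalityI subsetI)
    fix k assume "k \<in> Op \<inter> {l + 1..r}"
    thus "k \<in> {u..r}" unfolding u_def by auto
   next
    fix k assume k: "k \<in> {u..r}"
    hence "k \<in> Op" using run[of u k] u lr by (auto simp: l_def r_def min_def max_def split: if_splits)
    thus "k \<in> Op \<inter> {l + 1..r}" using k u by auto
   qed
   moreover from this have "c = r + 1 - u" by (simp add: c_def)
   hence "r - c + 1 = u" using u by auto
   ultimately show ?thesis by simp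
  qed (simp add: c_def)
 qed
 have OE: "Op = {1..l} Un {r - c + 1..r}"
 proof (intro equalityI subsetI)
  fix k assume k: "k \<in> Op"
  show "k \<in> {1..l} Un {r - c + 1..r}"
  proof (cases "k <= l")
   case True thus ?thesis using subsetD[OF sub k] by simp
  next
   case False
   hence "k \<in> Op \<inter> {l + 1..r}" using last[of k] k sub by force
   thus ?thesis unfolding mid by blast
  qed
 next
  fix k assume "k \<in> {1..l} Un {r - c + 1..r}"
  thus "k \<in> Op" using first mid by blast
 qed
 have "card Op = l + c"
 proof -
  have "{1..l} \<inter> {r - c + 1..r} = {}" using cle by auto
  thus ?thesis unfolding OE using cle by (simp add: card_Un_disjoint)
 qed
 hence half: "2 * (l + c) = a + b" using card_openers[OF mm] by (simp add: Op_def N_def)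
 \<comment> \<open>Up to position \<open>r - c\<close> the openers are exactly the first
   \<open>l\<close> positions, so the ballot inequality compares \<open>l\<close> with the
   \<open>r - c - l\<close> closers that follow them.\<close>
 have dyck: "r - c <= 2 * l"
 proof -
  have k: "r - c <= N" "l <= r - c" using lr cle by auto
  have e: "Op \<inter> {1..r - c} = {1..l}" unfolding OE using k(2) by auto
  have "{1..r - c} - Op = {1..r - c} - Op \<inter> {1..r - c}" by blast
  also have "\<dots> = {l + 1..r - c}" unfolding e by auto
  finally show ?thesis using closers_le_openers[OF mm[folded N_def] k(1), folded Op_def] e by simp
 qed
 show "openers (a + b) mm = (if t <= b then {1..t} Un {b - ((a + b) div 2 - t) + 1..b} else {1..b} Un {t - ((a + b) div 2 - b) + 1..t})"
 proof -
  have "(a + b) div 2 = l + c" using half by simp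
  thus ?thesis using OE unfolding Op_def N_def by (auto simp: l_def r_def)
 qed
 \<comment> \<open>As \<open>t\<close> itself is an opener, the second run is nonempty if it ends at
   \<open>t\<close>. This gives \<open>b < a\<close> in that case.\<close>
 have cz: "0 < c" if "b < t" using tO(1) that mid by (auto simp: c_def l_def r_def card_gt_0_iff)
 consider "t = b" | "t < b" | "b < t" by linarith
 thus "t \<in> Tset a b"
 proof cases
  case 1
  hence "c <= 0" using cle by (simp add: l_def r_def)
  thus ?thesis using half 1 b by (simp add: Tset_def l_def)
 next
  case 2
  hence e: "l = t" "r = b" by (auto simp: l_def r_def)
  have "a <= b" "(b - a) div 2 = b - t - c" using half cle e 2 by auto
  thus ?thesis using half dyck cle e tO(2) 2 by (auto simp: Tset_def)
 next
  case 3
  hence e: "l = b" "r = t" by (auto simp: l_def r_def)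
  have d: "b < a" "(a - b) div 2 = c" using half cz[OF 3] e 3 by auto
  have "b + c <= t" "t <= 2 * b + c" using dyck cle e 3 by linarith+
  thus ?thesis using d by (simp add: Tset_def)
 qed
qed

section \<open>The matchings of a tight diagram\<close>

lemma rank_bij:
 fixes f :: "'a => real"
 assumes S: "finite S" "inj_on f S"
 defines "r \<equiv> \<lambda>x. card {y \<in> S. f y <= f x}"
 shows "bij_betw r S {1..card S}" "x \<in> S ==> y \<in> S ==> r x < r y \<longleftrightarrow> f x < f y"
proof -
 have less: "r x < r y" if "x \<in> S" "y \<in> S" "f x < f y" for x y
 proof -
  have "y \<in> {z \<in> S. f z <= f y}" "y \<notin> {z \<in> S. f z <= f x}" "{z \<in> S. f z <= f x} <= {z \<in> S. f z <= f y}" using that by auto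
  hence "{z \<in> S. f z <= f x} \<subset> {z \<in> S. f z <= f y}" by blast
  thus ?thesis unfolding r_def using S(1) by (intro psubset_card_mono) auto
 qed
 show "r x < r y \<longleftrightarrow> f x < f y" if xy: "x \<in> S" "y \<in> S" for x y
 proof
  assume "r x < r y"
  moreover have "r y <= r x" if "f y <= f x"
   unfolding r_def by (rule card_mono) (use S(1) that in auto)
  ultimately show "f x < f y" by force
 qed (rule less[OF xy])
 have inj: "inj_on r S"
 proof (rule inj_onI)
  fix x y assume xy: "x \<in> S" "y \<in> S" "r x = r y"
  hence "\<not> f x < f y" "\<not> f y < f x" using less[of x y] less[of y x] by auto
  thus "x = y" using inj_onD[OF S(2)] xy by force
 qed
 have "r ` S <= {1..card S}"
 proof (rule image_subsetI)
  fix x assume x: "x \<in> S"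
  have "r x <= card S" unfolding r_def by (rule card_mono) (use S(1) in auto)
  moreover have "r x ~= 0" unfolding r_def using S(1) x by (subst card_0_eq) auto
  ultimately show "r x \<in> {1..card S}" by simp
 qed
 moreover have "card (r ` S) = card {1..card S}" using card_image[OF inj] by simp
 ultimately have "r ` S = {1..card S}" by (intro card_subset_eq) auto
 thus "bij_betw r S {1..card S}" using inj by (simp add: bij_betw_def)
qed

locale tight_diagram = punctured_disc +
 fixes h :: "complex => complex"
 assumes h: "h \<in> H" "finite (X h)" "\<not> reducible h"
begin

definition hr :: "real => complex" where "hr x = h (of_real x)"

definition a :: "nat => nat" where "a j = card {x \<in> X h. Re (hr x) = m j}"

definition gap :: "nat => real => real => bool" where
 "gap s x y \<longleftrightarrow> s \<in> {1..n} & consec (X h) x y & (\<forall>u. x < u \<longrightarrow> u < y \<longrightarrow> m (s - 1) < Re (hr u) & Re (hr u) < m s)"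

definition XS :: "nat => real set" where "XS s = {x \<in> X h. Re (hr x) = m (s - 1) \<or> Re (hr x) = m s}"

lemma hr_inj: "hr x = hr y \<longleftrightarrow> x = y"
 unfolding hr_def using injD[OF bhD(2)[OF h(1)]] of_real_eq_iff by metis

lemma hr_cont: "continuous_on S hr"
 unfolding hr_def by (intro continuous_on_compose2[OF bhD(1)[OF h(1), of UNIV]] continuous_intros) auto

lemma X_bounds: "x \<in> X h ==> -1 <= x & x <= 1" by (simp add: X_def)

lemma hr_ends: "hr (-1) = -1" "hr 1 = 1"
 using bhD(6,7)[OF h(1)] by (simp_all add: hr_def)

lemma hr_interior: assumes "-1 < x" "x < 1" shows "-1 < Re (hr x)" "Re (hr x) < 1"
 using Re_inner[OF norm_inner[OF h(1) assms]] by (simp_all add: hr_def)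

lemma line_ends: assumes "x \<in> X h" shows "Re (hr x) = m 0 \<longleftrightarrow> x = -1" "Re (hr x) = m n \<longleftrightarrow> x = 1"
proof -
 have "x = -1 \<or> x = 1 \<or> -1 < x & x < 1" using X_bounds[OF assms] by auto
 thus "Re (hr x) = m 0 \<longleftrightarrow> x = -1" "Re (hr x) = m n \<longleftrightarrow> x = 1"
  using hr_ends hr_interior[of x] unfolding m_ends by auto
qed

lemma a_ends: "a 0 = 1" "a n = 1"
proof -
 have "{x \<in> X h. Re (hr x) = m 0} = {-1}" "{x \<in> X h. Re (hr x) = m n} = {1}"
  using line_ends X_ends[OF h(1)] by blast+
 thus "a 0 = 1" "a n = 1" by (simp_all add: a_def)
qed

lemma X_line: assumes "x \<in> X h" obtains j where "j <= n" "Re (hr x) = m j"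
proof -
 have "Re (hr x) \<in> M" using assms by (simp add: X_def hr_def)
 then obtain j where "j \<in> {0..n}" "Re (hr x) = m j" by blast
 thus thesis by (intro that) auto
qed

lemma gap_ex: assumes xy: "consec (X h) x y" shows "\<exists>s. gap s x y"
proof -
 define f where "f = (\<lambda>u. Re (hr u))"
 have b: "-1 <= x" "y <= 1" "x < y" using xy X_bounds by (auto simp: consec_def)
 have con: "connected (f ` {x<..<y})" unfolding f_def by (intro connected_continuous_image continuous_on_Re hr_cont) auto
 have nM: "f u \<notin> M" if "x < u" "u < y" for u
 proof
  assume "f u \<in> M"
  hence "u \<in> X h" using that b by (auto simp: X_def f_def hr_def)
  thus False using that xy by (auto simp: consec_def)
 qed
 define u0 where "u0 = (x + y) / 2"
 have u0: "x < u0" "u0 < y" using b by (auto simp: u0_def)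
 have "-1 < f u0" "f u0 < 1" using hr_interior[of u0] u0 b by (auto simp: f_def)
 then obtain s where s: "s \<in> {1..n}" "m (s - 1) <= f u0" "f u0 <= m s" using strip_index[of "f u0"] by auto
 have sM: "m (s - 1) \<in> M" "m s \<in> M" using s(1) by auto
 have "m (s - 1) < f u & f u < m s" if u: "x < u" "u < y" for u
 proof (rule ccontr)
  assume c: "\<not> (m (s - 1) < f u & f u < m s)"
  have I: "f u \<in> f ` {x<..<y}" "f u0 \<in> f ` {x<..<y}" using u u0 by auto
  from c consider "f u <= m (s - 1)" | "m s <= f u" by linarith
  hence "m (s - 1) \<in> f ` {x<..<y} \<or> m s \<in> f ` {x<..<y}"
   by cases (use connectedD_interval[OF con I(1,2)] connectedD_interval[OF con I(2,1)] s in blast)+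
  thus False using nM sM by force
 qed
 thus ?thesis using s(1) xy unfolding gap_def f_def by blast
qed

lemma gap_facts:
 assumes "gap s x y"
 shows "s \<in> {1..n}" "consec (X h) x y" "x \<in> XS s" "y \<in> XS s" "x < y" "x \<in> X h" "y \<in> X h"
proof -
 show s: "s \<in> {1..n}" and c: "consec (X h) x y" using assms by (auto simp: gap_def)
 thus xy: "x < y" "x \<in> X h" "y \<in> X h" by (auto simp: consec_def)
 have m2: "m (s - 1) < m s" by (rule m_less) (use s in auto)
 have "{x<..<y} <= {u. m (s - 1) <= Re (hr u) & Re (hr u) <= m s}" using assms by (auto simp: gap_def intro: less_imp_le)
 moreover have "closed {u. m (s - 1) <= Re (hr u) & Re (hr u) <= m s}"
  by (intro closed_Collect_conj closed_Collect_le continuous_intros hr_cont)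
 ultimately have "closure {x<..<y} <= {u. m (s - 1) <= Re (hr u) & Re (hr u) <= m s}" by (rule closure_minimal)
 hence cl: "m (s - 1) <= Re (hr u) & Re (hr u) <= m s" if u: "u = x \<or> u = y" for u
 proof -
  have "u \<in> closure {x<..<y}" using u xy(1) by auto
  thus ?thesis using \<open>closure {x<..<y} <= _\<close> by blast
 qed
 have "u \<in> XS s" if u: "u = x \<or> u = y" for u
 proof -
  have uX: "u \<in> X h" using u xy by blast
  obtain j where j: "j <= n" "Re (hr u) = m j" by (rule X_line[OF uX])
  have "m j < m (s - 1)" if "j < s - 1" using that s by (intro m_less) auto
  hence "\<not> j < s - 1" using cl[OF u] j by auto
  moreover have "m s < m j" if "s < j" using that j(1) by (intro m_less) auto
  hence "\<not> s < j" using cl[OF u] j(2) by auto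
  ultimately have "j = s - 1 \<or> j = s" using s by auto
  thus ?thesis using uX j(2) by (auto simp: XS_def)
 qed
 thus "x \<in> XS s" "y \<in> XS s" by blast+
qed

text \<open>Two successive pieces of the curve in the same strip would make the diagram touch a line
  at their common end \<open>y\<close>.\<close>

lemma gap_switch: assumes g: "gap s x y" "gap s' y z" shows "s' ~= s"
proof
 assume "s' = s"
 note g1 = gap_facts[OF g(1)] and g2 = gap_facts[OF g(2)]
 have y: "y \<in> X h" "-1 < y" "y < 1" using g1(5-7) g2(5-7) X_bounds[of x] X_bounds[of z] by auto
 obtain j :: nat and ta :: real where j: "j <= n" "Re (h (of_real y)) = m j" "ta = 1 & j = s \<or> ta = -1 & j = s - 1"
 proof -
  have s: "s <= n" "s - 1 <= n" using g1(1) by auto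
  have "Re (h (of_real y)) = m (s - 1) \<or> Re (h (of_real y)) = m s" using g1(4) by (simp add: XS_def hr_def)
  thus thesis using that[OF s(1), of 1] that[OF s(2), of "-1"] by blast
 qed
 have "reducible h"
 proof (rule diagram_touch_reducible[OF h(1,2) y j(1,2), of ta "min (y - x) (z - y)"])
  show "ta = 1 \<or> ta = -1" using j(3) by blast
  show "0 < min (y - x) (z - y)" using g1(5) g2(5) by simp
  fix u assume u: "0 < \<bar>u - y\<bar>" "\<bar>u - y\<bar> < min (y - x) (z - y)"
  hence "x < u & u < y \<or> y < u & u < z" by (auto simp: abs_if split: if_splits)
  hence "m (s - 1) < Re (hr u) & Re (hr u) < m s" using g \<open>s' = s\<close> by (auto simp: gap_def)
  thus "ta * (Re (h (of_real u)) - m j) < 0" using j(3) by (auto simp: hr_def)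
 qed
 thus False using h(3) by simp
qed

lemma gap_next:
 assumes g: "gap s x y" "gap s' y z"
 shows "Re (hr y) = m s ==> s' = s + 1" "Re (hr y) = m (s - 1) ==> s' = s - 1"
proof -
 note g1 = gap_facts[OF g(1)] and g2 = gap_facts[OF g(2)] and ne = gap_switch[OF g]
 have e: "Re (hr y) = m (s' - 1) \<or> Re (hr y) = m s'" using g2(3) by (auto simp: XS_def)
 have s: "s \<in> {1..n}" "s' \<in> {1..n}" using g1(1) g2(1) .
 show "s' = s + 1" if "Re (hr y) = m s" 
 proof -
  have "s = s' - 1 \<or> s = s'" using e that s by (metis m_eq atLeastAtMost_iff diff_le_self le_trans)
  thus ?thesis using ne s by auto
 qed
 show "s' = s - 1" if "Re (hr y) = m (s - 1)" 
 proof -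
  have "s - 1 = s' - 1 \<or> s - 1 = s'" using e that s by (metis m_eq atLeastAtMost_iff diff_le_self le_trans)
  thus ?thesis using ne s by auto
 qed
qed

lemma next_X: assumes "x \<in> X h" "x ~= 1" obtains y where "consec (X h) x y"
proof -
 define y where "y = Min {y \<in> X h. x < y}"
 have ne: "1 \<in> {y \<in> X h. x < y}" using X_ends[OF h(1)] X_bounds[OF assms(1)] assms(2) by auto
 have y: "y \<in> {y \<in> X h. x < y}" unfolding y_def using h(2) ne by (intro Min_in) auto
 have "y <= z" if "z \<in> X h" "x < z" for z unfolding y_def using h(2) that by (intro Min_le) auto
 hence "consec (X h) x y" using y assms(1) by (force simp: consec_def)
 thus thesis by (rule that)
qed

lemma prev_X: assumes "x \<in> X h" "x ~= -1" obtains y where "consec (X h) y x"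
proof -
 define y where "y = Max {y \<in> X h. y < x}"
 have ne: "-1 \<in> {y \<in> X h. y < x}" using X_ends[OF h(1)] X_bounds[OF assms(1)] assms(2) by auto
 have y: "y \<in> {y \<in> X h. y < x}" unfolding y_def using h(2) ne by (intro Max_in) auto
 have "z <= y" if "z \<in> X h" "z < x" for z unfolding y_def using h(2) that by (intro Max_ge) auto
 hence "consec (X h) y x" using y assms(1) by (force simp: consec_def)
 thus thesis by (rule that)
qed

lemma consec_unique: "consec S x y ==> consec S x z ==> y = z" "consec S y x ==> consec S z x ==> y = z"
proof -
 assume "consec S x y" "consec S x z"
 hence "\<not> y < z" "\<not> z < y" by (auto simp: consec_def disjoint_iff)
 thus "y = z" by simp
next
 assume "consec S y x" "consec S z x"
 hence "\<not> y < z" "\<not> z < y" by (auto simp: consec_def disjoint_iff)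
 thus "y = z" by simp
qed

definition mates :: "nat => real => real => bool" where "mates s x y \<longleftrightarrow> gap s x y \<or> gap s y x"

lemma mates_unique: assumes "mates s x y" "mates s x z" shows "y = z"
proof -
 consider "gap s x y" "gap s x z" | "gap s x y" "gap s z x" | "gap s y x" "gap s x z" | "gap s y x" "gap s z x"
  using assms unfolding mates_def by blast
 thus ?thesis
 proof cases
  case 1 thus ?thesis using consec_unique(1) gap_facts(2) by blast
 next
  case 2 thus ?thesis using gap_switch by blast
 next
  case 3 thus ?thesis using gap_switch by blast
 next
  case 4 thus ?thesis using consec_unique(2) gap_facts(2) by blast
 qed
qed

text \<open>At an inner crossing the two adjacent pieces lie in the two strips next to the line,
  because the strip changes there. At \<open>-1\<close> and \<open>1\<close> there is a single
  piece, and it lies in the first or last strip.\<close>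

lemma mates_ex: assumes s: "s \<in> {1..n}" and x: "x \<in> XS s" shows "\<exists>y. mates s x y"
proof -
 have xX: "x \<in> X h" and xl: "Re (hr x) = m (s - 1) \<or> Re (hr x) = m s" using x by (auto simp: XS_def)
 have adj: "s' = s" if "gap s' x y \<or> gap s' y x" "Re (hr x) = m j" "j = 0 & s = 1 \<or> j = n & s = n" for s' y j
 proof -
  have s': "s' \<in> {1..n}" "x \<in> XS s'" using that(1) gap_facts(1,3,4) by blast+
  hence "m j = m (s' - 1) \<or> m j = m s'" using that(2) by (auto simp: XS_def)
  moreover have "j <= n" "s' <= n" "s' - 1 <= n" using that(3) s'(1) by auto
  ultimately have "j = s' - 1 \<or> j = s'" using m_eq by blast
  thus ?thesis using that(3) s'(1) by auto
 qed
 consider "x = -1" | "x = 1" | "x ~= -1" "x ~= 1" by blast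
 thus ?thesis
 proof cases
  case 1
  hence e: "Re (hr x) = m 0" using line_ends[OF xX] by simp
  have sn: "s <= n" "s - 1 <= n" using s by auto
  have "0 = s - 1 \<or> 0 = s" using xl e m_eq[OF _ sn(1), of 0] m_eq[OF _ sn(2), of 0] by auto
  hence "s = 1" using s by auto
  moreover obtain y where "consec (X h) x y" using next_X[OF xX] 1 by auto
  ultimately show ?thesis using gap_ex[of x y] adj[OF _ e] unfolding mates_def by blast
 next
  case 2
  hence e: "Re (hr x) = m n" using line_ends[OF xX] by simp
  have sn: "s <= n" "s - 1 <= n" using s by auto
  have "n = s - 1 \<or> n = s" using xl e m_eq[OF _ sn(1), of n] m_eq[OF _ sn(2), of n] by auto
  hence "s = n" using s by auto
  moreover obtain y where "consec (X h) y x" using prev_X[OF xX] 2 by auto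
  ultimately show ?thesis using gap_ex[of y x] adj[OF _ e] unfolding mates_def by blast
 next
  case 3
  obtain y where "consec (X h) y x" using prev_X[OF xX] 3 by auto
  then obtain r where r: "gap r y x" using gap_ex by blast
  obtain z where "consec (X h) x z" using next_X[OF xX] 3 by auto
  then obtain r' where r': "gap r' x z" using gap_ex by blast
  note n1 = gap_next[OF r r'] and f = gap_facts[OF r] 
  have "Re (hr x) = m r & r' = r + 1 \<or> Re (hr x) = m (r - 1) & r' = r - 1" using f(4) n1 by (auto simp: XS_def)
  moreover have sn: "s <= n" "s - 1 <= n" "r <= n" "r - 1 <= n" using s f(1) by auto
  ultimately have "(r = s - 1 \<or> r = s) & r' = r + 1 \<or> (r - 1 = s - 1 \<or> r - 1 = s) & r' = r - 1"
   using xl m_eq[OF sn(3,1)] m_eq[OF sn(3,2)] m_eq[OF sn(4,1)] m_eq[OF sn(4,2)] by auto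
  hence "s = r \<or> s = r'" using s f(1) by auto
  thus ?thesis using r r' unfolding mates_def by blast
 qed
qed

definition mate :: "nat => real => real" where "mate s x = (THE y. mates s x y)"

lemma mate:
 assumes s: "s \<in> {1..n}" and x: "x \<in> XS s"
 shows "mates s x (mate s x)" "mate s x \<in> XS s" "mate s x ~= x" "mate s (mate s x) = x"
proof -
 have eq: "mate s x = y" if "mates s x y" for x y
  unfolding mate_def by (rule the_equality[of "mates s x", OF that]) (rule mates_unique[OF _ that])
 obtain y where y: "mates s x y" using mates_ex[OF s x] by blast
 show 1: "mates s x (mate s x)" using eq[OF y] y by simp
 then consider "gap s x (mate s x)" | "gap s (mate s x) x" unfolding mates_def by blast
 thus "mate s x \<in> XS s" "mate s x ~= x" using gap_facts(3-5)[of s x "mate s x"] gap_facts(3-5)[of s "mate s x" x] by (cases; force)+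
 have "mates s (mate s x) x" using 1 unfolding mates_def by blast
 thus "mate s (mate s x) = x" by (rule eq)
qed

text \<open>Increasing \<open>key\<close> is the order along the boundary of strip \<open>s\<close>
  used for the noncrossing property: down the right-hand line, then up the left-hand line. Hence the
  positions \<open>1..a s\<close> lie on the right, counted from the top.\<close>

definition key :: "nat => complex => real" where "key s z = (if Re z = m s then - exp (Im z) else exp (Im z))"

lemma key_inj: assumes "s \<in> {1..n}" shows "inj_on (\<lambda>x. key s (hr x)) (XS s)"
proof (rule inj_onI)
 fix x y assume x: "x \<in> XS s" and y: "y \<in> XS s" and e: "key s (hr x) = key s (hr y)"
 have s: "key s (hr z) < 0 \<longleftrightarrow> Re (hr z) = m s" for z using exp_gt_zero[of "Im (hr z)"] by (simp add: key_def)
 have R: "Re (hr x) = m s \<longleftrightarrow> Re (hr y) = m s" using s[of x] s[of y] e by simp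
 hence "Re (hr x) = Re (hr y)" using x y by (auto simp: XS_def)
 moreover have "Im (hr x) = Im (hr y)" using e R by (simp add: key_def split: if_splits)
 ultimately have "hr x = hr y" by (simp add: complex_eq_iff)
 thus "x = y" using hr_inj by simp
qed

definition pos :: "nat => real => nat" where "pos s x = card {y \<in> XS s. key s (hr y) <= key s (hr x)}"

lemma XS_fin: "finite (XS s)" using h(2) by (simp add: XS_def)

lemma card_XS: assumes s: "s \<in> {1..n}" shows "card (XS s) = a (s - 1) + a s"
proof -
 have "m (s - 1) ~= m s" using m_less[of "s - 1" s] s by auto
 hence "XS s = {x \<in> X h. Re (hr x) = m (s - 1)} Un {x \<in> X h. Re (hr x) = m s}"
  "{x \<in> X h. Re (hr x) = m (s - 1)} \<inter> {x \<in> X h. Re (hr x) = m s} = {}" by (auto simp: XS_def)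
 thus ?thesis unfolding a_def using h(2) by (simp add: card_Un_disjoint)
qed

lemma pos:
 assumes s: "s \<in> {1..n}"
 shows "bij_betw (pos s) (XS s) {1..a (s - 1) + a s}"
  "x \<in> XS s ==> y \<in> XS s ==> pos s x < pos s y \<longleftrightarrow> key s (hr x) < key s (hr y)"
 using rank_bij[OF XS_fin key_inj[OF s], folded pos_def] card_XS[OF s] by simp_all

lemma pos_code:
 assumes s: "s \<in> {1..n}" and x: "x \<in> XS s"
 shows "Re (hr x) = m s ==> pos s x + snd (code h x) = a s + 1" "Re (hr x) = m (s - 1) ==> pos s x = a s + snd (code h x)"
  "pos s x <= a s \<longleftrightarrow> Re (hr x) = m s" "1 <= snd (code h x)"
proof -
 define L where "L = {x \<in> X h. Re (hr x) = m (s - 1)}"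
 define R where "R = {x \<in> X h. Re (hr x) = m s}"
 have ne: "m (s - 1) ~= m s" using m_less[of "s - 1" s] s by auto
 have xX: "x \<in> X h" using x by (simp add: XS_def)
 have c: "snd (code h x) = card {y \<in> X h. Re (hr y) = Re (hr x) & Im (hr y) <= Im (hr x)}" by (simp add: code_def hr_def)
 have kp: "key s (hr y) > 0" if "y \<in> L" for y using that ne by (simp add: key_def L_def)
 have kn: "key s (hr y) = - exp (Im (hr y))" if "y \<in> R" for y using that by (simp add: key_def R_def)
 have XS: "XS s = L Un R" "L \<inter> R = {}" using ne by (auto simp: XS_def L_def R_def)
 have fin: "finite L" "finite R" using h(2) by (auto simp: L_def R_def)
 show "1 <= snd (code h x)"
 proof -
  have "{y \<in> X h. Re (hr y) = Re (hr x) & Im (hr y) <= Im (hr x)} ~= {}" using xX by blast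
  hence "snd (code h x) ~= 0" unfolding c using h(2) by (subst card_0_eq) auto
  thus ?thesis by simp
 qed
 show R1: "pos s x + snd (code h x) = a s + 1" if r: "Re (hr x) = m s"
 proof -
  have xR: "x \<in> R" using xX r by (simp add: R_def)
  have "{y \<in> XS s. key s (hr y) <= key s (hr x)} = {y \<in> R. Im (hr x) <= Im (hr y)}"
  proof (rule set_eqI)
   fix y
   have "\<not> key s (hr y) <= key s (hr x) & y \<notin> R" if "y \<in> L"
   proof -
    have "key s (hr x) < 0" using kn[OF xR] by simp
    thus ?thesis using kp[OF that] XS(2) that by force
   qed
   moreover have "key s (hr y) <= key s (hr x) \<longleftrightarrow> Im (hr x) <= Im (hr y)" if "y \<in> R"
    by (simp add: kn[OF that] kn[OF xR])
   ultimately show "y \<in> {y \<in> XS s. key s (hr y) <= key s (hr x)} \<longleftrightarrow> y \<in> {y \<in> R. Im (hr x) <= Im (hr y)}"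
    unfolding XS by blast
  qed
  moreover have "{y \<in> X h. Re (hr y) = Re (hr x) & Im (hr y) <= Im (hr x)} = {y \<in> R. Im (hr y) <= Im (hr x)}"
   using r by (auto simp: R_def)
  moreover have "card {y \<in> R. Im (hr x) <= Im (hr y)} + card {y \<in> R. Im (hr y) <= Im (hr x)} = card R + 1"
  proof -
   have "{y \<in> R. Im (hr x) <= Im (hr y)} Un {y \<in> R. Im (hr y) <= Im (hr x)} = R" by auto
   moreover have "{y \<in> R. Im (hr x) <= Im (hr y)} \<inter> {y \<in> R. Im (hr y) <= Im (hr x)} = {x}"
   proof -
    have "y = x" if "y \<in> R" "Im (hr x) = Im (hr y)" for y
     using that r hr_inj[of y x] by (simp add: R_def complex_eq_iff)
    thus ?thesis using xR by force
   qed
   ultimately show ?thesis using card_Un_Int[of "{y \<in> R. Im (hr x) <= Im (hr y)}" "{y \<in> R. Im (hr y) <= Im (hr x)}"] fin by simp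
  qed
  ultimately show ?thesis unfolding pos_def c a_def R_def by simp
 qed
 show L1: "pos s x = a s + snd (code h x)" if l: "Re (hr x) = m (s - 1)"
 proof -
  have xL: "x \<in> L" using xX l by (simp add: L_def)
  have kL: "key s (hr y) = exp (Im (hr y))" if "y \<in> L" for y using that ne by (simp add: key_def L_def)
  have "{y \<in> XS s. key s (hr y) <= key s (hr x)} = R Un {y \<in> L. Im (hr y) <= Im (hr x)}"
  proof -
   have "key s (hr y) <= key s (hr x)" if "y \<in> R" for y
    using kn[OF that] kp[OF xL] exp_gt_zero[of "Im (hr y)"] by linarith
   thus ?thesis unfolding XS using kL xL by auto
  qed
  moreover have "{y \<in> X h. Re (hr y) = Re (hr x) & Im (hr y) <= Im (hr x)} = {y \<in> L. Im (hr y) <= Im (hr x)}"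
   using l by (auto simp: L_def)
  moreover have "card (R Un {y \<in> L. Im (hr y) <= Im (hr x)}) = card R + card {y \<in> L. Im (hr y) <= Im (hr x)}"
   using fin XS(2) by (intro card_Un_disjoint) auto
  ultimately show ?thesis unfolding pos_def c a_def R_def by simp
 qed
 show "pos s x <= a s \<longleftrightarrow> Re (hr x) = m s"
 proof
  assume le: "pos s x <= a s"
  show "Re (hr x) = m s"
  proof (rule ccontr)
   assume "Re (hr x) ~= m s"
   hence "Re (hr x) = m (s - 1)" using x by (auto simp: XS_def)
   thus False using L1 le \<open>1 <= snd (code h x)\<close> by simp
  qed
 next
  assume "Re (hr x) = m s" thus "pos s x <= a s" using R1 \<open>1 <= snd (code h x)\<close> by simp
 qed
qed

end

section \<open>The matching of a strip and the arc through its puncture\<close>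

context tight_diagram begin

definition ip :: "nat => nat => real" where "ip s = inv_into (XS s) (pos s)"

definition mu :: "nat => nat => nat" where "mu s i = pos s (mate s (ip s i))"

lemma ip:
 assumes s: "s \<in> {1..n}"
 shows "i \<in> {1..a (s - 1) + a s} ==> ip s i \<in> XS s" "i \<in> {1..a (s - 1) + a s} ==> pos s (ip s i) = i"
  "x \<in> XS s ==> ip s (pos s x) = x" "x \<in> XS s ==> pos s x \<in> {1..a (s - 1) + a s}"
proof -
 note b = pos(1)[OF s]
 show "ip s i \<in> XS s" if i: "i \<in> {1..a (s - 1) + a s}"
 proof -
  have "i \<in> pos s ` XS s" using i by (simp only: bij_betw_imp_surj_on[OF b])
  thus ?thesis unfolding ip_def by (rule inv_into_into)
 qed
 show "i \<in> {1..a (s - 1) + a s} ==> pos s (ip s i) = i" unfolding ip_def by (rule bij_betw_inv_into_right[OF b])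
 show "x \<in> XS s ==> ip s (pos s x) = x" unfolding ip_def by (rule bij_betw_inv_into_left[OF b])
 show "x \<in> XS s ==> pos s x \<in> {1..a (s - 1) + a s}" by (rule bspec[OF bij_betwE[OF b]])
qed

lemma mu_pos: assumes s: "s \<in> {1..n}" and x: "x \<in> XS s" shows "mu s (pos s x) = pos s (mate s x)"
 using ip(3)[OF s x] by (simp add: mu_def)

lemma gap_segment:
 assumes g: "gap s x y \<or> gap s y x" and u: "u \<in> closed_segment x y"
 shows "m (s - 1) <= Re (hr u)" "Re (hr u) <= m s"
proof -
 have *: "m (s - 1) <= Re (hr u) & Re (hr u) <= m s" if g: "gap s x y" and u: "x <= u" "u <= y" for x y
 proof (cases "u = x \<or> u = y")
  case True
  hence "u \<in> XS s" using gap_facts(3,4)[OF g] by blast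
  moreover have "m (s - 1) < m s" using gap_facts(1)[OF g] by (intro m_less) auto
  ultimately show ?thesis by (auto simp: XS_def)
 next
  case False
  hence "x < u" "u < y" using u by auto
  thus ?thesis using g by (auto simp: gap_def intro: less_imp_le)
 qed
 have "m (s - 1) <= Re (hr u) & Re (hr u) <= m s" using g
 proof
  assume "gap s x y" thus ?thesis using *[of x y] u gap_facts(5)[of s x y] by (simp add: closed_segment_eq_real_ivl)
 next
  assume "gap s y x" thus ?thesis using *[of y x] u gap_facts(5)[of s y x] by (simp add: closed_segment_eq_real_ivl split: if_splits)
 qed
 thus "m (s - 1) <= Re (hr u)" "Re (hr u) <= m s" by simp_all
qed

lemma gap_disjoint:
 assumes g: "gap s x y \<or> gap s y x" "gap s x' y' \<or> gap s y' x'" and ne: "x ~= x'" "x ~= y'" "y ~= x'" "y ~= y'"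
 shows "closed_segment x y \<inter> closed_segment x' y' = {}"
proof -
 have *: "{x..y} \<inter> {x'..y'} = {}" if g: "gap s x y" "gap s x' y'" and ne: "x ~= x'" "x ~= y'" "y ~= x'" for x y x' y'
 proof -
  note c = gap_facts(2,5-7)[OF g(1)] and c' = gap_facts(2,5-7)[OF g(2)]
  have "\<not> (x < x' & x' < y)" using c(1) c'(3) by (auto simp: consec_def)
  moreover have "\<not> (x' < x & x < y')" using c'(1) c(3) by (auto simp: consec_def)
  ultimately have "y < x' \<or> y' < x" using ne by linarith
  thus ?thesis by auto
 qed
 have o: "closed_segment x y = {x..y}" if "gap s x y" for x y using gap_facts(5)[OF that] by (simp add: closed_segment_eq_real_ivl)
 have o': "closed_segment x y = {y..x}" if "gap s y x" for x y using o[OF that] by (simp add: closed_segment_commute)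
 show ?thesis using g(1)
 proof
  assume g1: "gap s x y"
  show ?thesis using g(2)
  proof
   assume "gap s x' y'" thus ?thesis using *[OF g1] o[OF g1] o ne by simp
  next
   assume "gap s y' x'" thus ?thesis using *[OF g1] o[OF g1] o' ne by simp
  qed
 next
  assume g1: "gap s y x"
  show ?thesis using g(2)
  proof
   assume "gap s x' y'" thus ?thesis using *[OF g1] o'[OF g1] o ne by simp
  next
   assume "gap s y' x'" thus ?thesis using *[OF g1] o'[OF g1] o' ne by simp
  qed
 qed
qed

lemma ncm_mu: assumes s: "s \<in> {1..n}" shows "ncm (a (s - 1) + a s) (mu s)"
proof -
 have inv: "mu s i \<in> {1..a (s - 1) + a s} & mu s i ~= i & mu s (mu s i) = i" if i: "i \<in> {1..a (s - 1) + a s}" for i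
 proof (intro conjI)
 note x = ip(1)[OF s i]
 note mt = mate[OF s x]
 show "mu s i \<in> {1..a (s - 1) + a s}" unfolding mu_def by (rule ip(4)[OF s mt(2)])
 show "mu s i ~= i"
 proof
  assume "mu s i = i"
  hence "ip s (pos s (mate s (ip s i))) = ip s i" by (simp add: mu_def)
  thus False using ip(3)[OF s mt(2)] mt(3) by simp
 qed
 show "mu s (mu s i) = i" unfolding mu_def ip(3)[OF s mt(2)] mt(4) by (rule ip(2)[OF s i])
 qed
 have cross: False if i: "i \<in> {1..a (s - 1) + a s}" and k: "k \<in> {1..a (s - 1) + a s}" and lt: "i < k & k < mu s i & mu s i < mu s k" for i k
 proof -
 note x = ip(1)[OF s i]
 note mt = mate[OF s x]
 note x' = ip(1)[OF s k]
 note mt' = mate[OF s x']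
 define x y x' y' where "x = ip s i" and "y = mate s x" and "x' = ip s k" and "y' = mate s x'"
 have P: "pos s x = i" "pos s x' = k" "mu s i = pos s y" "mu s k = pos s y'"
  using ip(2)[OF s] i k by (simp_all add: x_def y_def x'_def y'_def mu_def)
 have XS: "x \<in> XS s" "y \<in> XS s" "x' \<in> XS s" "y' \<in> XS s" using x x' mt(2) mt'(2) by (simp_all add: x_def y_def x'_def y'_def)
 have K: "key s (hr x) < key s (hr x')" "key s (hr x') < key s (hr y)" "key s (hr y) < key s (hr y')"
  using lt P pos(2)[OF s XS(1,3)] pos(2)[OF s XS(3,2)] pos(2)[OF s XS(2,4)] by auto
 have g: "gap s x y \<or> gap s y x" "gap s x' y' \<or> gap s y' x'"
  using mt(1) mt'(1) unfolding mates_def x_def y_def x'_def y'_def by blast+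
 have path: "path (\<lambda>t. hr (linepath x y t))" "path_image (\<lambda>t. hr (linepath x y t)) = hr ` closed_segment x y"
  "pathstart (\<lambda>t. hr (linepath x y t)) = hr x" "pathfinish (\<lambda>t. hr (linepath x y t)) = hr y" for x y
 proof -
  have eq: "(\<lambda>t. hr (linepath x y t)) = hr \<circ> linepath x y" by (simp add: o_def)
  show "path (\<lambda>t. hr (linepath x y t))" unfolding eq by (intro path_continuous_image path_linepath hr_cont)
  show "path_image (\<lambda>t. hr (linepath x y t)) = hr ` closed_segment x y" unfolding eq by (simp only: path_image_compose path_image_linepath)
  show "pathstart (\<lambda>t. hr (linepath x y t)) = hr x" "pathfinish (\<lambda>t. hr (linepath x y t)) = hr y"
   by (simp_all add: pathstart_def pathfinish_def linepath_def)
 qed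
 have E: "Re (hr z) \<in> {m (s - 1), m s}" if "z \<in> XS s" for z using that by (simp add: XS_def)
 show False
 proof (rule strip_noncrossing[where f = "\<lambda>t. hr (linepath x y t)" and g = "\<lambda>t. hr (linepath x' y' t)" and l = "m (s - 1)" and r = "m s"])
  show "m (s - 1) < m s" by (rule m_less) (use s in auto)
  show "m (s - 1) <= Re z & Re z <= m s" if "z \<in> path_image (\<lambda>t. hr (linepath x y t))" for z
   using that gap_segment[OF g(1)] unfolding path(2) by blast
  show "m (s - 1) <= Re z & Re z <= m s" if "z \<in> path_image (\<lambda>t. hr (linepath x' y' t))" for z
   using that gap_segment[OF g(2)] unfolding path(2) by blast
  have "inj hr" by (rule injI) (simp add: hr_inj)
  have "closed_segment x y \<inter> closed_segment x' y' = {}"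
   by (rule gap_disjoint[OF g]) (use K in auto)
  thus "path_image (\<lambda>t. hr (linepath x y t)) \<inter> path_image (\<lambda>t. hr (linepath x' y' t)) = {}"
   unfolding path(2) image_Int[OF \<open>inj hr\<close>, symmetric] by simp
 qed (use path(1) E[OF XS(1)] E[OF XS(2)] E[OF XS(3)] E[OF XS(4)] K[unfolded key_def] in \<open>simp_all only: path(3,4)\<close>)
 qed
 show ?thesis unfolding ncm_def using inv cross by blast
qed

text \<open>Each strip is perfectly matched, so neighbouring lines carry numbers of the same parity,
  starting from \<open>a 0 = 1\<close>.\<close>

lemma a_odd: assumes "j <= n" shows "odd (a j)"
 using assms
proof (induction j)
 case 0 thus ?case by (simp add: a_ends)
next
 case (Suc j)
 hence "2 * card (openers (a j + a (Suc j)) (mu (Suc j))) = a j + a (Suc j)" using card_openers[OF ncm_mu[of "Suc j"]] by simp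
 hence "even (a j + a (Suc j))" by (metis dvd_triv_left)
 thus ?case using Suc by simp
qed

definition gp :: "real => real => nat set" where "gp x y = {r \<in> {1..n}. x < p r & p r < y}"

text \<open>A puncture on a piece of the curve inside strip \<open>s\<close> is mapped to a puncture
  inside this strip, and \<open>p s\<close> is the only one.\<close>

lemma gp_image: assumes g: "gap s x y" and r: "r \<in> gp x y" shows "hr (p r) = of_real (p s)"
proof -
 have r': "r \<in> {1..n}" "x < p r" "p r < y" using r by (auto simp: gp_def)
 have "of_real (p r) \<in> punctures n p" using r'(1) by (simp add: punctures_def)
 hence "hr (p r) \<in> punctures n p" using bhD(4)[OF h(1)] unfolding hr_def by blast
 then obtain q where q: "q \<in> {1..n}" "hr (p r) = of_real (p q)" by (auto simp: punctures_def)
 have b: "m (s - 1) < p q" "p q < m s" using g r' q(2) by (auto simp: gap_def)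
 have s: "s \<in> {1..n}" using g by (simp add: gap_def)
 have "m q <= m (s - 1)" if "q < s" using that s by (intro m_le) auto
 moreover have "m s <= m (q - 1)" if "s < q" using that q by (intro m_le) auto
 ultimately have "q = s" using b m_p[OF q(1)] by (cases q s rule: linorder_cases) auto
 thus ?thesis using q(2) by simp
qed

lemma gp_unique: assumes "gap s x y" "r \<in> gp x y" "gap s x' y'" "r' \<in> gp x' y'" shows "r = r'" "x = x'" "y = y'"
proof -
 have "hr (p r) = hr (p r')" using gp_image assms by simp
 hence e: "p r = p r'" by (simp add: hr_inj)
 have i: "r \<in> {1..n}" "r' \<in> {1..n}" using assms by (auto simp: gp_def)
 show "r = r'" using e p_less[of r r'] p_less[of r' r] i by (cases r r' rule: linorder_cases) auto
 have b: "x < p r" "p r < y" "x' < p r" "p r < y'" using assms(2,4) e by (auto simp: gp_def)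
 note c = gap_facts(2,6,7)[OF assms(1)] and c' = gap_facts(2,6,7)[OF assms(3)]
 have "\<not> (x < x' & x' < y)" "\<not> (x < y' & y' < y)" using c(1) c'(2,3) by (auto simp: consec_def)
 moreover have "\<not> (x' < x & x < y')" "\<not> (x' < y & y < y')" using c'(1) c(2,3) by (auto simp: consec_def)
 ultimately show "x = x'" "y = y'" using b by linarith+
qed

lemma gp_ex: assumes s: "s \<in> {1..n}" shows "\<exists>x y. gap s x y & gp x y ~= {}"
proof -
 have "of_real (p s) \<in> punctures n p" using s by (simp add: punctures_def)
 hence "of_real (p s) \<in> h ` punctures n p" by (simp only: bhD(4)[OF h(1)])
 then obtain z where z: "z \<in> punctures n p" "h z = of_real (p s)" by (metis imageE)
 then obtain r where r: "r \<in> {1..n}" "hr (p r) = of_real (p s)" by (auto simp: punctures_def hr_def)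
 obtain x y where xy: "consec (X h) x y" "x < p r" "p r < y"
  using consec_around[OF h(2) X_ends[OF h(1)], of "p r"] p_bounds[OF r(1)] X_puncture[OF h(1) r(1)] by auto
 obtain s' where g: "gap s' x y" using gap_ex[OF xy(1)] by blast
 have rg: "r \<in> gp x y" using r(1) xy by (simp add: gp_def)
 have "p s' = p s" using gp_image[OF g rg] r(2) by simp
 hence "s' = s" using p_less[of s s'] p_less[of s' s] s gap_facts(1)[OF g] by (cases s s' rule: linorder_cases) auto
 thus ?thesis using g rg by blast
qed

text \<open>The piece of the curve in strip \<open>s\<close> that passes through the puncture; it is
  unique by \<open>gp_unique\<close>, and \<open>tt s\<close> is the smaller of its two
  positions.\<close>

definition tg :: "nat => real \<times> real" where "tg s = (SOME g. gap s (fst g) (snd g) & gp (fst g) (snd g) ~= {})"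

definition tt :: "nat => nat" where "tt s = min (pos s (fst (tg s))) (pos s (snd (tg s)))"

lemma tg: assumes "s \<in> {1..n}" shows "gap s (fst (tg s)) (snd (tg s))" "gp (fst (tg s)) (snd (tg s)) ~= {}"
proof -
 have "\<exists>g. gap s (fst g) (snd g) & gp (fst g) (snd g) ~= {}" using gp_ex[OF assms] by (metis fst_conv snd_conv)
 from someI_ex[OF this, folded tg_def]
 show "gap s (fst (tg s)) (snd (tg s))" "gp (fst (tg s)) (snd (tg s)) ~= {}" by simp_all
qed

lemma gap_mate: assumes "gap s x y" shows "mate s x = y" "mate s y = x"
proof -
 have "mates s x (mate s x)" "mates s y (mate s y)" using mate(1)[OF gap_facts(1)[OF assms]] gap_facts(3,4)[OF assms] by auto
 thus "mate s x = y" "mate s y = x" using mates_unique assms unfolding mates_def by blast+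
qed

lemma gp_tt: assumes g: "gap s x y" shows "gp x y ~= {} \<longleftrightarrow> min (pos s x) (pos s y) = tt s"
proof
 note f = gap_facts[OF g]
 note t = tg[OF f(1)]
 { assume "gp x y ~= {}"
  hence "x = fst (tg s)" "y = snd (tg s)" using gp_unique[OF g _ t(1)] t(2) by blast+
  thus "min (pos s x) (pos s y) = tt s" by (simp add: tt_def) }
 assume e: "min (pos s x) (pos s y) = tt s"
 note f' = gap_facts[OF t(1)]
 obtain u u' where u: "u = x \<or> u = y" "u' = fst (tg s) \<or> u' = snd (tg s)" "pos s u = pos s u'"
  using e unfolding tt_def by (metis min_def)
 have "u \<in> XS s" "u' \<in> XS s" using u f f' by auto
 hence "u = u'" using u(3) ip(3)[OF f(1)] by metis
 hence "{x, y} = {fst (tg s), snd (tg s)}" using u gap_mate[OF g] gap_mate[OF t(1)] by auto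
 hence "x = fst (tg s)" "y = snd (tg s)" using f(5) f'(5) by (auto simp: doubleton_eq_iff)
 thus "gp x y ~= {}" using t(2) by simp
qed

lemma card_gp: assumes g: "gap s x y" shows "card (gp x y) = (if min (pos s x) (pos s y) = tt s then 1 else 0)"
proof (cases "gp x y = {}")
 case False
 then obtain r where r: "r \<in> gp x y" by blast
 hence "gp x y = {r}" using gp_unique(1)[OF g _ g] by blast
 thus ?thesis using gp_tt[OF g] False by simp
qed (use gp_tt[OF g] in simp)

lemma tt_opener: assumes s: "s \<in> {1..n}" shows "tt s \<in> openers (a (s - 1) + a s) (mu s)"
proof -
 define x y where "x = fst (tg s)" and "y = snd (tg s)"
 have g: "gap s x y" using tg(1)[OF s] by (simp add: x_def y_def)
 note f = gap_facts[OF g] and gm = gap_mate[OF g]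
 have ne: "pos s x ~= pos s y" using ip(3)[OF s f(3)] ip(3)[OF s f(4)] f(5) by auto
 have "mu s (pos s x) = pos s y" "mu s (pos s y) = pos s x" using mu_pos[OF s] f gm by auto
 moreover have "tt s = min (pos s x) (pos s y)" by (simp add: tt_def x_def y_def)
 ultimately show ?thesis using ip(4)[OF s f(3)] ip(4)[OF s f(4)] ne by (auto simp: openers_def min_def)
qed

text \<open>Adjacent positions other than \<open>a s\<close> and \<open>a s + 1\<close>, the lowest
  points of the two lines, are consecutive heights on one line. If the arc between them did not pass
  through a puncture, it would form a bigon with the line.\<close>

lemma mu_adjacent:
 assumes s: "s \<in> {1..n}" and i: "i \<in> {1..a (s - 1) + a s}" "mu s i = i + 1" "i ~= a s"
 shows "i = tt s"
proof -
 define x y where "x = ip s i" and "y = mate s x"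
 have x: "x \<in> XS s" "pos s x = i" using ip(1,2)[OF s i(1)] by (simp_all add: x_def)
 note mt = mate[OF s x(1), folded y_def]
 have py: "pos s y = i + 1" using mu_pos[OF s x(1)] x(2) i(2) by (simp add: y_def)
 obtain j where j: "j \<in> {1..n - 1}" "j = s \<or> j = s - 1" "Re (hr x) = m j" "Re (hr y) = m j"
 proof (cases "i < a s")
  case True
  hence r: "Re (hr x) = m s" "Re (hr y) = m s" using pos_code(3)[OF s x(1)] pos_code(3)[OF s mt(2)] x(2) py by auto
  have "s ~= n" using True i(1) a_ends by auto
  hence "s \<in> {1..n - 1}" using s by auto
  thus thesis using that[of s] r by blast
 next
  case False
  hence "\<not> pos s x <= a s" "\<not> pos s y <= a s" using i(3) x(2) py by auto
  hence r: "Re (hr x) = m (s - 1)" "Re (hr y) = m (s - 1)"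
   using pos_code(3)[OF s x(1)] pos_code(3)[OF s mt(2)] x(1) mt(2) by (auto simp: XS_def)
  have "pos s y \<in> {1..a (s - 1) + a s}" by (rule ip(4)[OF s mt(2)])
  hence "2 <= a (s - 1)" using False i(3) py by auto
  hence "s - 1 ~= 0" using a_ends(1) by (metis numeral_le_one_iff semiring_norm(69))
  hence "s - 1 \<in> {1..n - 1}" using s by auto
  thus thesis using that[of "s - 1"] r by blast
 qed
 define v w where "v = min (Im (hr x)) (Im (hr y))" and "w = max (Im (hr x)) (Im (hr y))"
 have X: "x \<in> X h" "y \<in> X h" using x(1) mt(2) by (auto simp: XS_def)
 note Vx = V_I[OF h(1) j(1) X(1) j(3)[unfolded hr_def], folded hr_def] and Vy = V_I[OF h(1) j(1) X(2) j(4)[unfolded hr_def], folded hr_def]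
 have kxy: "key s (hr x) < key s (hr y)" using pos(2)[OF s x(1) mt(2)] x(2) py by simp
 have kj: "key s z = (if j = s then - exp (Im z) else exp (Im z))" if "Re z = m j" for z
 proof -
  have "m (s - 1) < m s" by (rule m_less) (use s in auto)
  thus ?thesis using that j(2) by (auto simp: key_def)
 qed
 have vw: "consec (V h j) v w"
 proof -
  have "Im (hr x) ~= Im (hr y)" using mt(3) hr_inj j(3,4) by (metis complex_eq_iff)
  hence "v < w" by (auto simp: v_def w_def)
  moreover have "v \<in> V h j" "w \<in> V h j" using Vx(1) Vy(1) by (auto simp: v_def w_def min_def max_def)
  moreover have "u \<notin> {v<..<w}" if u: "u \<in> V h j" for u
  proof
   assume uvw: "u \<in> {v<..<w}"
   hence "\<bar>u\<bar> ~= tp j" using Vx(2) Vy(2) by (auto simp: v_def w_def abs_if split: if_splits)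
   then obtain z where z: "z \<in> X h" "h (of_real z) = Complex (m j) u" by (rule V_cases[OF h(1) j(1) u])
   have hz: "hr z = Complex (m j) u" using z(2) by (simp add: hr_def)
   have zS: "z \<in> XS s" using z(1) hz j(2) by (auto simp: XS_def)
   have "key s (hr x) < key s (hr z) & key s (hr z) < key s (hr y)"
    using kxy uvw unfolding kj[OF j(3)] kj[OF j(4)] hz kj[of "Complex (m j) u", simplified]
    by (auto simp: v_def w_def split: if_splits)
   hence "pos s x < pos s z" "pos s z < pos s y" using pos(2)[OF s] x(1) mt(2) zS by auto
   thus False using x(2) py by simp
  qed
  ultimately show ?thesis by (auto simp: consec_def)
 qed
 have sw: "{v, w} = {Im (hr x), Im (hr y)}" by (auto simp: v_def w_def min_def max_def)
 obtain lo hi where g: "gap s lo hi" and lh: "lo = x & hi = y \<or> lo = y & hi = x" using mt(1) unfolding mates_def by blast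
 have "gp lo hi ~= {}"
 proof
  assume "gp lo hi = {}"
  hence noP: "\<And>r. r \<in> {1..n} ==> p r \<notin> {lo<..<hi}" by (auto simp: gp_def)
  have "reducible h"
  proof (rule bigon_reducible[OF h(1,2) gap_facts(2)[OF g] noP j(1) _ _ vw])
   show "Re (h (of_real lo)) = m j" "Re (h (of_real hi)) = m j" "{v, w} = {Im (h (of_real lo)), Im (h (of_real hi))}"
    using lh j(3,4) sw by (auto simp: hr_def)
  qed
  thus False using h(3) by simp
 qed
 hence "min (pos s lo) (pos s hi) = tt s" using gp_tt[OF g] by blast
 thus ?thesis using lh x(2) py by auto
qed

lemma strip_data:
 assumes s: "s \<in> {1..n}"
 shows "tt s \<in> Tset (a (s - 1)) (a s)"
  "openers (a (s - 1) + a s) (mu s) = (if tt s <= a s then {1..tt s} Un {a s - ((a (s - 1) + a s) div 2 - tt s) + 1..a s}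
   else {1..a s} Un {tt s - ((a (s - 1) + a s) div 2 - a s) + 1..tt s})"
proof -
 have "s - 1 <= n" "s <= n" using s by auto
 hence "0 < a (s - 1)" "0 < a s" using a_odd[of "s - 1"] a_odd[of s] by (auto intro: odd_pos)
 note two_descents[OF ncm_mu[OF s] tt_opener[OF s] this mu_adjacent[OF s]]
 thus "tt s \<in> Tset (a (s - 1)) (a s)"
  "openers (a (s - 1) + a s) (mu s) = (if tt s <= a s then {1..tt s} Un {a s - ((a (s - 1) + a s) div 2 - tt s) + 1..a s}
   else {1..a s} Un {tt s - ((a (s - 1) + a s) div 2 - a s) + 1..tt s})" by blast+
qed

end

section \<open>Crossings and punctures in the order along the curve\<close>

context tight_diagram begin

definition xs :: "nat => real" where "xs i = sorted_list_of_set (X h) ! i"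

lemma xs:
 shows "i < card (X h) ==> xs i \<in> X h" "i < card (X h) ==> k < card (X h) ==> xs i < xs k \<longleftrightarrow> i < k"
  "x \<in> X h ==> \<exists>i<card (X h). x = xs i"
proof -
 let ?l = "sorted_list_of_set (X h)"
 have len: "length ?l = card (X h)" and set: "set ?l = X h" using h(2) by simp_all
 show "i < card (X h) ==> xs i \<in> X h" unfolding xs_def using len set nth_mem by metis
 have less: "xs i < xs k" if "i < k" "k < card (X h)" for i k
  unfolding xs_def by (rule sorted_wrt_nth_less[OF strict_sorted_list_of_set that(1)]) (use that len in simp)
 show "i < card (X h) ==> k < card (X h) ==> xs i < xs k \<longleftrightarrow> i < k"
  using less[of i k] less[of k i] by (cases i k rule: linorder_cases) auto
 show "x \<in> X h ==> \<exists>i<card (X h). x = xs i" unfolding xs_def using len set in_set_conv_nth by metis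
qed

lemma xs_inj: "inj_on xs {..<card (X h)}"
proof (rule inj_onI)
 fix i k assume "i \<in> {..<card (X h)}" "k \<in> {..<card (X h)}" "xs i = xs k"
 thus "i = k" using xs(2)[of i k] xs(2)[of k i] by (cases i k rule: linorder_cases) auto
qed

lemma xs_consec: assumes "Suc i < card (X h)" shows "consec (X h) (xs i) (xs (Suc i))"
proof -
 have "z \<notin> {xs i<..<xs (Suc i)}" if z: "z \<in> X h" for z
 proof
  assume "z \<in> {xs i<..<xs (Suc i)}"
  moreover obtain k where "k < card (X h)" "z = xs k" using xs(3)[OF z] by blast
  ultimately have "i < k" "k < Suc i" using xs(2)[of i k] xs(2)[of k "Suc i"] assms by auto
  thus False by simp
 qed
 thus ?thesis using xs(1)[of i] xs(1)[of "Suc i"] xs(2)[of i "Suc i"] assms by (auto simp: consec_def)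
qed

lemma xs_0: "0 < card (X h)" "xs 0 = -1"
proof -
 obtain k where k: "k < card (X h)" "-1 = xs k" using xs(3)[OF X_ends(1)[OF h(1)]] by blast
 thus 0: "0 < card (X h)" by simp
 have "\<not> xs 0 < xs k" using X_bounds[OF xs(1)[OF 0]] k(2) by simp
 thus "xs 0 = -1" using xs(2)[OF 0 k(1)] k(2) by simp
qed

lemma first_gap: assumes g: "gap s x y" "x = -1" shows "s = 1"
proof -
 note f = gap_facts[OF g(1)]
 have "m 0 = m (s - 1) \<or> m 0 = m s" using f(3) line_ends(1)[OF f(6)] g(2) by (auto simp: XS_def)
 moreover have "m 0 < m s" using f(1) by (intro m_less) auto
 moreover have "m 0 < m (s - 1)" if "s ~= 1" using f(1) that by (intro m_less) auto
 ultimately show ?thesis by force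
qed

text \<open>The increasing order of the punctures makes this number determine how \<open>x\<close>
  compares with each of them, which is how punctures are interleaved with crossings.\<close>

definition q :: "real => nat" where "q x = card {r \<in> {1..n}. p r < x}"

lemma q_step: assumes xy: "x \<in> X h" "x < y" shows "q y = q x + card (gp x y)"
proof -
 have "{r \<in> {1..n}. p r < y} = {r \<in> {1..n}. p r < x} Un gp x y"
 proof (intro equalityI subsetI)
  fix r assume r: "r \<in> {r \<in> {1..n}. p r < y}"
  hence "p r ~= x" using X_puncture[OF h(1), of r] xy(1) by auto
  thus "r \<in> {r \<in> {1..n}. p r < x} Un gp x y" using r by (auto simp: gp_def)
 qed (use xy(2) in \<open>auto simp: gp_def\<close>)
 moreover have "{r \<in> {1..n}. p r < x} \<inter> gp x y = {}" by (auto simp: gp_def)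
 ultimately show ?thesis unfolding q_def by (simp add: card_Un_disjoint gp_def)
qed

lemma q_less: assumes "r \<in> {1..n}" shows "p r < x \<longleftrightarrow> r <= q x"
proof -
 have mono: "p i < x" if "i \<in> {1..n}" "k \<in> {1..n}" "i <= k" "p k < x" for i k
  using p_less[of i k] that by (cases "i = k") auto
 show ?thesis
 proof
  assume "p r < x"
  hence "{1..r} <= {r \<in> {1..n}. p r < x}" using mono[of _ r] assms by auto
  hence "card {1..r} <= q x" unfolding q_def by (intro card_mono) auto
  thus "r <= q x" by simp
 next
  assume le: "r <= q x"
  show "p r < x"
  proof (rule ccontr)
   assume c: "\<not> p r < x"
   have "{i \<in> {1..n}. p i < x} <= {1..<r}"
   proof
    fix i assume i: "i \<in> {i \<in> {1..n}. p i < x}"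
    hence "\<not> r <= i" using mono[OF assms, of i] c by blast
    thus "i \<in> {1..<r}" using i by simp
   qed
   hence "q x <= card {1..<r}" unfolding q_def by (intro card_mono) auto
   hence "r <= r - 1" using le by simp
   moreover have "1 <= r" using assms by simp
   ultimately show False by arith
  qed
 qed
qed

lemma card_X: "card (X h) = (\<Sum>j\<in>{0..n}. a j)"
proof -
 have "X h = (\<Union>j\<in>{0..n}. {x \<in> X h. Re (hr x) = m j})"
 proof (intro equalityI subsetI)
  fix x assume x: "x \<in> X h"
  obtain j where "j <= n" "Re (hr x) = m j" by (rule X_line[OF x])
  hence "j \<in> {0..n}" "x \<in> {x \<in> X h. Re (hr x) = m j}" using x by simp_all
  thus "x \<in> (\<Union>j\<in>{0..n}. {x \<in> X h. Re (hr x) = m j})" by blast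
 qed blast
 moreover have "card (\<Union>j\<in>{0..n}. {x \<in> X h. Re (hr x) = m j}) = (\<Sum>j\<in>{0..n}. card {x \<in> X h. Re (hr x) = m j})"
  using h(2) m_eq by (intro card_UN_disjoint) auto
 ultimately show ?thesis by (simp add: a_def)
qed

lemma puncture_code:
 assumes g: "gap s x y" and r: "r \<in> gp x y"
 shows "code h (p r) = (p s, 0)"
proof -
 have e: "h (of_real (p r)) = of_real (p s)" using gp_image[OF g r] by (simp add: hr_def)
 have "p s \<notin> M" using m_ne_p[OF gap_facts(1)[OF g]] by force
 hence emp: "{y \<in> X h. Re (h (of_real y)) = p s & Im (h (of_real y)) <= 0} = {}" by (auto simp: X_def)
 show ?thesis by (simp only: code_def e Re_complex_of_real Im_complex_of_real emp card.empty)
qed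

lemma puncture_gap:
 assumes r: "r \<in> {1..n}"
 obtains i s where "Suc i < card (X h)" "gap s (xs i) (xs (Suc i))" "r \<in> gp (xs i) (xs (Suc i))"
proof -
 obtain x y where xy: "consec (X h) x y" "x < p r" "p r < y"
  using consec_around[OF h(2) X_ends[OF h(1)], of "p r"] p_bounds[OF r] X_puncture[OF h(1) r] by auto
 have X: "x \<in> X h" "y \<in> X h" "x < y" using xy(1) by (auto simp: consec_def)
 obtain i where i: "i < card (X h)" "x = xs i" using xs(3)[OF X(1)] by blast
 obtain k where k: "k < card (X h)" "y = xs k" using xs(3)[OF X(2)] by blast
 have si: "Suc i < card (X h)" using xs(2)[OF i(1) k(1)] X(3) i k by simp
 hence "y = xs (Suc i)" using consec_unique(1)[OF xy(1)] xs_consec[OF si] i(2) by blast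
 moreover obtain s where "gap s x y" using gap_ex[OF xy(1)] by blast
 ultimately show thesis using that[of i s] si i(2) r xy by (simp add: gp_def)
qed

end

section \<open>Diagrams with equal data are isotopic\<close>

locale equal_data = L: tight_diagram n p h + R: tight_diagram n p h' for n p h h' +
 assumes a_eq: "\<And>j. j <= n ==> R.a j = L.a j" and t_eq: "\<And>s. s \<in> {1..n} ==> R.tt s = L.tt s"
begin

lemma card_eq: "card (L.X h') = card (L.X h)"
proof -
 have "card (L.X h') = (\<Sum>j\<in>{0..n}. R.a j)" by (rule R.card_X)
 also have "\<dots> = (\<Sum>j\<in>{0..n}. L.a j)" by (rule sum.cong[OF refl]) (simp add: a_eq)
 also have "\<dots> = card (L.X h)" by (rule L.card_X[symmetric])
 finally show ?thesis .
qed

lemma mu_eq: assumes s: "s \<in> {1..n}" and i: "i \<in> {1..L.a (s - 1) + L.a s}" shows "R.mu s i = L.mu s i"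
proof -
 have "s - 1 <= n" "s <= n" using s by auto
 hence e: "R.a (s - 1) = L.a (s - 1)" "R.a s = L.a s" by (simp_all only: a_eq)
 show ?thesis
 proof (rule ncm_determined[OF R.ncm_mu[OF s, unfolded e] L.ncm_mu[OF s] _ i])
  show "openers (L.a (s - 1) + L.a s) (R.mu s) = openers (L.a (s - 1) + L.a s) (L.mu s)"
   using R.strip_data(2)[OF s] L.strip_data(2)[OF s] unfolding e t_eq[OF s] by simp
 qed
qed

lemma pos_eq_iff:
 assumes s: "s \<in> {1..n}" and x: "x \<in> L.XS s" and x': "x' \<in> R.XS s"
 shows "L.code h' x' = L.code h x \<longleftrightarrow> R.pos s x' = L.pos s x"
proof -
 have e: "R.a s = L.a s" using a_eq s by auto
 have R: "fst (L.code h x) = Re (L.hr x)" "fst (L.code h' x') = Re (R.hr x')" by (simp_all add: L.code_def L.hr_def R.hr_def)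
 note l = L.pos_code[OF s x] and r = R.pos_code[OF s x']
 have lx: "Re (L.hr x) = L.m (s - 1) \<or> Re (L.hr x) = L.m s" "Re (R.hr x') = L.m (s - 1) \<or> Re (R.hr x') = L.m s"
  using x x' by (auto simp: L.XS_def R.XS_def)
 show ?thesis
 proof
  assume c: "L.code h' x' = L.code h x"
  hence Re: "Re (R.hr x') = Re (L.hr x)" using R by metis
  from lx(1) show "R.pos s x' = L.pos s x"
  proof
   assume h1: "Re (L.hr x) = L.m (s - 1)"
   thus ?thesis using l(2) r(2) Re c e by simp
  next
   assume h1: "Re (L.hr x) = L.m s"
   thus ?thesis using l(1) r(1) Re c e by simp
  qed
 next
  assume p: "R.pos s x' = L.pos s x"
  hence iff: "Re (R.hr x') = L.m s \<longleftrightarrow> Re (L.hr x) = L.m s" using l(3) r(3) e by simp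
  hence Re: "Re (R.hr x') = Re (L.hr x)" using lx by auto
  have "snd (L.code h' x') = snd (L.code h x)" using lx(1)
  proof
   assume "Re (L.hr x) = L.m (s - 1)"
   thus ?thesis using l(2) r(2) Re p e by simp
  next
   assume "Re (L.hr x) = L.m s"
   thus ?thesis using l(1) r(1) Re p e by simp
  qed
  thus "L.code h' x' = L.code h x" using R Re by (simp add: prod_eq_iff)
 qed
qed

text \<open>Both curves are followed simultaneously from \<open>-1\<close>. The common matching of
  the strip determines the position of the next crossing, its line determines the next strip, and a
  puncture is passed exactly when the smaller position of the arc is \<open>tt s\<close>.\<close>

lemma gap_index:
 "i < card (L.X h) ==> L.code h' (R.xs i) = L.code h (L.xs i) & L.q (R.xs i) = L.q (L.xs i) &
  (Suc i < card (L.X h) \<longrightarrow> (\<exists>s. L.gap s (L.xs i) (L.xs (Suc i)) & R.gap s (R.xs i) (R.xs (Suc i))))"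
proof (induction i)
 case 0
 have c: "L.code h (-1) = (-1, 1)"
 proof -
  have "{y \<in> L.X h. Re (L.hr y) = -1 & Im (L.hr y) <= 0} = {-1}"
   using L.line_ends(1) L.m_ends(1) L.X_ends(1)[OF L.h(1)] L.hr_ends(1) by auto
  thus ?thesis using L.hr_ends(1) by (simp add: L.code_def L.hr_def)
 qed
 have c': "L.code h' (-1) = (-1, 1)"
 proof -
  have "{y \<in> L.X h'. Re (R.hr y) = -1 & Im (R.hr y) <= 0} = {-1}"
   using R.line_ends(1) L.m_ends(1) L.X_ends(1)[OF R.h(1)] R.hr_ends(1) by auto
  thus ?thesis using R.hr_ends(1) by (simp add: L.code_def R.hr_def)
 qed
 have "\<exists>s. L.gap s (L.xs 0) (L.xs (Suc 0)) & R.gap s (R.xs 0) (R.xs (Suc 0))" if N: "Suc 0 < card (L.X h)"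
 proof -
  obtain s where s: "L.gap s (L.xs 0) (L.xs (Suc 0))" using L.gap_ex[OF L.xs_consec[OF N]] by blast
  obtain s' where s': "R.gap s' (R.xs 0) (R.xs (Suc 0))" using R.gap_ex[OF R.xs_consec[OF N[folded card_eq]]] by blast
  have "s = 1" "s' = 1" using L.first_gap[OF s] R.first_gap[OF s'] L.xs_0 R.xs_0 by auto
  thus ?thesis using s s' by auto
 qed
 thus ?case using c c' L.xs_0 R.xs_0 by simp
next
 case (Suc i)
 then obtain s where g: "L.gap s (L.xs i) (L.xs (Suc i))" and g': "R.gap s (R.xs i) (R.xs (Suc i))"
  and ci: "L.code h' (R.xs i) = L.code h (L.xs i)" and qi: "L.q (R.xs i) = L.q (L.xs i)" by auto
 note f = L.gap_facts[OF g] and f' = R.gap_facts[OF g']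
 have p0: "R.pos s (R.xs i) = L.pos s (L.xs i)" using pos_eq_iff[OF f(1) f(3) f'(3)] ci by blast
 have "R.pos s (R.xs (Suc i)) = R.mu s (R.pos s (R.xs i))" using R.mu_pos[OF f(1) f'(3)] R.gap_mate(1)[OF g'] by simp
 also have "\<dots> = L.mu s (L.pos s (L.xs i))" unfolding p0 by (rule mu_eq[OF f(1) L.ip(4)[OF f(1) f(3)]])
 also have "\<dots> = L.pos s (L.xs (Suc i))" using L.mu_pos[OF f(1) f(3)] L.gap_mate(1)[OF g] by simp
 finally have p1: "R.pos s (R.xs (Suc i)) = L.pos s (L.xs (Suc i))" .
 hence c1: "L.code h' (R.xs (Suc i)) = L.code h (L.xs (Suc i))" using pos_eq_iff[OF f(1) f(4) f'(4)] by blast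
 have "card (L.gp (R.xs i) (R.xs (Suc i))) = card (L.gp (L.xs i) (L.xs (Suc i)))"
  using L.card_gp[OF g] R.card_gp[OF g'] p0 p1 t_eq[OF f(1)] by (simp add: L.gp_def R.gp_def)
 hence q1: "L.q (R.xs (Suc i)) = L.q (L.xs (Suc i))"
  using L.q_step[OF f(6) f(5)] R.q_step[OF f'(6) f'(5)] qi by (simp add: L.q_def R.q_def L.gp_def R.gp_def)
 have "\<exists>s. L.gap s (L.xs (Suc i)) (L.xs (Suc (Suc i))) & R.gap s (R.xs (Suc i)) (R.xs (Suc (Suc i)))" if N: "Suc (Suc i) < card (L.X h)"
 proof -
  obtain s1 where s1: "L.gap s1 (L.xs (Suc i)) (L.xs (Suc (Suc i)))" using L.gap_ex[OF L.xs_consec[OF N]] by blast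
  obtain s2 where s2: "R.gap s2 (R.xs (Suc i)) (R.xs (Suc (Suc i)))" using R.gap_ex[OF R.xs_consec[OF N[folded card_eq]]] by blast
  have Re: "Re (R.hr (R.xs (Suc i))) = Re (L.hr (L.xs (Suc i)))" using c1 by (simp add: L.code_def L.hr_def R.hr_def)
  have "Re (L.hr (L.xs (Suc i))) = L.m (s - 1) \<or> Re (L.hr (L.xs (Suc i))) = L.m s" using f(4) by (simp add: L.XS_def)
  hence "s2 = s1" using L.gap_next[OF g s1] R.gap_next[OF g' s2] Re by metis
  thus ?thesis using s1 s2 by blast
 qed
 thus ?case using c1 q1 by blast
qed

text \<open>\<open>e\<close> sends the i-th crossing to the i-th crossing and fixes the punctures.
  It is increasing because the i-th crossings of both curves have the same number of punctures
  before them.\<close>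

theorem isotopic: "(h, h') \<in> braid_isotopy n p"
proof -
 let ?N = "card (L.X h)"
 define e where "e = (\<lambda>x. if x \<in> L.X h then R.xs (inv_into {..<?N} L.xs x) else x)"
 have exs: "e (L.xs i) = R.xs i" if "i < ?N" for i
  using that L.xs(1)[OF that] inv_into_f_f[OF L.xs_inj, of i] by (simp add: e_def)
 have ep: "e (p r) = p r" if "r \<in> {1..n}" for r using L.X_puncture[OF L.h(1) that] by (simp add: e_def)
 have Ycase: "(\<exists>i<?N. x = L.xs i) \<or> (\<exists>r\<in>{1..n}. x = p r)" if "x \<in> L.Y h" for x
  using that L.xs(3) by (auto simp: L.Y_def)
 have pL: "p r < L.xs i \<longleftrightarrow> p r < R.xs i" "L.xs i < p r \<longleftrightarrow> R.xs i < p r" if "r \<in> {1..n}" "i < ?N" for r i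
 proof -
  show 1: "p r < L.xs i \<longleftrightarrow> p r < R.xs i" using L.q_less[OF that(1)] gap_index[OF that(2)] by simp
  have "p r ~= L.xs i" "p r ~= R.xs i"
   using L.X_puncture[OF L.h(1) that(1)] L.X_puncture[OF R.h(1) that(1)] L.xs(1)[OF that(2)] R.xs(1)[of i] that(2) card_eq by auto
  thus "L.xs i < p r \<longleftrightarrow> R.xs i < p r" using 1 by linarith
 qed
 interpret D: matching_diagrams n p h h' e
 proof
  show "h \<in> L.H" "finite (L.X h)" "\<not> L.reducible h" "h' \<in> L.H" "finite (L.X h')" "\<not> L.reducible h'"
   using L.h R.h by simp_all
  show "strict_mono_on (L.Y h) e"
  proof (rule strict_mono_onI)
   fix x y assume xy: "x \<in> L.Y h" "y \<in> L.Y h" "x < y"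
   show "e x < e y" using Ycase[OF xy(1)]
   proof
    assume "\<exists>i<?N. x = L.xs i"
    then obtain i where i: "i < ?N" "x = L.xs i" by blast
    show ?thesis using Ycase[OF xy(2)]
    proof
     assume "\<exists>i<?N. y = L.xs i"
     then obtain k where k: "k < ?N" "y = L.xs k" by blast
     hence "i < k" using L.xs(2)[OF i(1) k(1)] xy(3) i(2) by simp
     thus ?thesis using exs i k R.xs(2)[of i k] card_eq by simp
    next
     assume "\<exists>r\<in>{1..n}. y = p r"
     thus ?thesis using exs i ep pL(2)[OF _ i(1)] xy(3) by auto
    qed
   next
    assume "\<exists>r\<in>{1..n}. x = p r"
    then obtain r where r: "r \<in> {1..n}" "x = p r" by blast
    show ?thesis using Ycase[OF xy(2)]
    proof
     assume "\<exists>i<?N. y = L.xs i"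
     thus ?thesis using exs r ep pL(1)[OF r(1)] xy(3) by auto
    next
     assume "\<exists>r\<in>{1..n}. y = p r"
     thus ?thesis using r ep xy(3) by auto
    qed
   qed
  qed
  have eX: "e ` L.X h = L.X h'"
  proof (intro equalityI subsetI)
   fix y assume "y \<in> e ` L.X h"
   then obtain i where "i < ?N" "y = e (L.xs i)" using L.xs(3) by blast
   thus "y \<in> L.X h'" using exs R.xs(1)[of i] card_eq by simp
  next
   fix y assume "y \<in> L.X h'"
   then obtain i where "i < ?N" "y = R.xs i" using R.xs(3) card_eq by metis
   thus "y \<in> e ` L.X h" using exs L.xs(1)[of i] by (metis imageI)
  qed
  moreover have "e ` p ` {1..n} = p ` {1..n}" unfolding image_image by (rule image_cong[OF refl]) (rule ep)
  ultimately show "e ` L.Y h = L.Y h'" unfolding L.Y_def image_Un by simp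
  fix x assume "x \<in> L.Y h"
  from Ycase[OF this] show "L.code h' (e x) = L.code h x"
  proof
   assume "\<exists>i<?N. x = L.xs i"
   thus ?thesis using exs gap_index by auto
  next
   assume "\<exists>r\<in>{1..n}. x = p r"
   then obtain r where r: "r \<in> {1..n}" "x = p r" by blast
   obtain i s where i: "Suc i < ?N" "L.gap s (L.xs i) (L.xs (Suc i))" "r \<in> L.gp (L.xs i) (L.xs (Suc i))"
    by (rule L.puncture_gap[OF r(1)])
   have iN: "i < ?N" using i(1) by simp
   obtain s' where s': "L.gap s' (L.xs i) (L.xs (Suc i))" "R.gap s' (R.xs i) (R.xs (Suc i))"
    using gap_index[OF iN] i(1) by blast
   have "r \<in> R.gp (R.xs i) (R.xs (Suc i))" using i(3) pL[OF r(1) iN] pL[OF r(1) i(1)] by (simp add: L.gp_def R.gp_def)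
   thus ?thesis using L.puncture_code[OF s'(1) i(3)] R.puncture_code[OF s'(2)] r(2) ep[OF r(1)] by simp
  qed
 qed
 show ?thesis by (rule D.matching_isotopic)
qed

end

section \<open>Counting\<close>

text \<open>Let \<open>J\<close> be the index of the largest \<open>K j\<close>. Bounding each
  minimum by the neighbour farther from \<open>J\<close> leaves each factor \<open>K j + 1\<close>
  with \<open>j ~= J\<close> exactly once, and these have an average of at most \<open>A\<close>,
  the average over all \<open>n - 1\<close> indices.\<close>

lemma prod_min_le:
 fixes K :: "nat => nat"
 assumes n: "2 <= n" and K: "K 0 = 0" "K n = 0" "(\<Sum>j\<in>{1..n - 1}. K j) = k"
 shows "real (\<Prod>s\<in>{1..n}. min (K (s - 1)) (K s) + 1) <= ((real k + real n - 1) / (real n - 1)) ^ (n - 2)"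
proof -
 define S where "S = {1..n - 1}"
 have S: "finite S" "S ~= {}" "card S = n - 1" using n by (auto simp: S_def)
 obtain J where J: "J \<in> S" "\<And>j. j \<in> S ==> K j <= K J"
 proof -
  have "Max (K ` S) \<in> K ` S" using S by (intro Max_in) auto
  then obtain J where "J \<in> S" "Max (K ` S) = K J" by blast
  moreover have "K j <= Max (K ` S)" if "j \<in> S" for j using S(1) that by (intro Max_ge) auto
  ultimately show thesis using that by metis
 qed
 define ph where "ph = (\<lambda>s. if s <= J then s - 1 else s)"
 have J1: "1 <= J" "J <= n - 1" using J(1) by (auto simp: S_def)
 have bij: "bij_betw ph {1..n} ({0..n} - {J})"
  unfolding bij_betw_def
 proof
  show "inj_on ph {1..n}" by (rule inj_onI) (auto simp: ph_def split: if_splits)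
  show "ph ` {1..n} = {0..n} - {J}"
  proof (intro equalityI subsetI)
   fix j assume j: "j \<in> {0..n} - {J}"
   show "j \<in> ph ` {1..n}"
   proof (cases "j < J")
    case True
    thus ?thesis using J1 by (intro rev_image_eqI[of "j + 1"]) (auto simp: ph_def)
   next
    case False
    thus ?thesis using j by (intro rev_image_eqI[of j]) (auto simp: ph_def)
   qed
  next
   fix j assume "j \<in> ph ` {1..n}"
   then obtain s where "s \<in> {1..n}" "j = ph s" by blast
   thus "j \<in> {0..n} - {J}" using J1 by (auto simp: ph_def)
  qed
 qed
 have "(\<Prod>s\<in>{1..n}. min (K (s - 1)) (K s) + 1) <= (\<Prod>s\<in>{1..n}. K (ph s) + 1)"
  by (rule prod_mono) (auto simp: ph_def)
 also have "\<dots> = (\<Prod>j\<in>{0..n} - {J}. K j + 1)" by (rule prod.reindex_bij_betw[OF bij])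
 also have "\<dots> = (\<Prod>j\<in>S - {J}. K j + 1)"
 proof (rule prod.mono_neutral_right)
  show "\<forall>i\<in>{0..n} - {J} - (S - {J}). K i + 1 = 1"
  proof
   fix i assume "i \<in> {0..n} - {J} - (S - {J})"
   hence "i = 0 \<or> i = n" by (auto simp: S_def)
   thus "K i + 1 = 1" using K by auto
  qed
 qed (auto simp: S_def)
 finally have le: "(\<Prod>s\<in>{1..n}. min (K (s - 1)) (K s) + 1) <= (\<Prod>j\<in>S - {J}. K j + 1)" .
 define A where "A = (real k + real n - 1) / (real n - 1)"
 have A0: "0 <= A" using n by (simp add: A_def)
 have card: "card (S - {J}) = n - 2" using S J(1) by simp
 have "real (\<Prod>j\<in>S - {J}. K j + 1) <= A ^ (n - 2)"
 proof (cases "n = 2")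
  case True
  hence "card (S - {J}) = 0" using card by simp
  hence "S - {J} = {}" using S(1) by (metis card_0_eq finite_Diff)
  hence e: "(\<Prod>j\<in>S - {J}. K j + 1) = 1" by (simp only: prod.empty)
  show ?thesis unfolding e True by simp
 next
  case False
  define x where "x = (\<lambda>j. real (K j) + 1)"
  define Q where "Q = (\<Prod>j\<in>S - {J}. x j)"
  have c0: "card (S - {J}) ~= 0" "0 < real (n - 2)" using card False n by auto
  have sumS: "(\<Sum>j\<in>S. x j) = real k + real n - 1" using K(3) S n by (simp add: x_def S_def sum.distrib of_nat_diff flip: of_nat_sum)
  have "(\<Sum>j\<in>S. x j) <= (\<Sum>j\<in>S. x J)" by (rule sum_mono) (use J(2) in \<open>simp add: x_def\<close>)
  also have "\<dots> = (real n - 1) * x J" using S n by (simp add: of_nat_diff)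
  finally have "A <= x J" unfolding sumS A_def using n by (simp add: field_simps)
  moreover have "(\<Sum>j\<in>S - {J}. x j) = (\<Sum>j\<in>S. x j) - x J" using S(1) J(1) by (simp add: sum_diff1)
  moreover have "(\<Sum>j\<in>S. x j) = (real n - 1) * A" unfolding sumS A_def using n by simp
  \<comment> \<open>Removing a largest term, which is at least the average \<open>A\<close>, does
    not raise the average of the rest above \<open>A\<close>.\<close>
  ultimately have "(\<Sum>j\<in>S - {J}. x j) <= (real n - 2) * A" by (simp add: algebra_simps)
  hence sle: "(\<Sum>j\<in>S - {J}. x j / card (S - {J})) <= A"
   unfolding sum_divide_distrib[symmetric] card using c0(2) n by (simp add: of_nat_diff divide_le_eq mult.commute)
  have Q0: "0 <= Q" unfolding Q_def x_def by (intro prod_nonneg) auto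
  have "Q powr (1 / real (n - 2)) <= (\<Sum>j\<in>S - {J}. x j / card (S - {J}))"
   unfolding Q_def card[symmetric] using S(1) c0(1) by (intro arith_geom_mean) (auto simp: x_def)
  also note sle
  finally have "(Q powr (1 / real (n - 2))) ^ (n - 2) <= A ^ (n - 2)" by (intro power_mono) auto
  moreover have "(Q powr (1 / real (n - 2))) ^ (n - 2) = Q"
  proof (cases "Q = 0")
   case True thus ?thesis using c0 card by simp
  next
   case False
   hence "(Q powr (1 / real (n - 2))) ^ (n - 2) = (Q powr (1 / real (n - 2))) powr real (n - 2)"
    using Q0 by (simp add: powr_realpow)
   also have "\<dots> = Q" using c0(2) Q0 by (simp add: powr_powr)
   finally show ?thesis .
  qed
  ultimately show ?thesis by (simp add: Q_def x_def of_nat_prod add.commute)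
 qed
 thus ?thesis using le of_nat_le_iff[of _ "\<Prod>j\<in>S - {J}. K j + 1", where 'a = real] unfolding A_def by linarith
qed

section \<open>From braids to compositions and arc indices\<close>

context punctured_disc begin

text \<open>The infimum in the norm is attained, as the extended naturals are well-ordered, and a
  reducible minimizer would have a competitor with fewer crossings. The number of crossing
  parameters is the norm plus 2, for the ends of the curve.\<close>

lemma minimal_representative:
 assumes bet: "bet \<in> braid_group n p" and norm: "diagrammatic_norm n p bet = enat (2 * k + n - 1)"
 shows "\<exists>h\<in>bet. tight_diagram n p h & card (X h) = 2 * k + n + 1"
proof -
 obtain h0 where h0: "h0 \<in> H" "bet = braid_isotopy n p `` {h0}"
  using bet unfolding braid_group_def by (rule quotientE)
 define N where "N = (\<lambda>h :: complex => complex. ecard (h ` closed_segment (-1) 1 \<inter> trivial_lamination n p))"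
 have D: "diagrammatic_norm n p bet = Inf (N ` bet)" by (simp add: diagrammatic_norm_def N_def)
 have "h0 \<in> bet" using h0 braid_isotopy_refl[OF h0(1)] by auto
 hence "N h0 \<in> N ` bet" by blast
 hence "Inf (N ` bet) \<in> N ` bet" unfolding Inf_enat_def using LeastI[of "\<lambda>x. x \<in> N ` bet"] by auto
 then obtain h where h: "h \<in> bet" "N h = enat (2 * k + n - 1)" using D norm by auto
 have iso: "(h0, h) \<in> braid_isotopy n p" using h(1) h0(2) by simp
 have hH: "h \<in> H" by (rule braid_isotopy_mem(2)[OF iso])
 have N: "N h = (if finite (X h) then enat (card (X h) - 2) else \<infinity>)" if "h \<in> H" for h
  unfolding N_def by (rule lamination_card[OF that])
 have fin: "finite (X h)" using h(2) N[OF hH] by (auto split: if_splits)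
 hence c: "card (X h) - 2 = 2 * k + n - 1" using h(2) N[OF hH] by simp
 have "\<not> reducible h"
 proof
  assume "reducible h"
  then obtain h2 where h2: "(h, h2) \<in> braid_isotopy n p" "finite (X h2)" "card (X h2) < card (X h)" unfolding reducible_def by blast
  have "h2 \<in> bet" using braid_isotopy_trans[OF iso h2(1)] h0(2) by simp
  hence "Inf (N ` bet) <= N h2" by (intro Inf_lower imageI)
  moreover have "Inf (N ` bet) = enat (2 * k + n - 1)" using D norm by (rule trans[OF sym])
  moreover have "N h2 = enat (card (X h2) - 2)" using N[OF braid_isotopy_mem(2)[OF h2(1)]] h2(2) by simp
  ultimately have "2 * k + n - 1 <= card (X h2) - 2" by (simp only: enat_ord_simps)
  thus False using c h2(3) n2 by arith
 qed
 hence "tight_diagram n p h" using hH fin by unfold_locales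
 moreover have "card (X h) = 2 * k + n + 1" using c n2 by simp
 ultimately show ?thesis using h(1) by blast
qed

text \<open>The zeros at \<open>0\<close> and \<open>n\<close> correspond to the single points on
  the outer lines, in the encoding \<open>2 i + 1\<close> of the numbers of points.\<close>

definition ext :: "nat list => nat => nat" where "ext l j = (if 1 <= j & j <= n - 1 then l ! (j - 1) else 0)"

definition comps :: "nat => nat list set" where "comps k = {l. length l = n - 1 & sum_list l = k}"

definition patterns :: "nat list => (nat => nat) set" where
 "patterns l = (\<Pi>\<^sub>E s\<in>{1..n}. Tset (2 * ext l (s - 1) + 1) (2 * ext l s + 1))"

lemma ext_sum: assumes "length l = n - 1" shows "(\<Sum>j\<in>{1..n - 1}. ext l j) = sum_list l"
proof -
 have "(\<Sum>j\<in>{1..n - 1}. ext l j) = (\<Sum>i\<in>{0..<n - 1}. ext l (Suc i))"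
  using sum.shift_bounds_Suc_ivl[of "ext l" 0 "n - 1"] by (simp add: atLeastLessThanSuc_atLeastAtMost)
 also have "\<dots> = (\<Sum>i\<in>{0..<n - 1}. l ! i)" by (rule sum.cong) (auto simp: ext_def)
 also have "\<dots> = sum_list l" using assms by (simp add: sum_list_sum_nth)
 finally show ?thesis .
qed

lemma card_patterns:
 assumes "l \<in> comps k"
 shows "finite (patterns l)" "real (card (patterns l)) <= 2 ^ n * ((real k + real n - 1) / (real n - 1)) ^ (n - 2)"
proof -
 define f where "f = (\<lambda>s. min (ext l (s - 1)) (ext l s) + 1)"
 have ev: "even (2 * i + 1 + (2 * j + 1))" for i j :: nat by simp
 note T = card_Tset(1)[OF ev]
 show "finite (patterns l)" unfolding patterns_def by (rule finite_PiE) (simp_all add: card_Tset(2))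
 have "card (patterns l) = (\<Prod>s\<in>{1..n}. card (Tset (2 * ext l (s - 1) + 1) (2 * ext l s + 1)))"
  unfolding patterns_def by (rule card_PiE) simp
 also have "\<dots> <= (\<Prod>s\<in>{1..n}. 2 * f s)"
 proof (rule prod_mono)
  fix s
  have "card (Tset (2 * ext l (s - 1) + 1) (2 * ext l s + 1)) <= min (2 * ext l (s - 1) + 1) (2 * ext l s + 1) + 1" by (rule T)
  also have "\<dots> = 2 * f s" by (simp add: f_def min_def)
  finally show "0 <= card (Tset (2 * ext l (s - 1) + 1) (2 * ext l s + 1)) &
   card (Tset (2 * ext l (s - 1) + 1) (2 * ext l s + 1)) <= 2 * f s" by simp
 qed
 also have "\<dots> = 2 ^ n * (\<Prod>s\<in>{1..n}. f s)" by (simp add: prod.distrib)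
 finally have "real (card (patterns l)) <= real (2 ^ n * (\<Prod>s\<in>{1..n}. f s))" by (rule of_nat_mono)
 hence 1: "real (card (patterns l)) <= 2 ^ n * real (\<Prod>s\<in>{1..n}. f s)" by simp
 have "ext l 0 = 0" "ext l n = 0" using n2 by (auto simp: ext_def)
 moreover have "(\<Sum>j\<in>{1..n - 1}. ext l j) = k" using assms ext_sum by (simp add: comps_def)
 ultimately have "real (\<Prod>s\<in>{1..n}. f s) <= ((real k + real n - 1) / (real n - 1)) ^ (n - 2)"
  unfolding f_def by (intro prod_min_le n2)
 hence "2 ^ n * real (\<Prod>s\<in>{1..n}. f s) <= 2 ^ n * ((real k + real n - 1) / (real n - 1)) ^ (n - 2)"
  by (intro mult_left_mono) auto
 thus "real (card (patterns l)) <= 2 ^ n * ((real k + real n - 1) / (real n - 1)) ^ (n - 2)" using 1 by linarith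
qed

lemma card_comps: "finite (comps k)" "card (comps k) = (k + n - 2) choose (n - 2)"
proof -
 have "card (comps k) = (k + (n - 1) - 1) choose k" unfolding comps_def by (rule card_length_sum_list)
 also have "k + (n - 1) - 1 = k + n - 2" using n2 by simp
 also have "(k + n - 2) choose k = (k + n - 2) choose (n - 2)" using binomial_symmetric[of k "k + n - 2"] n2 by simp
 finally show "card (comps k) = (k + n - 2) choose (n - 2)" .
 hence "card (comps k) ~= 0" using n2 by simp
 thus "finite (comps k)" by (metis card.infinite)
qed

definition data :: "(complex => complex) => nat list \<times> (nat => nat)" where
 "data h = (map (\<lambda>j. (tight_diagram.a n p h j - 1) div 2) [1..<n], \<lambda>s\<in>{1..n}. tight_diagram.tt n p h s)"

lemma data_a:
 assumes t: "tight_diagram n p h" and "j <= n"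
 shows "tight_diagram.a n p h j = 2 * ext (fst (data h)) j + 1"
proof -
 interpret tight_diagram n p h by (rule t)
 show ?thesis
 proof (cases "j = 0 \<or> j = n")
  case True thus ?thesis using a_ends n2 by (auto simp: ext_def)
 next
  case False
  hence j: "1 <= j" "j <= n - 1" "j - 1 < length [1..<n]" using assms(2) by auto
  have "ext (fst (data h)) j = (a j - 1) div 2" using j by (simp add: ext_def data_def)
  moreover have "odd (a j)" by (rule a_odd[OF assms(2)])
  ultimately show ?thesis by (simp add: odd_pos)
 qed
qed

text \<open>The \<open>n + 1\<close> lines carry \<open>2 k + n + 1\<close> points in all. Writing
  each number as \<open>2 k_j + 1\<close> removes the summand \<open>n + 1\<close> and leaves the
  \<open>k_j\<close> with sum \<open>k\<close>.\<close>

lemma data_range: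
 assumes t: "tight_diagram n p h" and c: "card (X h) = 2 * k + n + 1"
 shows "data h \<in> Sigma (comps k) patterns"
proof -
 interpret tight_diagram n p h by (rule t)
 define l where "l = fst (data h)"
 have len: "length l = n - 1" by (simp add: l_def data_def)
 have al: "a j = 2 * ext l j + 1" if "j <= n" for j unfolding l_def by (rule data_a[OF t that])
 have "2 * k + n + 1 = (\<Sum>j\<in>{0..n}. 2 * ext l j + 1)" using card_X c al by simp
 also have "\<dots> = (\<Sum>j\<in>{0..n}. 2 * ext l j) + (\<Sum>j\<in>{0..n}. 1)" by (rule sum.distrib)
 also have "\<dots> = 2 * (\<Sum>j\<in>{0..n}. ext l j) + (n + 1)" by (simp add: sum_distrib_left[symmetric])
 finally have "(\<Sum>j\<in>{0..n}. ext l j) = k" by simp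
 moreover have "(\<Sum>j\<in>{0..n}. ext l j) = (\<Sum>j\<in>{1..n - 1}. ext l j)"
  by (rule sum.mono_neutral_right) (auto simp: ext_def)
 ultimately have "l \<in> comps k" using ext_sum[OF len] len by (simp add: comps_def)
 moreover have "snd (data h) \<in> patterns l"
  unfolding patterns_def
 proof (rule PiE_I)
  fix s assume s: "s \<in> {1..n}"
  hence "s - 1 <= n" "s <= n" by auto
  thus "snd (data h) s \<in> Tset (2 * ext l (s - 1) + 1) (2 * ext l s + 1)"
   using strip_data(1)[OF s] al s by (simp add: data_def)
 next
  fix s assume "s \<notin> {1..n}"
  thus "snd (data h) s = undefined" unfolding data_def snd_conv by (rule restrict_apply[THEN trans, OF if_not_P])
 qed
 ultimately have "(l, snd (data h)) \<in> Sigma (comps k) patterns" by (rule SigmaI)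
 thus ?thesis unfolding l_def by simp
qed

lemma data_inj:
 assumes "tight_diagram n p h" "tight_diagram n p h'" "data h = data h'"
 shows "(h, h') \<in> braid_isotopy n p"
proof -
 interpret L: tight_diagram n p h by (rule assms(1))
 interpret R: tight_diagram n p h' by (rule assms(2))
 have "equal_data n p h h'"
 proof
  show "R.a j = L.a j" if "j <= n" for j using data_a[OF assms(1) that] data_a[OF assms(2) that] assms(3) by simp
  show "R.tt s = L.tt s" if s: "s \<in> {1..n}" for s
  proof -
   have "snd (data h) s = snd (data h') s" using assms(3) by simp
   thus ?thesis using s by (simp add: data_def)
  qed
 qed
 thus ?thesis by (rule equal_data.isotopic)
qed

lemma count_braids:
 defines "Bk \<equiv> \<lambda>k. {bet \<in> braid_group n p. diagrammatic_norm n p bet = enat (2 * k + n - 1)}"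
 shows "finite (Bk k) & real (card (Bk k))
  <= 2 ^ n * ((real k + real n - 1) / (real n - 1)) ^ (n - 2) * real ((k + n - 2) choose (n - 2))"
proof -
 define rep where "rep = (\<lambda>bet. SOME h. h \<in> bet & tight_diagram n p h & card (X h) = 2 * k + n + 1)"
 have rep: "rep bet \<in> bet & tight_diagram n p (rep bet) & card (X (rep bet)) = 2 * k + n + 1" if "bet \<in> Bk k" for bet
 proof -
  have "\<exists>h. h \<in> bet & tight_diagram n p h & card (X h) = 2 * k + n + 1"
   using minimal_representative[of bet k] that unfolding Bk_def by blast
  from someI_ex[OF this] show ?thesis unfolding rep_def .
 qed
 define D where "D = Sigma (comps k) patterns"
 have inj: "inj_on (\<lambda>bet. data (rep bet)) (Bk k)"
 proof (rule inj_onI)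
  fix bet bet' assume b: "bet \<in> Bk k" "bet' \<in> Bk k" and e: "data (rep bet) = data (rep bet')"
  have "(rep bet, rep bet') \<in> braid_isotopy n p" using data_inj rep[OF b(1)] rep[OF b(2)] e by blast
  moreover have "bet \<in> H // braid_isotopy n p" "bet' \<in> H // braid_isotopy n p" using b by (simp_all add: Bk_def braid_group_def)
  ultimately show "bet = bet'" using quotient_eqI[OF equiv_braid_isotopy] rep[OF b(1)] rep[OF b(2)] by blast
 qed
 have sub: "(\<lambda>bet. data (rep bet)) ` Bk k <= D" unfolding D_def using data_range rep by blast
 have finD: "finite D" unfolding D_def by (rule finite_SigmaI[OF card_comps(1) card_patterns(1)])
 have "card (Bk k) <= card D" by (rule card_inj_on_le[OF inj sub finD])
 hence "real (card (Bk k)) <= real (card D)" by simp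
 also have "real (card D) = (\<Sum>l\<in>comps k. real (card (patterns l)))"
  unfolding D_def using card_comps(1) card_patterns(1) by (subst card_SigmaI) auto
 also have "\<dots> <= (\<Sum>l\<in>comps k. 2 ^ n * ((real k + real n - 1) / (real n - 1)) ^ (n - 2))"
  by (rule sum_mono) (rule card_patterns(2))
 also have "\<dots> = 2 ^ n * ((real k + real n - 1) / (real n - 1)) ^ (n - 2) * real ((k + n - 2) choose (n - 2))"
  by (simp add: card_comps(2) mult.commute)
 finally show ?thesis using inj_on_finite[OF inj sub finD] by blast
qed

end

theorem proposition5p7:
  fixes n k :: nat and p :: "nat \<Rightarrow> real"
  assumes "n \<ge> 2"
    and "valid_punctures n p"
  shows "finite {\<beta> \<in> braid_group n p. diagrammatic_norm n p \<beta> = enat (2 * k + n - 1)} \<and>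
         real (card {\<beta> \<in> braid_group n p. diagrammatic_norm n p \<beta> = enat (2 * k + n - 1)})
           \<le> 2 ^ n * ((real k + real n - 1) / (real n - 1)) ^ (n - 2)
               * real ((k + n - 2) choose (n - 2))"
proof -
  interpret punctured_disc n p by unfold_locales (use assms in auto)
  show ?thesis by (rule count_braids)
qed

end
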